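(* Let $T>0$, let $\Omega$ be either $\mathbb{R}^d$, the torus $\mathbb{T}^d=\mathbb{R}^d/\mathbb{Z}^d$, or a compact domain in $\mathbb{R}^d$ with $C^2$ boundary, and let $m_0\in\mathscr{P}_2(\Omega)$. Let $L:\Omega\times\mathbb{R}^d\to\mathbb{R}$ be continuously differentiable, convex with respect to the second variable, and such that for some constant $C>0$, $$\tfrac1C|v|^2-C\le L(x,v)\le C|v|^2+C\qquad\forall v\in\mathbb{R}^d,\ x\in\Omega.$$ Let $f,g:\mathscr{P}_2(\Omega)\times\Omega\to\mathbb{R}$ be continuous, and suppose there are real-valued functions $F,G$ on $\mathscr{P}(\Omega)$, bounded below, such that $f$ and $g$ are linear derivatives of $F$ and $G$, respectively. Define, for $\eta\in\mathscr{P}_{m_0}(\Gamma)$ and $\gamma\in\Gamma$, $$J(\eta,\gamma)=\int_0^T\big(L(\gamma(t),\dot\gamma(t))+f(m^\eta(t),\gamma(t))\big)\,dt+g(m^\eta(T),\gamma(T)),$$ $$\mathcal{J}(\eta)=\int_\Gamma\int_0^T L(\gamma(t),\dot\gamma(t))\,dt\,d\eta(\gamma)+\int_0^T F(m^\eta(t))\,dt+G(m^\eta(T)).$$ If $\eta$ minimizes $\mathcal{J}$ over $\mathscr{P}_{m_0}(\Gamma)$, then $\eta$ is a Nash equilibrium with respect to $J$.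
   Context: For a separable metric space $X$, $\mathscr{P}(X)$ is the set of Borel probability measures on $X$, and $\mathscr{P}_2(X)$ is the subset of measures with finite second moment ($\int d(x,x_0)^2\,dm(x)<\infty$ for some $x_0$), with the Wasserstein metric $W_2$. The support $\operatorname{supp} m$ is the set of $x$ such that $m(B_\varepsilon(x))>0$ for every $\varepsilon>0$. Push-forward: $(f\sharp m)(B)=m(f^{-1}(B))$. Linear derivative: $f(m,x)$ is a linear derivative of $F$ if, for every $m\in\mathscr{P}_2(\Omega)$, $$\lim_{t\to0}\frac{F(m+t(\tilde m-m))-F(m)}{t}=\int_\Omega f(m,x)\,d(\tilde m-m)(x)\quad\forall\tilde m\in\mathscr{P}_2(\Omega).$$ $\Gamma$ is the set of absolutely continuous curves $\gamma:[0,T]\to\Omega$ with $\int_0^T|\dot\gamma(t)|^2dt<\infty$, with the topology of uniform convergence. $\Gamma_x=\{\gamma\in\Gamma:\gamma(0)=x\}$. $e_t:\Gamma\to\Omega$ is $e_t(\gamma)=\gamma(t)$, and $m^\eta(t)=e_t\sharp\eta$ for $\eta\in\mathscr{P}(\Gamma)$. $\mathscr{P}_{m_0}(\Gamma)$ is the set of $\eta\in\mathscr{P}(\Gamma)$ with $e_0\sharp\eta=m_0$. Convention: $\mathcal{J}(\eta)=+\infty$ if $\int_\Gamma\int_0^T|\dot\gamma|^2\,dt\,d\eta=\infty$; if this integral is finite, then $m^\eta(t)\in\mathscr{P}_2(\Omega)$ for all $t$. Set of best responses: $\Gamma_x(\eta)$ is the set of all $\gamma^*\in\Gamma_x$ such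 that $J(\eta,\gamma^* )\le J(\eta,\gamma)$ for all $\gamma\in\Gamma_x$. A measure $\eta\in\mathscr{P}_{m_0}(\Gamma)$ is a Nash equilibrium with respect to $J$ if $\operatorname{supp}\eta\subset\bigcup_{x\in\Omega}\Gamma_x(\eta)$ (support taken in $\Gamma$). *)

theory Defs
  imports "HOL-Probability.Probability"
begin

section \<open>State spaces\<close>

definition int_lattice :: "(real^'d) set" where
  "int_lattice = {k. \<forall>i. k $ i \<in> \<int>}"

definition C2_function :: "('a::real_normed_vector \<Rightarrow> real) \<Rightarrow> bool" where
  "C2_function h \<longleftrightarrow>
    (\<exists>(D1 :: 'a \<Rightarrow> 'a \<Rightarrow>\<^sub>L real) (D2 :: 'a \<Rightarrow> 'a \<Rightarrow>\<^sub>L ('a \<Rightarrow>\<^sub>L real)).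
      (\<forall>x. (h has_derivative blinfun_apply (D1 x)) (at x)) \<and>
      (\<forall>x. (D1 has_derivative blinfun_apply (D2 x)) (at x)) \<and>
      continuous_on UNIV D2)"

text \<open>The boundary of the open set \<open>U\<close> is, near each of its points and after a rotation, the graph
  of a \<open>C\<^sup>2\<close> function of \<open>d - 1\<close> coordinates with \<open>U\<close> on one side of it. The unit vector \<open>e\<close> is the
  rotated last coordinate axis and \<open>x - (x \<bullet> e) *\<^sub>R e\<close> stands for the remaining coordinates of \<open>x\<close>,
  so only the values of \<open>h\<close> on the hyperplane orthogonal to \<open>e\<close> matter.\<close>

definition C2_boundary :: "(real^'d) set \<Rightarrow> bool" where
  "C2_boundary U \<longleftrightarrow>
    (\<forall>x0\<in>frontier U. \<exists>r>0. \<exists>e h. norm e = 1 \<and> C2_function h \<and>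
      U \<inter> ball x0 r = {x \<in> ball x0 r. x \<bullet> e > h (x - (x \<bullet> e) *\<^sub>R e)})"

definition compact_C2_domain :: "(real^'d) set \<Rightarrow> bool" where
  "compact_C2_domain D \<longleftrightarrow>
    (\<exists>U. open U \<and> connected U \<and> U \<noteq> {} \<and> bounded U \<and> C2_boundary U \<and> D = closure U)"

text \<open>To treat the three kinds of state space at once, \<open>\<Omega>\<close> is a subset of a metric space \<open>'p\<close> which
  comes with a map \<open>q\<close> from \<open>\<real>\<^sup>d\<close> onto \<open>'p\<close>: either \<open>q\<close> identifies \<open>'p\<close> with \<open>\<real>\<^sup>d\<close>, or \<open>q\<close> is the
  quotient map onto the flat torus. Concrete instances are \<open>q = id\<close> and, for the torus,
  \<open>to_torus\<close> at the end of this theory.\<close>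

definition euclidean_chart :: "(real^'d \<Rightarrow> 'p::metric_space) \<Rightarrow> bool" where
  "euclidean_chart q \<longleftrightarrow> surj q \<and> (\<forall>x y. dist (q x) (q y) = dist x y)"

text \<open>Here \<open>infdist (x - y) int_lattice\<close> is the infimum of \<open>norm (x - y - k)\<close> over integer vectors
  \<open>k\<close>; in particular \<open>q x = q y\<close> iff \<open>x - y\<close> is an integer vector.\<close>

definition torus_chart :: "(real^'d \<Rightarrow> 'p::metric_space) \<Rightarrow> bool" where
  "torus_chart q \<longleftrightarrow> surj q \<and> (\<forall>x y. dist (q x) (q y) = infdist (x - y) int_lattice)"

definition state_space :: "(real^'d \<Rightarrow> 'p::metric_space) \<Rightarrow> 'p set \<Rightarrow> bool" where
  "state_space q \<Omega> \<longleftrightarrow>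
    (euclidean_chart q \<and> \<Omega> = UNIV) \<or>
    (torus_chart q \<and> \<Omega> = UNIV) \<or>
    (euclidean_chart q \<and> (\<exists>D. compact_C2_domain D \<and> \<Omega> = q ` D))"


section \<open>Spaces of probability measures\<close>

definition prob_measures :: "'a::topological_space set \<Rightarrow> 'a measure set" where
  "prob_measures S = {m. prob_space m \<and> sets m = sets (restrict_space borel S)}"

definition prob_measures2 :: "'a::metric_space set \<Rightarrow> 'a measure set" where
  "prob_measures2 S =
    {m \<in> prob_measures S. \<exists>x0\<in>S. (\<integral>\<^sup>+x. ennreal ((dist x x0)\<^sup>2) \<partial>m) < \<infinity>}"

definition couplings :: "'a::metric_space set \<Rightarrow> 'a measure \<Rightarrow> 'a measure \<Rightarrow> ('a \<times> 'a) measure set" where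
  "couplings S m m' =
    {p. sets p = sets (restrict_space borel S \<Otimes>\<^sub>M restrict_space borel S) \<and>
        distr p (restrict_space borel S) fst = m \<and>
        distr p (restrict_space borel S) snd = m'}"

definition W2 :: "'a::metric_space set \<Rightarrow> 'a measure \<Rightarrow> 'a measure \<Rightarrow> real" where
  "W2 S m m' =
    sqrt (enn2real (INF p\<in>couplings S m m'. \<integral>\<^sup>+z. ennreal ((dist (fst z) (snd z))\<^sup>2) \<partial>p))"

definition continuous_on_P2 :: "'a::metric_space set \<Rightarrow> ('a measure \<Rightarrow> 'a \<Rightarrow> real) \<Rightarrow> bool" where
  "continuous_on_P2 S f \<longleftrightarrow>
    (\<forall>m\<in>prob_measures2 S. \<forall>x\<in>S. \<forall>\<epsilon>>0. \<exists>\<delta>>0. \<forall>m'\<in>prob_measures2 S. \<forall>x'\<in>S.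
      W2 S m m' < \<delta> \<and> dist x x' < \<delta> \<longrightarrow> \<bar>f m' x' - f m x\<bar> < \<epsilon>)"

text \<open>The measure \<open>m + t (m' - m)\<close>, for \<open>t\<close> between 0 and 1.\<close>

definition interpolate :: "real \<Rightarrow> 'a measure \<Rightarrow> 'a measure \<Rightarrow> 'a measure" where
  "interpolate t m m' = measure_of (space m) (sets m)
    (\<lambda>A. ennreal (1 - t) * emeasure m A + ennreal t * emeasure m' A)"

text \<open>The limit is one-sided because \<open>F\<close> is only defined on probability measures. The integrability
  requirement is part of the assertion that the integral against the signed measure \<open>m' - m\<close> exists.\<close>

definition linear_derivative ::
  "'a::metric_space set \<Rightarrow> ('a measure \<Rightarrow> real) \<Rightarrow> ('a measure \<Rightarrow> 'a \<Rightarrow> real) \<Rightarrow> bool" where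
  "linear_derivative S F f \<longleftrightarrow>
    (\<forall>m\<in>prob_measures2 S. \<forall>m'\<in>prob_measures2 S.
      integrable m (f m) \<and> integrable m' (f m) \<and>
      ((\<lambda>t. (F (interpolate t m m') - F m) / t)
        \<longlongrightarrow> (\<integral>x. f m x \<partial>m') - (\<integral>x. f m x \<partial>m)) (at_right 0))"


section \<open>Curves\<close>

definition absolutely_continuous_curve :: "real \<Rightarrow> (real \<Rightarrow> 'p::metric_space) \<Rightarrow> bool" where
  "absolutely_continuous_curve T c \<longleftrightarrow>
    (\<forall>\<epsilon>>0. \<exists>\<delta>>0. \<forall>(n::nat) a b.
      (\<forall>i<n. 0 \<le> a i \<and> a i \<le> b i \<and> b i \<le> T) \<longrightarrow>
      pairwise (\<lambda>i j. {a i<..<b i} \<inter> {a j<..<b j} = {}) {..<n} \<longrightarrow>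
      (\<Sum>i<n. b i - a i) < \<delta> \<longrightarrow>
      (\<Sum>i<n. dist (c (a i)) (c (b i))) < \<epsilon>)"

text \<open>Differentiation goes through a lift to \<open>\<real>\<^sup>d\<close>. On the torus two lifts that are both
  differentiable (hence continuous) at \<open>t\<close> differ near \<open>t\<close> by a constant integer vector, so the
  velocity does not depend on the lift. The value 0 at the times where no velocity exists is
  immaterial, as absolutely continuous curves have a velocity almost everywhere.\<close>

definition has_velocity ::
  "(real^'d \<Rightarrow> 'p) \<Rightarrow> real \<Rightarrow> (real \<Rightarrow> 'p) \<Rightarrow> real^'d \<Rightarrow> real \<Rightarrow> bool" where
  "has_velocity q T c v t \<longleftrightarrow>
    (\<exists>l. (\<forall>s\<in>{0..T}. q (l s) = c s) \<and> (l has_vector_derivative v) (at t within {0..T}))"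

definition velocity :: "(real^'d \<Rightarrow> 'p) \<Rightarrow> real \<Rightarrow> (real \<Rightarrow> 'p) \<Rightarrow> real \<Rightarrow> real^'d" where
  "velocity q T c t =
    (if \<exists>v. has_velocity q T c v t then SOME v. has_velocity q T c v t else 0)"

definition kinetic_energy :: "(real^'d \<Rightarrow> 'p) \<Rightarrow> real \<Rightarrow> (real \<Rightarrow> 'p) \<Rightarrow> ennreal" where
  "kinetic_energy q T c = (\<integral>\<^sup>+t\<in>{0..T}. ennreal ((norm (velocity q T c t))\<^sup>2) \<partial>lborel)"

text \<open>A curve on \<open>[0, T]\<close> is represented by its extension to \<open>\<real>\<close> that is constant to the left of 0
  and to the right of \<open>T\<close>. On these extensions the metric of the type of bounded continuous functions is
  \<open>SUP t\<in>{0..T}. dist (\<gamma> t) (\<gamma>' t)\<close>, so \<open>curves q \<Omega> T\<close> carries the topology of uniform convergence.\<close>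

definition curves :: "(real^'d \<Rightarrow> 'p::metric_space) \<Rightarrow> 'p set \<Rightarrow> real \<Rightarrow> (real \<Rightarrow>\<^sub>C 'p) set" where
  "curves q \<Omega> T =
    {\<gamma> :: real \<Rightarrow>\<^sub>C 'p. (\<forall>t\<le>0. \<gamma> t = \<gamma> 0) \<and> (\<forall>t\<ge>T. \<gamma> t = \<gamma> T) \<and>
        (\<forall>t\<in>{0..T}. \<gamma> t \<in> \<Omega>) \<and>
        absolutely_continuous_curve T \<gamma> \<and>
        kinetic_energy q T \<gamma> < \<infinity>}"

definition curves_from ::
  "(real^'d \<Rightarrow> 'p::metric_space) \<Rightarrow> 'p set \<Rightarrow> real \<Rightarrow> 'p \<Rightarrow> (real \<Rightarrow>\<^sub>C 'p) set" where
  "curves_from q \<Omega> T x = {\<gamma> \<in> curves q \<Omega> T. \<gamma> 0 = x}"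

text \<open>The push-forward of \<open>\<eta>\<close> under evaluation at time \<open>t\<close>.\<close>

definition marginal ::
  "'p::metric_space set \<Rightarrow> (real \<Rightarrow>\<^sub>C 'p) measure \<Rightarrow> real \<Rightarrow> 'p measure" where
  "marginal \<Omega> \<eta> t = distr \<eta> (restrict_space borel \<Omega>) (\<lambda>\<gamma> :: real \<Rightarrow>\<^sub>C 'p. \<gamma> t)"

definition prob_measures_from ::
  "(real^'d \<Rightarrow> 'p::metric_space) \<Rightarrow> 'p set \<Rightarrow> real \<Rightarrow> 'p measure \<Rightarrow> (real \<Rightarrow>\<^sub>C 'p) measure set" where
  "prob_measures_from q \<Omega> T m0 = {\<eta> \<in> prob_measures (curves q \<Omega> T). marginal \<Omega> \<eta> 0 = m0}"

definition support_in :: "'a::metric_space set \<Rightarrow> 'a measure \<Rightarrow> 'a set" where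
  "support_in S m = {x \<in> S. \<forall>\<epsilon>>0. emeasure m (ball x \<epsilon> \<inter> S) > 0}"


section \<open>Lagrangian, costs and equilibria\<close>

text \<open>Differentiability in the position is differentiability of the lift to \<open>\<real>\<^sup>d\<close>. If \<open>\<Omega>\<close> has a
  boundary, the derivative is taken within \<open>\<Omega>\<close> and is continuous up to the boundary.\<close>

definition C1_lagrangian ::
  "(real^'d \<Rightarrow> 'p) \<Rightarrow> 'p set \<Rightarrow> ('p \<Rightarrow> real^'d \<Rightarrow> real) \<Rightarrow> bool" where
  "C1_lagrangian q \<Omega> L \<longleftrightarrow>
    (\<exists>DL :: (real^'d) \<times> (real^'d) \<Rightarrow> ((real^'d) \<times> (real^'d)) \<Rightarrow>\<^sub>L real.
      continuous_on ((q -` \<Omega>) \<times> UNIV) DL \<and>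
      (\<forall>z \<in> (q -` \<Omega>) \<times> UNIV.
        ((\<lambda>(y, v). L (q y) v) has_derivative blinfun_apply (DL z)) (at z within (q -` \<Omega>) \<times> UNIV)))"

definition individual_cost ::
  "(real^'d \<Rightarrow> 'p::metric_space) \<Rightarrow> 'p set \<Rightarrow> real \<Rightarrow> ('p \<Rightarrow> real^'d \<Rightarrow> real) \<Rightarrow>
   ('p measure \<Rightarrow> 'p \<Rightarrow> real) \<Rightarrow> ('p measure \<Rightarrow> 'p \<Rightarrow> real) \<Rightarrow>
   (real \<Rightarrow>\<^sub>C 'p) measure \<Rightarrow> (real \<Rightarrow>\<^sub>C 'p) \<Rightarrow> real" where
  "individual_cost q \<Omega> T L f g \<eta> \<gamma> =
    (LINT t:{0..T}|lborel. L (\<gamma> t) (velocity q T \<gamma> t) + f (marginal \<Omega> \<eta> t) (\<gamma> t))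
    + g (marginal \<Omega> \<eta> T) (\<gamma> T)"

text \<open>The integral of \<open>F\<close> along a curve of measures, for \<open>F\<close> bounded below on \<open>prob_measures \<Omega>\<close>. It
  takes values in \<open>(-\<infinity>, \<infinity>]\<close> and is reduced to the integral of a nonnegative function by
  subtracting the infimum of \<open>F\<close>.\<close>

definition integral_bdd_below ::
  "'p::metric_space set \<Rightarrow> real \<Rightarrow> ('p measure \<Rightarrow> real) \<Rightarrow> (real \<Rightarrow> 'p measure) \<Rightarrow> ereal" where
  "integral_bdd_below \<Omega> T F \<mu> =
    (let b = Inf (F ` prob_measures \<Omega>)
     in enn2ereal (\<integral>\<^sup>+t\<in>{0..T}. ennreal (F (\<mu> t) - b) \<partial>lborel) + ereal (b * T))"

definition total_cost ::
  "(real^'d \<Rightarrow> 'p::metric_space) \<Rightarrow> 'p set \<Rightarrow> real \<Rightarrow> ('p \<Rightarrow> real^'d \<Rightarrow> real) \<Rightarrow>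
   ('p measure \<Rightarrow> real) \<Rightarrow> ('p measure \<Rightarrow> real) \<Rightarrow> (real \<Rightarrow>\<^sub>C 'p) measure \<Rightarrow> ereal" where
  "total_cost q \<Omega> T L F G \<eta> =
    (if (\<integral>\<^sup>+\<gamma>. kinetic_energy q T \<gamma> \<partial>\<eta>) = \<infinity> then \<infinity>
     else ereal (\<integral>\<gamma>. (LINT t:{0..T}|lborel. L (\<gamma> t) (velocity q T \<gamma> t)) \<partial>\<eta>)
          + integral_bdd_below \<Omega> T F (marginal \<Omega> \<eta>)
          + ereal (G (marginal \<Omega> \<eta> T)))"

definition best_responses ::
  "(real^'d \<Rightarrow> 'p::metric_space) \<Rightarrow> 'p set \<Rightarrow> real \<Rightarrow>
   ((real \<Rightarrow>\<^sub>C 'p) measure \<Rightarrow> (real \<Rightarrow>\<^sub>C 'p) \<Rightarrow> real) \<Rightarrow>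
   (real \<Rightarrow>\<^sub>C 'p) measure \<Rightarrow> 'p \<Rightarrow> (real \<Rightarrow>\<^sub>C 'p) set" where
  "best_responses q \<Omega> T J \<eta> x =
    {\<gamma>s \<in> curves_from q \<Omega> T x. \<forall>\<gamma>\<in>curves_from q \<Omega> T x. J \<eta> \<gamma>s \<le> J \<eta> \<gamma>}"

definition nash_equilibrium ::
  "(real^'d \<Rightarrow> 'p::metric_space) \<Rightarrow> 'p set \<Rightarrow> real \<Rightarrow> 'p measure \<Rightarrow>
   ((real \<Rightarrow>\<^sub>C 'p) measure \<Rightarrow> (real \<Rightarrow>\<^sub>C 'p) \<Rightarrow> real) \<Rightarrow>
   (real \<Rightarrow>\<^sub>C 'p) measure \<Rightarrow> bool" where
  "nash_equilibrium q \<Omega> T m0 J \<eta> \<longleftrightarrow>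
    \<eta> \<in> prob_measures_from q \<Omega> T m0 \<and>
    support_in (curves q \<Omega> T) \<eta> \<subseteq> (\<Union>x\<in>\<Omega>. best_responses q \<Omega> T J \<eta> x)"


section \<open>Concrete instances of state spaces\<close>

lemma euclidean_chart_id: "euclidean_chart (id :: real^'d \<Rightarrow> real^'d)"
  by (simp add: euclidean_chart_def)

lemma state_space_euclidean: "state_space (id :: real^'d \<Rightarrow> real^'d) UNIV"
  by (simp add: state_space_def euclidean_chart_id)

lemma state_space_domain: "compact_C2_domain D \<Longrightarrow> state_space (id :: real^'d \<Rightarrow> real^'d) D"
  by (auto simp: state_space_def euclidean_chart_id)

lemma int_lattice_0 [simp]: "0 \<in> int_lattice"
  by (simp add: int_lattice_def)

lemma int_lattice_add: "a \<in> int_lattice \<Longrightarrow> b \<in> int_lattice \<Longrightarrow> a + b \<in> int_lattice"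
  by (simp add: int_lattice_def)

lemma int_lattice_minus: "a \<in> int_lattice \<Longrightarrow> - a \<in> int_lattice"
  by (simp add: int_lattice_def)

lemma closed_int_lattice: "closed (int_lattice :: (real^'d) set)"
proof -
  have eq: "int_lattice = (\<Inter>i. (\<lambda>x::real^'d. x $ i) -` \<int>)"
    by (auto simp: int_lattice_def)
  have "closed ((\<lambda>x::real^'d. x $ i) -` \<int>)" for i
    by (intro continuous_closed_vimage continuous_intros) simp
  then show ?thesis
    unfolding eq by (intro closed_INT ballI)
qed

quotient_type 'd torus = "real^'d::finite" / "\<lambda>x y. x - y \<in> int_lattice"
  morphisms rep_torus to_torus
proof (rule equivpI)
  show "reflp (\<lambda>x y::real^'d. x - y \<in> int_lattice)"
    by (simp add: reflp_def)
  show "symp (\<lambda>x y::real^'d. x - y \<in> int_lattice)"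
    unfolding symp_def by (metis int_lattice_minus minus_diff_eq)
  show "transp (\<lambda>x y::real^'d. x - y \<in> int_lattice)"
    unfolding transp_def
  proof (intro allI impI)
    fix x y z :: "real^'d"
    assume "x - y \<in> int_lattice" "y - z \<in> int_lattice"
    then have "(x - y) + (y - z) \<in> int_lattice" by (rule int_lattice_add)
    then show "x - z \<in> int_lattice" by simp
  qed
qed

lemma infdist_lattice_le:
  fixes x y :: "real^'d"
  assumes "x - y \<in> int_lattice"
  shows "infdist x int_lattice \<le> infdist y int_lattice"
proof -
  have "infdist x int_lattice \<le> dist y k" if k: "k \<in> int_lattice" for k :: "real^'d"
  proof -
    have "(x - y) + k \<in> int_lattice" using assms k by (rule int_lattice_add)
    then have "infdist x int_lattice \<le> dist x ((x - y) + k)" by (rule infdist_le)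
    then show ?thesis by (simp add: dist_norm)
  qed
  moreover have "(int_lattice :: (real^'d) set) \<noteq> {}" using int_lattice_0 by blast
  ultimately show ?thesis
    unfolding infdist_notempty[OF \<open>int_lattice \<noteq> {}\<close>, of y] by (intro cINF_greatest)
qed

lemma infdist_lattice_minus:
  "infdist (- x) int_lattice = infdist (x :: real^'d) int_lattice"
proof -
  have ne: "(int_lattice :: (real^'d) set) \<noteq> {}" using int_lattice_0 by blast
  have "infdist (- x) int_lattice \<le> infdist x int_lattice" for x :: "real^'d"
    unfolding infdist_notempty[OF ne, of x]
  proof (rule cINF_greatest[OF ne])
    fix k :: "real^'d" assume "k \<in> int_lattice"
    then have "infdist (- x) int_lattice \<le> dist (- x) (- k)"
      by (intro infdist_le int_lattice_minus)
    then show "infdist (- x) int_lattice \<le> dist x k" by (simp add: dist_minus)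
  qed
  from this[of x] this[of "- x"] show ?thesis by simp
qed

lemma infdist_lattice_triangle:
  fixes x y :: "real^'d"
  shows "infdist (x + y) int_lattice \<le> infdist x int_lattice + infdist y int_lattice"
proof -
  have ne: "(int_lattice :: (real^'d) set) \<noteq> {}" using int_lattice_0 by blast
  obtain a where a: "a \<in> int_lattice" "infdist x int_lattice = dist x a"
    using infdist_attains_inf[OF closed_int_lattice ne] by metis
  obtain b where b: "b \<in> int_lattice" "infdist y int_lattice = dist y b"
    using infdist_attains_inf[OF closed_int_lattice ne] by metis
  have "infdist (x + y) int_lattice \<le> dist (x + y) (a + b)"
    using a b by (intro infdist_le int_lattice_add)
  also have "\<dots> \<le> dist x a + dist y b" by (rule dist_triangle_add)
  finally show ?thesis using a b by simp
qed

instantiation torus :: (finite) metric_space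
begin

lift_definition dist_torus :: "'a torus \<Rightarrow> 'a torus \<Rightarrow> real"
  is "\<lambda>x y. infdist (x - y) int_lattice"
proof -
  fix x x' y y' :: "real^'a"
  assume "x - x' \<in> int_lattice" "y - y' \<in> int_lattice"
  then have "(x - x') + - (y - y') \<in> int_lattice"
    by (intro int_lattice_add int_lattice_minus)
  moreover have "(x - x') + - (y - y') = (x - y) - (x' - y')" by simp
  ultimately have "(x - y) - (x' - y') \<in> int_lattice" by (simp only:)
  moreover from this have "(x' - y') - (x - y) \<in> int_lattice"
    by (metis int_lattice_minus minus_diff_eq)
  ultimately show "infdist (x - y) int_lattice = infdist (x' - y') int_lattice"
    by (intro antisym infdist_lattice_le)
qed

definition uniformity_torus :: "('a torus \<times> 'a torus) filter" where
  "uniformity_torus = (INF e\<in>{0 <..}. principal {(x, y). dist x y < e})"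

definition open_torus :: "'a torus set \<Rightarrow> bool" where
  "open_torus S = (\<forall>x\<in>S. \<forall>\<^sub>F (x', y) in uniformity. x' = x \<longrightarrow> y \<in> S)"

instance
proof
  fix x y z :: "'a torus"
  show "dist x y = 0 \<longleftrightarrow> x = y"
  proof transfer
    fix x y :: "real^'a"
    have "x - y \<in> int_lattice \<longleftrightarrow> infdist (x - y) int_lattice = 0"
      using int_lattice_0 by (intro in_closed_iff_infdist_zero closed_int_lattice) blast
    then show "infdist (x - y) int_lattice = 0 \<longleftrightarrow> x - y \<in> int_lattice" by simp
  qed
  show "dist x y \<le> dist x z + dist y z"
  proof transfer
    fix x y z :: "real^'a"
    have "infdist ((x - z) + - (y - z)) int_lattice
        \<le> infdist (x - z) int_lattice + infdist (- (y - z)) int_lattice"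
      by (rule infdist_lattice_triangle)
    then show "infdist (x - y) int_lattice
        \<le> infdist (x - z) int_lattice + infdist (y - z) int_lattice"
      unfolding infdist_lattice_minus by simp
  qed
qed (simp_all add: uniformity_torus_def open_torus_def)

end

lemma surj_to_torus: "surj to_torus"
proof (rule surjI)
  show "to_torus (rep_torus x) = x" for x :: "'a torus"
    by (rule Quotient3_abs_rep[OF Quotient3_torus])
qed

lemma torus_chart_to_torus: "torus_chart to_torus"
  by (auto simp: torus_chart_def surj_to_torus dist_torus.abs_eq)

lemma dist_to_torus_le: "dist (to_torus x) (to_torus y) \<le> dist x y"
  using infdist_le[OF int_lattice_0, of "x - y"] by (simp add: dist_torus.abs_eq dist_norm)

lemma continuous_on_to_torus: "continuous_on S to_torus"
  unfolding continuous_on_iff by (meson dist_to_torus_le le_less_trans)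

lemma to_torus_eq: "x - y \<in> int_lattice \<Longrightarrow> to_torus x = to_torus y"
  by (simp add: torus.abs_eq_iff)

lemma compact_torus: "compact (UNIV :: 'd::finite torus set)"
proof -
  have "x \<in> to_torus ` cbox 0 (\<chi> i. 1)" for x :: "'d torus"
  proof -
    obtain y where y: "x = to_torus y" using surj_to_torus by (metis surj_def)
    define z :: "real^'d" where "z = (\<chi> i. frac (y $ i))"
    have "y - z \<in> int_lattice" by (simp add: int_lattice_def z_def frac_def)
    then have "x = to_torus z" using y to_torus_eq by simp
    moreover have "z \<in> cbox 0 (\<chi> i. 1)"
      by (simp add: z_def mem_box_cart frac_ge_0 less_imp_le[OF frac_lt_1])
    ultimately show ?thesis by blast
  qed
  then have eq: "(UNIV :: 'd torus set) = to_torus ` cbox 0 (\<chi> i. 1)" by blast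
  show ?thesis
    by (subst eq) (intro compact_continuous_image continuous_on_to_torus compact_cbox)
qed

lemma open_to_torus_image:
  fixes U :: "(real^'d) set"
  assumes "open U"
  shows "open (to_torus ` U)"
  unfolding open_dist
proof safe
  fix x assume "x \<in> U"
  then obtain e where e: "e > 0" "\<And>y. dist y x < e \<Longrightarrow> y \<in> U"
    using assms unfolding open_dist by blast
  have "w \<in> to_torus ` U" if w: "dist w (to_torus x) < e" for w
  proof -
    obtain y where y: "w = to_torus y" using surj_to_torus by (metis surj_def)
    obtain k where k: "k \<in> int_lattice" "infdist (y - x) int_lattice = dist (y - x) k"
      using infdist_attains_inf[OF closed_int_lattice] int_lattice_0 by (metis empty_iff)
    have "dist (y - k) x < e" using w k by (simp add: y dist_torus.abs_eq dist_norm algebra_simps)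
    then have "y - k \<in> U" by (rule e)
    moreover have "to_torus (y - k) = w"
      unfolding y by (rule to_torus_eq) (simp add: k(1) int_lattice_minus)
    ultimately show ?thesis by blast
  qed
  then show "\<exists>e>0. \<forall>y. dist y (to_torus x) < e \<longrightarrow> y \<in> to_torus ` U" using e(1) by blast
qed

instance torus :: (finite) polish_space
proof
  fix X :: "nat \<Rightarrow> 'a torus" assume "Cauchy X"
  then show "convergent X"
    using compact_imp_complete[OF compact_torus] by (auto simp: complete_def convergent_def)
next
  obtain B :: "(real^'a) set set" where B: "countable B" "topological_basis B"
    using ex_countable_basis by blast
  have "topological_basis ((`) to_torus ` B)"
  proof (rule topological_basisI)
    show "open b'" if "b' \<in> (`) to_torus ` B" for b' :: "'a torus set"
      using that topological_basis_open[OF B(2)] by (auto intro: open_to_torus_image)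
    fix V :: "'a torus set" and x assume V: "open V" "x \<in> V"
    obtain y where y: "x = to_torus y" using surj_to_torus by (metis surj_def)
    have "open (to_torus -` V)"
      using V(1) continuous_on_to_torus by (rule open_vimage)
    moreover have "y \<in> to_torus -` V" using V(2) y by simp
    ultimately obtain b where "b \<in> B" "y \<in> b" "b \<subseteq> to_torus -` V"
      by (rule topological_basisE[OF B(2)])
    then show "\<exists>b'\<in>(`) to_torus ` B. x \<in> b' \<and> b' \<subseteq> V"
      unfolding y by (intro bexI[of _ "to_torus ` b"]) auto
  qed
  then have "open = generate_topology ((`) (to_torus :: real^'a \<Rightarrow> _) ` B)"
    by (rule topological_basis_imp_subbasis)
  with B(1) show "\<exists>B::'a torus set set. countable B \<and> open = generate_topology B"
    by (intro exI[of _ "(`) to_torus ` B"]) simp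
qed

lemma state_space_torus: "state_space (to_torus :: real^'d \<Rightarrow> 'd torus) UNIV"
  by (simp add: state_space_def torus_chart_to_torus)

end

theory Submission imports Defs begin

text \<open>Write \<open>m\<close> for the flow of marginals of the minimizer \<open>\<eta>\<close>. For a mixture \<open>(1 - s) \<eta> + s \<eta>'\<close>, the
  derivative of the total cost at \<open>s = 0\<close> is the integral of the individual cost \<open>J(\<eta>, \<cdot>)\<close> with respect to
  \<open>\<eta>' - \<eta>\<close>, because \<open>f\<close> and \<open>g\<close> are the linear derivatives of \<open>F\<close> and \<open>G\<close>. Minimality makes it
  nonnegative. If a curve \<open>\<gamma>s\<close> in the support of \<open>\<eta>\<close> were beaten by a curve \<open>\<gamma>'\<close> with the same starting point,
  it would therefore suffice to take for \<open>\<eta>'\<close> the measure that arises from \<open>\<eta>\<close> by moving the mass near \<open>\<gamma>s\<close>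
  to curves near \<open>\<gamma>'\<close>, as this would make the derivative negative. This is the argument of
  \<open>support_optimal\<close>. It meets four difficulties.

  It must pay to leave not only \<open>\<gamma>s\<close> but the curves near it, so their running cost must
  not be much below that of \<open>\<gamma>s\<close>.
  This is Tonelli's lower semicontinuity, \<open>running_cost_lsc\<close>, which rests on the convexity of \<open>L\<close> in the
  velocity and on weak convergence of velocities. The latter comes from the fundamental theorem of
  calculus for absolutely continuous curves, \<open>ac_curve_FTC\<close>; curves on the torus are first lifted to
  \<open>\<real>\<^sup>d\<close>.

  Since the distribution of the starting points is prescribed, a curve starting near \<open>\<gamma>s 0\<close> cannot be
  replaced by \<open>\<gamma>'\<close> itself. It is replaced by a competitor that runs from its own starting point to the position
  of \<open>\<gamma>'\<close> at a small time \<open>h\<close> and then follows \<open>\<gamma>'\<close>. In a domain with boundary a straight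
  connection may leave the domain; near a boundary point the connection makes a detour into the
  interior, \<open>detour_connected_C2_domain\<close>. Its energy is small because \<open>\<gamma>'\<close> spends little energy up to time \<open>h\<close>.

  The definition of a linear derivative gives no rate that is uniform in time, and values of \<open>F\<close> along
  the flow need not be measurable in time. Measurability is dispensed with by
  \<open>nn_integral_le_add_measurable\<close>, and a rate by not passing to the limit \<open>s \<rightarrow> 0\<close> at all:
  along the segment from \<open>m t\<close> to the modified marginal, \<open>F\<close> is differentiable, and the mean value
  theorem, \<open>linear_derivative_mean_value\<close>, expresses its increment by \<open>f\<close> at an intermediate measure. This gives
  the inequality \<open>variation_inequality\<close> for small positive \<open>s\<close>.

  Finally \<open>f\<close> and \<open>g\<close> at the intermediate measures must be close to their values at \<open>m t\<close>, uniformly in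
  time and on a compact set of positions. This follows from their continuity for \<open>W2\<close>, as an explicit coupling
  bounds the Wasserstein distance of the marginals of the mixture, \<open>W2_mixture\<close>.\<close>


section \<open>Differentiation of integrals on the line\<close>

text \<open>The points of \<open>A\<close> around which arbitrarily small intervals carry mass at least \<open>\<alpha>\<close> times their
  radius are covered, by Vitali's lemma, by the five-fold enlargements of disjoint such intervals
  lying in an open neighbourhood of \<open>A\<close> of small mass; so they form a null set.\<close>

lemma AE_density_zero:
  fixes M :: "real measure"
  assumes setsM: "sets M = sets borel" and finM: "emeasure M UNIV \<noteq> \<infinity>"
    and A: "A \<in> sets borel" and null: "emeasure M A = 0"
  shows "AE x in lborel. x \<in> A \<longrightarrow> (\<forall>\<alpha>>0. \<exists>d>0. \<forall>r. 0 < r \<and> r < d \<longrightarrow> emeasure M (cball x r) \<le> ennreal (\<alpha> * r))"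
proof -
  have spM: "space M = UNIV" using sets_eq_imp_space_eq[OF setsM] by simp
  define N where "N \<alpha> = {x \<in> A. \<forall>d>0. \<exists>r. 0 < r \<and> r < d \<and> emeasure M (cball x r) > ennreal (\<alpha> * r)}" for \<alpha> :: real
  have neg: "negligible (N \<alpha>)" if \<alpha>: "\<alpha> > 0" for \<alpha>
    unfolding negligible_outer_le
  proof (intro allI impI)
    fix e :: real assume e: "e > 0"
    \<comment> \<open>the enlarged interval has length \<open>10 r\<close>, the original one has mass more than \<open>\<alpha> r\<close>\<close>
    define e' where "e' = e * \<alpha> / 10"
    have e': "e' > 0" using e \<alpha> by (simp add: e'_def)
    have "(INF U \<in> {U. A \<subseteq> U \<and> open U}. emeasure M U) = 0"
      using outer_regular[OF setsM _ A] finM null spM by simp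
    then have "(INF U \<in> {U. A \<subseteq> U \<and> open U}. emeasure M U) < ennreal e'"
      using e' by simp
    then obtain V where V: "A \<subseteq> V" "open V" "emeasure M V < ennreal e'"
      by (auto simp: INF_less_iff)
    define K where "K = {(x,r). x \<in> N \<alpha> \<and> 0 < r \<and> r < 1 \<and> cball x r \<subseteq> V \<and> emeasure M (cball x r) > ennreal (\<alpha> * r)}"
    have cov: "N \<alpha> \<subseteq> (\<Union>i\<in>K. cball (fst i) (snd i))"
    proof
      fix x assume x: "x \<in> N \<alpha>"
      then have "x \<in> V" using V(1) by (auto simp: N_def)
      then obtain d where d: "d > 0" "cball x d \<subseteq> V" using V(2) by (meson open_contains_cball)
      obtain r where r: "0 < r" "r < min d 1" "emeasure M (cball x r) > ennreal (\<alpha> * r)"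
        using x d(1) by (auto simp: N_def) (metis min_less_iff_conj zero_less_one)
      then have "(x,r) \<in> K" using x d by (auto simp: K_def)
      then show "x \<in> (\<Union>i\<in>K. cball (fst i) (snd i))" using r by force
    qed
    have "\<And>i. i \<in> K \<Longrightarrow> 0 < snd i \<and> snd i \<le> 1" by (auto simp: K_def)
    from Vitali_covering_lemma_cballs[OF cov this] obtain C where
      C: "countable C" "C \<subseteq> K" "pairwise (\<lambda>i j. disjnt (cball (fst i) (snd i)) (cball (fst j) (snd j))) C"
        "N \<alpha> \<subseteq> (\<Union>i\<in>C. cball (fst i) (5 * snd i))"
      by blast
    define T where "T = (\<Union>i\<in>C. cball (fst i) (5 * snd i))"
    have Tb: "T \<in> sets lborel"
      unfolding T_def using C(1) by (intro sets.countable_UN') auto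
    \<comment> \<open>countable subadditivity, with the sum over \<open>C\<close> written as an integral\<close>
    have "emeasure lborel T = (\<integral>\<^sup>+x. indicator T x \<partial>lborel)" using Tb by simp
    also have "\<dots> \<le> (\<integral>\<^sup>+x. (\<integral>\<^sup>+i. indicator (cball (fst i) (5 * snd i)) x \<partial>count_space C) \<partial>lborel)"
    proof (intro nn_integral_mono)
      fix x :: real
      show "indicator T x \<le> (\<integral>\<^sup>+i. indicator (cball (fst i) (5 * snd i)) x \<partial>count_space C :: ennreal)"
      proof (cases "x \<in> T")
        case True
        then obtain i where i: "i \<in> C" "x \<in> cball (fst i) (5 * snd i)" by (auto simp: T_def)
        have "(1::ennreal) = (\<integral>\<^sup>+j. indicator {i} j \<partial>count_space C)"
          using i(1) by (simp add: nn_integral_indicator)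
        also have "\<dots> \<le> (\<integral>\<^sup>+j. indicator (cball (fst j) (5 * snd j)) x \<partial>count_space C)"
          using i by (intro nn_integral_mono) (auto split: split_indicator)
        finally show ?thesis using True by simp
      qed simp
    qed
    also have "\<dots> = (\<integral>\<^sup>+i. emeasure lborel (cball (fst i) (5 * snd i)) \<partial>count_space C)"
      by (subst nn_integral_count_space_nn_integral[OF C(1)])
        (auto intro!: nn_integral_cong borel_measurable_indicator)
    also have "\<dots> \<le> (\<integral>\<^sup>+i. ennreal (10 / \<alpha>) * emeasure M (cball (fst i) (snd i)) \<partial>count_space C)"
    proof (intro nn_integral_mono)
      fix i assume "i \<in> space (count_space C)"
      then have i: "0 < snd i" "emeasure M (cball (fst i) (snd i)) > ennreal (\<alpha> * snd i)"
        using C(2) by (auto simp: K_def)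
      have "emeasure lborel (cball (fst i) (5 * snd i)) = ennreal (10 * snd i)"
        using i(1) by (simp add: cball_eq_atLeastAtMost)
      also have "\<dots> = ennreal (10/\<alpha>) * ennreal (\<alpha> * snd i)"
        using \<alpha> i(1) by (simp add: ennreal_mult'[symmetric])
      also have "\<dots> \<le> ennreal (10 / \<alpha>) * emeasure M (cball (fst i) (snd i))"
        using i(2) by (intro mult_left_mono) auto
      finally show "emeasure lborel (cball (fst i) (5 * snd i)) \<le> ennreal (10 / \<alpha>) * emeasure M (cball (fst i) (snd i))" .
    qed
    also have "\<dots> = ennreal (10 / \<alpha>) * (\<integral>\<^sup>+i. emeasure M (cball (fst i) (snd i)) \<partial>count_space C)"
      by (simp add: nn_integral_cmult)
    also have "(\<integral>\<^sup>+i. emeasure M (cball (fst i) (snd i)) \<partial>count_space C) = emeasure M (\<Union>i\<in>C. cball (fst i) (snd i))"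
    proof (rule emeasure_UN_countable[symmetric])
      show "disjoint_family_on (\<lambda>i. cball (fst i) (snd i)) C"
        using C(3) unfolding disjoint_family_on_def pairwise_def disjnt_def by blast
    qed (use C setsM in auto)
    also have "\<dots> \<le> emeasure M V"
      using C(2) V(2) setsM by (intro emeasure_mono) (auto simp: K_def subset_iff)
    also have "\<dots> \<le> ennreal e'" using V(3) by simp
    also have "ennreal (10/\<alpha>) * ennreal e' = ennreal e"
      using \<alpha> e' by (simp add: ennreal_mult'[symmetric] e'_def)
    finally have le: "emeasure lborel T \<le> ennreal e" by (simp add: mult_left_mono)
    have "T \<in> lmeasurable" using Tb le
      by (intro fmeasurableI) (auto simp: less_top[symmetric] top_unique)
    moreover have "measure lebesgue T \<le> e"
    proof -
      have "emeasure lebesgue T \<le> ennreal e" using le Tb by simp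
      then show ?thesis using e by (simp add: measure_def enn2real_leI)
    qed
    ultimately show "\<exists>T. N \<alpha> \<subseteq> T \<and> T \<in> lmeasurable \<and> measure lebesgue T \<le> e"
      using C(4) T_def by blast
  qed
  have "AE x in lebesgue. \<forall>n::nat. x \<notin> N (1 / Suc n)"
    unfolding AE_all_countable
  proof
    fix n :: nat
    have "N (1 / Suc n) \<in> null_sets lebesgue" using neg[of "1 / Suc n"] by (simp add: negligible_iff_null_sets)
    then show "AE x in lebesgue. x \<notin> N (1 / Suc n)" by (rule AE_not_in)
  qed
  then have "AE x in lborel. \<forall>n::nat. x \<notin> N (1 / Suc n)" by (simp only: AE_completion_iff)
  then show ?thesis
  proof (rule AE_mp, intro AE_I2 impI allI)
    fix x :: real and \<alpha> :: real
    assume *: "\<forall>n::nat. x \<notin> N (1 / Suc n)" "x \<in> A" "0 < \<alpha>"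
    obtain n :: nat where n: "1 / Suc n < \<alpha>" using *(3) nat_approx_posE by metis
    obtain d where d: "d > 0" "\<And>r. 0 < r \<Longrightarrow> r < d \<Longrightarrow> emeasure M (cball x r) \<le> ennreal (1 / Suc n * r)"
    proof -
      have "\<exists>d>0. \<forall>r. 0 < r \<and> r < d \<longrightarrow> \<not> ennreal (1 / Suc n * r) < emeasure M (cball x r)"
        using *(1)[rule_format, of n] *(2) unfolding N_def by blast
      then show thesis using that by (metis not_less)
    qed
    have "emeasure M (cball x r) \<le> ennreal (\<alpha> * r)" if "0 < r" "r < d" for r
      using d(2)[OF that] n that(1)
      by (elim order_trans) (intro ennreal_leI mult_right_mono, auto)
    then show "\<exists>d>0. \<forall>r. 0 < r \<and> r < d \<longrightarrow> emeasure M (cball x r) \<le> ennreal (\<alpha> * r)"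
      using d(1) by blast
  qed
qed

text \<open>Above the level \<open>c\<close>, the excess \<open>(\<rho> - c)\<^sup>+\<close> is the density of a measure which does not charge
  \<open>{\<rho> \<le> c}\<close>, so by the previous lemma averages of \<open>\<rho>\<close> around almost every point of this set are
  eventually at most \<open>c + e\<close>.\<close>

lemma AE_averages_upper:
  fixes \<rho> :: "real \<Rightarrow> real"
  assumes int: "set_integrable lborel {0..T} \<rho>" and T: "T > 0"
  shows "AE x in lborel. x \<in> {0<..<T} \<longrightarrow> \<rho> x \<le> c \<longrightarrow>
    (\<forall>e>0. \<exists>d>0. \<forall>a b. a \<le> x \<and> x \<le> b \<and> a < b \<and> b - a < d \<longrightarrow> (LINT t:{a..b}|lborel. \<rho> t) \<le> (c + e) * (b - a))"
proof -
  define \<rho>0 where "\<rho>0 x = indicator {0..T} x * \<rho> x" for x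
  have \<rho>0: "integrable lborel \<rho>0" using int by (simp add: set_integrable_def \<rho>0_def[abs_def])
  have [measurable]: "\<rho>0 \<in> borel_measurable borel" using \<rho>0 by auto
  define h where "h x = indicator {0..T} x * max 0 (\<rho>0 x - c)" for x :: real
  have h0: "h x \<ge> 0" for x by (simp add: h_def)
  have [measurable]: "h \<in> borel_measurable borel" by (simp add: h_def[abs_def])
  have "integrable lborel (\<lambda>x. indicator {0..T} x * \<bar>c\<bar> + \<bar>\<rho>0 x\<bar>)"
    using \<rho>0 by (intro Bochner_Integration.integrable_add integrable_mult_left integrable_abs)
      (auto simp: integrable_indicator_iff emeasure_lborel_Icc_eq)
  then have hint: "integrable lborel h"
    by (rule Bochner_Integration.integrable_bound) (auto simp: h_def split: split_indicator)
  define M where "M = density lborel (\<lambda>x. ennreal (h x))"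
  define A where "A = {x \<in> {0<..<T}. \<rho>0 x \<le> c}"
  have A: "A \<in> sets borel" unfolding A_def by measurable
  have emM: "emeasure M S = ennreal (LINT t:S|lborel. h t)" if "S \<in> sets borel" for S
  proof -
    have "emeasure M S = (\<integral>\<^sup>+x. ennreal (indicator S x * h x) \<partial>lborel)"
      using that by (simp add: M_def emeasure_density mult.commute ennreal_mult' ennreal_indicator h0)
    also have "\<dots> = ennreal (LINT t:S|lborel. h t)"
      unfolding set_lebesgue_integral_def
      using h0 that integrable_mult_indicator[OF _ hint, of S] by (subst nn_integral_eq_integral) auto
    finally show ?thesis .
  qed
  have 1: "sets M = sets borel" by (simp add: M_def)
  have 2: "emeasure M UNIV \<noteq> \<infinity>" by (simp add: emM)
  have "(\<lambda>t. indicator A t *\<^sub>R h t) = (\<lambda>t. 0)"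
    by (auto simp: A_def h_def fun_eq_iff split: split_indicator)
  then have 3: "emeasure M A = 0" using A by (simp add: emM set_lebesgue_integral_def)
  show ?thesis
    using AE_density_zero[OF 1 2 A 3]
  proof (rule AE_mp, intro AE_I2 impI allI)
    fix x e assume *: "x \<in> A \<longrightarrow> (\<forall>\<alpha>>0. \<exists>d>0. \<forall>r. 0 < r \<and> r < d \<longrightarrow> emeasure M (cball x r) \<le> ennreal (\<alpha> * r))"
      "x \<in> {0<..<T}" "\<rho> x \<le> c" "0 < (e::real)"
    then have "x \<in> A" by (auto simp: A_def \<rho>0_def)
    with *(1,4) obtain d where d: "d > 0" "\<And>r. 0 < r \<Longrightarrow> r < d \<Longrightarrow> emeasure M (cball x r) \<le> ennreal (e * r)" by blast
    define d' where "d' = min d (min x (T - x))"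
    have "(LINT t:{a..b}|lborel. \<rho> t) \<le> (c + e) * (b - a)"
      if ab: "a \<le> x" "x \<le> b" "a < b" "b - a < d'" for a b
    proof -
      define r where "r = b - a"
      have r: "0 < r" "r < d" and sub: "{a..b} \<subseteq> cball x r" "{a..b} \<subseteq> {0..T}"
        using ab *(2) by (auto simp: r_def d'_def cball_eq_atLeastAtMost)
      have "(LINT t:{a..b}|lborel. h t) \<le> (LINT t:cball x r|lborel. h t)"
        unfolding set_lebesgue_integral_def using sub h0
        by (intro integral_mono integrable_mult_indicator hint) (auto split: split_indicator)
      also have "\<dots> \<le> e * r"
        using d(2)[OF r] r *(4) by (subst (asm) emM) (auto simp: ennreal_le_iff)
      finally have 1: "(LINT t:{a..b}|lborel. h t) \<le> e * (b - a)" by (simp add: r_def)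
      have i1: "integrable lborel (\<lambda>t. indicator {a..b} t *\<^sub>R \<rho> t)"
        using set_integrable_subset[OF int _ sub(2)] by (simp add: set_integrable_def)
      have i2: "integrable lborel (\<lambda>t. indicator {a..b} t *\<^sub>R h t + indicator {a..b} t *\<^sub>R c)"
        using integrable_mult_indicator[OF _ hint, of "{a..b}"]
        by (intro Bochner_Integration.integrable_add)
          (auto intro!: integrable_real_indicator simp: mult.commute emeasure_lborel_Icc_eq)
      have "(LINT t:{a..b}|lborel. \<rho> t) \<le> (\<integral>t. (indicator {a..b} t *\<^sub>R h t + indicator {a..b} t *\<^sub>R c) \<partial>lborel)"
        unfolding set_lebesgue_integral_def using sub(2)
        by (intro integral_mono i1 i2) (auto simp: h_def \<rho>0_def split: split_indicator)
      also have "\<dots> = (LINT t:{a..b}|lborel. h t) + c * (b - a)"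
        using integrable_mult_indicator[OF _ hint, of "{a..b}"] ab
        unfolding set_lebesgue_integral_def
        by (subst Bochner_Integration.integral_add)
          (auto intro!: integrable_real_indicator simp: mult.commute emeasure_lborel_Icc_eq)
      also have "\<dots> \<le> (c + e) * (b - a)" using 1 by (simp add: algebra_simps)
      finally show ?thesis .
    qed
    then show "\<exists>d>0. \<forall>a b. a \<le> x \<and> x \<le> b \<and> a < b \<and> b - a < d \<longrightarrow> (LINT t:{a..b}|lborel. \<rho> t) \<le> (c + e) * (b - a)"
      using d(1) *(2) by (intro exI[of _ d']) (auto simp: d'_def)
  qed
qed

text \<open>Apply the upper bound to \<open>\<rho>\<close> and to \<open>- \<rho>\<close>, at all rational levels at once: a rational level just
  above \<open>\<rho> x\<close> gives the bound at \<open>x\<close>.\<close>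

lemma AE_averages:
  fixes \<rho> :: "real \<Rightarrow> real"
  assumes int: "set_integrable lborel {0..T} \<rho>" and T: "T > 0"
  shows "AE x in lborel. x \<in> {0<..<T} \<longrightarrow>
    (\<forall>e>0. \<exists>d>0. \<forall>a b. a \<le> x \<and> x \<le> b \<and> a < b \<and> b - a < d \<longrightarrow>
      \<bar>(LINT t:{a..b}|lborel. \<rho> t) - \<rho> x * (b - a)\<bar> \<le> e * (b - a))"
proof -
  have int': "set_integrable lborel {0..T} (\<lambda>x. - \<rho> x)"
    using int unfolding set_integrable_def by simp
  have "AE x in lborel. \<forall>c\<in>\<rat>. x \<in> {0<..<T} \<longrightarrow> \<rho> x \<le> c \<longrightarrow>
    (\<forall>e>0. \<exists>d>0. \<forall>a b. a \<le> x \<and> x \<le> b \<and> a < b \<and> b - a < d \<longrightarrow> (LINT t:{a..b}|lborel. \<rho> t) \<le> (c + e) * (b - a))"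
    by (subst AE_ball_countable[OF countable_rat]) (intro ballI AE_averages_upper[OF int T])
  moreover have "AE x in lborel. \<forall>c\<in>\<rat>. x \<in> {0<..<T} \<longrightarrow> - \<rho> x \<le> c \<longrightarrow>
    (\<forall>e>0. \<exists>d>0. \<forall>a b. a \<le> x \<and> x \<le> b \<and> a < b \<and> b - a < d \<longrightarrow> (LINT t:{a..b}|lborel. - \<rho> t) \<le> (c + e) * (b - a))"
    by (subst AE_ball_countable[OF countable_rat]) (intro ballI AE_averages_upper[OF int' T])
  ultimately show ?thesis
  proof eventually_elim
    case (elim x)
    show ?case
    proof (intro impI allI)
      fix e :: real assume x: "x \<in> {0<..<T}" and e: "e > 0"
      obtain c where c: "c \<in> \<rat>" "\<rho> x < c" "c < \<rho> x + e/2" using Rats_dense_in_real[of "\<rho> x" "\<rho> x + e/2"] e by auto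
      obtain c' where c': "c' \<in> \<rat>" "- \<rho> x < c'" "c' < - \<rho> x + e/2" using Rats_dense_in_real[of "- \<rho> x" "- \<rho> x + e/2"] e by auto
      obtain d where d: "d > 0" "\<And>a b. a \<le> x \<and> x \<le> b \<and> a < b \<and> b - a < d \<Longrightarrow> (LINT t:{a..b}|lborel. \<rho> t) \<le> (c + e/2) * (b - a)"
        using elim(1)[rule_format, OF c(1) x _ half_gt_zero[OF e]] c(2) by (auto simp: less_imp_le)
      obtain d' where d': "d' > 0" "\<And>a b. a \<le> x \<and> x \<le> b \<and> a < b \<and> b - a < d' \<Longrightarrow> (LINT t:{a..b}|lborel. - \<rho> t) \<le> (c' + e/2) * (b - a)"
        using elim(2)[rule_format, OF c'(1) x _ half_gt_zero[OF e]] c'(2) by (auto simp: less_imp_le)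
      have "\<bar>(LINT t:{a..b}|lborel. \<rho> t) - \<rho> x * (b - a)\<bar> \<le> e * (b - a)"
        if ab: "a \<le> x" "x \<le> b" "a < b" "b - a < min d d'" for a b
      proof -
        have "(LINT t:{a..b}|lborel. \<rho> t) \<le> (c + e/2) * (b - a)" using d(2)[of a b] ab by simp
        also have "\<dots> \<le> (\<rho> x + e) * (b - a)" using c(3) ab by (intro mult_right_mono) auto
        finally have 1: "(LINT t:{a..b}|lborel. \<rho> t) \<le> (\<rho> x + e) * (b - a)" .
        have "- (LINT t:{a..b}|lborel. \<rho> t) \<le> (c' + e/2) * (b - a)" using d'(2)[of a b] ab
          by (simp add: set_lebesgue_integral_def)
        also have "\<dots> \<le> (- \<rho> x + e) * (b - a)" using c'(3) ab by (intro mult_right_mono) auto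
        finally have "- (LINT t:{a..b}|lborel. \<rho> t) \<le> (- \<rho> x + e) * (b - a)" .
        with 1 show ?thesis by (simp add: algebra_simps abs_le_iff)
      qed
      then show "\<exists>d>0. \<forall>a b. a \<le> x \<and> x \<le> b \<and> a < b \<and> b - a < d \<longrightarrow>
        \<bar>(LINT t:{a..b}|lborel. \<rho> t) - \<rho> x * (b - a)\<bar> \<le> e * (b - a)"
        using d(1) d'(1) by (intro exI[of _ "min d d'"]) auto
    qed
  qed
qed


section \<open>Absolutely continuous curves\<close>

definition interval_family :: "real \<Rightarrow> nat \<Rightarrow> (nat \<Rightarrow> real) \<Rightarrow> (nat \<Rightarrow> real) \<Rightarrow> bool" where
  "interval_family T n A B \<longleftrightarrow> (\<forall>i<n. 0 \<le> A i \<and> A i \<le> B i \<and> B i \<le> T) \<and>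
    pairwise (\<lambda>i j. {A i<..<B i} \<inter> {A j<..<B j} = {}) {..<n}"

lemma ac_curveD:
  assumes "absolutely_continuous_curve T c" "\<epsilon> > 0"
  shows "\<exists>\<delta>>0. \<forall>n A B. interval_family T n A B \<longrightarrow> (\<Sum>i<n. B i - A i) < \<delta> \<longrightarrow>
    (\<Sum>i<n. dist (c (A i)) (c (B i))) < \<epsilon>"
  using assms unfolding absolutely_continuous_curve_def interval_family_def by meson

lemma ac_curveI:
  assumes "\<And>\<epsilon>. \<epsilon> > 0 \<Longrightarrow> \<exists>\<delta>>0. \<forall>n A B. interval_family T n A B \<longrightarrow> (\<Sum>i<n. B i - A i) < \<delta> \<longrightarrow>
    (\<Sum>i<n. dist (c (A i)) (c (B i))) < \<epsilon>"
  shows "absolutely_continuous_curve T c"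
  using assms unfolding absolutely_continuous_curve_def interval_family_def by meson

text \<open>Absolute continuity compares chords of short intervals only.\<close>

lemma ac_curve_dominated:
  fixes c :: "real \<Rightarrow> 'a::metric_space" and l :: "real \<Rightarrow> 'b::metric_space"
  assumes l: "absolutely_continuous_curve T l" and e: "e > 0"
    and le: "\<And>s t. 0 \<le> s \<Longrightarrow> s \<le> t \<Longrightarrow> t \<le> T \<Longrightarrow> t - s < e \<Longrightarrow> dist (c s) (c t) \<le> dist (l s) (l t)"
  shows "absolutely_continuous_curve T c"
proof (rule ac_curveI)
  fix \<epsilon> :: real assume "\<epsilon> > 0"
  then obtain \<delta> where \<delta>: "\<delta> > 0" "\<And>n A B. interval_family T n A B \<Longrightarrow> (\<Sum>i<n. B i - A i) < \<delta> \<Longrightarrow> (\<Sum>i<n. dist (l (A i)) (l (B i))) < \<epsilon>"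
    using ac_curveD[OF l] by blast
  have "(\<Sum>i<n. dist (c (A i)) (c (B i))) < \<epsilon>"
    if fam: "interval_family T n A B" and len: "(\<Sum>i<n. B i - A i) < min \<delta> e" for n A B
  proof -
    have AB: "0 \<le> A i" "A i \<le> B i" "B i \<le> T" if "i < n" for i using fam that by (auto simp: interval_family_def)
    have "(\<Sum>i<n. dist (c (A i)) (c (B i))) \<le> (\<Sum>i<n. dist (l (A i)) (l (B i)))"
    proof (intro sum_mono le)
      fix i assume i: "i \<in> {..<n}"
      have "B i - A i \<le> (\<Sum>i<n. B i - A i)" using i AB(2) by (intro member_le_sum) auto
      then show "B i - A i < e" using len by simp
    qed (use AB in auto)
    also have "\<dots> < \<epsilon>" using \<delta>(2)[OF fam] len by simp
    finally show ?thesis .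
  qed
  then show "\<exists>\<delta>>0. \<forall>n A B. interval_family T n A B \<longrightarrow> (\<Sum>i<n. B i - A i) < \<delta> \<longrightarrow>
      (\<Sum>i<n. dist (c (A i)) (c (B i))) < \<epsilon>"
    using \<delta>(1) e by (intro exI[of _ "min \<delta> e"]) auto
qed

lemma interval_family_single: "0 \<le> a \<Longrightarrow> a \<le> b \<Longrightarrow> b \<le> T \<Longrightarrow> interval_family T 1 (\<lambda>_. a) (\<lambda>_. b)"
  by (auto simp: interval_family_def pairwise_def)

lemma interval_family_sub:
  assumes "interval_family T n A B" "\<And>i. i < n \<Longrightarrow> 0 \<le> A' i \<and> A' i \<le> B' i \<and> B' i \<le> T"
    "\<And>i. i < n \<Longrightarrow> {A' i<..<B' i} \<subseteq> {A i<..<B i}"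
  shows "interval_family T n A' B'"
  unfolding interval_family_def
proof (intro conjI pairwiseI)
  show "\<forall>i<n. 0 \<le> A' i \<and> A' i \<le> B' i \<and> B' i \<le> T" using assms(2) by blast
  fix i j assume ij: "i \<in> {..<n}" "j \<in> {..<n}" "i \<noteq> j"
  then have "{A i<..<B i} \<inter> {A j<..<B j} = {}"
    using assms(1) by (simp add: interval_family_def pairwise_def)
  then show "{A' i<..<B' i} \<inter> {A' j<..<B' j} = {}"
    using assms(3)[of i] assms(3)[of j] ij by blast
qed

lemma interval_family_length:
  assumes "interval_family T n A B" "\<And>i. i < n \<Longrightarrow> {A i<..<B i} \<subseteq> E" "E \<in> sets borel"
  shows "ennreal (\<Sum>i<n. B i - A i) \<le> emeasure lborel E"
proof -
  have AB: "A i \<le> B i" if "i < n" for i using assms(1) that by (auto simp: interval_family_def)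
  have "ennreal (\<Sum>i<n. B i - A i) = (\<Sum>i<n. ennreal (B i - A i))"
    using AB by (subst sum_ennreal) auto
  also have "\<dots> = (\<Sum>i<n. emeasure lborel {A i<..<B i})" using AB by simp
  also have "\<dots> = emeasure lborel (\<Union>i<n. {A i<..<B i})"
    using assms(1) by (intro sum_emeasure) (auto simp: interval_family_def pairwise_def disjoint_family_on_def)
  also have "\<dots> \<le> emeasure lborel E" using assms(2,3) by (intro emeasure_mono) auto
  finally show ?thesis .
qed

lemma ac_curve_uniformly_continuous:
  assumes "absolutely_continuous_curve T c" "\<epsilon> > 0"
  shows "\<exists>\<delta>>0. \<forall>s\<in>{0..T}. \<forall>t\<in>{0..T}. \<bar>s - t\<bar> < \<delta> \<longrightarrow> dist (c s) (c t) < \<epsilon>"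
proof -
  obtain \<delta> where \<delta>: "\<delta> > 0" "\<And>n A B. interval_family T n A B \<Longrightarrow> (\<Sum>i<n. B i - A i) < \<delta> \<Longrightarrow> (\<Sum>i<n. dist (c (A i)) (c (B i))) < \<epsilon>"
    using ac_curveD[OF assms] by blast
  have le: "dist (c s) (c t) < \<epsilon>" if "s \<in> {0..T}" "t \<in> {0..T}" "\<bar>s - t\<bar> < \<delta>" "s \<le> t" for s t
    using \<delta>(2)[OF interval_family_single[of s t T]] that by simp
  have "dist (c s) (c t) < \<epsilon>" if "s \<in> {0..T}" "t \<in> {0..T}" "\<bar>s - t\<bar> < \<delta>" for s t
    using le[of s t] le[of t s] that by (cases "s \<le> t") (auto simp: dist_commute abs_minus_commute)
  then show ?thesis using \<delta>(1) by blast
qed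

lemma ac_curve_continuous:
  assumes "absolutely_continuous_curve T c"
  shows "continuous_on {0..T} c"
  unfolding continuous_on_iff
proof (intro ballI allI impI)
  fix x \<epsilon> :: real assume "x \<in> {0..T}" "0 < \<epsilon>"
  obtain \<delta> where "\<delta> > 0" "\<And>s t. s \<in> {0..T} \<Longrightarrow> t \<in> {0..T} \<Longrightarrow> \<bar>s - t\<bar> < \<delta> \<Longrightarrow> dist (c s) (c t) < \<epsilon>"
    using ac_curve_uniformly_continuous[OF assms \<open>0 < \<epsilon>\<close>] by blast
  then show "\<exists>d>0. \<forall>x'\<in>{0..T}. dist x' x < d \<longrightarrow> dist (c x') (c x) < \<epsilon>"
    using \<open>x \<in> {0..T}\<close> by (auto simp: dist_real_def)
qed

text \<open>The total variation is taken as a set function of the open set that carries the chords, so that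
  it is superadditive by concatenation of families, and subadditive when a point is removed. Hence it is
  additive on adjacent intervals.\<close>

definition chord_sums :: "real \<Rightarrow> (real \<Rightarrow> 'p::metric_space) \<Rightarrow> real set \<Rightarrow> real set" where
  "chord_sums T c E = {x. \<exists>n A B. interval_family T n A B \<and> (\<forall>i<n. {A i<..<B i} \<subseteq> E) \<and>
    x = (\<Sum>i<n. dist (c (A i)) (c (B i)))}"

definition total_variation :: "real \<Rightarrow> (real \<Rightarrow> 'p::metric_space) \<Rightarrow> real set \<Rightarrow> real" where
  "total_variation T c E = Sup (chord_sums T c E)"

lemma zero_in_chord_sums: "0 \<in> chord_sums T c E"
  unfolding chord_sums_def by (intro CollectI exI[of _ "0::nat"]) (auto simp: interval_family_def pairwise_def)

lemma chord_sums_mono: "E \<subseteq> E' \<Longrightarrow> chord_sums T c E \<subseteq> chord_sums T c E'"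
  unfolding chord_sums_def by blast

text \<open>Cutting every interval of the family at \<open>s\<close> does not decrease the sum, by the triangle
  inequality.\<close>

lemma chord_sums_split:
  assumes "x \<in> chord_sums T c E" "s \<in> {0..T}"
  obtains y z where "y \<in> chord_sums T c (E \<inter> {..<s})" "z \<in> chord_sums T c (E \<inter> {s<..})" "x \<le> y + z"
proof -
  obtain n A B where AB: "interval_family T n A B" "\<And>i. i < n \<Longrightarrow> {A i<..<B i} \<subseteq> E"
    "x = (\<Sum>i<n. dist (c (A i)) (c (B i)))"
    using assms(1) unfolding chord_sums_def by blast
  have r: "0 \<le> A i \<and> A i \<le> B i \<and> B i \<le> T" if "i < n" for i
    using AB(1) that by (auto simp: interval_family_def)
  let ?y = "\<Sum>i<n. dist (c (min (A i) s)) (c (min (B i) s))"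
  let ?z = "\<Sum>i<n. dist (c (max (A i) s)) (c (max (B i) s))"
  have f1: "interval_family T n (\<lambda>i. min (A i) s) (\<lambda>i. min (B i) s)"
    by (rule interval_family_sub[OF AB(1)]) (use r assms(2) in \<open>force+\<close>)
  have f2: "interval_family T n (\<lambda>i. max (A i) s) (\<lambda>i. max (B i) s)"
    by (rule interval_family_sub[OF AB(1)]) (use r assms(2) in \<open>force+\<close>)
  have s1: "{min (A i) s<..<min (B i) s} \<subseteq> {A i<..<B i} \<inter> {..<s}" for i
    by (auto simp: min_def split: if_splits)
  have s2: "{max (A i) s<..<max (B i) s} \<subseteq> {A i<..<B i} \<inter> {s<..}" for i
    by (auto simp: max_def split: if_splits)
  have "?y \<in> chord_sums T c (E \<inter> {..<s})"
    unfolding chord_sums_def using f1 s1 AB(2) by blast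
  moreover have "?z \<in> chord_sums T c (E \<inter> {s<..})"
    unfolding chord_sums_def using f2 s2 AB(2) by blast
  moreover have "x \<le> ?y + ?z"
    unfolding AB(3) sum.distrib[symmetric]
  proof (rule sum_mono)
    fix i assume "i \<in> {..<n}"
    then have "A i \<le> B i" using r by auto
    then show "dist (c (A i)) (c (B i)) \<le> dist (c (min (A i) s)) (c (min (B i) s)) + dist (c (max (A i) s)) (c (max (B i) s))"
      by (auto simp: min_def max_def dist_triangle)
  qed
  ultimately show ?thesis by (rule that)
qed

lemma sum_lessThan_append:
  fixes n m :: nat
  shows "(\<Sum>k<n + m. if k < n then f k else g (k - n)) = (\<Sum>k<n. f k) + (\<Sum>k<m. (g k :: real))"
  by (induction m) (auto simp: algebra_simps)

lemma chord_sums_concat: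
  assumes "x \<in> chord_sums T c E" "y \<in> chord_sums T c E'" "E \<inter> E' = {}"
  shows "x + y \<in> chord_sums T c (E \<union> E')"
proof -
  obtain n A B where AB: "interval_family T n A B" "\<And>i. i < n \<Longrightarrow> {A i<..<B i} \<subseteq> E"
    "x = (\<Sum>i<n. dist (c (A i)) (c (B i)))"
    using assms(1) unfolding chord_sums_def by blast
  obtain m A' B' where AB': "interval_family T m A' B'" "\<And>i. i < m \<Longrightarrow> {A' i<..<B' i} \<subseteq> E'"
    "y = (\<Sum>i<m. dist (c (A' i)) (c (B' i)))"
    using assms(2) unfolding chord_sums_def by blast
  define P where "P i = (if i < n then A i else A' (i - n))" for i
  define Q where "Q i = (if i < n then B i else B' (i - n))" for i
  have disj: "{A i<..<B i} \<inter> {A' j<..<B' j} = {}" if "i < n" "j < m" for i j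
    using AB(2)[OF that(1)] AB'(2)[OF that(2)] assms(3) by blast
  have pw: "i < n \<Longrightarrow> j < n \<Longrightarrow> i \<noteq> j \<Longrightarrow> {A i<..<B i} \<inter> {A j<..<B j} = {}"
    "i < m \<Longrightarrow> j < m \<Longrightarrow> i \<noteq> j \<Longrightarrow> {A' i<..<B' i} \<inter> {A' j<..<B' j} = {}" for i j
    using AB(1) AB'(1) by (auto simp: interval_family_def pairwise_def)
  have fam: "interval_family T (n + m) P Q"
    unfolding interval_family_def
  proof (intro conjI pairwiseI)
    show "\<forall>i<n + m. 0 \<le> P i \<and> P i \<le> Q i \<and> Q i \<le> T"
      using AB(1) AB'(1) by (auto simp: interval_family_def P_def Q_def)
    fix i j assume ij: "i \<in> {..<n + m}" "j \<in> {..<n + m}" "i \<noteq> j"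
    show "{P i<..<Q i} \<inter> {P j<..<Q j} = {}"
    proof (cases "i < n"; cases "j < n")
      assume "i < n" "j < n"
      then show ?thesis using pw(1)[of i j] ij by (simp add: P_def Q_def)
    next
      assume "i < n" "\<not> j < n"
      then show ?thesis using disj[of i "j - n"] ij by (simp add: P_def Q_def)
    next
      assume "\<not> i < n" "j < n"
      then show ?thesis using disj[of j "i - n"] ij by (simp add: P_def Q_def Int_commute)
    next
      assume *: "\<not> i < n" "\<not> j < n"
      moreover have "i - n \<noteq> j - n" "i - n < m" "j - n < m" using * ij by auto
      ultimately show ?thesis using pw(2)[of "i - n" "j - n"] by (simp add: P_def Q_def)
    qed
  qed
  have "(\<Sum>i<n + m. dist (c (P i)) (c (Q i))) = x + y"
    unfolding AB(3) AB'(3) sum_lessThan_append[symmetric] by (intro sum.cong) (auto simp: P_def Q_def)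
  moreover have "{P i<..<Q i} \<subseteq> E \<union> E'" if "i < n + m" for i
  proof (cases "i < n")
    case True
    then show ?thesis using AB(2)[of i] by (auto simp: P_def Q_def)
  next
    case False
    then have "i - n < m" using that by simp
    then show ?thesis using AB'(2)[of "i - n"] False by (auto simp: P_def Q_def)
  qed
  ultimately show ?thesis unfolding chord_sums_def using fam
    by (intro CollectI exI[of _ "n + m"] exI[of _ P] exI[of _ Q]) simp
qed

lemma ac_chord_sums_small:
  assumes "absolutely_continuous_curve T c" "\<epsilon> > 0"
  shows "\<exists>\<delta>>0. \<forall>E\<in>sets borel. emeasure lborel E < ennreal \<delta> \<longrightarrow> (\<forall>x\<in>chord_sums T c E. x < \<epsilon>)"
proof -
  obtain \<delta> where \<delta>: "\<delta> > 0" "\<And>n A B. interval_family T n A B \<Longrightarrow> (\<Sum>i<n. B i - A i) < \<delta> \<Longrightarrow> (\<Sum>i<n. dist (c (A i)) (c (B i))) < \<epsilon>"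
    using ac_curveD[OF assms] by blast
  show ?thesis
  proof (intro exI[of _ \<delta>] conjI \<delta>(1) ballI impI)
    fix E x assume E: "E \<in> sets borel" "emeasure lborel E < ennreal \<delta>" "x \<in> chord_sums T c E"
    then obtain n A B where AB: "interval_family T n A B" "\<And>i. i < n \<Longrightarrow> {A i<..<B i} \<subseteq> E"
      "x = (\<Sum>i<n. dist (c (A i)) (c (B i)))"
      unfolding chord_sums_def by blast
    have "ennreal (\<Sum>i<n. B i - A i) < ennreal \<delta>"
      using interval_family_length[OF AB(1,2) E(1)] E(2) by (rule le_less_trans)
    then have "(\<Sum>i<n. B i - A i) < \<delta>" by (meson ennreal_leI leD leI)
    then show "x < \<epsilon>" using \<delta>(2)[OF AB(1)] AB(3) by simp
  qed
qed

text \<open>On short intervals all chord sums are at most 1, and boundedness passes from two adjacent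
  intervals to their union; bisection gives it on the whole interval.\<close>

lemma ac_bdd_chord_sums:
  assumes "absolutely_continuous_curve T c" "T > 0"
  shows "bdd_above (chord_sums T c E)"
proof -
  obtain \<delta> where \<delta>: "\<delta> > 0" "\<And>E x. E \<in> sets borel \<Longrightarrow> emeasure lborel E < ennreal \<delta> \<Longrightarrow> x \<in> chord_sums T c E \<Longrightarrow> x < 1"
    using ac_chord_sums_small[OF assms(1) zero_less_one] by blast
  define Q where "Q a b \<longleftrightarrow> (0 \<le> a \<longrightarrow> b \<le> T \<longrightarrow> a \<le> b \<longrightarrow> bdd_above (chord_sums T c {a<..<b}))" for a b
  have "0 \<le> T" using assms by simp
  then have "Q 0 T"
  proof (induction rule: Bolzano)
    case (trans a b d)
    show ?case
      unfolding Q_def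
    proof (intro impI)
      assume ad: "0 \<le> a" "d \<le> T" "a \<le> d"
      obtain K K' where K: "\<And>x. x \<in> chord_sums T c {a<..<b} \<Longrightarrow> x \<le> K" "\<And>x. x \<in> chord_sums T c {b<..<d} \<Longrightarrow> x \<le> K'"
        using trans ad unfolding Q_def bdd_above_def by (meson order_trans)
      have "x \<le> K + K'" if x: "x \<in> chord_sums T c {a<..<d}" for x
      proof -
        have "b \<in> {0..T}" using trans ad by simp
        from chord_sums_split[OF x this] obtain y z where
          yz: "y \<in> chord_sums T c ({a<..<d} \<inter> {..<b})" "z \<in> chord_sums T c ({a<..<d} \<inter> {b<..})" "x \<le> y + z" .
        have "y \<le> K" using chord_sums_mono[of "{a<..<d} \<inter> {..<b}" "{a<..<b}" T c] yz(1) by (intro K(1)) (auto simp: subset_iff)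
        moreover have "z \<le> K'" using chord_sums_mono[of "{a<..<d} \<inter> {b<..}" "{b<..<d}" T c] yz(2) by (intro K(2)) (auto simp: subset_iff)
        ultimately show ?thesis using yz(3) by simp
      qed
      then show "bdd_above (chord_sums T c {a<..<d})" by (rule bdd_aboveI)
    qed
  next
    case (local x)
    have "bdd_above (chord_sums T c {a<..<b})" if "a \<le> x" "x \<le> b" "b - a < \<delta>" for a b
    proof (rule bdd_aboveI[of _ 1])
      fix y assume "y \<in> chord_sums T c {a<..<b}"
      moreover have "emeasure lborel {a<..<b} < ennreal \<delta>" using that \<delta>(1) by (simp add: ennreal_lessI)
      ultimately show "y \<le> 1" using \<delta>(2)[of "{a<..<b}" y] by simp
    qed
    then show ?case using \<delta>(1) unfolding Q_def by (intro exI[of _ \<delta>]) simp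
  qed
  then have b: "bdd_above (chord_sums T c {0<..<T})" using assms by (simp add: Q_def)
  have "chord_sums T c E \<subseteq> chord_sums T c {0<..<T}"
  proof
    fix x assume "x \<in> chord_sums T c E"
    then obtain n A B where AB: "interval_family T n A B" "x = (\<Sum>i<n. dist (c (A i)) (c (B i)))"
      unfolding chord_sums_def by blast
    have "{A i<..<B i} \<subseteq> {0<..<T}" if "i < n" for i
      using AB(1) that unfolding interval_family_def by fastforce
    then show "x \<in> chord_sums T c {0<..<T}" unfolding chord_sums_def using AB by blast
  qed
  with b show ?thesis by (rule bdd_above_mono)
qed

context
  fixes T :: real and c :: "real \<Rightarrow> 'p::metric_space"
  assumes ac: "absolutely_continuous_curve T c" and T: "T > 0"
begin

lemma chord_sum_le_variation: "x \<in> chord_sums T c E \<Longrightarrow> x \<le> total_variation T c E"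
  unfolding total_variation_def by (intro cSup_upper ac_bdd_chord_sums ac T)

lemma variation_le: "(\<And>x. x \<in> chord_sums T c E \<Longrightarrow> x \<le> K) \<Longrightarrow> total_variation T c E \<le> K"
  unfolding total_variation_def using zero_in_chord_sums[of T c E] by (intro cSup_least) auto

lemma variation_mono: "E \<subseteq> E' \<Longrightarrow> total_variation T c E \<le> total_variation T c E'"
  by (intro variation_le chord_sum_le_variation) (use chord_sums_mono in blast)

lemma variation_superadditive:
  assumes "E \<inter> E' = {}"
  shows "total_variation T c E + total_variation T c E' \<le> total_variation T c (E \<union> E')"
proof -
  have "total_variation T c E \<le> total_variation T c (E \<union> E') - y" if y: "y \<in> chord_sums T c E'" for y
  proof (rule variation_le)
    fix x assume "x \<in> chord_sums T c E"
    from chord_sum_le_variation[OF chord_sums_concat[OF this y assms]]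
    show "x \<le> total_variation T c (E \<union> E') - y" by simp
  qed
  then have "total_variation T c E' \<le> total_variation T c (E \<union> E') - total_variation T c E"
    by (intro variation_le) (force simp: algebra_simps)
  then show ?thesis by simp
qed

lemma variation_split:
  assumes "s \<in> {0..T}"
  shows "total_variation T c E \<le> total_variation T c (E \<inter> {..<s}) + total_variation T c (E \<inter> {s<..})"
proof (rule variation_le)
  fix x assume "x \<in> chord_sums T c E"
  from chord_sums_split[OF this assms] obtain y z where
    "y \<in> chord_sums T c (E \<inter> {..<s})" "z \<in> chord_sums T c (E \<inter> {s<..})" "x \<le> y + z" .
  then show "x \<le> total_variation T c (E \<inter> {..<s}) + total_variation T c (E \<inter> {s<..})"
    using chord_sum_le_variation[of y] chord_sum_le_variation[of z] by fastforce
qed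

lemma variation_interval:
  assumes "0 \<le> s" "s \<le> t" "t \<le> T"
  shows "total_variation T c {0<..<t} - total_variation T c {0<..<s} = total_variation T c {s<..<t}"
proof (rule antisym)
  have "{0<..<t} \<inter> {..<s} = {0<..<s}" "{0<..<t} \<inter> {s<..} = {s<..<t}" using assms by auto
  then show "total_variation T c {0<..<t} - total_variation T c {0<..<s} \<le> total_variation T c {s<..<t}"
    using variation_split[of s "{0<..<t}"] assms by simp
  have "total_variation T c {0<..<s} + total_variation T c {s<..<t} \<le> total_variation T c ({0<..<s} \<union> {s<..<t})"
    by (intro variation_superadditive) auto
  also have "\<dots> \<le> total_variation T c {0<..<t}" using assms by (intro variation_mono) auto
  finally show "total_variation T c {s<..<t} \<le> total_variation T c {0<..<t} - total_variation T c {0<..<s}" by simp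
qed

lemma chord_le_variation:
  assumes "0 \<le> s" "s \<le> t" "t \<le> T"
  shows "dist (c s) (c t) \<le> total_variation T c {s<..<t}"
proof (rule chord_sum_le_variation)
  show "dist (c s) (c t) \<in> chord_sums T c {s<..<t}"
    unfolding chord_sums_def using interval_family_single[OF assms]
    by (intro CollectI exI[of _ 1] exI[of _ "\<lambda>_. s"] exI[of _ "\<lambda>_. t"]) auto
qed

lemma variation_sum:
  assumes "interval_family T n A B"
  shows "(\<Sum>i<n. total_variation T c {A i<..<B i}) \<le> total_variation T c (\<Union>i<n. {A i<..<B i})"
  using assms
proof (induction n)
  case 0
  then show ?case using chord_sum_le_variation[OF zero_in_chord_sums] by simp
next
  case (Suc n)
  have fam: "interval_family T n A B"
    using Suc.prems by (auto simp: interval_family_def pairwise_def)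
  have disj: "(\<Union>i<n. {A i<..<B i}) \<inter> {A n<..<B n} = {}"
  proof -
    have "{A i<..<B i} \<inter> {A n<..<B n} = {}" if "i < n" for i
      using Suc.prems that unfolding interval_family_def pairwise_def by (simp add: Ball_def)
    then show ?thesis by blast
  qed
  have eq: "(\<Union>i<Suc n. {A i<..<B i}) = (\<Union>i<n. {A i<..<B i}) \<union> {A n<..<B n}"
    by (auto simp: lessThan_Suc)
  show ?case unfolding eq using Suc.IH[OF fam] variation_superadditive[OF disj] by simp
qed

text \<open>The increments of the variation over a family of intervals add up to at most the variation on
  their union, an open set of small measure.\<close>

lemma ac_variation: "absolutely_continuous_curve T (\<lambda>t. total_variation T c {0<..<t})"
proof (rule ac_curveI)
  fix \<epsilon> :: real assume \<epsilon>: "\<epsilon> > 0"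
  obtain \<delta> where \<delta>: "\<delta> > 0" "\<And>E x. E \<in> sets borel \<Longrightarrow> emeasure lborel E < ennreal \<delta> \<Longrightarrow> x \<in> chord_sums T c E \<Longrightarrow> x < \<epsilon>/2"
    using ac_chord_sums_small[OF ac half_gt_zero[OF \<epsilon>]] by blast
  have "(\<Sum>i<n. dist (total_variation T c {0<..<A i}) (total_variation T c {0<..<B i})) < \<epsilon>"
    if fam: "interval_family T n A B" and len: "(\<Sum>i<n. B i - A i) < \<delta>" for n A B
  proof -
    let ?E = "\<Union>i<n. {A i<..<B i}"
    have AB: "0 \<le> A i" "A i \<le> B i" "B i \<le> T" if "i < n" for i using fam that by (auto simp: interval_family_def)
    have "(\<Sum>i<n. dist (total_variation T c {0<..<A i}) (total_variation T c {0<..<B i})) = (\<Sum>i<n. total_variation T c {A i<..<B i})"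
    proof (intro sum.cong refl)
      fix i assume "i \<in> {..<n}"
      then have i: "i < n" by simp
      show "dist (total_variation T c {0<..<A i}) (total_variation T c {0<..<B i}) = total_variation T c {A i<..<B i}"
        using variation_interval[OF AB[OF i]] chord_sum_le_variation[OF zero_in_chord_sums, of "{A i<..<B i}"]
        by (simp add: dist_real_def)
    qed
    also have "\<dots> \<le> total_variation T c ?E" by (rule variation_sum[OF fam])
    also have "\<dots> \<le> \<epsilon>/2"
    proof (rule variation_le, rule less_imp_le, rule \<delta>(2))
      have "emeasure lborel ?E \<le> (\<Sum>i<n. emeasure lborel {A i<..<B i})"
        by (intro emeasure_subadditive_finite) auto
      also have "\<dots> = ennreal (\<Sum>i<n. B i - A i)" using AB(2) by (subst sum_ennreal[symmetric]) auto
      also have "\<dots> < ennreal \<delta>" using len \<delta>(1) by (simp add: ennreal_lessI)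
      finally show "emeasure lborel ?E < ennreal \<delta>" .
    qed auto
    finally show ?thesis using \<epsilon> by simp
  qed
  then show "\<exists>\<delta>>0. \<forall>n A B. interval_family T n A B \<longrightarrow> (\<Sum>i<n. B i - A i) < \<delta> \<longrightarrow>
    (\<Sum>i<n. dist (total_variation T c {0<..<A i}) (total_variation T c {0<..<B i})) < \<epsilon>"
    using \<delta>(1) by blast
qed

end


text \<open>A nondecreasing absolutely continuous function is the distribution function of a
  Stieltjes measure that does not charge Lebesgue null sets; its Radon-Nikodym density is the
  required integrand.\<close>

lemma ac_mono_density:
  fixes W :: "real \<Rightarrow> real"
  assumes ac: "absolutely_continuous_curve T W" and T: "T > 0"
    and mono: "\<And>s t. 0 \<le> s \<Longrightarrow> s \<le> t \<Longrightarrow> t \<le> T \<Longrightarrow> W s \<le> W t"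
  shows "\<exists>\<rho>. set_integrable lborel {0..T} \<rho> \<and>
    (\<forall>s t. 0 \<le> s \<and> s \<le> t \<and> t \<le> T \<longrightarrow> (LINT r:{s..t}|lborel. \<rho> r) = W t - W s)"
proof -
  define cl where "cl t = max 0 (min T t)" for t :: real
  have cl: "0 \<le> cl t" "cl t \<le> T" for t using T by (auto simp: cl_def)
  have cl_mono: "s \<le> t \<Longrightarrow> cl s \<le> cl t" for s t by (auto simp: cl_def)
  have cl_id: "t \<in> {0..T} \<Longrightarrow> cl t = t" for t by (auto simp: cl_def)
  define W' where "W' t = W (cl t)" for t
  have mono': "s \<le> t \<Longrightarrow> W' s \<le> W' t" for s t
    unfolding W'_def by (intro mono cl cl_mono)
  have cont: "continuous_on UNIV W'"
    unfolding W'_def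
    by (rule continuous_on_compose2[OF ac_curve_continuous[OF ac]])
      (use cl in \<open>auto simp: cl_def intro!: continuous_intros\<close>)
  define M where "M = interval_measure W'"
  have setsM[simp, measurable_cong]: "sets M = sets borel" by (simp add: M_def)
  have Icc: "emeasure M {s..t} = ennreal (W' t - W' s)" if "s \<le> t" for s t
    unfolding M_def by (rule emeasure_interval_measure_Icc[OF that mono' cont])
  \<comment> \<open>a null set lies in an open set of measure below \<open>\<delta>\<close>, and is covered there by non-overlapping
    intervals; over finitely many of these the increments of \<open>W\<close> add up to less than \<open>\<epsilon>\<close>\<close>
  have small: "emeasure M N \<le> ennreal \<epsilon>"
    if \<epsilon>: "\<epsilon> > 0" and N: "emeasure lborel N = 0" "N \<in> sets borel" "N \<subseteq> {-k..k}" for \<epsilon> k N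
  proof -
    obtain \<delta> where \<delta>: "\<delta> > 0" "\<And>n A B. interval_family T n A B \<Longrightarrow> (\<Sum>i<n. B i - A i) < \<delta> \<Longrightarrow> (\<Sum>i<n. dist (W (A i)) (W (B i))) < \<epsilon>"
      using ac_curveD[OF ac \<epsilon>] by blast
    show ?thesis
    proof (cases "k > 0")
      case False
      then have "N \<subseteq> {0..0}" using N(3) by auto
      then have "emeasure M N \<le> emeasure M {0..0}" by (intro emeasure_mono) auto
      then show ?thesis using Icc[of 0 0] by simp
    next
      case True
      obtain U where U: "open U" "N \<subseteq> U" "emeasure lborel (U - N) < ennreal \<delta>"
        using outer_regular_lborel[OF N(2) \<delta>(1)] by blast
      have "emeasure lborel U \<le> emeasure lborel (N \<union> (U - N))" using U N(2) by (intro emeasure_mono) auto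
      also have "\<dots> \<le> emeasure lborel N + emeasure lborel (U - N)"
        using U(1) N(2) by (intro emeasure_subadditive) auto
      also have "\<dots> < ennreal \<delta>" using U(3) N(1) by simp
      finally have U\<delta>: "emeasure lborel U < ennreal \<delta>" .
      obtain e where e: "\<And>x. x \<in> N \<Longrightarrow> e x > 0 \<and> ball x (e x) \<subseteq> U"
        using U(1,2) by (metis open_contains_ball subsetD)
      define g where "g x = (if x \<in> N then ball x (e x) else ball x 1)" for x
      have g: "gauge g" unfolding gauge_def g_def using e by auto
      have Nk: "N \<subseteq> cbox (-k) k" "box (-k) k \<noteq> {}" using N(3) True by auto
      obtain D where D: "countable D" "\<And>K. K \<in> D \<Longrightarrow> interior K \<noteq> {} \<and> (\<exists>c d. K = cbox c d)"
        "pairwise (\<lambda>A B. interior A \<inter> interior B = {}) D"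
        "\<And>K. K \<in> D \<Longrightarrow> \<exists>x \<in> N \<inter> K. K \<subseteq> g x" "N \<subseteq> \<Union>D"
        using covering_lemma[OF Nk g] by metis
      have DU: "K \<subseteq> U" if "K \<in> D" for K
        using D(4)[OF that] e unfolding g_def by fastforce
      obtain u v where "\<And>K. K \<in> D \<Longrightarrow> K = cbox (u K) (v K)" using D(2) by metis
      then have uv: "K = {u K..v K}" if "K \<in> D" for K
        using that by (metis cbox_interval)
      have uv2: "u K < v K" if "K \<in> D" for K
      proof -
        have "interior {u K..v K} \<noteq> {}" using D(2)[OF that] uv[OF that] by metis
        then show ?thesis by (auto simp: interior_atLeastAtMost_real)
      qed
      have fin: "emeasure M (\<Union>F) \<le> ennreal \<epsilon>" if F: "finite F" "F \<subseteq> D" for F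
      proof -
        obtain h where h: "bij_betw h {..<card F} F"
          using ex_bij_betw_nat_finite[OF F(1)] by (auto simp: lessThan_atLeast0)
        have hF: "h i \<in> D" if "i < card F" for i using h F(2) that by (auto simp: bij_betw_def)
        define A where "A i = cl (u (h i))" for i
        define B where "B i = cl (v (h i))" for i
        have disj: "{u (h i)<..<v (h i)} \<inter> {u (h j)<..<v (h j)} = {}" if "i < card F" "j < card F" "i \<noteq> j" for i j
        proof -
          have "h i \<noteq> h j" using h that by (auto simp: bij_betw_def inj_on_def)
          then have "interior (h i) \<inter> interior (h j) = {}"
            using D(3) hF that unfolding pairwise_def by blast
          then show ?thesis using uv[OF hF[OF that(1)]] uv[OF hF[OF that(2)]]
            by (metis interior_atLeastAtMost_real)
        qed
        have ABsub: "{A i<..<B i} \<subseteq> {u (h i)<..<v (h i)}" for i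
          unfolding A_def B_def cl_def by auto
        have fam: "interval_family T (card F) A B"
          unfolding interval_family_def
        proof (intro conjI pairwiseI)
          show "\<forall>i<card F. 0 \<le> A i \<and> A i \<le> B i \<and> B i \<le> T"
            unfolding A_def B_def using cl cl_mono uv2[OF hF] by (simp add: less_imp_le)
          fix i j assume "i \<in> {..<card F}" "j \<in> {..<card F}" "i \<noteq> j"
          then show "{A i<..<B i} \<inter> {A j<..<B j} = {}" using disj[of i j] ABsub[of i] ABsub[of j] by blast
        qed
        have "ennreal (\<Sum>i<card F. B i - A i) \<le> emeasure lborel U"
        proof (rule interval_family_length[OF fam])
          show "{A i<..<B i} \<subseteq> U" if "i < card F" for i
          proof -
            have "{u (h i)<..<v (h i)} \<subseteq> {u (h i)..v (h i)}" by auto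
            then show ?thesis using ABsub[of i] uv[OF hF[OF that]] DU[OF hF[OF that]] by blast
          qed
          show "U \<in> sets borel" using U(1) by simp
        qed
        then have "ennreal (\<Sum>i<card F. B i - A i) < ennreal \<delta>" using U\<delta> by (rule le_less_trans)
        then have len: "(\<Sum>i<card F. B i - A i) < \<delta>" by (meson ennreal_leI leD leI)
        have "\<Union>F = (\<Union>i<card F. h i)" using h by (auto simp: bij_betw_def)
        then have "emeasure M (\<Union>F) \<le> (\<Sum>i<card F. emeasure M (h i))"
        proof (simp only:, intro emeasure_subadditive_finite image_subsetI)
          fix i assume "i \<in> {..<card F}"
          then have "h i = {u (h i)..v (h i)}" using uv hF by simp
          then show "h i \<in> sets M" by (metis atLeastAtMost_borel setsM)
        qed simp
        also have "\<dots> = (\<Sum>i<card F. ennreal (W (B i) - W (A i)))"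
        proof (intro sum.cong refl)
          fix i assume "i \<in> {..<card F}"
          then have i: "h i \<in> D" using hF by simp
          have "emeasure M (h i) = emeasure M {u (h i)..v (h i)}" using uv[OF i] by simp
          then show "emeasure M (h i) = ennreal (W (B i) - W (A i))"
            using uv2[OF i] by (simp add: Icc W'_def A_def B_def)
        qed
        also have "\<dots> = ennreal (\<Sum>i<card F. W (B i) - W (A i))"
          using fam mono by (intro sum_ennreal) (auto simp: interval_family_def)
        also have "\<dots> \<le> ennreal (\<Sum>i<card F. dist (W (A i)) (W (B i)))"
          by (intro ennreal_leI sum_mono) (auto simp: dist_real_def)
        also have "\<dots> \<le> ennreal \<epsilon>" using \<delta>(2)[OF fam len] by (intro ennreal_leI) simp
        finally show ?thesis .
      qed
      show ?thesis
      proof (cases "D = {}")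
        case True
        then show ?thesis using D(5) by simp
      next
        case False
        define X where "X n = \<Union>(from_nat_into D ` {..<n})" for n :: nat
        have inD: "from_nat_into D n \<in> D" for n using from_nat_into[OF False] by simp
        have Xb: "X n \<in> sets M" for n
          unfolding X_def
        proof (intro sets.finite_UN)
          show "from_nat_into D i \<in> sets M" for i using uv[OF inD] by (metis atLeastAtMost_borel setsM)
        qed simp
        have "\<Union>D = (\<Union>n. X n)"
        proof -
          have "\<Union>D = (\<Union>n. from_nat_into D n)" using range_from_nat_into[OF False D(1)] by auto
          also have "\<dots> = (\<Union>n. X n)" unfolding X_def by auto
          finally show ?thesis .
        qed
        moreover have "emeasure M (\<Union>n. X n) = (SUP n. emeasure M (X n))"
          using Xb by (intro SUP_emeasure_incseq[symmetric]) (auto simp: incseq_def X_def intro: less_le_trans)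
        moreover have "(SUP n. emeasure M (X n)) \<le> ennreal \<epsilon>"
          unfolding X_def using inD by (intro SUP_least fin) auto
        moreover have "emeasure M N \<le> emeasure M (\<Union>n. X n)"
        proof (rule emeasure_mono)
          show "N \<subseteq> (\<Union>n. X n)" using D(5) \<open>\<Union>D = (\<Union>n. X n)\<close> by simp
          show "(\<Union>n. X n) \<in> sets M" using Xb by blast
        qed
        ultimately show ?thesis by simp
      qed
    qed
  qed
  have "absolutely_continuous lborel M"
    unfolding absolutely_continuous_def
  proof
    fix N :: "real set" assume N: "N \<in> null_sets lborel"
    have Nb: "N \<in> sets borel" using N by auto
    have "emeasure M (N \<inter> {-real k..real k}) = 0" for k :: nat
    proof -
      have le: "emeasure lborel (N \<inter> {-real k..real k}) \<le> emeasure lborel N" using Nb by (intro emeasure_mono) auto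
      have le2: "emeasure M (N \<inter> {-real k..real k}) \<le> 0 + ennreal \<epsilon>" if \<epsilon>: "\<epsilon> > 0" for \<epsilon>
      proof -
        have 0: "emeasure lborel (N \<inter> {-real k..real k}) = 0" using le N by (auto simp: null_sets_def)
        have 1: "N \<inter> {-real k..real k} \<in> sets borel" using Nb by auto
        have "emeasure M (N \<inter> {-real k..real k}) \<le> ennreal \<epsilon>"
          by (rule small[OF \<epsilon> 0 1]) auto
        then show ?thesis by simp
      qed
      have "emeasure M (N \<inter> {-real k..real k}) \<le> 0" by (rule ennreal_le_epsilon) (rule le2)
      then show ?thesis by simp
    qed
    then have "N \<inter> {-real k..real k} \<in> null_sets M" for k :: nat using Nb by auto
    then have "(\<Union>k. N \<inter> {-real k..real k}) \<in> null_sets M" by (rule null_sets_UN)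
    also have "(\<Union>k. N \<inter> {-real k..real k}) = N"
    proof -
      have "\<exists>k::nat. x \<in> {- real k..real k}" for x       proof -
        obtain k :: nat where "\<bar>x\<bar> \<le> real k" using real_arch_simple by blast
        then show ?thesis by (intro exI[of _ k]) auto
      qed
      then show ?thesis by auto
    qed
    finally show "N \<in> null_sets M" .
  qed
  from sigma_finite_measure.Radon_Nikodym[OF sigma_finite_lborel this] obtain f where f[measurable]: "f \<in> borel_measurable lborel" and fM: "density lborel f = M"
    by auto
  have em: "(\<integral>\<^sup>+x\<in>{s..t}. f x \<partial>lborel) = ennreal (W t - W s)" if "0 \<le> s" "s \<le> t" "t \<le> T" for s t
  proof -
    have "(\<integral>\<^sup>+x\<in>{s..t}. f x \<partial>lborel) = emeasure M {s..t}" by (simp add: fM[symmetric] emeasure_density)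
    then show ?thesis using that by (simp add: Icc W'_def cl_id)
  qed
  define \<rho> where "\<rho> x = enn2real (f x)" for x
  have [measurable]: "\<rho> \<in> borel_measurable borel" using f unfolding \<rho>_def by measurable
  have "AE x in lborel. f x * indicator {0..T} x \<noteq> \<infinity>"
    using em[of 0 T] T by (intro nn_integral_noteq_infinite) auto
  then have AE: "AE x in lborel. x \<in> {0..T} \<longrightarrow> ennreal (\<rho> x) = f x"
    by eventually_elim (auto simp: \<rho>_def less_top split: split_indicator_asm)
  have em': "(\<integral>\<^sup>+x. ennreal (indicator {s..t} x *\<^sub>R \<rho> x) \<partial>lborel) = ennreal (W t - W s)" if "0 \<le> s" "s \<le> t" "t \<le> T" for s t
    unfolding em[OF that, symmetric]
    by (rule nn_integral_cong_AE, use AE in eventually_elim) (use that in \<open>auto split: split_indicator\<close>)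
  have "set_integrable lborel {0..T} \<rho>"
    unfolding set_integrable_def
    by (rule integrableI_nonneg) (use em'[of 0 T] T in \<open>auto simp: \<rho>_def\<close>)
  moreover have "(LINT r:{s..t}|lborel. \<rho> r) = W t - W s" if "0 \<le> s" "s \<le> t" "t \<le> T" for s t
    unfolding set_lebesgue_integral_def using em'[OF that] mono[OF that]
    by (subst integral_eq_nn_integral) (auto simp: \<rho>_def)
  ultimately show ?thesis by blast
qed

lemma ac_curve_add:
  fixes u v :: "real \<Rightarrow> 'a::real_normed_vector"
  assumes "absolutely_continuous_curve T u" "absolutely_continuous_curve T v"
  shows "absolutely_continuous_curve T (\<lambda>t. u t + v t)"
proof (rule ac_curveI)
  fix \<epsilon> :: real assume \<epsilon>: "\<epsilon> > 0"
  obtain d where d: "d > 0" "\<And>n A B. interval_family T n A B \<Longrightarrow> (\<Sum>i<n. B i - A i) < d \<Longrightarrow> (\<Sum>i<n. dist (u (A i)) (u (B i))) < \<epsilon>/2"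
    using ac_curveD[OF assms(1) half_gt_zero[OF \<epsilon>]] by blast
  obtain d' where d': "d' > 0" "\<And>n A B. interval_family T n A B \<Longrightarrow> (\<Sum>i<n. B i - A i) < d' \<Longrightarrow> (\<Sum>i<n. dist (v (A i)) (v (B i))) < \<epsilon>/2"
    using ac_curveD[OF assms(2) half_gt_zero[OF \<epsilon>]] by blast
  have "(\<Sum>i<n. dist (u (A i) + v (A i)) (u (B i) + v (B i))) < \<epsilon>"
    if "interval_family T n A B" "(\<Sum>i<n. B i - A i) < min d d'" for n A B
  proof -
    have "(\<Sum>i<n. dist (u (A i) + v (A i)) (u (B i) + v (B i))) \<le> (\<Sum>i<n. dist (u (A i)) (u (B i)) + dist (v (A i)) (v (B i)))"
      by (intro sum_mono dist_triangle_add)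
    then show ?thesis using d(2)[OF that(1)] d'(2)[OF that(1)] that(2) by (simp add: sum.distrib)
  qed
  then show "\<exists>d>0. \<forall>n A B. interval_family T n A B \<longrightarrow> (\<Sum>i<n. B i - A i) < d \<longrightarrow>
      (\<Sum>i<n. dist (u (A i) + v (A i)) (u (B i) + v (B i))) < \<epsilon>"
    using d(1) d'(1) by (intro exI[of _ "min d d'"]) auto
qed

text \<open>A real absolutely continuous function is the difference of two nondecreasing ones, namely of its
  variation plus itself and its variation.\<close>

lemma ac_density:
  fixes g :: "real \<Rightarrow> real"
  assumes ac: "absolutely_continuous_curve T g" and T: "T > 0"
  shows "\<exists>\<rho>. set_integrable lborel {0..T} \<rho> \<and>
    (\<forall>s t. 0 \<le> s \<and> s \<le> t \<and> t \<le> T \<longrightarrow> (LINT r:{s..t}|lborel. \<rho> r) = g t - g s)"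
proof -
  define V where "V t = total_variation T g {0<..<t}" for t
  have inc: "\<bar>g t - g s\<bar> \<le> V t - V s" if "0 \<le> s" "s \<le> t" "t \<le> T" for s t
    unfolding V_def variation_interval[OF ac T that]
    using chord_le_variation[OF ac T that] by (simp add: dist_real_def abs_minus_commute)
  have acV: "absolutely_continuous_curve T V" unfolding V_def by (rule ac_variation[OF ac T])
  obtain \<rho>1 where \<rho>1: "set_integrable lborel {0..T} \<rho>1"
    "\<And>s t. 0 \<le> s \<Longrightarrow> s \<le> t \<Longrightarrow> t \<le> T \<Longrightarrow> (LINT r:{s..t}|lborel. \<rho>1 r) = V t - V s"
    using ac_mono_density[OF acV T] inc by fastforce
  have "\<exists>\<rho>. set_integrable lborel {0..T} \<rho> \<and>
    (\<forall>s t. 0 \<le> s \<and> s \<le> t \<and> t \<le> T \<longrightarrow> (LINT r:{s..t}|lborel. \<rho> r) = (V t + g t) - (V s + g s))"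
    by (rule ac_mono_density[OF ac_curve_add[OF acV ac] T]) (use inc in fastforce)
  then obtain \<rho>2 where \<rho>2: "set_integrable lborel {0..T} \<rho>2"
    "\<And>s t. 0 \<le> s \<Longrightarrow> s \<le> t \<Longrightarrow> t \<le> T \<Longrightarrow> (LINT r:{s..t}|lborel. \<rho>2 r) = (V t + g t) - (V s + g s)"
    by blast
  show ?thesis
  proof (intro exI[of _ "\<lambda>r. \<rho>2 r - \<rho>1 r"] conjI allI impI)
    show "set_integrable lborel {0..T} (\<lambda>r. \<rho>2 r - \<rho>1 r)" using \<rho>1(1) \<rho>2(1) by (rule set_integral_diff(1)[rotated])
    fix s t assume st: "0 \<le> s \<and> s \<le> t \<and> t \<le> T"
    then have "set_integrable lborel {s..t} \<rho>1" "set_integrable lborel {s..t} \<rho>2"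
      using set_integrable_subset[OF \<rho>1(1), of "{s..t}"] set_integrable_subset[OF \<rho>2(1), of "{s..t}"] by auto
    then have "(LINT r:{s..t}|lborel. \<rho>2 r - \<rho>1 r) = (LINT r:{s..t}|lborel. \<rho>2 r) - (LINT r:{s..t}|lborel. \<rho>1 r)"
      by (intro set_integral_diff(2))
    then show "(LINT r:{s..t}|lborel. \<rho>2 r - \<rho>1 r) = g t - g s" using \<rho>1(2)[of s t] \<rho>2(2)[of s t] st by simp
  qed
qed

text \<open>The fundamental theorem of calculus. Each component has a density, and wherever the averages of the
  density converge to its value, which is almost everywhere, the component is differentiable.\<close>

theorem ac_curve_FTC:
  fixes l :: "real \<Rightarrow> real^'d"
  assumes ac: "absolutely_continuous_curve T l" and T: "T > 0"
  shows "\<exists>\<rho>. set_integrable lborel {0..T} \<rho> \<and>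
    (\<forall>s t. 0 \<le> s \<and> s \<le> t \<and> t \<le> T \<longrightarrow> (LINT r:{s..t}|lborel. \<rho> r) = l t - l s) \<and>
    (AE t in lborel. t \<in> {0<..<T} \<longrightarrow> (l has_vector_derivative \<rho> t) (at t))"
proof -
  have "absolutely_continuous_curve T (\<lambda>t. l t $ i)" for i
    by (rule ac_curve_dominated[OF ac zero_less_one]) (rule dist_vec_nth_le)
  from ac_density[OF this T] have "\<forall>i. \<exists>\<rho>. set_integrable lborel {0..T} \<rho> \<and>
    (\<forall>s t. 0 \<le> s \<and> s \<le> t \<and> t \<le> T \<longrightarrow> (LINT r:{s..t}|lborel. \<rho> r) = l t $ i - l s $ i)" by blast
  then obtain \<rho>' where \<rho>': "\<And>i. set_integrable lborel {0..T} (\<rho>' i)"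
    "\<And>i s t. 0 \<le> s \<Longrightarrow> s \<le> t \<Longrightarrow> t \<le> T \<Longrightarrow> (LINT r:{s..t}|lborel. \<rho>' i r) = l t $ i - l s $ i"
    by metis
  define \<rho> where "\<rho> t = (\<Sum>i\<in>UNIV. \<rho>' i t *\<^sub>R (axis i 1 :: real^'d))" for t
  have \<rho>_nth: "\<rho> t $ i = \<rho>' i t" for t i
    by (simp add: \<rho>_def axis_def if_distrib cong: if_cong)
  have sub: "set_integrable lborel {s..t} (\<rho>' i)" if "0 \<le> s" "s \<le> t" "t \<le> T" for i s t
    using set_integrable_subset[OF \<rho>'(1), of "{s..t}"] that by auto
  have hb: "has_bochner_integral lborel (\<lambda>r. indicator {s..t} r *\<^sub>R \<rho> r) (l t - l s)" if "0 \<le> s" "s \<le> t" "t \<le> T" for s t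
  proof -
    have "has_bochner_integral lborel (\<lambda>r. \<Sum>i\<in>UNIV. (indicator {s..t} r *\<^sub>R \<rho>' i r) *\<^sub>R axis i (1::real))
      (\<Sum>i\<in>UNIV. (l t $ i - l s $ i) *\<^sub>R axis i 1)"
      using sub[OF that] \<rho>'(2)[OF that]
      by (intro has_bochner_integral_sum has_bochner_integral_scaleR_left)
        (simp_all add: has_bochner_integral_iff set_integrable_def set_lebesgue_integral_def)
    also have "(\<Sum>i\<in>UNIV. (l t $ i - l s $ i) *\<^sub>R axis i 1) = l t - l s"
      by (simp add: vec_eq_iff axis_def if_distrib cong: if_cong)
    also have "(\<lambda>r. \<Sum>i\<in>UNIV. (indicator {s..t} r *\<^sub>R \<rho>' i r) *\<^sub>R axis i (1::real)) = (\<lambda>r. indicator {s..t} r *\<^sub>R \<rho> r)"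
      by (simp add: \<rho>_def scaleR_sum_right)
    finally show ?thesis .
  qed
  have "AE t in lborel. \<forall>i\<in>UNIV. t \<in> {0<..<T} \<longrightarrow> (\<forall>e>0. \<exists>d>0. \<forall>a b. a \<le> t \<and> t \<le> b \<and> a < b \<and> b - a < d \<longrightarrow>
      \<bar>(LINT r:{a..b}|lborel. \<rho>' i r) - \<rho>' i t * (b - a)\<bar> \<le> e * (b - a))"
    by (subst AE_ball_countable) (intro countable_finite finite ballI AE_averages[OF \<rho>'(1) T])+
  then have "AE t in lborel. t \<in> {0<..<T} \<longrightarrow> (l has_vector_derivative \<rho> t) (at t)"
  proof (rule AE_mp, intro AE_I2 impI)
    fix t assume *: "\<forall>i\<in>UNIV. t \<in> {0<..<T} \<longrightarrow> (\<forall>e>0. \<exists>d>0. \<forall>a b. a \<le> t \<and> t \<le> b \<and> a < b \<and> b - a < d \<longrightarrow>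
      \<bar>(LINT r:{a..b}|lborel. \<rho>' i r) - \<rho>' i t * (b - a)\<bar> \<le> e * (b - a))" and t: "t \<in> {0<..<T}"
    have "((\<lambda>s. l s $ i) has_derivative (\<lambda>h. h * \<rho>' i t)) (at t)" for i
      unfolding has_derivative_within_alt
    proof (intro conjI allI impI bounded_linear_mult_left)
      fix e :: real assume e: "e > 0"
      obtain d where d: "d > 0" "\<And>a b. a \<le> t \<Longrightarrow> t \<le> b \<Longrightarrow> a < b \<Longrightarrow> b - a < d \<Longrightarrow>
        \<bar>(LINT r:{a..b}|lborel. \<rho>' i r) - \<rho>' i t * (b - a)\<bar> \<le> e * (b - a)"
      proof -
        have "\<exists>d>0. \<forall>a b. a \<le> t \<and> t \<le> b \<and> a < b \<and> b - a < d \<longrightarrow>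
          \<bar>(LINT r:{a..b}|lborel. \<rho>' i r) - \<rho>' i t * (b - a)\<bar> \<le> e * (b - a)"
          using *[THEN bspec[of _ _ i], OF UNIV_I] t e by simp
        then show thesis using that by (elim exE conjE) blast
      qed
      define d' where "d' = min d (min t (T - t))"
      have "norm (l y $ i - l t $ i - (y - t) * \<rho>' i t) \<le> e * norm (y - t)" if y: "norm (y - t) < d'" for y
      proof -
        consider "y = t" | "y < t" | "y > t" by linarith
        then show ?thesis
        proof cases
          case 2
          then have "\<bar>(l t $ i - l y $ i) - \<rho>' i t * (t - y)\<bar> \<le> e * (t - y)"
            using d(2)[of y t] y t by (simp add: d'_def \<rho>'(2))
          then show ?thesis using 2 by (simp add: abs_le_iff algebra_simps)
        next
          case 3
          then have "\<bar>(l y $ i - l t $ i) - \<rho>' i t * (y - t)\<bar> \<le> e * (y - t)"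
            using d(2)[of t y] y t by (simp add: d'_def \<rho>'(2))
          then show ?thesis using 3 by (simp add: abs_le_iff algebra_simps)
        qed simp
      qed
      then show "\<exists>d>0. \<forall>y\<in>UNIV. norm (y - t) < d \<longrightarrow> norm (l y $ i - l t $ i - (y - t) * \<rho>' i t) \<le> e * norm (y - t)"
        using d(1) t by (intro exI[of _ d']) (auto simp: d'_def)
    qed
    then have "(l has_derivative (\<lambda>h. \<chi> i. h * \<rho>' i t)) (at t)"
      by (subst has_derivative_componentwise_within)
        (auto simp: Basis_vec_def inner_axis)
    moreover have "(\<lambda>h. \<chi> i. h * \<rho>' i t) = (\<lambda>h. h *\<^sub>R \<rho> t)" by (simp add: fun_eq_iff vec_eq_iff \<rho>_nth)
    ultimately show "(l has_vector_derivative \<rho> t) (at t)" by (simp add: has_vector_derivative_def)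
  qed
  moreover have "set_integrable lborel {0..T} \<rho>" using hb[of 0 T] T by (auto simp: set_integrable_def has_bochner_integral_iff)
  moreover have "(LINT r:{s..t}|lborel. \<rho> r) = l t - l s" if "0 \<le> s" "s \<le> t" "t \<le> T" for s t
    using hb[OF that] by (simp add: set_lebesgue_integral_def has_bochner_integral_iff)
  ultimately show ?thesis by blast
qed

section \<open>Charts and lifts of curves\<close>

text \<open>The Euclidean and the torus chart are treated at once: in both cases the distance of \<open>q x\<close> and
  \<open>q y\<close> is the distance of \<open>x - y\<close> to a uniformly discrete group of periods, \<open>{0}\<close> or the integer
  lattice.\<close>

locale lattice_chart =
  fixes q :: "real^'d \<Rightarrow> 'p::metric_space" and \<Lambda> :: "(real^'d) set"
  assumes surj_q: "surj q"
    and dist_q: "dist (q x) (q y) = infdist (x - y) \<Lambda>"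
    and closed_periods: "closed \<Lambda>"
    and zero_period: "0 \<in> \<Lambda>"
    and diff_period: "a \<in> \<Lambda> \<Longrightarrow> b \<in> \<Lambda> \<Longrightarrow> a - b \<in> \<Lambda>"
    and norm_period: "a \<in> \<Lambda> \<Longrightarrow> a \<noteq> 0 \<Longrightarrow> norm a \<ge> 1"

lemma lattice_chart_euclidean:
  assumes "euclidean_chart q"
  shows "lattice_chart q {0}"
  using assms by unfold_locales (auto simp: euclidean_chart_def dist_norm)

lemma lattice_chart_torus:
  assumes "torus_chart q"
  shows "lattice_chart q int_lattice"
proof
  fix a b :: "real^'a"
  show "a - b \<in> int_lattice" if "a \<in> int_lattice" "b \<in> int_lattice"
    using int_lattice_add[OF that(1) int_lattice_minus[OF that(2)]] by simp
  show "norm a \<ge> 1" if "a \<in> int_lattice" "a \<noteq> 0"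
  proof -
    obtain i where "a $ i \<noteq> 0" using \<open>a \<noteq> 0\<close> by (auto simp: vec_eq_iff)
    moreover have "a $ i \<in> \<int>" using that by (auto simp: int_lattice_def)
    ultimately have "1 \<le> \<bar>a $ i\<bar>" by (auto elim!: Ints_cases)
    then show ?thesis using component_le_norm_cart[of a i] by simp
  qed
qed (use assms in \<open>auto simp: torus_chart_def closed_int_lattice\<close>)

context lattice_chart
begin

lemma periods_ne: "\<Lambda> \<noteq> {}" using zero_period by blast

lemma q_eq_iff: "q x = q y \<longleftrightarrow> x - y \<in> \<Lambda>"
  using dist_q[of x y] in_closed_iff_infdist_zero[OF closed_periods periods_ne, of "x - y"] by auto

lemma dist_q_le: "dist (q x) (q y) \<le> dist x y"
  unfolding dist_q using infdist_le[OF zero_period, of "x - y"] by (simp add: dist_norm)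

lemma continuous_on_q: "continuous_on S q"
  unfolding continuous_on_iff by (meson dist_q_le le_less_trans)

text \<open>Periods other than 0 have norm at least 1, hence are not closest to a vector shorter than 1/2.
  This is where the thresholds 1/4 and 1/2 below come from.\<close>

lemma dist_q_local:
  assumes "dist x y < 1/2"
  shows "dist (q x) (q y) = dist x y"
proof (rule antisym[OF dist_q_le])
  have "dist x y \<le> dist (x - y) k" if "k \<in> \<Lambda>" for k
  proof (cases "k = 0")
    case False
    then have "1 \<le> norm k" using norm_period that by blast
    also have "norm k \<le> norm (x - y) + norm (x - y - k)" by norm
    finally show ?thesis using assms by (simp add: dist_norm)
  qed (simp add: dist_norm)
  then show "dist x y \<le> dist (q x) (q y)"
    unfolding dist_q infdist_notempty[OF periods_ne] by (intro cINF_greatest periods_ne)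
qed

lemma lift_point: "\<exists>y. q y = z \<and> dist x y = dist (q x) z"
proof -
  obtain w where w: "z = q w" using surj_q by (metis surj_def)
  obtain k where k: "k \<in> \<Lambda>" "infdist (x - w) \<Lambda> = dist (x - w) k"
    using infdist_attains_inf[OF closed_periods periods_ne] by metis
  have "q (w + k) = z" using k(1) by (simp add: w q_eq_iff)
  moreover have "dist x (w + k) = dist (q x) z" using k(2) by (simp add: w dist_q dist_norm algebra_simps)
  ultimately show ?thesis by blast
qed

text \<open>Near a given time the curve moves so little that choosing the lifts closest to a fixed point
  is an isometric, hence continuous, choice. Bolzano's bisection principle glues such pieces.\<close>

lemma ex_lift:
  fixes a b :: real
  assumes "a \<le> b" "continuous_on {a..b} c" "q x0 = c a"
  shows "\<exists>l. continuous_on {a..b} l \<and> l a = x0 \<and> (\<forall>s\<in>{a..b}. q (l s) = c s)"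
proof -
  define P where "P s t \<longleftrightarrow> (a \<le> s \<longrightarrow> t \<le> b \<longrightarrow> s \<le> t \<longrightarrow> (\<forall>x. q x = c s \<longrightarrow>
    (\<exists>l. continuous_on {s..t} l \<and> l s = x \<and> (\<forall>r\<in>{s..t}. q (l r) = c r))))" for s t
  have "P a b" using assms(1)
  proof (induction rule: Bolzano)
    case (trans r s t)
    show ?case unfolding P_def
    proof (intro impI allI)
      fix x assume *: "a \<le> r" "t \<le> b" "r \<le> t" "q x = c r"
      obtain l where l: "continuous_on {r..s} l" "l r = x" "\<And>v. v \<in> {r..s} \<Longrightarrow> q (l v) = c v"
        using trans * unfolding P_def by (meson order_trans)
      have "q (l s) = c s" using l(3) trans by auto
      then obtain l' where l': "continuous_on {s..t} l'" "l' s = l s" "\<And>v. v \<in> {s..t} \<Longrightarrow> q (l' v) = c v"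
        using trans * unfolding P_def by (meson order_trans)
      have eq: "{r..t} = {r..s} \<union> {s..t}" using trans by auto
      have "continuous_on {r..t} (\<lambda>v. if v \<le> s then l v else l' v)"
        unfolding eq using l(1) l'(1,2)
        by (intro continuous_on_If) auto
      then show "\<exists>l. continuous_on {r..t} l \<and> l r = x \<and> (\<forall>v\<in>{r..t}. q (l v) = c v)"
        using l l' trans by (intro exI[of _ "\<lambda>v. if v \<le> s then l v else l' v"]) auto
    qed
  next
    case (local t0)
    obtain d where d: "d > 0" "\<And>s. s \<in> {a..b} \<Longrightarrow> dist s t0 < d \<Longrightarrow> dist (c s) (c t0) < 1/8"
      using assms(2) local unfolding continuous_on_iff by (metis atLeastAtMost_iff zero_less_divide_1_iff zero_less_numeral)
    have "P s t" if st: "s \<le> t0" "t0 \<le> t" "t - s < d" for s t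
      unfolding P_def
    proof (intro impI allI)
      fix x assume *: "a \<le> s" "t \<le> b" "s \<le> t" "q x = c s"
      obtain l where l: "\<And>r. q (l r) = c r \<and> dist x (l r) = dist (q x) (c r)"
        using choice[of "\<lambda>r y. q y = c r \<and> dist x y = dist (q x) (c r)"] lift_point by blast
      have osc: "dist (c r) (c r') < 1/4" if "r \<in> {s..t}" "r' \<in> {s..t}" for r r'
      proof -
        have "dist (c r) (c t0) < 1/8" "dist (c r') (c t0) < 1/8"
          using d(2)[of r] d(2)[of r'] that st * by (auto simp: dist_real_def)
        then show ?thesis using dist_triangle2[of "c r" "c r'" "c t0"] by linarith
      qed
      have "dist (l r) (l r') = dist (c r) (c r')" if r: "r \<in> {s..t}" "r' \<in> {s..t}" for r r'
      proof -
        have "dist x (l r) < 1/4" "dist x (l r') < 1/4" using l osc r * by auto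
        then have "dist (l r) (l r') < 1/2" using dist_triangle3[of "l r" "l r'" x] by linarith
        then show ?thesis using dist_q_local l by metis
      qed
      moreover have "continuous_on {s..t} c" using assms(2) * by (auto intro: continuous_on_subset)
      ultimately have "continuous_on {s..t} l" unfolding continuous_on_iff by auto
      moreover have "l s = x" using l[of s] * by simp
      ultimately show "\<exists>l. continuous_on {s..t} l \<and> l s = x \<and> (\<forall>r\<in>{s..t}. q (l r) = c r)" using l by blast
    qed
    then show ?case using d(1) by blast
  qed
  then show ?thesis using assms unfolding P_def by blast
qed

text \<open>As long as the distance of the lifts is below 1/2, it equals the distance of the curves, which is
  below 1/4. Being continuous, it cannot cross the gap between 1/4 and 1/2.\<close>

lemma dist_lifts:
  fixes a b :: real
  assumes "continuous_on {a..b} l" "continuous_on {a..b} l'"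
    and "\<And>s. s \<in> {a..b} \<Longrightarrow> q (l s) = c s" "\<And>s. s \<in> {a..b} \<Longrightarrow> q (l' s) = c' s"
    and "dist (l a) (l' a) < 1/4" "\<And>s. s \<in> {a..b} \<Longrightarrow> dist (c s) (c' s) < 1/4" "s \<in> {a..b}"
  shows "dist (l s) (l' s) = dist (c s) (c' s)"
proof -
  have "dist (l s) (l' s) < 1/2"
  proof (rule ccontr)
    assume "\<not> dist (l s) (l' s) < 1/2"
    moreover have "continuous_on {a..s} (\<lambda>s. dist (l s) (l' s))"
      using assms(1,2,7) by (intro continuous_on_dist) (auto elim: continuous_on_subset)
    ultimately obtain r where r: "a \<le> r" "r \<le> s" "dist (l r) (l' r) = 1/4"
      using IVT'[of "\<lambda>s. dist (l s) (l' s)" a "1/4" s] assms(5,7) by auto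
    then have "dist (c r) (c' r) = 1/4" using dist_q_local[of "l r" "l' r"] assms(3)[of r] assms(4)[of r] assms(7) by auto
    then show False using assms(6)[of r] r assms(7) by auto
  qed
  then show ?thesis using dist_q_local assms by metis
qed

lemma ac_project:
  assumes "absolutely_continuous_curve T l" "\<forall>s\<in>{0..T}. q (l s) = c s"
  shows "absolutely_continuous_curve T c"
proof (rule ac_curve_dominated[OF assms(1) zero_less_one])
  fix s t assume "0 \<le> s" "s \<le> t" "t \<le> T"
  then show "dist (c s) (c t) \<le> dist (l s) (l t)" using dist_q_le[of "l s" "l t"] assms(2) by simp
qed

text \<open>The chart is isometric at small scales, and a continuous lift moves little in short time.\<close>

lemma ac_lift:
  assumes "absolutely_continuous_curve T c" "continuous_on {0..T} l" "\<forall>s\<in>{0..T}. q (l s) = c s"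
  shows "absolutely_continuous_curve T l"
proof -
  have "uniformly_continuous_on {0..T} l" using assms(2) by (intro compact_uniformly_continuous) auto
  then obtain e where e: "e > 0" "\<And>s t. s \<in> {0..T} \<Longrightarrow> t \<in> {0..T} \<Longrightarrow> dist t s < e \<Longrightarrow> dist (l t) (l s) < 1/2"
    unfolding uniformly_continuous_on_def by (metis half_gt_zero zero_less_one)
  show ?thesis
  proof (rule ac_curve_dominated[OF assms(1) e(1)])
    fix s t assume "0 \<le> s" "s \<le> t" "t \<le> T" "t - s < e"
    then have st: "s \<in> {0..T}" "t \<in> {0..T}" "dist s t < e" by (auto simp: dist_real_def)
    then show "dist (l s) (l t) \<le> dist (c s) (c t)"
      using dist_q_local[OF e(2)[OF st(2,1,3)]] assms(3) by simp
  qed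
qed

section \<open>Velocity and energy of curves\<close>

text \<open>A continuous lift differs from any differentiable one by a locally constant period, so it
  detects the velocity.\<close>

lemma has_velocity_iff:
  assumes "T > 0" "t \<in> {0..T}" "\<forall>s\<in>{0..T}. q (l s) = c s" "continuous (at t within {0..T}) l"
  shows "has_velocity q T c v t \<longleftrightarrow> (l has_vector_derivative v) (at t within {0..T})"
proof
  assume "(l has_vector_derivative v) (at t within {0..T})"
  then show "has_velocity q T c v t" using assms(3) unfolding has_velocity_def by blast
next
  assume "has_velocity q T c v t"
  then obtain l' where l': "\<And>s. s \<in> {0..T} \<Longrightarrow> q (l' s) = c s" "(l' has_vector_derivative v) (at t within {0..T})"
    unfolding has_velocity_def by blast
  have per: "l s - l' s \<in> \<Lambda>" if "s \<in> {0..T}" for s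
    using l'(1)[OF that] assms(3) that by (simp add: q_eq_iff[symmetric])
  have "continuous (at t within {0..T}) (\<lambda>s. l s - l' s)"
    using assms(4) has_vector_derivative_continuous[OF l'(2)] by (intro continuous_diff)
  then obtain d where d: "d > 0" "\<And>s. s \<in> {0..T} \<Longrightarrow> dist s t < d \<Longrightarrow> dist (l s - l' s) (l t - l' t) < 1"
    unfolding continuous_within_eps_delta by (metis zero_less_one)
  have "l' s + (l t - l' t) = l s" if "s \<in> {0..T}" "dist s t < d" for s
  proof -
    have "(l s - l' s) - (l t - l' t) \<in> \<Lambda>" using per[OF that(1)] per[OF assms(2)] by (rule diff_period)
    moreover have "norm ((l s - l' s) - (l t - l' t)) < 1" using d(2)[OF that] by (simp add: dist_norm)
    ultimately have "(l s - l' s) - (l t - l' t) = 0" using norm_period by fastforce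
    then show ?thesis by (simp add: algebra_simps)
  qed
  moreover have "((\<lambda>s. l' s + (l t - l' t)) has_vector_derivative v) (at t within {0..T})"
    using l'(2) by (auto intro!: derivative_eq_intros)
  ultimately show "(l has_vector_derivative v) (at t within {0..T})"
    using d(1) assms(2) has_vector_derivative_transform_within by blast
qed

lemma velocity_lift:
  assumes "T > 0" "t \<in> {0..T}" "\<forall>s\<in>{0..T}. q (l s) = c s" "(l has_vector_derivative v) (at t within {0..T})"
  shows "velocity q T c t = v"
proof -
  have iff: "has_velocity q T c w t \<longleftrightarrow> (l has_vector_derivative w) (at t within {0..T})" for w
    by (rule has_velocity_iff[OF assms(1-3) has_vector_derivative_continuous[OF assms(4)]])
  have "w = v" if "(l has_vector_derivative w) (at t within {0..T})" for w
    using vector_derivative_unique_within_closed_interval[of 0 T t l w v] that assms by (simp add: cbox_interval)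
  then have "has_velocity q T c w t \<longleftrightarrow> w = v" for w using iff assms(4) by blast
  then show ?thesis unfolding velocity_def by auto
qed

end

text \<open>By continuity it suffices to test difference quotients with rational increments, which makes
  the set of points of differentiability Borel; on it the derivative is a limit of a sequence of
  difference quotients.\<close>

lemma borel_measurable_derivative:
  fixes f :: "real \<Rightarrow> real^'d"
  assumes cont: "continuous_on UNIV f"
  shows "(\<lambda>t. if \<exists>v. (f has_vector_derivative v) (at t) then vector_derivative f (at t) else 0) \<in> borel_measurable borel"
proof -
  have [measurable]: "f \<in> borel_measurable borel" using cont by (rule borel_measurable_continuous_onI)
  define u where "u t = lim (\<lambda>n. real (Suc n) *\<^sub>R (f (t + 1 / real (Suc n)) - f t))" for t
  have [measurable]: "u \<in> borel_measurable borel"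
    unfolding u_def by (intro borel_measurable_lim_metric) measurable
  define D where "D = {t. \<forall>k::nat. \<exists>n::nat. \<forall>h\<in>\<rat>. 0 < \<bar>h\<bar> \<longrightarrow> \<bar>h\<bar> < 1 / Suc n \<longrightarrow>
    norm (f (t + h) - f t - h *\<^sub>R u t) \<le> \<bar>h\<bar> / Suc k}"
  have D: "D \<in> sets borel"
  proof -
    have "D = {t \<in> space borel. \<forall>k::nat. \<exists>n::nat. \<forall>h\<in>\<rat>. 0 < \<bar>h\<bar> \<longrightarrow> \<bar>h\<bar> < 1 / Suc n \<longrightarrow>
      norm (f (t + h) - f t - h *\<^sub>R u t) \<le> \<bar>h\<bar> / Suc k}" by (simp add: D_def)
    also have "\<dots> \<in> sets borel"
      using countable_rat by measurable
    finally show ?thesis .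
  qed
  have lim: "u t = v" if v: "(f has_vector_derivative v) (at t)" for t v
  proof -
    have "((\<lambda>h. norm (f (t + h) - f t - h *\<^sub>R v) / norm h) \<longlongrightarrow> 0) (at 0)"
      using v unfolding has_vector_derivative_def has_derivative_at by blast
    moreover have "\<forall>\<^sub>F h in at 0. norm (f (t + h) - f t - h *\<^sub>R v) / norm h = norm ((f (t + h) - f t) /\<^sub>R h - v)"
      unfolding eventually_at_filter
    proof (intro always_eventually allI impI)
      fix h :: real assume "h \<noteq> 0"
      then have "(f (t + h) - f t) /\<^sub>R h - v = (f (t + h) - f t - h *\<^sub>R v) /\<^sub>R h"
        by (simp add: scaleR_diff_right)
      then show "norm (f (t + h) - f t - h *\<^sub>R v) / norm h = norm ((f (t + h) - f t) /\<^sub>R h - v)"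
        by (simp add: divide_inverse mult.commute)
    qed
    ultimately have "((\<lambda>h. norm ((f (t + h) - f t) /\<^sub>R h - v)) \<longlongrightarrow> 0) (at 0)"
      by (rule Lim_transform_eventually)
    then have "((\<lambda>h. (f (t + h) - f t) /\<^sub>R h) \<longlongrightarrow> v) (at 0)"
      by (simp add: tendsto_norm_zero_iff LIM_zero_iff)
    moreover have "filterlim (\<lambda>n. 1 / real (Suc n)) (at 0) sequentially"
      by (intro filterlim_atI LIMSEQ_inverse_real_of_nat[unfolded inverse_eq_divide]) auto
    ultimately have "(\<lambda>n. (f (t + 1 / real (Suc n)) - f t) /\<^sub>R (1 / real (Suc n))) \<longlonglongrightarrow> v"
      by (rule filterlim_compose)
    then show ?thesis unfolding u_def by (intro limI) (simp add: divide_inverse)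
  qed
  have iff: "(f has_vector_derivative v) (at t) \<longleftrightarrow> t \<in> D \<and> v = u t" for t v
  proof
    assume v: "(f has_vector_derivative v) (at t)"
    have "t \<in> D" unfolding D_def
    proof (intro CollectI allI)
      fix k :: nat
      have "0 < 1 / real (Suc k)" by simp
      then obtain d where d: "d > 0" "\<And>y. norm (y - t) < d \<Longrightarrow> norm (f y - f t - (y - t) *\<^sub>R v) \<le> 1 / Suc k * norm (y - t)"
        using v unfolding has_vector_derivative_def has_derivative_within_alt by (meson UNIV_I)
      obtain n :: nat where n: "1 / Suc n < d" using nat_approx_posE[OF d(1)] by blast
      have "norm (f (t + h) - f t - h *\<^sub>R u t) \<le> \<bar>h\<bar> / Suc k" if "\<bar>h\<bar> < 1 / Suc n" for h
        using d(2)[of "t + h"] that n lim[OF v] by simp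
      then show "\<exists>n::nat. \<forall>h\<in>\<rat>. 0 < \<bar>h\<bar> \<longrightarrow> \<bar>h\<bar> < 1 / Suc n \<longrightarrow> norm (f (t + h) - f t - h *\<^sub>R u t) \<le> \<bar>h\<bar> / Suc k"
        by blast
    qed
    then show "t \<in> D \<and> v = u t" using lim[OF v] by simp
  next
    assume tD: "t \<in> D \<and> v = u t"
    show "(f has_vector_derivative v) (at t)"
      unfolding has_vector_derivative_def has_derivative_within_alt
    proof (intro conjI allI impI bounded_linear_scaleR_left)
      fix e :: real assume e: "e > 0"
      obtain k :: nat where k: "1 / Suc k < e" using nat_approx_posE[OF e] by blast
      obtain n :: nat where n: "\<And>h. h \<in> \<rat> \<Longrightarrow> 0 < \<bar>h\<bar> \<Longrightarrow> \<bar>h\<bar> < 1 / Suc n \<Longrightarrow> norm (f (t + h) - f t - h *\<^sub>R u t) \<le> \<bar>h\<bar> / Suc k"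
        using tD unfolding D_def by blast
      have "norm (f (t + h) - f t - h *\<^sub>R v) \<le> e * \<bar>h\<bar>" if h: "\<bar>h\<bar> < 1 / Suc n" "h \<noteq> 0" for h
      proof -
        let ?S = "{h. 0 < \<bar>h\<bar> \<and> \<bar>h\<bar> < 1 / Suc n}"
        \<comment> \<open>the set where the bound fails is open and contains no rational number\<close>
        define G where "G = {h. e * \<bar>h\<bar> < norm (f (t + h) - f t - h *\<^sub>R v)} \<inter> ?S"
        have "open G" unfolding G_def
          by (intro open_Int open_Collect_less open_Collect_conj continuous_intros continuous_on_compose2[OF cont]) auto
        have "G = {}"
        proof (rule ccontr)
          assume "G \<noteq> {}"
          then obtain x d where x: "d > 0" "ball x d \<subseteq> G" using \<open>open G\<close> by (meson ex_in_conv openE)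
          obtain r where "r \<in> \<rat>" "x < r" "r < x + d" using Rats_dense_in_real[of x "x + d"] x(1) by auto
          then have "r \<in> \<rat>" "r \<in> G" using x(2) by (auto simp: dist_real_def subset_iff)
          then have "norm (f (t + r) - f t - r *\<^sub>R v) \<le> \<bar>r\<bar> / Suc k" using n[of r] tD by (auto simp: G_def)
          also have "\<dots> \<le> e * \<bar>r\<bar>" using k by (metis abs_ge_zero divide_inverse inverse_eq_divide less_imp_le mult.commute mult_right_mono)
          finally show False using \<open>r \<in> G\<close> by (simp add: G_def)
        qed
        then have "h \<notin> G" by blast
        then show ?thesis using h unfolding G_def by simp
      qed
      note step = this
      have "norm (f y - f t - (y - t) *\<^sub>R v) \<le> e * norm (y - t)" if "norm (y - t) < 1 / Suc n" for y
        using step[of "y - t"] that by (cases "y = t") auto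
      then show "\<exists>d>0. \<forall>y\<in>UNIV. norm (y - t) < d \<longrightarrow> norm (f y - f t - (y - t) *\<^sub>R v) \<le> e * norm (y - t)"
        by (intro exI[of _ "1 / real (Suc n)"]) simp
    qed
  qed
  have "(\<lambda>t. if \<exists>v. (f has_vector_derivative v) (at t) then vector_derivative f (at t) else 0) = (\<lambda>t. if t \<in> D then u t else 0)"
    using iff vector_derivative_at by fastforce
  also have "\<dots> \<in> borel_measurable borel" using D by measurable
  finally show ?thesis .
qed

text \<open>Jensen's inequality: the mean square deviation from the mean \<open>a\<close> is nonnegative.\<close>

lemma square_integral_le:
  fixes u :: "real \<Rightarrow> real"
  assumes "s < t" "set_integrable lborel {s..t} u" "set_integrable lborel {s..t} (\<lambda>r. (u r)\<^sup>2)"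
  shows "(LINT r:{s..t}|lborel. u r)\<^sup>2 \<le> (t - s) * (LINT r:{s..t}|lborel. (u r)\<^sup>2)"
proof -
  define a where "a = (LINT r:{s..t}|lborel. u r) / (t - s)"
  have c: "set_integrable lborel {s..t} (\<lambda>r. a\<^sup>2)" "(LINT r:{s..t}|lborel. a\<^sup>2) = a\<^sup>2 * (t - s)"
    using assms(1) by (auto simp: set_integrable_def set_lebesgue_integral_def)
  have eq: "(u r - a)\<^sup>2 = (u r)\<^sup>2 + a\<^sup>2 - 2 * a * u r" for r by (simp add: power2_eq_square algebra_simps)
  have "0 \<le> (LINT r:{s..t}|lborel. (u r - a)\<^sup>2)"
    unfolding set_lebesgue_integral_def by (intro Bochner_Integration.integral_nonneg) auto
  also have "\<dots> = (LINT r:{s..t}|lborel. (u r)\<^sup>2) + a\<^sup>2 * (t - s) - 2 * a * (LINT r:{s..t}|lborel. u r)"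
    unfolding eq using assms c by (simp add: set_integral_add set_integral_diff)
  also have "\<dots> = (LINT r:{s..t}|lborel. (u r)\<^sup>2) - (LINT r:{s..t}|lborel. u r)\<^sup>2 / (t - s)"
  proof -
    have "a * (t - s) = (LINT r:{s..t}|lborel. u r)" using assms(1) by (simp add: a_def)
    then have "a\<^sup>2 * (t - s) = a * (LINT r:{s..t}|lborel. u r)" by (simp add: power2_eq_square)
    then show ?thesis by (simp add: a_def power2_eq_square)
  qed
  finally show ?thesis using assms(1) by (simp add: field_simps)
qed


context lattice_chart
begin

lemma curve_lift:
  assumes "\<gamma> \<in> curves q \<Omega> T" "T > 0" "q x0 = \<gamma> 0"
  shows "\<exists>l. continuous_on {0..T} l \<and> l 0 = x0 \<and> (\<forall>s\<in>{0..T}. q (l s) = \<gamma> s)"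
  using assms by (intro ex_lift continuous_intros) auto

lemma velocity_borel:
  assumes "T > 0" "continuous_on {0..T} l" "\<forall>s\<in>{0..T}. q (l s) = c s"
  shows "(\<lambda>t. indicator {0..T} t *\<^sub>R velocity q T c t) \<in> borel_measurable borel"
proof -
  define l' where "l' t = l (max 0 (min T t))" for t
  have cl: "continuous_on UNIV l'"
    unfolding l'_def using assms(1)
    by (intro continuous_on_compose2[OF assms(2)] continuous_intros) auto
  define D where "D t = (if \<exists>v. (l' has_vector_derivative v) (at t) then vector_derivative l' (at t) else 0)" for t
  have [measurable]: "D \<in> borel_measurable borel"
    unfolding D_def[abs_def] by (rule borel_measurable_derivative[OF cl])
  have eq: "velocity q T c t = D t" if t: "t \<in> {0<..<T}" for t
  proof -
    have "continuous (at t within {0..T}) l" using assms(2) t by (simp add: continuous_on_eq_continuous_within)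
    then have 1: "has_velocity q T c v t \<longleftrightarrow> (l has_vector_derivative v) (at t within {0..T})" for v
      using has_velocity_iff[OF assms(1) _ assms(3)] t by simp
    have at: "at t within {0..T} = at t" using t by (intro at_within_interior) (simp add: interior_atLeastAtMost_real)
    have "(l has_vector_derivative v) (at t) \<longleftrightarrow> (l' has_vector_derivative v) (at t)" for v
    proof (rule has_vector_derivative_cong_ev)
      have "\<forall>\<^sub>F s in nhds t. s \<in> {0<..<T}" using t by (intro eventually_nhds_in_open) auto
      then show "\<forall>\<^sub>F s in nhds t. s \<in> UNIV \<longrightarrow> l s = l' s" by eventually_elim (auto simp: l'_def)
      show "l t = l' t" using t by (simp add: l'_def)
    qed
    then have 2: "has_velocity q T c v t \<longleftrightarrow> (l' has_vector_derivative v) (at t)" for v using 1 at by simp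
    show ?thesis unfolding velocity_def 2 D_def vector_derivative_def by simp
  qed
  have "(\<lambda>t. indicator {0..T} t *\<^sub>R velocity q T c t) =
    (\<lambda>t. indicator {0<..<T} t *\<^sub>R D t + indicator {0} t *\<^sub>R velocity q T c 0 + indicator {T} t *\<^sub>R velocity q T c T)"
    using eq assms(1) by (auto simp: fun_eq_iff split: split_indicator)
  also have "\<dots> \<in> borel_measurable borel" by measurable
  finally show ?thesis .
qed

lemma ac_velocity:
  assumes "T > 0" "continuous_on {0..T} l" "\<forall>s\<in>{0..T}. q (l s) = c s" "absolutely_continuous_curve T c"
  shows "set_integrable lborel {0..T} (velocity q T c)"
    and "\<And>s t. 0 \<le> s \<Longrightarrow> s \<le> t \<Longrightarrow> t \<le> T \<Longrightarrow> (LINT r:{s..t}|lborel. velocity q T c r) = l t - l s"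
    and "AE t in lborel. t \<in> {0<..<T} \<longrightarrow> (l has_vector_derivative velocity q T c t) (at t within {0..T})"
proof -
  obtain \<rho> where \<rho>: "set_integrable lborel {0..T} \<rho>"
    "\<And>s t. 0 \<le> s \<Longrightarrow> s \<le> t \<Longrightarrow> t \<le> T \<Longrightarrow> (LINT r:{s..t}|lborel. \<rho> r) = l t - l s"
    "AE t in lborel. t \<in> {0<..<T} \<longrightarrow> (l has_vector_derivative \<rho> t) (at t)"
    using ac_curve_FTC[OF ac_lift[OF assms(4,2,3)] assms(1)] by blast
  have eq: "velocity q T c t = \<rho> t \<and> (l has_vector_derivative velocity q T c t) (at t within {0..T})"
    if "t \<in> {0<..<T}" "(l has_vector_derivative \<rho> t) (at t)" for t
  proof -
    have d: "(l has_vector_derivative \<rho> t) (at t within {0..T})" using that(2) by (rule has_vector_derivative_at_within)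
    have "velocity q T c t = \<rho> t" by (rule velocity_lift[OF assms(1) _ assms(3) d]) (use that in auto)
    then show ?thesis using d by simp
  qed
  show "AE t in lborel. t \<in> {0<..<T} \<longrightarrow> (l has_vector_derivative velocity q T c t) (at t within {0..T})"
  proof (rule AE_mp[OF \<rho>(3)], intro AE_I2 impI)
    fix t assume "t \<in> {0<..<T} \<longrightarrow> (l has_vector_derivative \<rho> t) (at t)" and t: "t \<in> {0<..<T}"
    from eq[OF t this(1)[rule_format, OF t]] show "(l has_vector_derivative velocity q T c t) (at t within {0..T})"
      by (rule conjunct2)
  qed
  have "AE t in lborel. t \<in> {0<..<T} \<longrightarrow> velocity q T c t = \<rho> t"
  proof (rule AE_mp[OF \<rho>(3)], intro AE_I2 impI)
    fix t assume "t \<in> {0<..<T} \<longrightarrow> (l has_vector_derivative \<rho> t) (at t)" and t: "t \<in> {0<..<T}"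
    from this(1)[rule_format, OF t] eq[OF t] show "velocity q T c t = \<rho> t" by simp
  qed
  moreover have "AE t in lborel. t \<noteq> 0" "AE t in lborel. t \<noteq> T" by (rule AE_lborel_singleton)+
  ultimately have AE: "AE t in lborel. t \<in> {0..T} \<longrightarrow> velocity q T c t = \<rho> t" by eventually_elim auto
  note meas = velocity_borel[OF assms(1-3)]
  have "integrable lborel (\<lambda>t. indicator {0..T} t *\<^sub>R velocity q T c t)"
    using \<rho>(1) unfolding set_integrable_def
  proof (rule integrable_cong_AE_imp)
    show "(\<lambda>t. indicator {0..T} t *\<^sub>R velocity q T c t) \<in> borel_measurable lborel" using meas by simp
    show "AE t in lborel. indicator {0..T} t *\<^sub>R \<rho> t = indicator {0..T} t *\<^sub>R velocity q T c t"
      using AE by eventually_elim (auto split: split_indicator)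
  qed
  then show int: "set_integrable lborel {0..T} (velocity q T c)" by (simp add: set_integrable_def)
  fix s t assume st: "0 \<le> s" "s \<le> t" "t \<le> T"
  have "(LINT r:{s..t}|lborel. velocity q T c r) = (LINT r:{s..t}|lborel. \<rho> r)"
    unfolding set_lebesgue_integral_def
  proof (rule integral_cong_AE)
    have sub: "{s..t} \<subseteq> {0..T}" using st by auto
    show "(\<lambda>r. indicator {s..t} r *\<^sub>R velocity q T c r) \<in> borel_measurable lborel"
      using set_integrable_subset[OF int _ sub] by (simp add: set_integrable_def)
    show "(\<lambda>r. indicator {s..t} r *\<^sub>R \<rho> r) \<in> borel_measurable lborel"
      using set_integrable_subset[OF \<rho>(1) _ sub] by (simp add: set_integrable_def)
    show "AE r in lborel. indicator {s..t} r *\<^sub>R velocity q T c r = indicator {s..t} r *\<^sub>R \<rho> r"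
      using AE by eventually_elim (use st in \<open>auto split: split_indicator\<close>)
  qed
  then show "(LINT r:{s..t}|lborel. velocity q T c r) = l t - l s" using \<rho>(2)[OF st] by simp
qed

text \<open>A real-valued version of \<open>kinetic_energy\<close>, which agrees with it on \<open>curves q \<Omega> T\<close>.\<close>

definition energy :: "real \<Rightarrow> (real \<Rightarrow> 'p) \<Rightarrow> real" where
  "energy T c = (LINT t:{0..T}|lborel. (norm (velocity q T c t))\<^sup>2)"

lemma curve_energy:
  assumes "T > 0" "\<gamma> \<in> curves q \<Omega> T"
  shows "set_integrable lborel {0..T} (\<lambda>t. (norm (velocity q T \<gamma> t))\<^sup>2)"
    and "kinetic_energy q T \<gamma> = ennreal (energy T \<gamma>)"
    and "energy T \<gamma> \<ge> 0"
proof -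
  obtain x0 where "q x0 = \<gamma> 0" using surj_q by (metis surj_def)
  then obtain l where l: "continuous_on {0..T} l" "\<forall>s\<in>{0..T}. q (l s) = \<gamma> s"
    using curve_lift[OF assms(2,1)] by blast
  have fin: "kinetic_energy q T \<gamma> < \<infinity>" using assms(2) by (simp add: curves_def)
  have eq: "(norm (indicator {0..T} t *\<^sub>R velocity q T \<gamma> t))\<^sup>2 = indicator {0..T} t *\<^sub>R (norm (velocity q T \<gamma> t))\<^sup>2" for t
    by (simp split: split_indicator)
  have eq2: "kinetic_energy q T \<gamma> = (\<integral>\<^sup>+t. ennreal (indicator {0..T} t *\<^sub>R (norm (velocity q T \<gamma> t))\<^sup>2) \<partial>lborel)"
    unfolding kinetic_energy_def by (intro nn_integral_cong) (auto split: split_indicator)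
  have "(\<lambda>t. (norm (indicator {0..T} t *\<^sub>R velocity q T \<gamma> t))\<^sup>2) \<in> borel_measurable lborel"
    using velocity_borel[OF assms(1) l] by measurable
  then have meas: "(\<lambda>t. indicator {0..T} t *\<^sub>R (norm (velocity q T \<gamma> t))\<^sup>2) \<in> borel_measurable lborel"
    by (simp only: eq)
  show int: "set_integrable lborel {0..T} (\<lambda>t. (norm (velocity q T \<gamma> t))\<^sup>2)"
    unfolding set_integrable_def
    by (rule integrableI_nonneg) (use meas fin eq2 in auto)
  show "kinetic_energy q T \<gamma> = ennreal (energy T \<gamma>)"
    unfolding eq2 energy_def set_lebesgue_integral_def
    using int by (intro nn_integral_eq_integral) (auto simp: set_integrable_def)
  show "energy T \<gamma> \<ge> 0" unfolding energy_def set_lebesgue_integral_def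
    by (intro Bochner_Integration.integral_nonneg) auto
qed

lemma dist_lift_energy:
  assumes "T > 0" "\<gamma> \<in> curves q \<Omega> T" "continuous_on {0..T} l" "\<forall>s\<in>{0..T}. q (l s) = \<gamma> s"
    and st: "0 \<le> s" "s \<le> t" "t \<le> T"
  shows "(dist (l s) (l t))\<^sup>2 \<le> (t - s) * (LINT r:{s..t}|lborel. (norm (velocity q T \<gamma> r))\<^sup>2)"
proof (cases "s = t")
  case False
  have ac: "absolutely_continuous_curve T \<gamma>" using assms(2) by (simp add: curves_def)
  note v = ac_velocity[OF assms(1,3,4) ac]
  have sub: "{s..t} \<subseteq> {0..T}" using st by auto
  have i: "set_integrable lborel {s..t} (velocity q T \<gamma>)"
    by (rule set_integrable_subset[OF v(1) _ sub]) auto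
  have i1: "set_integrable lborel {s..t} (\<lambda>r. norm (velocity q T \<gamma> r))"
    using set_integrable_norm[OF i] .
  have i2: "set_integrable lborel {s..t} (\<lambda>r. (norm (velocity q T \<gamma> r))\<^sup>2)"
    by (rule set_integrable_subset[OF curve_energy(1)[OF assms(1,2)] _ sub]) auto
  have "dist (l s) (l t) = norm (LINT r:{s..t}|lborel. velocity q T \<gamma> r)"
    using v(2)[OF st] by (simp add: dist_norm norm_minus_commute)
  also have "\<dots> \<le> (LINT r:{s..t}|lborel. norm (velocity q T \<gamma> r))"
    by (rule set_integral_norm_bound[OF i])
  finally have "(dist (l s) (l t))\<^sup>2 \<le> (LINT r:{s..t}|lborel. norm (velocity q T \<gamma> r))\<^sup>2"
    by (intro power_mono) auto
  also have "\<dots> \<le> (t - s) * (LINT r:{s..t}|lborel. (norm (velocity q T \<gamma> r))\<^sup>2)"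
    using square_integral_le[OF _ i1 i2] st False by simp
  finally show ?thesis .
qed (simp add: set_lebesgue_integral_def)

lemma dist_curve_energy:
  assumes "T > 0" "\<gamma> \<in> curves q \<Omega> T" "s \<in> {0..T}" "t \<in> {0..T}"
  shows "(dist (\<gamma> s) (\<gamma> t))\<^sup>2 \<le> \<bar>t - s\<bar> * energy T \<gamma>"
proof -
  obtain x0 where "q x0 = \<gamma> 0" using surj_q by (metis surj_def)
  then obtain l where l: "continuous_on {0..T} l" "\<forall>s\<in>{0..T}. q (l s) = \<gamma> s"
    using curve_lift[OF assms(2,1)] by blast
  have "(dist (\<gamma> s) (\<gamma> t))\<^sup>2 \<le> (t - s) * energy T \<gamma>" if st: "0 \<le> s" "s \<le> t" "t \<le> T" for s t
  proof -
    have "(dist (\<gamma> s) (\<gamma> t))\<^sup>2 \<le> (dist (l s) (l t))\<^sup>2"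
      using dist_q_le[of "l s" "l t"] l(2) st by (intro power_mono) auto
    also have "\<dots> \<le> (t - s) * (LINT r:{s..t}|lborel. (norm (velocity q T \<gamma> r))\<^sup>2)"
      by (rule dist_lift_energy[OF assms(1,2) l st])
    also have "\<dots> \<le> (t - s) * energy T \<gamma>"
    proof (rule mult_left_mono)
      have "set_integrable lborel {s..t} (\<lambda>r. (norm (velocity q T \<gamma> r))\<^sup>2)"
        by (rule set_integrable_subset[OF curve_energy(1)[OF assms(1,2)]]) (use st in auto)
      then show "(LINT r:{s..t}|lborel. (norm (velocity q T \<gamma> r))\<^sup>2) \<le> energy T \<gamma>"
        unfolding energy_def set_lebesgue_integral_def
        using curve_energy(1)[OF assms(1,2)] st
        by (intro integral_mono) (auto simp: set_integrable_def split: split_indicator)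
    qed (use st in simp)
    finally show ?thesis .
  qed
  from this[of s t] this[of t s] show ?thesis
    using assms(3,4) by (cases "s \<le> t") (auto simp: dist_commute)
qed

end

section \<open>Weak convergence in \<open>L\<^sup>2\<close>\<close>

abbreviation time_measure :: "real \<Rightarrow> real measure" where
  "time_measure T \<equiv> restrict_space lborel {0..T}"

lemma finite_measure_time: "finite_measure (time_measure T)"
  by (rule finite_measureI) (auto simp: emeasure_restrict_space emeasure_lborel_Icc_eq space_restrict_space)

lemma space_time [simp]: "space (time_measure T) = {0..T}"
  by (simp add: space_restrict_space)

lemma integrable_time_iff: "integrable (time_measure T) f \<longleftrightarrow> set_integrable lborel {0..T} f"
  for f :: "real \<Rightarrow> 'b::{banach, second_countable_topology}"
  unfolding set_integrable_def by (subst integrable_restrict_space) auto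

lemma integral_time: "(\<integral>t. f t \<partial>time_measure T) = (LINT t:{0..T}|lborel. f t)"
  for f :: "real \<Rightarrow> 'b::{banach, second_countable_topology}"
  unfolding set_lebesgue_integral_def by (subst integral_restrict_space) auto

lemma measurable_time_iff: "f \<in> borel_measurable (time_measure T) \<longleftrightarrow> (\<lambda>t. indicator {0..T} t *\<^sub>R f t) \<in> borel_measurable borel"
  for f :: "real \<Rightarrow> 'b::real_normed_vector"
  by (subst borel_measurable_restrict_space_iff) auto

lemma continuous_on_measurable_time:
  "continuous_on {0..T} f \<Longrightarrow> f \<in> borel_measurable (time_measure T)"
  for f :: "real \<Rightarrow> 'b::topological_space"
  by (metis borel_measurable_continuous_on_restrict measurable_cong_sets sets_lborel sets_restrict_space_cong)

lemma integrable_inner_Young: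
  fixes a b :: "'x \<Rightarrow> 'b::euclidean_space"
  assumes [measurable]: "a \<in> borel_measurable M" "b \<in> borel_measurable M"
    and a: "integrable M (\<lambda>x. (norm (a x))\<^sup>2)" and b: "integrable M (\<lambda>x. (norm (b x))\<^sup>2)"
  shows "integrable M (\<lambda>x. a x \<bullet> b x)"
    and "\<delta> > 0 \<Longrightarrow> \<bar>\<integral>x. a x \<bullet> b x \<partial>M\<bar> \<le> (\<integral>x. (norm (a x))\<^sup>2 \<partial>M) / \<delta> + \<delta> * (\<integral>x. (norm (b x))\<^sup>2 \<partial>M)"
proof -
  have young: "\<bar>a x \<bullet> b x\<bar> \<le> (norm (a x))\<^sup>2 / \<delta> + \<delta> * (norm (b x))\<^sup>2" if "\<delta> > 0" for x \<delta>
  proof -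
    have "2 * (norm (a x) * norm (b x)) \<le> (norm (a x))\<^sup>2 / \<delta> + \<delta> * (norm (b x))\<^sup>2"
      using sum_squares_bound[of "norm (a x) / sqrt \<delta>" "sqrt \<delta> * norm (b x)"] that
      by (simp add: power_divide power_mult_distrib)
    moreover have "0 \<le> norm (a x) * norm (b x)" by simp
    ultimately show ?thesis using Cauchy_Schwarz_ineq2[of "a x" "b x"] by linarith
  qed
  have i: "integrable M (\<lambda>x. (norm (a x))\<^sup>2 / \<delta> + \<delta> * (norm (b x))\<^sup>2)" for \<delta>
    using a b by auto
  show int: "integrable M (\<lambda>x. a x \<bullet> b x)"
    using young[of 1] by (intro Bochner_Integration.integrable_bound[OF i[of 1]]) (auto intro!: AE_I2 order_trans[OF _ abs_ge_self])
  show "\<bar>\<integral>x. a x \<bullet> b x \<partial>M\<bar> \<le> (\<integral>x. (norm (a x))\<^sup>2 \<partial>M) / \<delta> + \<delta> * (\<integral>x. (norm (b x))\<^sup>2 \<partial>M)" if "\<delta> > 0"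
  proof -
    have "\<bar>\<integral>x. a x \<bullet> b x \<partial>M\<bar> \<le> (\<integral>x. \<bar>a x \<bullet> b x\<bar> \<partial>M)" by (rule integral_abs_bound)
    also have "\<dots> \<le> (\<integral>x. ((norm (a x))\<^sup>2 / \<delta> + \<delta> * (norm (b x))\<^sup>2) \<partial>M)"
      using int i[of \<delta>] young[OF that] by (intro integral_mono) auto
    also have "\<dots> = (\<integral>x. (norm (a x))\<^sup>2 \<partial>M) / \<delta> + \<delta> * (\<integral>x. (norm (b x))\<^sup>2 \<partial>M)"
      using a b by simp
    finally show ?thesis .
  qed
qed

text \<open>Strong convergence of one factor beats boundedness of the other: Young's inequality with a
  weight \<open>\<delta>\<close> adapted to the bound \<open>K\<close>.\<close>

lemma L2_pairing_tendsto_zero: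
  fixes a b :: "nat \<Rightarrow> 'x \<Rightarrow> 'b::euclidean_space"
  assumes m: "\<And>n. a n \<in> borel_measurable M" "\<And>n. b n \<in> borel_measurable M"
    and a: "\<And>n. integrable M (\<lambda>x. (norm (a n x))\<^sup>2)" and b: "\<And>n. integrable M (\<lambda>x. (norm (b n x))\<^sup>2)"
    and K: "\<And>n. (\<integral>x. (norm (b n x))\<^sup>2 \<partial>M) \<le> K"
    and lim: "(\<lambda>n. \<integral>x. (norm (a n x))\<^sup>2 \<partial>M) \<longlonglongrightarrow> 0"
  shows "(\<lambda>n. \<integral>x. a n x \<bullet> b n x \<partial>M) \<longlonglongrightarrow> 0"
proof (rule LIMSEQ_I)
  fix r :: real assume r: "r > 0"
  have K0: "K \<ge> 0" using K[of 0] by (rule order_trans[rotated]) (intro Bochner_Integration.integral_nonneg, simp)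
  define \<delta> where "\<delta> = r / (2 * (K + 1))"
  have \<delta>: "\<delta> > 0" using r K0 by (simp add: \<delta>_def)
  have "\<delta> * K \<le> \<delta> * (K + 1)" using \<delta> by simp
  also have "\<dots> = r / 2" using K0 by (simp add: \<delta>_def field_simps)
  finally have \<delta>K: "\<delta> * K \<le> r / 2" .
  obtain N where N: "\<And>n. n \<ge> N \<Longrightarrow> norm ((\<integral>x. (norm (a n x))\<^sup>2 \<partial>M) - 0) < \<delta> * (r / 2)"
    using LIMSEQ_D[OF lim, of "\<delta> * (r / 2)"] \<delta> r by auto
  have "norm ((\<integral>x. a n x \<bullet> b n x \<partial>M) - 0) < r" if "n \<ge> N" for n
  proof -
    have "\<bar>\<integral>x. a n x \<bullet> b n x \<partial>M\<bar> \<le> (\<integral>x. (norm (a n x))\<^sup>2 \<partial>M) / \<delta> + \<delta> * (\<integral>x. (norm (b n x))\<^sup>2 \<partial>M)"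
      by (rule integrable_inner_Young(2)[OF m a b \<delta>])
    also have "(\<integral>x. (norm (a n x))\<^sup>2 \<partial>M) / \<delta> < r / 2" using N[OF that] \<delta> by (simp add: field_simps)
    also have "\<delta> * (\<integral>x. (norm (b n x))\<^sup>2 \<partial>M) \<le> r / 2"
      using \<delta>K mult_left_mono[OF K[of n], of \<delta>] \<delta> by linarith
    finally show ?thesis by simp
  qed
  then show "\<exists>no. \<forall>n\<ge>no. norm ((\<integral>x. a n x \<bullet> b n x \<partial>M) - 0) < r" by blast
qed

text \<open>A monotone class argument: the bounded functions \<open>p\<close> whose pairings tend to zero include the
  indicators of intervals and are closed under linear combinations and, as \<open>d\<close> is bounded in \<open>L\<^sup>2\<close>, under
  bounded pointwise limits.\<close>

lemma weak_limit_zero: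
  fixes d :: "nat \<Rightarrow> real \<Rightarrow> real"
  assumes d: "\<And>n. integrable (time_measure T) (d n)" "\<And>n. integrable (time_measure T) (\<lambda>t. (d n t)\<^sup>2)"
    and K: "\<And>n. (\<integral>t. (d n t)\<^sup>2 \<partial>time_measure T) \<le> K"
    and lim: "\<And>s t. (\<lambda>n. \<integral>r. indicator {s..t} r * d n r \<partial>time_measure T) \<longlonglongrightarrow> 0"
    and p: "p \<in> borel_measurable (time_measure T)" "\<And>t. \<bar>p t\<bar> \<le> B"
  shows "(\<lambda>n. \<integral>r. p r * d n r \<partial>time_measure T) \<longlonglongrightarrow> 0"
proof -
  let ?M = "time_measure T"
  interpret finite_measure ?M by (rule finite_measure_time)
  have K0: "K \<ge> 0" using K[of 0] by (rule order_trans[rotated]) (intro Bochner_Integration.integral_nonneg, simp)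
  have dm[measurable]: "d n \<in> borel_measurable ?M" for n using d(1) by auto
  have int: "integrable ?M (\<lambda>r. u r * d n r)"
    if "u \<in> borel_measurable ?M" "\<And>t. t \<in> {0..T} \<Longrightarrow> \<bar>u t\<bar> \<le> B" for u n B
  proof (rule Bochner_Integration.integrable_bound[OF integrable_mult_right[OF d(1), of B n]])
    have "\<bar>u t\<bar> \<le> \<bar>B\<bar>" if "t \<in> {0..T}" for t using \<open>\<And>t. t \<in> {0..T} \<Longrightarrow> \<bar>u t\<bar> \<le> B\<close>[OF that] by linarith
    then show "AE t in ?M. norm (u t * d n t) \<le> norm (B * d n t)"
      by (intro AE_I2) (simp add: abs_mult mult_right_mono)
  qed (use that in auto)
  define cv where "cv u \<longleftrightarrow> (\<lambda>n. \<integral>r. u r * d n r \<partial>?M) \<longlonglongrightarrow> 0" for u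
  \<comment> \<open>bounded pointwise limits are limits in \<open>L\<^sup>2\<close>, where the \<open>d n\<close> are bounded\<close>
  have approx: "cv u"
    if u: "\<And>k. u' k \<in> borel_measurable ?M" "\<And>k. cv (u' k)" "\<And>k t. \<bar>u' k t\<bar> \<le> B"
      "\<And>t. t \<in> {0..T} \<Longrightarrow> (\<lambda>k. u' k t) \<longlonglongrightarrow> u t" "u \<in> borel_measurable ?M" "\<And>t. \<bar>u t\<bar> \<le> B"
    for u and u' :: "nat \<Rightarrow> real \<Rightarrow> real" and B
    unfolding cv_def
  proof (rule LIMSEQ_I)
    fix r :: real assume r: "r > 0"
    have bd: "AE t in ?M. norm ((u t - u' k t)\<^sup>2) \<le> (2 * B)\<^sup>2" for k
    proof (rule AE_I2)
      fix t
      have "\<bar>u t - u' k t\<bar> \<le> 2 * B" using u(3)[of k t] u(6)[of t] by linarith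
      then show "norm ((u t - u' k t)\<^sup>2) \<le> (2 * B)\<^sup>2" using power_mono[of "\<bar>u t - u' k t\<bar>" "2 * B" 2] by simp
    qed
    have L2: "(\<lambda>k. \<integral>t. (u t - u' k t)\<^sup>2 \<partial>?M) \<longlonglongrightarrow> (\<integral>t. 0 \<partial>?M)"
    proof (rule integral_dominated_convergence[where w = "\<lambda>_. (2 * B)\<^sup>2"])
      show "AE t in ?M. (\<lambda>k. (u t - u' k t)\<^sup>2) \<longlonglongrightarrow> 0"
      proof (rule AE_I2)
        fix t assume "t \<in> space ?M"
        then have "(\<lambda>k. (u t - u' k t)\<^sup>2) \<longlonglongrightarrow> (u t - u t)\<^sup>2" using u(4) by (intro tendsto_intros) auto
        then show "(\<lambda>k. (u t - u' k t)\<^sup>2) \<longlonglongrightarrow> 0" by simp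
      qed
    qed (use u(1,5) bd in auto)
    define \<delta> where "\<delta> = r / (4 * (K + 1))"
    have \<delta>: "\<delta> > 0" using r K0 by (simp add: \<delta>_def)
    have "\<delta> * K \<le> \<delta> * (K + 1)" using \<delta> by simp
    also have "\<dots> = r / 4" using K0 by (simp add: \<delta>_def field_simps)
    finally have \<delta>K: "\<delta> * K \<le> r / 4" .
    obtain k where k: "norm ((\<integral>t. (u t - u' k t)\<^sup>2 \<partial>?M) - 0) < \<delta> * (r / 4)"
      using LIMSEQ_D[OF L2, of "\<delta> * (r / 4)"] \<delta> r by auto
    have intd: "integrable ?M (\<lambda>t. (u t - u' k t)\<^sup>2)"
      using u(1,5) by (intro integrable_const_bound[OF bd]) auto
    obtain N where N: "\<And>n. n \<ge> N \<Longrightarrow> norm ((\<integral>r. u' k r * d n r \<partial>?M) - 0) < r / 2"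
      using LIMSEQ_D[OF u(2)[of k, unfolded cv_def], of "r / 2"] r by auto
    have "norm ((\<integral>r. u r * d n r \<partial>?M) - 0) < r" if n: "n \<ge> N" for n
    proof -
      have "\<bar>\<integral>t. (u t - u' k t) \<bullet> d n t \<partial>?M\<bar> \<le> (\<integral>t. (norm (u t - u' k t))\<^sup>2 \<partial>?M) / \<delta> + \<delta> * (\<integral>t. (norm (d n t))\<^sup>2 \<partial>?M)"
        using u(1,5) intd d(2) by (intro integrable_inner_Young(2)[OF _ _ _ _ \<delta>]) auto
      also have "(\<integral>t. (norm (u t - u' k t))\<^sup>2 \<partial>?M) / \<delta> < r / 4" using k \<delta> by (simp add: field_simps)
      also have "\<delta> * (\<integral>t. (norm (d n t))\<^sup>2 \<partial>?M) \<le> r / 4"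
      proof -
        have "\<delta> * (\<integral>t. (d n t)\<^sup>2 \<partial>?M) \<le> \<delta> * K" using K[of n] \<delta> by (intro mult_left_mono) auto
        then show ?thesis using \<delta>K by simp
      qed
      finally have 1: "\<bar>\<integral>t. (u t - u' k t) * d n t \<partial>?M\<bar> < r / 2" by simp
      have "(\<integral>t. (u t - u' k t) * d n t \<partial>?M) = (\<integral>t. u t * d n t \<partial>?M) - (\<integral>t. u' k t * d n t \<partial>?M)"
        unfolding left_diff_distrib using int u by (intro Bochner_Integration.integral_diff) blast+
      then show ?thesis using 1 N[OF n] by (simp add: abs_if split: if_splits)
    qed
    then show "\<exists>no. \<forall>n\<ge>no. norm ((\<integral>r. u r * d n r \<partial>?M) - 0) < r" by blast
  qed
  have meas: "(\<lambda>t. indicator A t :: real) \<in> borel_measurable ?M" if "A \<in> sets borel" for A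
    using that by (intro borel_measurable_indicator') (auto simp: sets_restrict_space image_iff)
  have stable: "Int_stable (range (\<lambda>(a, b). {a..b::real}))"
    unfolding Int_stable_def by auto
  have subset_Pow: "range (\<lambda>(a, b). {a..b::real}) \<subseteq> Pow UNIV" by simp
  have "cv (indicator A)" if "A \<in> sigma_sets UNIV (range (\<lambda>(a, b). {a..b::real}))" for A :: "real set"
    using stable subset_Pow that
  proof (induction A rule: sigma_sets_induct_disjoint)
    case (basic A)
    then show ?case using lim by (auto simp: cv_def)
  next
    case empty
    then show ?case by (simp add: cv_def)
  next
    case (compl A)
    have A: "A \<in> sets borel" using compl(1) by (simp add: borel_eq_atLeastAtMost)
    have eq: "(\<integral>r. indicator (UNIV - A) r * d n r \<partial>?M) =
      (\<integral>r. indicator {0..T} r * d n r \<partial>?M) - (\<integral>r. indicator A r * d n r \<partial>?M)" for n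
    proof -
      have "(\<integral>r. indicator (UNIV - A) r * d n r \<partial>?M) = (\<integral>r. indicator {0..T} r * d n r - indicator A r * d n r \<partial>?M)"
        by (intro Bochner_Integration.integral_cong) (auto split: split_indicator)
      also have "\<dots> = (\<integral>r. indicator {0..T} r * d n r \<partial>?M) - (\<integral>r. indicator A r * d n r \<partial>?M)"
        using A by (intro Bochner_Integration.integral_diff int[of _ 1] meas) auto
      finally show ?thesis .
    qed
    show ?case unfolding cv_def eq using tendsto_diff[OF lim[of 0 T] compl(2)[unfolded cv_def]] by simp
  next
    case (union A)
    have A: "A i \<in> sets borel" for i using union(2) by (auto simp: borel_eq_atLeastAtMost)
    show ?case
    proof (rule approx[where u' = "\<lambda>k. indicator (\<Union>i<k. A i)" and B = 1])
      show "cv (indicator (\<Union>i<k. A i))" for k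
      proof -
        have "(\<integral>r. indicator (\<Union>i<k. A i) r * d n r \<partial>?M) = (\<Sum>i<k. \<integral>r. indicator (A i) r * d n r \<partial>?M)" for n
        proof -
          have "(indicator (\<Union>i<k. A i) r :: real) = (\<Sum>i<k. indicator (A i) r)" for r
            using union(1) by (intro indicator_UN_disjoint) (auto simp: disjoint_family_on_def)
          then have "(\<integral>r. indicator (\<Union>i<k. A i) r * d n r \<partial>?M) = (\<integral>r. (\<Sum>i<k. indicator (A i) r * d n r) \<partial>?M)"
            by (simp add: sum_distrib_right)
          also have "\<dots> = (\<Sum>i<k. \<integral>r. indicator (A i) r * d n r \<partial>?M)"
            using A by (intro Bochner_Integration.integral_sum int[of _ 1] meas) auto
          finally show ?thesis .
        qed
        moreover have "(\<lambda>n. \<Sum>i<k. \<integral>r. indicator (A i) r * d n r \<partial>?M) \<longlonglongrightarrow> (\<Sum>i<k. 0)"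
          using union(3) unfolding cv_def by (intro tendsto_sum) auto
        ultimately show ?thesis unfolding cv_def by simp
      qed
      show "(\<lambda>k. indicator (\<Union>i<k. A i) t :: real) \<longlonglongrightarrow> indicator (\<Union>i. A i) t" for t
        by (rule LIMSEQ_indicator_UN)
    qed (use A in \<open>auto intro!: meas split: split_indicator\<close>)
  qed
  then have ind: "cv (indicator A)" if "A \<in> sets borel" for A
    using that by (simp add: borel_eq_atLeastAtMost)
  have nonneg: "(\<exists>B. \<forall>t\<in>{0..T}. u t \<le> B) \<longrightarrow> cv u"
    if um: "u \<in> borel_measurable ?M" and u0: "\<And>x. 0 \<le> u x" for u
    using um u0
  proof (induction u rule: borel_measurable_induct_real)
    case (set A)
    then have "A \<in> sets borel" by (auto simp: sets_restrict_space)
    then show ?case using ind by simp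
  next
    case (mult u c)
    show ?case
    proof
      assume "\<exists>B. \<forall>t\<in>{0..T}. c * u t \<le> B"
      then obtain B where B: "\<And>t. t \<in> {0..T} \<Longrightarrow> c * u t \<le> B" by blast
      show "cv (\<lambda>x. c * u x)"
      proof (cases "c = 0")
        case False
        then have "c > 0" using mult by simp
        then have "u t \<le> B / c" if "t \<in> {0..T}" for t using B[OF that] by (simp add: field_simps)
        then have "cv u" using mult by blast
        then show ?thesis unfolding cv_def
          using tendsto_mult_left[of "\<lambda>n. \<integral>r. u r * d n r \<partial>?M" 0 sequentially c] by (simp add: mult.assoc)
      qed (simp add: cv_def)
    qed
  next
    case (add u v)
    show ?case
    proof
      assume "\<exists>B. \<forall>t\<in>{0..T}. v t + u t \<le> B"
      then obtain B where B: "\<And>t. t \<in> {0..T} \<Longrightarrow> v t + u t \<le> B" by blast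
      have u: "u t \<le> B" "v t \<le> B" if "t \<in> {0..T}" for t
        using B[OF that] add(2)[of t] add(4)[of t] by auto
      then have "cv u" "cv v" using add by blast+
      moreover have "(\<integral>r. (v r + u r) * d n r \<partial>?M) = (\<integral>r. v r * d n r \<partial>?M) + (\<integral>r. u r * d n r \<partial>?M)" for n
      proof -
        have "integrable ?M (\<lambda>r. w r * d n r)" if "w \<in> borel_measurable ?M" "\<And>x. 0 \<le> w x" "\<And>t. t \<in> {0..T} \<Longrightarrow> w t \<le> B" for w
          using that by (intro int[of _ B]) auto
        then show ?thesis using add u by (simp add: distrib_right)
      qed
      ultimately show "cv (\<lambda>x. v x + u x)" unfolding cv_def using tendsto_add[of _ 0 sequentially _ 0] by fastforce
    qed
  next
    case (seq U)
    show ?case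
    proof
      assume "\<exists>B. \<forall>t\<in>{0..T}. u t \<le> B"
      then obtain B where B: "\<And>t. t \<in> {0..T} \<Longrightarrow> u t \<le> B" by blast
      have Uu: "U i t \<le> u t" if "t \<in> {0..T}" for i t
        using seq(3,4) that by (intro incseq_le[of "\<lambda>i. U i t"]) (auto simp: incseq_def le_fun_def)
      have "cv (\<lambda>t. indicator {0..T} t * u t)"
      proof (rule approx[where u' = "\<lambda>i t. indicator {0..T} t * U i t" and B = "max B 0"])
        show "cv (\<lambda>t. indicator {0..T} t * U i t)" for i
        proof -
          have "cv (U i)" using seq.IH Uu B by (meson order_trans)
          moreover have "(\<integral>r. (indicator {0..T} r * U i r) * d n r \<partial>?M) = (\<integral>r. U i r * d n r \<partial>?M)" for n
            by (intro Bochner_Integration.integral_cong) auto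
          ultimately show ?thesis unfolding cv_def by simp
        qed
        show "\<bar>indicator {0..T} t * U i t\<bar> \<le> max B 0" for i t
          using Uu[of t i] B[of t] seq(2)[of i t] by (auto split: split_indicator)
        show "(\<lambda>i. indicator {0..T} t * U i t) \<longlonglongrightarrow> indicator {0..T} t * u t" if "t \<in> {0..T}" for t
          using seq(4)[of t] that by simp
        show "\<bar>indicator {0..T} t * u t\<bar> \<le> max B 0" for t
          using B[of t] u0[of t] by (auto split: split_indicator)
      qed (use seq(1) um in \<open>auto intro!: borel_measurable_times meas\<close>)
      moreover have "(\<integral>r. (indicator {0..T} r * u r) * d n r \<partial>?M) = (\<integral>r. u r * d n r \<partial>?M)" for n
        by (intro Bochner_Integration.integral_cong) auto
      ultimately show "cv u" unfolding cv_def by simp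
    qed
  qed
  have "cv (\<lambda>t. max 0 (p t))" "cv (\<lambda>t. max 0 (- p t))"
    using p nonneg[of "\<lambda>t. max 0 (p t)"] nonneg[of "\<lambda>t. max 0 (- p t)"]
    by (auto intro!: exI[of _ "\<bar>B\<bar>"]) (meson abs_le_D1 abs_le_D2 abs_ge_self order_trans p(2))+
  then have "(\<lambda>n. (\<integral>r. max 0 (p r) * d n r \<partial>?M) - (\<integral>r. max 0 (- p r) * d n r \<partial>?M)) \<longlonglongrightarrow> 0 - 0"
    unfolding cv_def by (rule tendsto_diff)
  moreover have "(\<integral>r. max 0 (p r) * d n r \<partial>?M) - (\<integral>r. max 0 (- p r) * d n r \<partial>?M) = (\<integral>r. p r * d n r \<partial>?M)" for n
  proof -
    have B: "\<bar>max 0 (p t)\<bar> \<le> B" "\<bar>max 0 (- p t)\<bar> \<le> B" for t using p(2)[of t] by auto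
    have "(\<integral>r. max 0 (p r) * d n r \<partial>?M) - (\<integral>r. max 0 (- p r) * d n r \<partial>?M) =
      (\<integral>r. max 0 (p r) * d n r - max 0 (- p r) * d n r \<partial>?M)"
      using p(1) B by (intro Bochner_Integration.integral_diff[symmetric] int[of _ B]) auto
    also have "\<dots> = (\<integral>r. p r * d n r \<partial>?M)"
      by (intro Bochner_Integration.integral_cong) (auto simp: max_def)
    finally show ?thesis .
  qed
  ultimately show ?thesis by simp
qed

section \<open>The running cost\<close>

lemma measurable_vec_nth:
  fixes u :: "'a \<Rightarrow> real^'d"
  assumes "u \<in> borel_measurable M"
  shows "(\<lambda>t. u t $ i) \<in> borel_measurable M"
  by (rule measurable_compose[OF assms borel_measurable_continuous_onI])
    (intro continuous_intros)

locale lagrangian = lattice_chart q \<Lambda> for q :: "real^'d \<Rightarrow> 'p::metric_space" and \<Lambda> +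
  fixes \<Omega> :: "'p set" and T C :: real and L :: "'p \<Rightarrow> real^'d \<Rightarrow> real"
  assumes T: "T > 0" and C: "C > 0" and C1: "C1_lagrangian q \<Omega> L"
    and convex_L: "x \<in> \<Omega> \<Longrightarrow> convex_on UNIV (L x)"
    and L_lower: "x \<in> \<Omega> \<Longrightarrow> (1 / C) * (norm v)\<^sup>2 - C \<le> L x v"
    and L_upper: "x \<in> \<Omega> \<Longrightarrow> L x v \<le> C * (norm v)\<^sup>2 + C"
    and closed_dom: "closed (q -` \<Omega>)"
begin

abbreviation "vel \<equiv> velocity q T"
abbreviation "\<Gamma> \<equiv> curves q \<Omega> T"
abbreviation "Dom \<equiv> q -` \<Omega>"

definition running_cost :: "(real \<Rightarrow> 'p) \<Rightarrow> real" where
  "running_cost c = (LINT t:{0..T}|lborel. L (c t) (vel c t))"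

lemma abs_L: "x \<in> \<Omega> \<Longrightarrow> \<bar>L x v\<bar> \<le> C * (norm v)\<^sup>2 + C"
proof -
  assume x: "x \<in> \<Omega>"
  have "0 \<le> (1 / C) * (norm v)\<^sup>2" "0 \<le> C * (norm v)\<^sup>2" using C by auto
  then show ?thesis using L_lower[OF x, of v] L_upper[OF x, of v] C by linarith
qed

lemma continuous_L: "continuous_on (Dom \<times> UNIV) (\<lambda>(y, v). L (q y) v)"
proof -
  obtain DL where DL: "\<And>z. z \<in> Dom \<times> UNIV \<Longrightarrow>
     ((\<lambda>(y, v). L (q y) v) has_derivative blinfun_apply (DL z)) (at z within Dom \<times> UNIV)"
    using C1 unfolding C1_lagrangian_def by blast
  show ?thesis
    unfolding continuous_on_eq_continuous_within
    using has_derivative_continuous[OF DL] by blast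
qed

text \<open>Convexity and differentiability in the velocity provide supporting hyperplanes whose slope
  \<open>p\<close>, the derivative of \<open>L\<close> in the velocity, is continuous in position and velocity.\<close>

lemma supporting_slope:
  "\<exists>p. continuous_on (Dom \<times> UNIV) p \<and>
    (\<forall>y\<in>Dom. \<forall>v w. L (q y) w + p (y, w) \<bullet> (v - w) \<le> L (q y) v)"
proof -
  obtain DL :: "(real^'d) \<times> (real^'d) \<Rightarrow> ((real^'d) \<times> (real^'d)) \<Rightarrow>\<^sub>L real" where
    cont: "continuous_on (Dom \<times> UNIV) DL" and
    DL: "\<And>z. z \<in> Dom \<times> UNIV \<Longrightarrow>
     ((\<lambda>(y, v). L (q y) v) has_derivative blinfun_apply (DL z)) (at z within Dom \<times> UNIV)"
    using C1 unfolding C1_lagrangian_def by blast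
  define p where "p z = (\<Sum>b\<in>Basis. blinfun_apply (DL z) (0, b) *\<^sub>R b)" for z
  have p: "p z \<bullet> u = blinfun_apply (DL z) (0, u)" for z u
  proof -
    have "blinfun_apply (DL z) (0, u) = blinfun_apply (DL z) (0, \<Sum>b\<in>Basis. (u \<bullet> b) *\<^sub>R b)"
      by (simp add: euclidean_representation)
    also have "(0, \<Sum>b\<in>Basis. (u \<bullet> b) *\<^sub>R b) = (\<Sum>b\<in>Basis. (u \<bullet> b) *\<^sub>R (0::real^'d, b))"
      by (simp add: sum_prod[symmetric] fst_sum snd_sum prod_eq_iff)
    also have "blinfun_apply (DL z) \<dots> = (\<Sum>b\<in>Basis. (u \<bullet> b) * blinfun_apply (DL z) (0, b))"
    proof -
      have "blinfun_apply (DL z) ((u \<bullet> b) *\<^sub>R (0::real^'d, b)) = (u \<bullet> b) * blinfun_apply (DL z) (0, b)" for b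
        unfolding blinfun.scaleR_right by simp
      then show ?thesis unfolding blinfun.sum_right by simp
    qed
    also have "\<dots> = p z \<bullet> u"
      by (simp add: p_def inner_sum_left inner_commute[of u] mult.commute)
    finally show ?thesis by simp
  qed
  have cp: "continuous_on (Dom \<times> UNIV) p"
    unfolding p_def by (intro continuous_intros cont)
  have "L (q y) w + p (y, w) \<bullet> (v - w) \<le> L (q y) v" if y: "y \<in> Dom" for y v w
  proof -
    define \<phi> where "\<phi> s = L (q y) (w + s *\<^sub>R (v - w))" for s :: real
    have "((\<lambda>(y, v). L (q y) v) has_derivative blinfun_apply (DL (y, w))) (at (y, w + 0 *\<^sub>R (v - w)) within Dom \<times> UNIV)"
      using DL[of "(y, w)"] y by simp
    moreover have "((\<lambda>s. (y, w + s *\<^sub>R (v - w))) has_derivative (\<lambda>s. (0, s *\<^sub>R (v - w)))) (at 0)"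
      by (auto intro!: derivative_eq_intros)
    moreover have "range (\<lambda>s. (y, w + s *\<^sub>R (v - w))) \<subseteq> Dom \<times> UNIV" using y by auto
    ultimately have "((\<lambda>(y, v). L (q y) v) \<circ> (\<lambda>s. (y, w + s *\<^sub>R (v - w))) has_derivative
        blinfun_apply (DL (y, w)) \<circ> (\<lambda>s. (0, s *\<^sub>R (v - w)))) (at 0)"
      by (intro diff_chain_within) (auto intro: has_derivative_subset)
    moreover have "blinfun_apply (DL (y, w)) \<circ> (\<lambda>s. (0, s *\<^sub>R (v - w))) = (\<lambda>s. s * (p (y, w) \<bullet> (v - w)))"
    proof
      fix s :: real
      have "(0::real^'d, s *\<^sub>R (v - w)) = s *\<^sub>R (0, v - w)" by simp
      then show "(blinfun_apply (DL (y, w)) \<circ> (\<lambda>s. (0, s *\<^sub>R (v - w)))) s = s * (p (y, w) \<bullet> (v - w))"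
        by (simp only: o_def blinfun.scaleR_right p real_scaleR_def)
    qed
    ultimately have "(\<phi> has_derivative (\<lambda>s. s * (p (y, w) \<bullet> (v - w)))) (at 0)"
      by (simp add: o_def \<phi>_def[abs_def])
    then have "(\<phi> has_field_derivative (p (y, w) \<bullet> (v - w))) (at 0)"
      by (simp add: has_field_derivative_def mult.commute[of _ "p (y, w) \<bullet> (v - w)"] mult_commute_abs)
    then have lim: "((\<lambda>s. (\<phi> s - \<phi> 0) / s) \<longlongrightarrow> p (y, w) \<bullet> (v - w)) (at_right 0)"
      unfolding has_field_derivative_iff by (auto intro: filterlim_at_split[THEN iffD1, THEN conjunct2])
    have "\<forall>\<^sub>F s in at_right 0. (\<phi> s - \<phi> 0) / s \<le> \<phi> 1 - \<phi> 0"
      using eventually_at_right_real[OF zero_less_one]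
    proof (eventually_elim)
      case (elim s)
      have "\<phi> s \<le> (1 - s) * \<phi> 0 + s * \<phi> 1"
        using convex_onD[OF convex_L, of "q y" s w v] y elim
        by (simp add: \<phi>_def algebra_simps)
      then have "\<phi> s - \<phi> 0 \<le> s * (\<phi> 1 - \<phi> 0)" by (simp add: algebra_simps)
      then show ?case using elim by (simp add: field_simps)
    qed
    then have "p (y, w) \<bullet> (v - w) \<le> \<phi> 1 - \<phi> 0"
      by (intro tendsto_upperbound[OF lim]) auto
    then show ?thesis by (simp add: \<phi>_def)
  qed
  then show ?thesis using cp by blast
qed

lemma measurable_along:
  fixes h :: "(real^'d) \<times> (real^'d) \<Rightarrow> 'b::euclidean_space"
  assumes h: "continuous_on (Dom \<times> UNIV) h"
    and l: "continuous_on {0..T} l" "\<And>t. t \<in> {0..T} \<Longrightarrow> l t \<in> Dom"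
    and u: "u \<in> borel_measurable (time_measure T)"
  shows "(\<lambda>t. h (l t, u t)) \<in> borel_measurable (time_measure T)"
proof -
  have "closed (Dom \<times> (UNIV :: (real^'d) set))" using closed_dom by (intro closed_Times) auto
  then have m: "(\<lambda>z. indicator (Dom \<times> UNIV) z *\<^sub>R h z) \<in> borel_measurable borel"
    by (intro borel_measurable_continuous_on_indicator h) auto
  have "(\<lambda>t. (l t, u t)) \<in> borel_measurable (time_measure T)"
    using u continuous_on_measurable_time[OF l(1)] by (intro borel_measurable_Pair)
  from measurable_compose[OF this m]
  show ?thesis
    by (rule measurable_cong[THEN iffD1, rotated]) (use l(2) in auto)
qed

lemma curve_in: "\<gamma> \<in> \<Gamma> \<Longrightarrow> t \<in> {0..T} \<Longrightarrow> \<gamma> t \<in> \<Omega>"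
  by (auto simp: curves_def)

lemma ex_curve_lift:
  assumes "\<gamma> \<in> \<Gamma>"
  shows "\<exists>l. continuous_on {0..T} l \<and> (\<forall>s\<in>{0..T}. q (l s) = \<gamma> s)"
  using curve_lift[OF assms T] surj_q by (metis surj_def)

lemma vel_measurable:
  assumes "\<gamma> \<in> \<Gamma>"
  shows "vel \<gamma> \<in> borel_measurable (time_measure T)"
proof -
  obtain l where l: "continuous_on {0..T} l" "\<forall>s\<in>{0..T}. q (l s) = \<gamma> s" using ex_curve_lift[OF assms] by blast
  show ?thesis unfolding measurable_time_iff by (rule velocity_borel[OF T l])
qed

lemma vel_integrable:
  assumes "\<gamma> \<in> \<Gamma>"
  shows "integrable (time_measure T) (vel \<gamma>)" "integrable (time_measure T) (\<lambda>t. (norm (vel \<gamma> t))\<^sup>2)"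
proof -
  obtain l where l: "continuous_on {0..T} l" "\<forall>s\<in>{0..T}. q (l s) = \<gamma> s" using ex_curve_lift[OF assms] by blast
  have ac: "absolutely_continuous_curve T \<gamma>" using assms by (simp add: curves_def)
  show "integrable (time_measure T) (vel \<gamma>)" unfolding integrable_time_iff by (rule ac_velocity(1)[OF T l ac])
  show "integrable (time_measure T) (\<lambda>t. (norm (vel \<gamma> t))\<^sup>2)"
    unfolding integrable_time_iff by (rule curve_energy(1)[OF T assms])
qed

lemma L_along_integrable:
  assumes l: "continuous_on {0..T} l" "\<And>t. t \<in> {0..T} \<Longrightarrow> q (l t) \<in> \<Omega>"
    and u: "u \<in> borel_measurable (time_measure T)" "integrable (time_measure T) (\<lambda>t. (norm (u t))\<^sup>2)"
  shows "integrable (time_measure T) (\<lambda>t. L (q (l t)) (u t))"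
proof -
  interpret finite_measure "time_measure T" by (rule finite_measure_time)
  have m: "(\<lambda>t. L (q (l t)) (u t)) \<in> borel_measurable (time_measure T)"
    using measurable_along[OF continuous_L l(1) _ u(1)] l(2) by simp
  have i: "integrable (time_measure T) (\<lambda>t. C * (norm (u t))\<^sup>2 + C)" using u(2) by simp
  show ?thesis
  proof (rule Bochner_Integration.integrable_bound[OF i m], rule AE_I2)
    fix t assume "t \<in> space (time_measure T)"
    then have "\<bar>L (q (l t)) (u t)\<bar> \<le> C * (norm (u t))\<^sup>2 + C" using abs_L l(2) by simp
    then show "norm (L (q (l t)) (u t)) \<le> norm (C * (norm (u t))\<^sup>2 + C)" by simp
  qed
qed

lemma running_integrable:
  assumes "\<gamma> \<in> \<Gamma>"
  shows "integrable (time_measure T) (\<lambda>t. L (\<gamma> t) (vel \<gamma> t))"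
proof -
  obtain l where l: "continuous_on {0..T} l" "\<forall>s\<in>{0..T}. q (l s) = \<gamma> s" using ex_curve_lift[OF assms] by blast
  have "integrable (time_measure T) (\<lambda>t. L (q (l t)) (vel \<gamma> t))"
    using l curve_in[OF assms] by (intro L_along_integrable vel_measurable vel_integrable assms) auto
  then show ?thesis
    by (rule Bochner_Integration.integrable_cong[THEN iffD1, rotated 2]) (use l in auto)
qed

lemma measure_time: "measure (time_measure T) {0..T} = T"
  using T by (simp add: measure_restrict_space)

text \<open>By the growth conditions on \<open>L\<close>, running cost and energy control each other.\<close>

lemma running_cost_bounds:
  assumes "\<gamma> \<in> \<Gamma>"
  shows "energy T \<gamma> \<le> C * (running_cost \<gamma> + C * T)" "running_cost \<gamma> \<le> C * energy T \<gamma> + C * T"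
proof -
  interpret finite_measure "time_measure T" by (rule finite_measure_time)
  have en: "energy T \<gamma> = (\<integral>t. (norm (vel \<gamma> t))\<^sup>2 \<partial>time_measure T)" by (simp add: energy_def integral_time)
  have rc: "running_cost \<gamma> = (\<integral>t. L (\<gamma> t) (vel \<gamma> t) \<partial>time_measure T)" by (simp add: running_cost_def integral_time)
  note i = vel_integrable(2)[OF assms] running_integrable[OF assms]
  have "(1 / C) * energy T \<gamma> - C * T = (\<integral>t. (1 / C) * (norm (vel \<gamma> t))\<^sup>2 - C \<partial>time_measure T)"
    using i by (simp add: en measure_time)
  also have "\<dots> \<le> running_cost \<gamma>" unfolding rc
    using i L_lower curve_in[OF assms] by (intro integral_mono) auto
  finally show "energy T \<gamma> \<le> C * (running_cost \<gamma> + C * T)" using C by (simp add: field_simps)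
  have "running_cost \<gamma> \<le> (\<integral>t. C * (norm (vel \<gamma> t))\<^sup>2 + C \<partial>time_measure T)" unfolding rc
    using i L_upper curve_in[OF assms] by (intro integral_mono) auto
  also have "\<dots> = C * energy T \<gamma> + C * T" using i by (simp add: en measure_time)
  finally show "running_cost \<gamma> \<le> C * energy T \<gamma> + C * T" .
qed

text \<open>Tonelli's lower semicontinuity. Let \<open>w\<close> be the limit velocity where its norm is at most \<open>R\<close>
  and zero elsewhere. Along the approximating curves, \<open>L\<close> lies above its supporting hyperplanes at
  \<open>w\<close>. Since \<open>w\<close> is bounded, their values and slopes converge boundedly, and the velocities converge
  weakly. This bounds the lower limit by a quantity that tends to the running cost of the limit as
  \<open>R\<close> grows.\<close>

lemma running_cost_liminf:
  fixes \<gamma>n :: "nat \<Rightarrow> real \<Rightarrow>\<^sub>C 'p"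
  assumes \<gamma>: "\<gamma> \<in> \<Gamma>" and \<gamma>n: "\<And>n. \<gamma>n n \<in> \<Gamma>" and lim: "\<gamma>n \<longlonglongrightarrow> \<gamma>"
    and close: "\<And>n. dist (\<gamma>n n) \<gamma> < 1 / 4"
    and bound: "\<And>n. running_cost (\<gamma>n n) \<le> K"
  shows "running_cost \<gamma> \<le> K"
proof -
  let ?M = "time_measure T"
  interpret finite_measure ?M by (rule finite_measure_time)
  obtain p where p: "continuous_on (Dom \<times> UNIV) p"
    "\<And>y v w. y \<in> Dom \<Longrightarrow> L (q y) w + p (y, w) \<bullet> (v - w) \<le> L (q y) v"
    using supporting_slope by blast
  have pt: "dist (\<gamma>n n t) (\<gamma> t) \<le> dist (\<gamma>n n) \<gamma>" for n t by (rule dist_bounded)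
  obtain l where l: "continuous_on {0..T} l" "\<forall>s\<in>{0..T}. q (l s) = \<gamma> s" using ex_curve_lift[OF \<gamma>] by blast
  \<comment> \<open>lifts of the approximating curves that converge uniformly to the lift \<open>l\<close>\<close>
  have "\<exists>ln. continuous_on {0..T} ln \<and> (\<forall>s\<in>{0..T}. q (ln s) = \<gamma>n n s) \<and> (\<forall>s\<in>{0..T}. dist (ln s) (l s) \<le> dist (\<gamma>n n) \<gamma>)" for n
  proof -
    obtain x0 where x0: "q x0 = \<gamma>n n 0" "dist (l 0) x0 = dist (\<gamma> 0) (\<gamma>n n 0)"
      using lift_point[of "\<gamma>n n 0" "l 0"] l T by auto
    obtain ln where ln: "continuous_on {0..T} ln" "ln 0 = x0" "\<forall>s\<in>{0..T}. q (ln s) = \<gamma>n n s"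
      using curve_lift[OF \<gamma>n T x0(1)] by blast
    have "dist (ln s) (l s) = dist (\<gamma>n n s) (\<gamma> s)" if s: "s \<in> {0..T}" for s
    proof (rule dist_lifts[OF ln(1) l(1), of _ _ s])
      show "dist (ln 0) (l 0) < 1 / 4" using x0 ln(2) pt[of n 0] close[of n] by (simp add: dist_commute)
      show "dist (\<gamma>n n s) (\<gamma> s) < 1 / 4" for s using pt[of n s] close[of n] by simp
    qed (use ln l s in auto)
    then show ?thesis using ln pt by metis
  qed
  then obtain ln where ln: "\<And>n. continuous_on {0..T} (ln n)" "\<And>n. \<forall>s\<in>{0..T}. q (ln n s) = \<gamma>n n s"
    "\<And>n s. s \<in> {0..T} \<Longrightarrow> dist (ln n s) (l s) \<le> dist (\<gamma>n n) \<gamma>"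
    by metis
  have ln_lim: "(\<lambda>n. ln n s) \<longlonglongrightarrow> l s" if "s \<in> {0..T}" for s
  proof (rule metric_LIMSEQ_I)
    fix r :: real assume "0 < r"
    then obtain N where "\<And>n. n \<ge> N \<Longrightarrow> dist (\<gamma>n n) \<gamma> < r" using lim metric_LIMSEQ_D by blast
    then show "\<exists>no. \<forall>n\<ge>no. dist (ln n s) (l s) < r" using ln(3)[OF that] by (meson le_less_trans)
  qed
  have dom_l: "l s \<in> Dom" "ln n s \<in> Dom" if "s \<in> {0..T}" for s n
    using l(2) ln(2)[of n] that curve_in[OF \<gamma> that] curve_in[OF \<gamma>n that, of n] by auto
  obtain B0 where B0: "\<And>s. s \<in> {0..T} \<Longrightarrow> norm (l s) \<le> B0"
  proof -
    have "bounded (l ` {0..T})" using l(1) by (intro compact_imp_bounded compact_continuous_image) auto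
    then obtain a where "\<forall>x\<in>l ` {0..T}. norm x \<le> a" unfolding bounded_iff by blast
    then show thesis by (intro that[of a]) auto
  qed
  have ln_bd: "norm (ln n s) \<le> B0 + 1" if "s \<in> {0..T}" for n s
    using B0[OF that] ln(3)[OF that, of n] close[of n] norm_triangle_ineq2[of "ln n s" "l s"] by (simp add: dist_norm)
  define EK where "EK = C * (K + C * T)"
  have en: "(\<integral>t. (norm (vel (\<gamma>n n) t))\<^sup>2 \<partial>?M) \<le> EK" for n
  proof -
    have "energy T (\<gamma>n n) \<le> C * (running_cost (\<gamma>n n) + C * T)" by (rule running_cost_bounds[OF \<gamma>n])
    also have "\<dots> \<le> EK" unfolding EK_def using C bound[of n] by (intro mult_left_mono) auto
    finally show ?thesis by (simp add: energy_def integral_time)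
  qed
  note vi = vel_integrable[OF \<gamma>] and vni = vel_integrable[OF \<gamma>n]
  note [measurable] = vel_measurable[OF \<gamma>] vel_measurable[OF \<gamma>n]
  \<comment> \<open>weak convergence of the velocities against bounded test fields: their integrals over intervals are
    increments of the lifts, which converge\<close>
  have weak: "(\<lambda>n. \<integral>t. a t \<bullet> vel (\<gamma>n n) t \<partial>?M) \<longlonglongrightarrow> (\<integral>t. a t \<bullet> vel \<gamma> t \<partial>?M)"
    if am[measurable]: "a \<in> borel_measurable ?M" and ab: "\<And>t. norm (a t) \<le> B" for a :: "real \<Rightarrow> real^'d" and B
  proof -
    define d where "d i n t = vel (\<gamma>n n) t $ i - vel \<gamma> t $ i" for i n t
    have sq: "(d i n t)\<^sup>2 \<le> 2 * (norm (vel (\<gamma>n n) t))\<^sup>2 + 2 * (norm (vel \<gamma> t))\<^sup>2" for i n t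
    proof -
      have "\<bar>d i n t\<bar> \<le> norm (vel (\<gamma>n n) t - vel \<gamma> t)"
        using component_le_norm_cart[of "vel (\<gamma>n n) t - vel \<gamma> t" i] by (simp add: d_def)
      also have "\<dots> \<le> norm (vel (\<gamma>n n) t) + norm (vel \<gamma> t)" by (rule norm_triangle_ineq4)
      finally have "(d i n t)\<^sup>2 \<le> (norm (vel (\<gamma>n n) t) + norm (vel \<gamma> t))\<^sup>2"
        by (metis abs_ge_zero power2_abs power_mono)
      also have "\<dots> \<le> 2 * (norm (vel (\<gamma>n n) t))\<^sup>2 + 2 * (norm (vel \<gamma> t))\<^sup>2"
        using sum_squares_bound[of "norm (vel (\<gamma>n n) t)" "norm (vel \<gamma> t)"] by (simp add: power2_sum)
      finally show ?thesis .
    qed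
    have ci: "integrable ?M (\<lambda>t. vel (\<gamma>n n) t $ i)" "integrable ?M (\<lambda>t. vel \<gamma> t $ i)" for n i
      using vni(1) vi(1) by (auto intro!: integrable_bounded_linear[OF bounded_linear_vec_nth])
    have di: "integrable ?M (d i n)" for i n unfolding d_def using ci by auto
    have dsq: "integrable ?M (\<lambda>t. 2 * (norm (vel (\<gamma>n n) t))\<^sup>2 + 2 * (norm (vel \<gamma> t))\<^sup>2)" for n
      using vi vni by auto
    have di2: "integrable ?M (\<lambda>t. (d i n t)\<^sup>2)" for i n
      using sq di[of i n] by (intro Bochner_Integration.integrable_bound[OF dsq[of n]]) auto
    have "(\<lambda>n. \<integral>t. a t $ i * d i n t \<partial>?M) \<longlonglongrightarrow> 0" for i
    proof (rule weak_limit_zero[OF di di2])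
      show "(\<integral>t. (d i n t)\<^sup>2 \<partial>?M) \<le> 2 * EK + 2 * (\<integral>t. (norm (vel \<gamma> t))\<^sup>2 \<partial>?M)" for n
      proof -
        have "(\<integral>t. (d i n t)\<^sup>2 \<partial>?M) \<le> (\<integral>t. 2 * (norm (vel (\<gamma>n n) t))\<^sup>2 + 2 * (norm (vel \<gamma> t))\<^sup>2 \<partial>?M)"
          by (intro integral_mono di2 dsq sq)
        also have "\<dots> = 2 * (\<integral>t. (norm (vel (\<gamma>n n) t))\<^sup>2 \<partial>?M) + 2 * (\<integral>t. (norm (vel \<gamma> t))\<^sup>2 \<partial>?M)"
          using vi vni by simp
        finally show ?thesis using en[of n] by simp
      qed
      show "(\<lambda>t. a t $ i) \<in> borel_measurable ?M" by (rule measurable_vec_nth[OF am])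
      show "\<bar>a t $ i\<bar> \<le> B" for t using component_le_norm_cart[of "a t" i] ab[of t] by simp
      fix s t
      show "(\<lambda>n. \<integral>r. indicator {s..t} r * d i n r \<partial>?M) \<longlonglongrightarrow> 0"
      proof (cases "max s 0 \<le> min t T")
        case False
        then have z: "indicator {s..t} r * d i n r = 0" if "r \<in> {0..T}" for r n using that by (auto split: split_indicator)
        have "(\<integral>r. indicator {s..t} r * d i n r \<partial>?M) = (\<integral>r. 0 \<partial>?M)" for n
          using z by (intro Bochner_Integration.integral_cong) simp_all
        then show ?thesis by simp
      next
        case True
        define s' where "s' = max s 0"
        define t' where "t' = min t T"
        have st: "0 \<le> s'" "s' \<le> t'" "t' \<le> T" using True by (auto simp: s'_def t'_def)
        have acn: "absolutely_continuous_curve T (\<gamma>n n)" "absolutely_continuous_curve T \<gamma>" for n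
          using \<gamma>n[of n] \<gamma> by (auto simp: curves_def)
        have "(\<integral>r. indicator {s..t} r * d i n r \<partial>?M) = (ln n t' - ln n s') $ i - (l t' - l s') $ i" for n
        proof -
          have sub: "set_integrable lborel {s'..t'} (vel (\<gamma>n n))" "set_integrable lborel {s'..t'} (vel \<gamma>)"
            using st by (auto intro: set_integrable_subset[OF ac_velocity(1)[OF T ln(1,2) acn(1)]]
                set_integrable_subset[OF ac_velocity(1)[OF T l acn(2)]])
          have "(\<integral>r. indicator {s..t} r * d i n r \<partial>?M) = (\<integral>r. indicator {s'..t'} r * d i n r \<partial>lborel)"
            by (subst integral_restrict_space) (auto intro!: Bochner_Integration.integral_cong simp: s'_def t'_def split: split_indicator)
          also have "\<dots> = (\<integral>r. (indicator {s'..t'} r *\<^sub>R vel (\<gamma>n n) r) $ i - (indicator {s'..t'} r *\<^sub>R vel \<gamma> r) $ i \<partial>lborel)"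
            by (intro Bochner_Integration.integral_cong) (auto simp: d_def algebra_simps)
          also have "\<dots> = (\<integral>r. (indicator {s'..t'} r *\<^sub>R vel (\<gamma>n n) r) $ i \<partial>lborel) - (\<integral>r. (indicator {s'..t'} r *\<^sub>R vel \<gamma> r) $ i \<partial>lborel)"
            using sub unfolding set_integrable_def
            by (intro Bochner_Integration.integral_diff integrable_bounded_linear[OF bounded_linear_vec_nth])
          also have "\<dots> = (LINT r:{s'..t'}|lborel. vel (\<gamma>n n) r) $ i - (LINT r:{s'..t'}|lborel. vel \<gamma> r) $ i"
            using sub unfolding set_integrable_def set_lebesgue_integral_def
            by (simp only: integral_bounded_linear[OF bounded_linear_vec_nth])
          also have "\<dots> = (ln n t' - ln n s') $ i - (l t' - l s') $ i"
            using ac_velocity(2)[OF T ln(1,2) acn(1) st] ac_velocity(2)[OF T l acn(2) st] by simp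
          finally show ?thesis .
        qed
        moreover have "(\<lambda>n. (ln n t' - ln n s') $ i - (l t' - l s') $ i) \<longlonglongrightarrow> (l t' - l s') $ i - (l t' - l s') $ i"
          using st by (intro tendsto_intros ln_lim) auto
        ultimately show ?thesis by simp
      qed
    qed
    note comp = this
    have "(\<lambda>n. \<Sum>i\<in>UNIV. \<integral>t. a t $ i * d i n t \<partial>?M) \<longlonglongrightarrow> (\<Sum>i\<in>(UNIV::'d set). 0)"
      by (rule tendsto_sum) (rule comp)
    moreover have "(\<Sum>i\<in>UNIV. \<integral>t. a t $ i * d i n t \<partial>?M) = (\<integral>t. a t \<bullet> vel (\<gamma>n n) t \<partial>?M) - (\<integral>t. a t \<bullet> vel \<gamma> t \<partial>?M)" for n
    proof -
      have bi: "integrable ?M (\<lambda>t. a t $ i * d i n t)" for i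
      proof (rule Bochner_Integration.integrable_bound[OF integrable_mult_right[OF di, of B]])
        show "AE t in ?M. norm (a t $ i * d i n t) \<le> norm (B * d i n t)"
        proof (rule AE_I2)
          fix t
          have "\<bar>a t $ i\<bar> \<le> \<bar>B\<bar>" using component_le_norm_cart[of "a t" i] ab[of t] by simp
          then show "norm (a t $ i * d i n t) \<le> norm (B * d i n t)" by (simp add: abs_mult mult_right_mono)
        qed
        show "(\<lambda>t. a t $ i * d i n t) \<in> borel_measurable ?M"
          using measurable_vec_nth[OF am] di[of i n] by (intro borel_measurable_times) auto
      qed
      have sq: "integrable ?M (\<lambda>t. (norm (a t))\<^sup>2)"
        using ab by (intro integrable_const_bound[of _ "B\<^sup>2"]) (auto intro!: AE_I2 power_mono)
      have "(\<Sum>i\<in>UNIV. \<integral>t. a t $ i * d i n t \<partial>?M) = (\<integral>t. (\<Sum>i\<in>UNIV. a t $ i * d i n t) \<partial>?M)"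
        using bi by (simp add: Bochner_Integration.integral_sum)
      also have "\<dots> = (\<integral>t. a t \<bullet> vel (\<gamma>n n) t - a t \<bullet> vel \<gamma> t \<partial>?M)"
        by (simp add: d_def inner_vec_def right_diff_distrib sum_subtractf)
      also have "\<dots> = (\<integral>t. a t \<bullet> vel (\<gamma>n n) t \<partial>?M) - (\<integral>t. a t \<bullet> vel \<gamma> t \<partial>?M)"
        using vi vni sq by (intro Bochner_Integration.integral_diff integrable_inner_Young(1)) auto
      finally show ?thesis .
    qed
    ultimately have "(\<lambda>n. (\<integral>t. a t \<bullet> vel (\<gamma>n n) t \<partial>?M) - (\<integral>t. a t \<bullet> vel \<gamma> t \<partial>?M)) \<longlonglongrightarrow> 0" by simp
    then show ?thesis by (simp add: LIM_zero_iff)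
  qed
  define w where "w R t = (if norm (vel \<gamma> t) \<le> R then vel \<gamma> t else 0)" for R :: real and t
  have wm[measurable]: "w R \<in> borel_measurable ?M" for R unfolding w_def by measurable
  have step: "(\<integral>t. L (\<gamma> t) (w R t) \<partial>?M) + (\<integral>t. p (l t, w R t) \<bullet> (vel \<gamma> t - w R t) \<partial>?M) \<le> K" if R: "R \<ge> 0" for R
  proof -
    have wR: "norm (w R t) \<le> R" for t using R by (simp add: w_def)
    have wi: "integrable ?M (\<lambda>t. (norm (w R t))\<^sup>2)"
      using wR by (intro integrable_const_bound[of _ "R\<^sup>2"]) (auto intro!: AE_I2 power_mono)
    have "compact ((Dom \<inter> cball 0 (B0 + 1)) \<times> cball (0::real^'d) R)"
      using closed_dom by (intro compact_Times closed_Int_compact) auto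
    then have bdp: "bounded (p ` ((Dom \<inter> cball 0 (B0 + 1)) \<times> cball 0 R))"
      by (intro compact_imp_bounded compact_continuous_image continuous_on_subset[OF p(1)]) auto
    obtain Bp where Bp: "\<And>y v. y \<in> Dom \<Longrightarrow> norm y \<le> B0 + 1 \<Longrightarrow> norm v \<le> R \<Longrightarrow> norm (p (y, v)) \<le> Bp"
    proof -
      obtain a where "\<forall>x\<in>p ` ((Dom \<inter> cball 0 (B0 + 1)) \<times> cball 0 R). norm x \<le> a"
        using bdp unfolding bounded_iff by blast
      then show thesis by (intro that[of a]) auto
    qed
    define P where "P t = p (l t, w R t)" for t
    define Pn where "Pn n t = p (ln n t, w R t)" for n t
    have Pm[measurable]: "P \<in> borel_measurable ?M" "Pn n \<in> borel_measurable ?M" for n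
      unfolding P_def Pn_def using dom_l by (auto intro!: measurable_along[OF p(1)] l ln wm)
    have Pb: "norm (P t) \<le> Bp" "norm (Pn n t) \<le> Bp" if "t \<in> {0..T}" for n t
      unfolding P_def Pn_def using dom_l[OF that] B0[OF that] ln_bd[OF that] wR by (auto intro!: Bp)
    have Pi: "integrable ?M (\<lambda>t. (norm (P t))\<^sup>2)" "integrable ?M (\<lambda>t. (norm (Pn n t))\<^sup>2)" for n
      using Pb by (auto intro!: integrable_const_bound[of _ "Bp\<^sup>2"] AE_I2 power_mono)
    have Plim: "(\<lambda>n. Pn n t) \<longlonglongrightarrow> P t" if "t \<in> {0..T}" for t
      unfolding P_def Pn_def
      using dom_l[OF that] ln_lim[OF that]
      by (intro continuous_on_tendsto_compose[OF p(1)] tendsto_Pair) (auto intro!: always_eventually)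
    have Ldiff: "(\<lambda>n. \<integral>t. L (\<gamma>n n t) (w R t) \<partial>?M) \<longlonglongrightarrow> (\<integral>t. L (\<gamma> t) (w R t) \<partial>?M)"
    proof (rule integral_dominated_convergence[where w = "\<lambda>_. C * R\<^sup>2 + C"])
      have "(\<lambda>t. L (q (l t)) (w R t)) \<in> borel_measurable ?M"
        using measurable_along[OF continuous_L l(1) _ wm] dom_l by simp
      then show "(\<lambda>t. L (\<gamma> t) (w R t)) \<in> borel_measurable ?M"
        by (rule measurable_cong[THEN iffD1, rotated]) (use l in auto)
      show "(\<lambda>t. L (\<gamma>n n t) (w R t)) \<in> borel_measurable ?M" for n
      proof -
        have "(\<lambda>t. L (q (ln n t)) (w R t)) \<in> borel_measurable ?M"
          using measurable_along[OF continuous_L ln(1) _ wm] dom_l by simp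
        then show ?thesis by (rule measurable_cong[THEN iffD1, rotated]) (use ln(2)[of n] in auto)
      qed
      show "AE t in ?M. (\<lambda>n. L (\<gamma>n n t) (w R t)) \<longlonglongrightarrow> L (\<gamma> t) (w R t)"
      proof (rule AE_I2)
        fix t assume "t \<in> space ?M"
        then have t: "t \<in> {0..T}" by simp
        have "(\<lambda>n. (\<lambda>(y, v). L (q y) v) (ln n t, w R t)) \<longlonglongrightarrow> (\<lambda>(y, v). L (q y) v) (l t, w R t)"
          using dom_l[OF t] ln_lim[OF t]
          by (intro continuous_on_tendsto_compose[OF continuous_L] tendsto_Pair) (auto intro!: always_eventually)
        then show "(\<lambda>n. L (\<gamma>n n t) (w R t)) \<longlonglongrightarrow> L (\<gamma> t) (w R t)" using l(2) ln(2) t by simp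
      qed
      show "AE t in ?M. norm (L (\<gamma>n n t) (w R t)) \<le> C * R\<^sup>2 + C" for n
      proof (rule AE_I2)
        fix t assume "t \<in> space ?M"
        then have "\<bar>L (\<gamma>n n t) (w R t)\<bar> \<le> C * (norm (w R t))\<^sup>2 + C" using curve_in[OF \<gamma>n] by (intro abs_L) simp
        also have "\<dots> \<le> C * R\<^sup>2 + C" using C wR[of t] by (intro add_right_mono mult_left_mono power_mono) auto
        finally show "norm (L (\<gamma>n n t) (w R t)) \<le> C * R\<^sup>2 + C" by simp
      qed
    qed auto
    have sqb: "integrable ?M (\<lambda>t. (norm (vel (\<gamma>n n) t - w R t))\<^sup>2)"
      "(\<integral>t. (norm (vel (\<gamma>n n) t - w R t))\<^sup>2 \<partial>?M) \<le> 2 * EK + 2 * (R\<^sup>2 * T)" for n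
    proof -
      have le: "(norm (vel (\<gamma>n n) t - w R t))\<^sup>2 \<le> 2 * (norm (vel (\<gamma>n n) t))\<^sup>2 + 2 * R\<^sup>2" for t
      proof -
        have "norm (vel (\<gamma>n n) t - w R t) \<le> norm (vel (\<gamma>n n) t) + R"
          using norm_triangle_ineq4[of "vel (\<gamma>n n) t" "w R t"] wR[of t] by linarith
        then have "(norm (vel (\<gamma>n n) t - w R t))\<^sup>2 \<le> (norm (vel (\<gamma>n n) t) + R)\<^sup>2" by (intro power_mono) auto
        also have "\<dots> \<le> 2 * (norm (vel (\<gamma>n n) t))\<^sup>2 + 2 * R\<^sup>2"
          using sum_squares_bound[of "norm (vel (\<gamma>n n) t)" R] by (simp add: power2_sum)
        finally show ?thesis .
      qed
      have i: "integrable ?M (\<lambda>t. 2 * (norm (vel (\<gamma>n n) t))\<^sup>2 + 2 * R\<^sup>2)" using vni by auto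
      show i': "integrable ?M (\<lambda>t. (norm (vel (\<gamma>n n) t - w R t))\<^sup>2)"
        using le by (intro Bochner_Integration.integrable_bound[OF i]) auto
      have "(\<integral>t. (norm (vel (\<gamma>n n) t - w R t))\<^sup>2 \<partial>?M) \<le> (\<integral>t. 2 * (norm (vel (\<gamma>n n) t))\<^sup>2 + 2 * R\<^sup>2 \<partial>?M)"
        by (intro integral_mono i i' le)
      also have "\<dots> = 2 * (\<integral>t. (norm (vel (\<gamma>n n) t))\<^sup>2 \<partial>?M) + 2 * (R\<^sup>2 * T)"
        using vni by (simp add: measure_time)
      finally show "(\<integral>t. (norm (vel (\<gamma>n n) t - w R t))\<^sup>2 \<partial>?M) \<le> 2 * EK + 2 * (R\<^sup>2 * T)" using en[of n] by simp
    qed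
    have PPi: "integrable ?M (\<lambda>t. (norm (Pn n t - P t))\<^sup>2)" and PPb: "\<And>t. t \<in> {0..T} \<Longrightarrow> (norm (Pn n t - P t))\<^sup>2 \<le> (2 * Bp)\<^sup>2" for n
    proof -
      show b: "(norm (Pn n t - P t))\<^sup>2 \<le> (2 * Bp)\<^sup>2" if "t \<in> {0..T}" for t
        using Pb(1)[OF that] Pb(2)[OF that, of n] norm_triangle_ineq4[of "Pn n t" "P t"] by (intro power_mono) auto
      show "integrable ?M (\<lambda>t. (norm (Pn n t - P t))\<^sup>2)"
        using b by (intro integrable_const_bound[of _ "(2 * Bp)\<^sup>2"]) (auto intro!: AE_I2)
    qed
    have err: "(\<lambda>n. \<integral>t. (Pn n t - P t) \<bullet> (vel (\<gamma>n n) t - w R t) \<partial>?M) \<longlonglongrightarrow> 0"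
    proof (rule L2_pairing_tendsto_zero)
      have "(\<lambda>n. \<integral>t. (norm (Pn n t - P t))\<^sup>2 \<partial>?M) \<longlonglongrightarrow> (\<integral>t. 0 \<partial>?M)"
      proof (rule integral_dominated_convergence[where w = "\<lambda>_. (2 * Bp)\<^sup>2"])
        show "AE t in ?M. (\<lambda>n. (norm (Pn n t - P t))\<^sup>2) \<longlonglongrightarrow> 0"
        proof (rule AE_I2)
          fix t assume "t \<in> space ?M"
          then have "(\<lambda>n. (norm (Pn n t - P t))\<^sup>2) \<longlonglongrightarrow> (norm (P t - P t))\<^sup>2" by (intro tendsto_intros Plim) simp
          then show "(\<lambda>n. (norm (Pn n t - P t))\<^sup>2) \<longlonglongrightarrow> 0" by simp
        qed
        show "AE t in ?M. norm ((norm (Pn n t - P t))\<^sup>2) \<le> (2 * Bp)\<^sup>2" for n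
          using PPb by (intro AE_I2) auto
      qed auto
      then show "(\<lambda>n. \<integral>t. (norm (Pn n t - P t))\<^sup>2 \<partial>?M) \<longlonglongrightarrow> 0" by simp
    qed (use PPi sqb in auto)
    have Pw: "integrable ?M (\<lambda>t. P t \<bullet> vel (\<gamma>n n) t)" "integrable ?M (\<lambda>t. P t \<bullet> vel \<gamma> t)" "integrable ?M (\<lambda>t. P t \<bullet> w R t)"
      "integrable ?M (\<lambda>t. (Pn n t - P t) \<bullet> (vel (\<gamma>n n) t - w R t))" for n
      using vi vni Pi wi PPi sqb by (auto intro!: integrable_inner_Young(1))
    have Pweak: "(\<lambda>n. \<integral>t. P t \<bullet> vel (\<gamma>n n) t \<partial>?M) \<longlonglongrightarrow> (\<integral>t. P t \<bullet> vel \<gamma> t \<partial>?M)"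
    proof -
      have "(\<lambda>n. \<integral>t. (indicator {0..T} t *\<^sub>R P t) \<bullet> vel (\<gamma>n n) t \<partial>?M) \<longlonglongrightarrow> (\<integral>t. (indicator {0..T} t *\<^sub>R P t) \<bullet> vel \<gamma> t \<partial>?M)"
      proof (rule weak[where B = "\<bar>Bp\<bar>"])
        show "(\<lambda>t. indicator {0..T} t *\<^sub>R P t) \<in> borel_measurable ?M"
          by (rule measurable_cong[THEN iffD1, OF _ Pm(1)]) auto
        show "norm (indicator {0..T} t *\<^sub>R P t) \<le> \<bar>Bp\<bar>" for t using Pb(1)[of t] by (auto split: split_indicator)
      qed
      also have "(\<lambda>n. \<integral>t. (indicator {0..T} t *\<^sub>R P t) \<bullet> vel (\<gamma>n n) t \<partial>?M) = (\<lambda>n. \<integral>t. P t \<bullet> vel (\<gamma>n n) t \<partial>?M)"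
        by (intro ext Bochner_Integration.integral_cong) auto
      also have "(\<integral>t. (indicator {0..T} t *\<^sub>R P t) \<bullet> vel \<gamma> t \<partial>?M) = (\<integral>t. P t \<bullet> vel \<gamma> t \<partial>?M)"
        by (intro Bochner_Integration.integral_cong) auto
      finally show ?thesis .
    qed
    have Lwi: "integrable ?M (\<lambda>t. L (\<gamma>n n t) (w R t))" for n
    proof -
      have "integrable ?M (\<lambda>t. L (q (ln n t)) (w R t))"
        using dom_l by (intro L_along_integrable ln(1) wm wi) auto
      then show ?thesis
        by (rule Bochner_Integration.integrable_cong[THEN iffD1, rotated 2]) (use ln(2)[of n] in auto)
    qed
    \<comment> \<open>the slope \<open>Pn n\<close> is split into its bounded limit \<open>P\<close>, paired with a weakly convergent sequence,
      and the error \<open>Pn n - P\<close>, which tends to 0 in \<open>L\<^sup>2\<close>, paired with a bounded one\<close>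
    have le: "(\<integral>t. L (\<gamma>n n t) (w R t) \<partial>?M) + (\<integral>t. (Pn n t - P t) \<bullet> (vel (\<gamma>n n) t - w R t) \<partial>?M)
        + (\<integral>t. P t \<bullet> vel (\<gamma>n n) t \<partial>?M) - (\<integral>t. P t \<bullet> w R t \<partial>?M) \<le> K" for n
    proof -
      have "(\<integral>t. L (\<gamma>n n t) (w R t) \<partial>?M) + (\<integral>t. (Pn n t - P t) \<bullet> (vel (\<gamma>n n) t - w R t) \<partial>?M)
        + (\<integral>t. P t \<bullet> vel (\<gamma>n n) t \<partial>?M) - (\<integral>t. P t \<bullet> w R t \<partial>?M) =
        (\<integral>t. L (\<gamma>n n t) (w R t) + (Pn n t - P t) \<bullet> (vel (\<gamma>n n) t - w R t) + P t \<bullet> vel (\<gamma>n n) t - P t \<bullet> w R t \<partial>?M)"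
        using Lwi[of n] Pw by simp
      also have "\<dots> \<le> (\<integral>t. L (\<gamma>n n t) (vel (\<gamma>n n) t) \<partial>?M)"
      proof (rule integral_mono)
        fix t assume "t \<in> space ?M"
        then have t: "t \<in> {0..T}" by simp
        have "L (q (ln n t)) (w R t) + p (ln n t, w R t) \<bullet> (vel (\<gamma>n n) t - w R t) \<le> L (q (ln n t)) (vel (\<gamma>n n) t)"
          using dom_l[OF t] by (intro p(2))
        then show "L (\<gamma>n n t) (w R t) + (Pn n t - P t) \<bullet> (vel (\<gamma>n n) t - w R t) + P t \<bullet> vel (\<gamma>n n) t - P t \<bullet> w R t
            \<le> L (\<gamma>n n t) (vel (\<gamma>n n) t)"
          using ln(2)[of n] t by (simp add: Pn_def inner_diff_left inner_diff_right)
      qed (use Lwi[of n] Pw running_integrable[OF \<gamma>n] in auto)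
      also have "\<dots> = running_cost (\<gamma>n n)" by (simp add: running_cost_def integral_time)
      finally show ?thesis using bound[of n] by simp
    qed
    have "(\<lambda>n. (\<integral>t. L (\<gamma>n n t) (w R t) \<partial>?M) + (\<integral>t. (Pn n t - P t) \<bullet> (vel (\<gamma>n n) t - w R t) \<partial>?M)
        + (\<integral>t. P t \<bullet> vel (\<gamma>n n) t \<partial>?M) - (\<integral>t. P t \<bullet> w R t \<partial>?M)) \<longlonglongrightarrow>
        (\<integral>t. L (\<gamma> t) (w R t) \<partial>?M) + 0 + (\<integral>t. P t \<bullet> vel \<gamma> t \<partial>?M) - (\<integral>t. P t \<bullet> w R t \<partial>?M)"
      by (intro tendsto_intros Ldiff err Pweak)
    then have "(\<integral>t. L (\<gamma> t) (w R t) \<partial>?M) + 0 + (\<integral>t. P t \<bullet> vel \<gamma> t \<partial>?M) - (\<integral>t. P t \<bullet> w R t \<partial>?M) \<le> K"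
      by (rule LIMSEQ_le_const2) (use le in auto)
    moreover have "(\<integral>t. P t \<bullet> (vel \<gamma> t - w R t) \<partial>?M) = (\<integral>t. P t \<bullet> vel \<gamma> t \<partial>?M) - (\<integral>t. P t \<bullet> w R t \<partial>?M)"
      unfolding inner_diff_right using Pw by (intro Bochner_Integration.integral_diff)
    ultimately show ?thesis by (simp add: P_def)
  qed
  \<comment> \<open>the truncation level tends to infinity\<close>
  have "compact (Dom \<inter> cball 0 B0)" using closed_dom by (intro closed_Int_compact) auto
  then have bdb: "bounded ((\<lambda>y. p (y, 0)) ` (Dom \<inter> cball 0 B0))"
    by (intro compact_imp_bounded compact_continuous_image continuous_on_compose2[OF p(1)] continuous_intros) auto
  obtain b where b: "\<And>y. y \<in> Dom \<Longrightarrow> norm y \<le> B0 \<Longrightarrow> norm (p (y, 0)) \<le> b"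
  proof -
    obtain a where "\<forall>x\<in>(\<lambda>y. p (y, 0)) ` (Dom \<inter> cball 0 B0). norm x \<le> a"
      using bdb unfolding bounded_iff by blast
    then show thesis by (intro that[of a]) auto
  qed
  have ev: "\<forall>\<^sub>F n in sequentially. w (real n) t = vel \<gamma> t" for t
  proof -
    obtain N :: nat where "norm (vel \<gamma> t) \<le> real N" using real_arch_simple by blast
    then show ?thesis unfolding eventually_sequentially w_def by (intro exI[of _ N]) auto
  qed
  have lim1: "(\<lambda>n. \<integral>t. L (\<gamma> t) (w (real n) t) \<partial>?M) \<longlonglongrightarrow> (\<integral>t. L (\<gamma> t) (vel \<gamma> t) \<partial>?M)"
  proof (rule integral_dominated_convergence[where w = "\<lambda>t. C * (norm (vel \<gamma> t))\<^sup>2 + C"])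
    show "(\<lambda>t. L (\<gamma> t) (vel \<gamma> t)) \<in> borel_measurable ?M" using running_integrable[OF \<gamma>] by auto
    show "(\<lambda>t. L (\<gamma> t) (w (real n) t)) \<in> borel_measurable ?M" for n
    proof -
      have "(\<lambda>t. L (q (l t)) (w (real n) t)) \<in> borel_measurable ?M"
        using measurable_along[OF continuous_L l(1) _ wm] dom_l by simp
      then show ?thesis by (rule measurable_cong[THEN iffD1, rotated]) (use l in auto)
    qed
    show "AE t in ?M. (\<lambda>n. L (\<gamma> t) (w (real n) t)) \<longlonglongrightarrow> L (\<gamma> t) (vel \<gamma> t)"
    proof (rule AE_I2)
      fix t show "(\<lambda>n. L (\<gamma> t) (w (real n) t)) \<longlonglongrightarrow> L (\<gamma> t) (vel \<gamma> t)"
        by (rule tendsto_eventually) (use ev[of t] in \<open>eventually_elim, simp\<close>)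
    qed
    show "AE t in ?M. norm (L (\<gamma> t) (w (real n) t)) \<le> C * (norm (vel \<gamma> t))\<^sup>2 + C" for n
    proof (rule AE_I2)
      fix t assume "t \<in> space ?M"
      then have "\<bar>L (\<gamma> t) (w (real n) t)\<bar> \<le> C * (norm (w (real n) t))\<^sup>2 + C" using curve_in[OF \<gamma>] by (intro abs_L) simp
      also have "\<dots> \<le> C * (norm (vel \<gamma> t))\<^sup>2 + C" using C by (simp add: w_def)
      finally show "norm (L (\<gamma> t) (w (real n) t)) \<le> C * (norm (vel \<gamma> t))\<^sup>2 + C" by simp
    qed
  qed (use vi in auto)
  have pm: "(\<lambda>t. p (l t, w (real n) t) \<bullet> (vel \<gamma> t - w (real n) t)) \<in> borel_measurable ?M" for n
    using measurable_along[OF p(1) l(1) dom_l(1) wm] by measurable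
  have lim2: "(\<lambda>n. \<integral>t. p (l t, w (real n) t) \<bullet> (vel \<gamma> t - w (real n) t) \<partial>?M) \<longlonglongrightarrow> (\<integral>t. 0 \<partial>?M)"
  proof (rule integral_dominated_convergence[where w = "\<lambda>t. b * norm (vel \<gamma> t)"])
    show "AE t in ?M. (\<lambda>n. p (l t, w (real n) t) \<bullet> (vel \<gamma> t - w (real n) t)) \<longlonglongrightarrow> 0"
    proof (rule AE_I2)
      fix t show "(\<lambda>n. p (l t, w (real n) t) \<bullet> (vel \<gamma> t - w (real n) t)) \<longlonglongrightarrow> 0"
        by (rule tendsto_eventually) (use ev[of t] in \<open>eventually_elim, simp\<close>)
    qed
    show "AE t in ?M. norm (p (l t, w (real n) t) \<bullet> (vel \<gamma> t - w (real n) t)) \<le> b * norm (vel \<gamma> t)" for n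
    proof (rule AE_I2)
      fix t assume "t \<in> space ?M"
      then have t: "t \<in> {0..T}" by simp
      have "norm (p (l t, 0)) \<le> b" using b dom_l[OF t] B0[OF t] by blast
      moreover have "0 \<le> norm (p (l t, 0))" by simp
      ultimately have b0: "0 \<le> b" by linarith
      have "\<bar>p (l t, 0) \<bullet> vel \<gamma> t\<bar> \<le> b * norm (vel \<gamma> t)"
        using Cauchy_Schwarz_ineq2[of "p (l t, 0)" "vel \<gamma> t"] \<open>norm (p (l t, 0)) \<le> b\<close>
          mult_right_mono[of "norm (p (l t, 0))" b "norm (vel \<gamma> t)"] by simp
      with b0 show "norm (p (l t, w (real n) t) \<bullet> (vel \<gamma> t - w (real n) t)) \<le> b * norm (vel \<gamma> t)"
        by (auto simp: w_def)
    qed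
  qed (use pm vi in auto)
  have "(\<lambda>n. (\<integral>t. L (\<gamma> t) (w (real n) t) \<partial>?M) + (\<integral>t. p (l t, w (real n) t) \<bullet> (vel \<gamma> t - w (real n) t) \<partial>?M)) \<longlonglongrightarrow>
    running_cost \<gamma> + 0"
    using tendsto_add[OF lim1 lim2] by (simp add: running_cost_def integral_time)
  then have "running_cost \<gamma> + 0 \<le> K"
    by (rule LIMSEQ_le_const2) (use step in auto)
  then show ?thesis by simp
qed

text \<open>Along a sequence violating the claim, the running costs are bounded by \<open>running_cost \<gamma> - \<epsilon>\<close>, which
  \<open>running_cost_liminf\<close> excludes.\<close>

theorem running_cost_lsc:
  assumes \<gamma>: "\<gamma> \<in> \<Gamma>" and \<epsilon>: "\<epsilon> > 0"
  shows "\<exists>\<delta>>0. \<forall>\<gamma>'\<in>\<Gamma>. dist \<gamma>' \<gamma> < \<delta> \<longrightarrow> running_cost \<gamma> - \<epsilon> < running_cost \<gamma>'"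
proof (rule ccontr)
  assume neg: "\<not> ?thesis"
  have "\<exists>\<gamma>'\<in>\<Gamma>. dist \<gamma>' \<gamma> < 1 / (real n + 4) \<and> running_cost \<gamma>' \<le> running_cost \<gamma> - \<epsilon>" for n :: nat
  proof -
    have "1 / (real n + 4) > 0" by simp
    then show ?thesis using neg by (meson not_less)
  qed
  then obtain \<gamma>n where \<gamma>n: "\<And>n. \<gamma>n n \<in> \<Gamma>" "\<And>n. dist (\<gamma>n n) \<gamma> < 1 / (real n + 4)"
    "\<And>n. running_cost (\<gamma>n n) \<le> running_cost \<gamma> - \<epsilon>" by metis
  have "1 / (real n + 4) \<le> 1 / 4" for n :: nat by (simp add: field_simps)
  then have close: "dist (\<gamma>n n) \<gamma> < 1 / 4" for n using \<gamma>n(2)[of n] by (meson less_le_trans)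
  have "(\<lambda>n. 1 / (real n + 4)) \<longlonglongrightarrow> 0" by real_asymp
  then have "(\<lambda>n. dist (\<gamma>n n) \<gamma>) \<longlonglongrightarrow> 0"
    by (rule Lim_null_comparison[rotated]) (use \<gamma>n(2) in \<open>auto intro!: always_eventually less_imp_le\<close>)
  then have "\<gamma>n \<longlonglongrightarrow> \<gamma>" by (rule tendsto_dist_iff[THEN iffD2])
  from running_cost_liminf[OF \<gamma> \<gamma>n(1) this close \<gamma>n(3)] \<epsilon> show False by simp
qed

end

section \<open>Mixtures of measures and linear derivatives\<close>

context
  fixes m m' :: "'a measure" and t :: real
  assumes sets_eq: "sets m' = sets m"
    and t: "0 \<le> t" "t \<le> 1"
begin

lemma space_interpolate: "space (interpolate t m m') = space m"
  by (simp add: interpolate_def space_measure_of_conv)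

lemma sets_interpolate: "sets (interpolate t m m') = sets m"
  by (simp add: interpolate_def sets.sigma_sets_eq sets.space_closed)

lemma emeasure_interpolate:
  assumes A: "A \<in> sets m"
  shows "emeasure (interpolate t m m') A = ennreal (1 - t) * emeasure m A + ennreal t * emeasure m' A"
  unfolding interpolate_def
proof (rule emeasure_measure_of_sigma)
  show "sigma_algebra (space m) (sets m)" by (rule sets.sigma_algebra_axioms)
  show "positive (sets m) (\<lambda>A. ennreal (1 - t) * emeasure m A + ennreal t * emeasure m' A)"
    by (simp add: positive_def)
  show "countably_additive (sets m) (\<lambda>A. ennreal (1 - t) * emeasure m A + ennreal t * emeasure m' A)"
  proof (rule countably_additiveI)
    fix A :: "nat \<Rightarrow> 'a set" assume A: "range A \<subseteq> sets m" "disjoint_family A" "\<Union>(range A) \<in> sets m"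
    have "(\<Sum>i. ennreal (1 - t) * emeasure m (A i) + ennreal t * emeasure m' (A i)) =
      ennreal (1 - t) * (\<Sum>i. emeasure m (A i)) + ennreal t * (\<Sum>i. emeasure m' (A i))"
      by (simp add: suminf_add[symmetric] ennreal_suminf_cmult)
    also have "\<dots> = ennreal (1 - t) * emeasure m (\<Union>(range A)) + ennreal t * emeasure m' (\<Union>(range A))"
      using A by (simp add: suminf_emeasure sets_eq)
    finally show "(\<Sum>i. ennreal (1 - t) * emeasure m (A i) + ennreal t * emeasure m' (A i)) =
      ennreal (1 - t) * emeasure m (\<Union>(range A)) + ennreal t * emeasure m' (\<Union>(range A))" .
  qed
qed (rule A)

lemma nn_integral_interpolate:
  assumes "f \<in> borel_measurable m"
  shows "(\<integral>\<^sup>+x. f x \<partial>interpolate t m m') = ennreal (1 - t) * (\<integral>\<^sup>+x. f x \<partial>m) + ennreal t * (\<integral>\<^sup>+x. f x \<partial>m')"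
  using assms
proof (induction f rule: borel_measurable_induct)
  case (cong f g)
  have "space m' = space m" using sets_eq by (rule sets_eq_imp_space_eq)
  then have "integral\<^sup>N (interpolate t m m') f = integral\<^sup>N (interpolate t m m') g"
    "integral\<^sup>N m f = integral\<^sup>N m g" "integral\<^sup>N m' f = integral\<^sup>N m' g"
    using cong(3) by (auto intro!: nn_integral_cong simp: space_interpolate)
  then show ?case using cong(4) by simp
next
  case (set A)
  then show ?case by (simp add: sets_interpolate sets_eq emeasure_interpolate)
next
  case (mult u c)
  then show ?case
    by (simp add: nn_integral_cmult measurable_cong_sets[OF sets_interpolate refl] measurable_cong_sets[OF sets_eq refl]
      algebra_simps)
next
  case (add u v)
  then show ?case
    by (simp add: nn_integral_add measurable_cong_sets[OF sets_interpolate refl] measurable_cong_sets[OF sets_eq refl]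
      algebra_simps)
next
  case (seq U)
  have m: "U i \<in> borel_measurable (interpolate t m m')" "U i \<in> borel_measurable m'" for i
    using seq(1) by (simp_all add: measurable_cong_sets[OF sets_interpolate refl] measurable_cong_sets[OF sets_eq refl])
  have inc: "incseq (\<lambda>i. integral\<^sup>N m (U i))" "incseq (\<lambda>i. integral\<^sup>N m' (U i))"
    using seq(3) by (auto simp: incseq_def le_fun_def intro!: nn_integral_mono)
  have sup: "integral\<^sup>N M (SUP i. U i) = (SUP i. integral\<^sup>N M (U i))" if "\<And>i. U i \<in> borel_measurable M" for M
    using nn_integral_monotone_convergence_SUP[OF seq(3) that] unfolding SUP_apply .
  have "(SUP i. ennreal (1 - t) * integral\<^sup>N m (U i) + ennreal t * integral\<^sup>N m' (U i)) =
    (SUP i. ennreal (1 - t) * integral\<^sup>N m (U i)) + (SUP i. ennreal t * integral\<^sup>N m' (U i))"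
    using inc by (intro ennreal_SUP_add) (auto simp: incseq_def intro!: mult_left_mono)
  moreover have "ennreal (1 - t) * (SUP i. integral\<^sup>N m (U i)) = (SUP i. ennreal (1 - t) * integral\<^sup>N m (U i))"
    "ennreal t * (SUP i. integral\<^sup>N m' (U i)) = (SUP i. ennreal t * integral\<^sup>N m' (U i))"
    by (simp_all add: SUP_mult_left_ennreal)
  moreover have "f = (SUP i. U i)" using seq by simp
  ultimately show ?case
    using sup[OF m(1)] sup[OF m(2)] sup[OF seq(1)] seq.IH by (simp only:)
qed

lemma integral_interpolate:
  fixes f :: "'a \<Rightarrow> real"
  assumes f: "integrable m f" "integrable m' f"
  shows "integrable (interpolate t m m') f"
    and "(\<integral>x. f x \<partial>interpolate t m m') = (1 - t) * (\<integral>x. f x \<partial>m) + t * (\<integral>x. f x \<partial>m')"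
proof -
  have fm: "f \<in> borel_measurable m" using f by auto
  have fm': "f \<in> borel_measurable (interpolate t m m')"
    using fm by (simp add: measurable_cong_sets[OF sets_interpolate refl])
  have fin: "(\<integral>\<^sup>+x. ennreal (f x) \<partial>m) < \<infinity>" "(\<integral>\<^sup>+x. ennreal (f x) \<partial>m') < \<infinity>"
    "(\<integral>\<^sup>+x. ennreal (- f x) \<partial>m) < \<infinity>" "(\<integral>\<^sup>+x. ennreal (- f x) \<partial>m') < \<infinity>"
    using f unfolding real_integrable_def by (auto simp: less_top)
  have nn: "(\<integral>\<^sup>+x. ennreal (f x) \<partial>interpolate t m m') = ennreal (1 - t) * (\<integral>\<^sup>+x. ennreal (f x) \<partial>m) + ennreal t * (\<integral>\<^sup>+x. ennreal (f x) \<partial>m')"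
    "(\<integral>\<^sup>+x. ennreal (- f x) \<partial>interpolate t m m') = ennreal (1 - t) * (\<integral>\<^sup>+x. ennreal (- f x) \<partial>m) + ennreal t * (\<integral>\<^sup>+x. ennreal (- f x) \<partial>m')"
    using fm by (auto intro!: nn_integral_interpolate)
  have lt: "ennreal (1 - t) * a + ennreal t * b < \<infinity>" if "a < \<infinity>" "b < \<infinity>" for a b
    using that by (simp add: ennreal_mult_less_top)
  show i: "integrable (interpolate t m m') f"
    unfolding real_integrable_def nn using fm' lt[OF fin(1,2)] lt[OF fin(3,4)] by auto
  have e: "enn2real (ennreal (1 - t) * a + ennreal t * b) = (1 - t) * enn2real a + t * enn2real b"
    if "a < \<infinity>" "b < \<infinity>" for a b
    using that t by (subst enn2real_plus) (auto simp: ennreal_mult_less_top enn2real_mult)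
  show "(\<integral>x. f x \<partial>interpolate t m m') = (1 - t) * (\<integral>x. f x \<partial>m) + t * (\<integral>x. f x \<partial>m')"
    unfolding real_lebesgue_integral_def[OF i] real_lebesgue_integral_def[OF f(1)] real_lebesgue_integral_def[OF f(2)] nn
      e[OF fin(1,2)] e[OF fin(3,4)]
    by (simp add: algebra_simps)
qed

end

lemma measure_interpolate_eqI:
  assumes "sets m' = sets m" "0 \<le> t" "t \<le> 1" "sets n = sets m"
    and "\<And>A. A \<in> sets m \<Longrightarrow> emeasure n A = ennreal (1 - t) * emeasure m A + ennreal t * emeasure m' A"
  shows "n = interpolate t m m'"
  by (rule measure_eqI) (use assms in \<open>auto simp: sets_interpolate emeasure_interpolate\<close>)

lemma distr_interpolate:
  assumes sets_eq: "sets m' = sets m" and t: "0 \<le> t" "t \<le> 1" and g: "g \<in> measurable m N"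
  shows "distr (interpolate t m m') N g = interpolate t (distr m N g) (distr m' N g)"
proof (rule measure_interpolate_eqI[OF _ t])
  have g': "g \<in> measurable m' N" "g \<in> measurable (interpolate t m m') N"
    using g by (simp_all add: measurable_cong_sets[OF sets_interpolate[OF sets_eq t] refl] measurable_cong_sets[OF sets_eq refl])
  have s: "space m' = space m" using sets_eq by (rule sets_eq_imp_space_eq)
  fix A assume "A \<in> sets (distr m N g)"
  then have A: "A \<in> sets N" by simp
  have "emeasure (distr (interpolate t m m') N g) A = emeasure (interpolate t m m') (g -` A \<inter> space m)"
    using g' A by (simp add: emeasure_distr space_interpolate[OF sets_eq t])
  also have "\<dots> = ennreal (1 - t) * emeasure m (g -` A \<inter> space m) + ennreal t * emeasure m' (g -` A \<inter> space m)"
    using g A by (intro emeasure_interpolate[OF sets_eq t]) auto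
  also have "\<dots> = ennreal (1 - t) * emeasure (distr m N g) A + ennreal t * emeasure (distr m' N g) A"
    using g g' A by (simp add: emeasure_distr s)
  finally show "emeasure (distr (interpolate t m m') N g) A =
    ennreal (1 - t) * emeasure (distr m N g) A + ennreal t * emeasure (distr m' N g) A" .
qed auto

lemma interpolate_0:
  assumes "sets m' = sets m"
  shows "interpolate 0 m m' = m"
  by (rule measure_interpolate_eqI[symmetric]) (use assms in auto)

lemma interpolate_towards:
  assumes "sets m' = sets m" "0 \<le> s" "s \<le> 1" "0 \<le> t" "t \<le> 1"
  shows "interpolate t (interpolate s m m') m' = interpolate (s + t * (1 - s)) m m'"
proof (rule measure_interpolate_eqI)
  note [simp] = sets_interpolate[OF assms(1-3)]
  have s': "sets m' = sets (interpolate s m m')" using assms by simp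
  show "0 \<le> s + t * (1 - s)" using assms by simp
  show "s + t * (1 - s) \<le> 1" using assms mult_left_le_one_le[of "1 - s" t] by simp
  show "sets (interpolate t (interpolate s m m') m') = sets m"
    using sets_interpolate[OF s' assms(4,5)] by simp
  fix A assume A: "A \<in> sets m"
  have eq: "1 - (s + t * (1 - s)) = (1 - t) * (1 - s)" "s + t * (1 - s) = (1 - t) * s + t" by (auto simp: algebra_simps)
  have "emeasure (interpolate t (interpolate s m m') m') A =
    ennreal (1 - t) * (ennreal (1 - s) * emeasure m A + ennreal s * emeasure m' A) + ennreal t * emeasure m' A"
    using A by (simp add: emeasure_interpolate[OF s' assms(4,5)] emeasure_interpolate[OF assms(1-3)])
  also have "\<dots> = ennreal ((1 - t) * (1 - s)) * emeasure m A + ennreal ((1 - t) * s + t) * emeasure m' A"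
    using assms by (simp add: ennreal_mult ennreal_plus distrib_left distrib_right mult.assoc add.assoc)
  finally show "emeasure (interpolate t (interpolate s m m') m') A =
    ennreal (1 - (s + t * (1 - s))) * emeasure m A + ennreal (s + t * (1 - s)) * emeasure m' A"
    by (simp only: eq(1)) (simp only: eq(2))
qed (use assms in auto)

lemma interpolate_back:
  assumes "sets m' = sets m" "0 \<le> s" "s \<le> 1" "0 \<le> t" "t \<le> 1"
  shows "interpolate t (interpolate s m m') m = interpolate (s - t * s) m m'"
proof (rule measure_interpolate_eqI)
  note [simp] = sets_interpolate[OF assms(1-3)]
  have s': "sets m = sets (interpolate s m m')" using assms by simp
  show "0 \<le> s - t * s" using assms mult_right_mono[of t 1 s] by simp
  have "0 \<le> t * s" using assms by simp
  then show "s - t * s \<le> 1" using assms by linarith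
  show "sets (interpolate t (interpolate s m m') m) = sets m"
    using sets_interpolate[OF s' assms(4,5)] by simp
  fix A assume A: "A \<in> sets m"
  have eq: "1 - (s - t * s) = (1 - t) * (1 - s) + t" "s - t * s = (1 - t) * s" by (auto simp: algebra_simps)
  have "emeasure (interpolate t (interpolate s m m') m) A =
    ennreal (1 - t) * (ennreal (1 - s) * emeasure m A + ennreal s * emeasure m' A) + ennreal t * emeasure m A"
    using A by (simp add: emeasure_interpolate[OF s' assms(4,5)] emeasure_interpolate[OF assms(1-3)])
  also have "\<dots> = ennreal ((1 - t) * (1 - s) + t) * emeasure m A + ennreal ((1 - t) * s) * emeasure m' A"
    using assms by (simp add: ennreal_mult ennreal_plus distrib_left distrib_right mult.assoc add.assoc add.commute[of "ennreal t * _"] add.left_commute)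
  finally show "emeasure (interpolate t (interpolate s m m') m) A =
    ennreal (1 - (s - t * s)) * emeasure m A + ennreal (s - t * s) * emeasure m' A"
    by (simp only: eq(1)) (simp only: eq(2))
qed (use assms in auto)

lemma prob_measures_sets: "m \<in> prob_measures S \<Longrightarrow> m' \<in> prob_measures S \<Longrightarrow> sets m' = sets m"
  by (simp add: prob_measures_def)

lemma interpolate_prob_measures:
  assumes "m \<in> prob_measures S" "m' \<in> prob_measures S" "0 \<le> t" "t \<le> 1"
  shows "interpolate t m m' \<in> prob_measures S"
proof -
  note s = prob_measures_sets[OF assms(1,2)]
  have sp: "space m' = space m" using s by (rule sets_eq_imp_space_eq)
  have "emeasure m (space m) = 1" "emeasure m' (space m) = 1"
    using assms(1,2) sp prob_space.emeasure_space_1 unfolding prob_measures_def by (metis (mono_tags) mem_Collect_eq)+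
  then have "emeasure (interpolate t m m') (space (interpolate t m m')) = 1"
    using assms(3,4)
    by (simp add: space_interpolate[OF s assms(3,4)] emeasure_interpolate[OF s assms(3,4)] flip: ennreal_plus)
  then have "prob_space (interpolate t m m')" by (rule prob_spaceI)
  then show ?thesis using assms(1) sets_interpolate[OF s assms(3,4)] by (simp add: prob_measures_def)
qed

lemma nn_second_moment_le:
  assumes m: "m \<in> prob_measures S" and x: "x \<in> S" "x' \<in> S"
    and fin: "(\<integral>\<^sup>+y. ennreal ((dist y x)\<^sup>2) \<partial>m) < \<infinity>"
  shows "(\<integral>\<^sup>+y. ennreal ((dist y x')\<^sup>2) \<partial>m) < \<infinity>"
proof -
  interpret prob_space m using m by (simp add: prob_measures_def)
  have meas: "(\<lambda>y. ennreal ((dist y x)\<^sup>2)) \<in> borel_measurable m"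
  proof -
    have "(\<lambda>y. (dist y x)\<^sup>2) \<in> borel_measurable (restrict_space borel S)"
      by (intro measurable_restrict_space1 borel_measurable_continuous_onI continuous_intros)
    then have "(\<lambda>y. (dist y x)\<^sup>2) \<in> borel_measurable m"
      using m measurable_cong_sets[of m "restrict_space borel S"] by (auto simp: prob_measures_def)
    then show ?thesis by simp
  qed
  have "(\<integral>\<^sup>+y. ennreal ((dist y x')\<^sup>2) \<partial>m) \<le> (\<integral>\<^sup>+y. ennreal 2 * ennreal ((dist y x)\<^sup>2) + ennreal (2 * (dist x x')\<^sup>2) \<partial>m)"
  proof (rule nn_integral_mono)
    fix y
    have "(dist y x')\<^sup>2 \<le> (dist y x + dist x x')\<^sup>2" by (intro power_mono dist_triangle) auto
    also have "\<dots> \<le> 2 * (dist y x)\<^sup>2 + 2 * (dist x x')\<^sup>2"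
      using sum_squares_bound[of "dist y x" "dist x x'"] by (simp add: power2_sum)
    finally have "ennreal ((dist y x')\<^sup>2) \<le> ennreal (2 * (dist y x)\<^sup>2 + 2 * (dist x x')\<^sup>2)" by (rule ennreal_leI)
    then show "ennreal ((dist y x')\<^sup>2) \<le> ennreal 2 * ennreal ((dist y x)\<^sup>2) + ennreal (2 * (dist x x')\<^sup>2)"
      by (simp add: ennreal_plus ennreal_mult)
  qed
  also have "\<dots> = ennreal 2 * (\<integral>\<^sup>+y. ennreal ((dist y x)\<^sup>2) \<partial>m) + ennreal (2 * (dist x x')\<^sup>2)"
    using meas by (simp add: nn_integral_add nn_integral_cmult emeasure_space_1)
  also have "\<dots> < \<infinity>" using fin by (simp add: ennreal_mult_less_top)
  finally show ?thesis .
qed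

lemma interpolate_prob_measures2:
  assumes "m \<in> prob_measures2 S" "m' \<in> prob_measures2 S" "0 \<le> t" "t \<le> 1"
  shows "interpolate t m m' \<in> prob_measures2 S"
proof -
  have p: "m \<in> prob_measures S" "m' \<in> prob_measures S" using assms by (auto simp: prob_measures2_def)
  obtain x x' where x: "x \<in> S" "(\<integral>\<^sup>+y. ennreal ((dist y x)\<^sup>2) \<partial>m) < \<infinity>" and x': "x' \<in> S" "(\<integral>\<^sup>+y. ennreal ((dist y x')\<^sup>2) \<partial>m') < \<infinity>"
    using assms by (auto simp: prob_measures2_def)
  have f: "(\<integral>\<^sup>+y. ennreal ((dist y x)\<^sup>2) \<partial>m') < \<infinity>" by (rule nn_second_moment_le[OF p(2) x'(1) x(1) x'(2)])
  have "(\<lambda>y. (dist y x)\<^sup>2) \<in> borel_measurable (restrict_space borel S)"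
    by (intro measurable_restrict_space1 borel_measurable_continuous_onI continuous_intros)
  then have "(\<lambda>y. (dist y x)\<^sup>2) \<in> borel_measurable m"
    using p(1) measurable_cong_sets[of m "restrict_space borel S"] by (auto simp: prob_measures_def)
  then have "(\<integral>\<^sup>+y. ennreal ((dist y x)\<^sup>2) \<partial>interpolate t m m') =
    ennreal (1 - t) * (\<integral>\<^sup>+y. ennreal ((dist y x)\<^sup>2) \<partial>m) + ennreal t * (\<integral>\<^sup>+y. ennreal ((dist y x)\<^sup>2) \<partial>m')"
    by (intro nn_integral_interpolate[OF prob_measures_sets[OF p] assms(3,4)]) simp
  also have "\<dots> < \<infinity>" using x f by (simp add: ennreal_mult_less_top)
  finally show ?thesis using interpolate_prob_measures[OF p assms(3,4)] x by (auto simp: prob_measures2_def)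
qed

text \<open>Along a segment of measures, \<open>F\<close> is differentiable in the interior: the definition of the
  linear derivative, applied at an interior point towards both ends of the segment, gives the two
  one-sided derivatives.\<close>

lemma linear_derivative_mean_value:
  assumes F: "linear_derivative S F f" and m: "m \<in> prob_measures2 S" "m' \<in> prob_measures2 S"
    and s: "0 < s" "s < 1"
  shows "\<exists>\<sigma>. 0 < \<sigma> \<and> \<sigma> < s \<and> F (interpolate s m m') - F m =
    s * ((\<integral>x. f (interpolate \<sigma> m m') x \<partial>m') - (\<integral>x. f (interpolate \<sigma> m m') x \<partial>m))"
proof -
  define \<phi> where "\<phi> \<sigma> = F (interpolate \<sigma> m m')" for \<sigma>
  define D where "D \<sigma> = (\<integral>x. f (interpolate \<sigma> m m') x \<partial>m') - (\<integral>x. f (interpolate \<sigma> m m') x \<partial>m)" for \<sigma>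
  have "m \<in> prob_measures S" "m' \<in> prob_measures S" using m by (simp_all add: prob_measures2_def)
  then have sets: "sets m' = sets m" by (rule prob_measures_sets)
  have P2: "interpolate \<sigma> m m' \<in> prob_measures2 S" if "0 \<le> \<sigma>" "\<sigma> \<le> 1" for \<sigma>
    using that m by (intro interpolate_prob_measures2)
  have int: "integrable m (f (interpolate \<sigma> m m'))" "integrable m' (f (interpolate \<sigma> m m'))" if "0 \<le> \<sigma>" "\<sigma> \<le> 1" for \<sigma>
    using F P2[OF that] m unfolding linear_derivative_def by blast+
  have self: "(\<integral>x. f (interpolate \<sigma> m m') x \<partial>interpolate \<sigma> m m') =
    (1 - \<sigma>) * (\<integral>x. f (interpolate \<sigma> m m') x \<partial>m) + \<sigma> * (\<integral>x. f (interpolate \<sigma> m m') x \<partial>m')" if "0 \<le> \<sigma>" "\<sigma> \<le> 1" for \<sigma>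
    by (rule integral_interpolate(2)[OF sets that int[OF that]])
  \<comment> \<open>moving from parameter \<open>\<sigma>\<close> towards \<open>m'\<close> by \<open>\<tau>\<close> leads to parameter \<open>\<sigma> + \<tau> (1 - \<sigma>)\<close>\<close>
  have right: "((\<lambda>h. (\<phi> (\<sigma> + h) - \<phi> \<sigma>) / h) \<longlongrightarrow> D \<sigma>) (at_right 0)" if \<sigma>: "0 \<le> \<sigma>" "\<sigma> < 1" for \<sigma>
  proof -
    have "((\<lambda>\<tau>. (F (interpolate \<tau> (interpolate \<sigma> m m') m') - \<phi> \<sigma>) / \<tau>) \<longlongrightarrow>
        (\<integral>x. f (interpolate \<sigma> m m') x \<partial>m') - (\<integral>x. f (interpolate \<sigma> m m') x \<partial>interpolate \<sigma> m m')) (at_right 0)"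
      using F P2[of \<sigma>] m(2) \<sigma> unfolding linear_derivative_def \<phi>_def by simp
    moreover have "(\<integral>x. f (interpolate \<sigma> m m') x \<partial>m') - (\<integral>x. f (interpolate \<sigma> m m') x \<partial>interpolate \<sigma> m m') = (1 - \<sigma>) * D \<sigma>"
      using \<sigma> by (simp add: self D_def algebra_simps)
    ultimately have l: "((\<lambda>\<tau>. (F (interpolate \<tau> (interpolate \<sigma> m m') m') - \<phi> \<sigma>) / \<tau>) \<longlongrightarrow> (1 - \<sigma>) * D \<sigma>) (at_right 0)" by simp
    have fl: "filterlim (\<lambda>h. h / (1 - \<sigma>)) (at_right 0) (at_right 0)"
    proof (rule filterlim_at_withinI)
      show "((\<lambda>h. h / (1 - \<sigma>)) \<longlongrightarrow> 0) (at_right 0)" using \<sigma> by (auto intro!: tendsto_eq_intros)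
      show "\<forall>\<^sub>F h in at_right 0. h / (1 - \<sigma>) \<in> {0<..} - {0}"
        using \<sigma> by (auto simp: eventually_at_filter)
    qed
    have "((\<lambda>h. (F (interpolate (h / (1 - \<sigma>)) (interpolate \<sigma> m m') m') - \<phi> \<sigma>) / (h / (1 - \<sigma>)) / (1 - \<sigma>)) \<longlongrightarrow> (1 - \<sigma>) * D \<sigma> / (1 - \<sigma>)) (at_right 0)"
      using \<sigma> by (intro tendsto_divide filterlim_compose[OF l fl] tendsto_const) auto
    moreover have "\<forall>\<^sub>F h in at_right 0. (F (interpolate (h / (1 - \<sigma>)) (interpolate \<sigma> m m') m') - \<phi> \<sigma>) / (h / (1 - \<sigma>)) / (1 - \<sigma>) = (\<phi> (\<sigma> + h) - \<phi> \<sigma>) / h"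
    proof -
      have "\<forall>\<^sub>F h in at_right 0. h \<in> {0<..<1 - \<sigma>}" using \<sigma> by (intro eventually_at_right_real) auto
      then show ?thesis
      proof eventually_elim
        case (elim h)
        have "interpolate (h / (1 - \<sigma>)) (interpolate \<sigma> m m') m' = interpolate (\<sigma> + h / (1 - \<sigma>) * (1 - \<sigma>)) m m'"
          using elim \<sigma> by (intro interpolate_towards sets) (auto simp: field_simps)
        then show ?case using \<sigma> by (simp add: \<phi>_def)
      qed
    qed
    ultimately have "((\<lambda>h. (\<phi> (\<sigma> + h) - \<phi> \<sigma>) / h) \<longlongrightarrow> (1 - \<sigma>) * D \<sigma> / (1 - \<sigma>)) (at_right 0)"
      by (rule Lim_transform_eventually)
    then show ?thesis using \<sigma> by simp
  qed
  \<comment> \<open>moving from parameter \<open>\<sigma>\<close> towards \<open>m\<close> by \<open>\<tau>\<close> leads to parameter \<open>\<sigma> - \<tau> \<sigma>\<close>\<close>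
  have left: "((\<lambda>h. (\<phi> (\<sigma> + h) - \<phi> \<sigma>) / h) \<longlongrightarrow> D \<sigma>) (at_left 0)" if \<sigma>: "0 < \<sigma>" "\<sigma> \<le> 1" for \<sigma>
  proof -
    have "((\<lambda>\<tau>. (F (interpolate \<tau> (interpolate \<sigma> m m') m) - \<phi> \<sigma>) / \<tau>) \<longlongrightarrow>
        (\<integral>x. f (interpolate \<sigma> m m') x \<partial>m) - (\<integral>x. f (interpolate \<sigma> m m') x \<partial>interpolate \<sigma> m m')) (at_right 0)"
      using F P2[of \<sigma>] m(1) \<sigma> unfolding linear_derivative_def \<phi>_def by simp
    moreover have "(\<integral>x. f (interpolate \<sigma> m m') x \<partial>m) - (\<integral>x. f (interpolate \<sigma> m m') x \<partial>interpolate \<sigma> m m') = - \<sigma> * D \<sigma>"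
      using \<sigma> by (simp add: self D_def algebra_simps)
    ultimately have l: "((\<lambda>\<tau>. (F (interpolate \<tau> (interpolate \<sigma> m m') m) - \<phi> \<sigma>) / \<tau>) \<longlongrightarrow> - \<sigma> * D \<sigma>) (at_right 0)" by simp
    have fl: "filterlim (\<lambda>h. - h / \<sigma>) (at_right 0) (at_left 0)"
    proof (rule filterlim_at_withinI)
      show "((\<lambda>h. - h / \<sigma>) \<longlongrightarrow> 0) (at_left 0)" using \<sigma> by (auto intro!: tendsto_eq_intros)
      show "\<forall>\<^sub>F h in at_left 0. - h / \<sigma> \<in> {0<..} - {0}"
        using \<sigma> by (auto simp: eventually_at_filter divide_neg_pos)
    qed
    have "((\<lambda>h. (F (interpolate (- h / \<sigma>) (interpolate \<sigma> m m') m) - \<phi> \<sigma>) / (- h / \<sigma>) / (- \<sigma>)) \<longlongrightarrow> - \<sigma> * D \<sigma> / (- \<sigma>)) (at_left 0)"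
      using \<sigma> by (intro tendsto_divide filterlim_compose[OF l fl] tendsto_const) auto
    moreover have "\<forall>\<^sub>F h in at_left 0. (F (interpolate (- h / \<sigma>) (interpolate \<sigma> m m') m) - \<phi> \<sigma>) / (- h / \<sigma>) / (- \<sigma>) = (\<phi> (\<sigma> + h) - \<phi> \<sigma>) / h"
    proof -
      have "\<forall>\<^sub>F h in at_left 0. h \<in> {- \<sigma><..<0}" using \<sigma> by (intro eventually_at_left_real) auto
      then show ?thesis
      proof eventually_elim
        case (elim h)
        have "interpolate (- h / \<sigma>) (interpolate \<sigma> m m') m = interpolate (\<sigma> - (- h / \<sigma>) * \<sigma>) m m'"
          using elim \<sigma> by (intro interpolate_back sets) (auto simp: field_simps)
        then show ?case using \<sigma> by (simp add: \<phi>_def)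
      qed
    qed
    ultimately have "((\<lambda>h. (\<phi> (\<sigma> + h) - \<phi> \<sigma>) / h) \<longlongrightarrow> - \<sigma> * D \<sigma> / (- \<sigma>)) (at_left 0)"
      by (rule Lim_transform_eventually)
    then show ?thesis using \<sigma> by simp
  qed
  have deriv: "(\<phi> has_field_derivative D \<sigma>) (at \<sigma>)" if "0 < \<sigma>" "\<sigma> < 1" for \<sigma>
    unfolding DERIV_def using right[of \<sigma>] left[of \<sigma>] that by (subst filterlim_split_at_real) auto
  have "continuous (at_right 0) \<phi>"
  proof -
    have "((\<lambda>h. (\<phi> (0 + h) - \<phi> 0) / h * h + \<phi> 0) \<longlongrightarrow> D 0 * 0 + \<phi> 0) (at_right 0)"
      using right[of 0] by (intro tendsto_intros) auto
    moreover have "\<forall>\<^sub>F h in at_right 0. (\<phi> (0 + h) - \<phi> 0) / h * h + \<phi> 0 = \<phi> h"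
      by (auto simp: eventually_at_filter)
    ultimately have "(\<phi> \<longlongrightarrow> D 0 * 0 + \<phi> 0) (at_right 0)" by (rule Lim_transform_eventually)
    then show ?thesis by (simp add: continuous_within)
  qed
  then have "continuous (at 0 within {0..s}) \<phi>"
    using at_within_Icc_at_right[OF s(1)] by simp
  moreover have "continuous (at \<sigma> within {0..s}) \<phi>" if "\<sigma> \<in> {0<..s}" for \<sigma>
    using deriv[of \<sigma>] that s by (auto intro!: continuous_at_imp_continuous_at_within DERIV_isCont)
  ultimately have cont: "continuous_on {0..s} \<phi>"
    unfolding continuous_on_eq_continuous_within by (metis atLeastAtMost_iff greaterThanAtMost_iff order_less_le)
  have dv: "(\<phi> has_derivative (*) (D \<sigma>)) (at \<sigma>)" if "0 < \<sigma>" "\<sigma> < s" for \<sigma>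
    using deriv[of \<sigma>] that s by (simp add: has_field_derivative_def)
  obtain \<sigma> where "0 < \<sigma>" "\<sigma> < s" "\<phi> s - \<phi> 0 = D \<sigma> * (s - 0)"
    by (rule mvt[OF s(1) cont dv])
  then show ?thesis
    by (intro exI[of _ \<sigma>]) (auto simp: \<phi>_def D_def interpolate_0[OF sets])
qed

text \<open>\<open>F\<close> is merely a function on measures, so its values along the flow of marginals need not be
  measurable in time and their integral is a lower integral. Subadditivity survives when one summand
  is measurable: for a simple \<open>g \<le> u\<close>, the positive part of \<open>g - w\<close> is measurable and lies below \<open>v\<close>.\<close>

lemma nn_integral_le_add_measurable:
  fixes u v w :: "'a \<Rightarrow> real"
  assumes w: "integrable M w" and v: "\<And>x. x \<in> space M \<Longrightarrow> 0 \<le> v x" and u: "\<And>x. x \<in> space M \<Longrightarrow> 0 \<le> u x"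
    and le: "\<And>x. x \<in> space M \<Longrightarrow> u x \<le> v x + w x"
    and fin: "(\<integral>\<^sup>+x. ennreal (v x) \<partial>M) < \<infinity>"
  shows "enn2ereal (\<integral>\<^sup>+x. ennreal (u x) \<partial>M) \<le> enn2ereal (\<integral>\<^sup>+x. ennreal (v x) \<partial>M) + ereal (\<integral>x. w x \<partial>M)"
proof -
  have [measurable]: "w \<in> borel_measurable M" using w by auto
  let ?p = "\<integral>\<^sup>+x. ennreal (w x) \<partial>M" and ?n = "\<integral>\<^sup>+x. ennreal (- w x) \<partial>M" and ?v = "\<integral>\<^sup>+x. ennreal (v x) \<partial>M"
  have pn: "?p < \<infinity>" "?n < \<infinity>" using w unfolding real_integrable_def by (auto simp: less_top)
  have step: "integral\<^sup>N M g + ?n \<le> ?v + ?p" if g: "simple_function M g" "g \<le> (\<lambda>x. ennreal (u x))" for g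
  proof -
    have [measurable]: "g \<in> borel_measurable M" using g(1) by (rule borel_measurable_simple_function)
    define k where "k x = ennreal (enn2real (g x) - w x)" for x
    have [measurable]: "k \<in> borel_measurable M" unfolding k_def by measurable
    have gx: "g x \<le> ennreal (u x)" for x using g(2) by (simp add: le_fun_def)
    have "integral\<^sup>N M g + ?n = (\<integral>\<^sup>+x. g x + ennreal (- w x) \<partial>M)" by (subst nn_integral_add) auto
    also have "\<dots> \<le> (\<integral>\<^sup>+x. k x + ennreal (w x) \<partial>M)"
    proof (rule nn_integral_mono)
      fix x
      have "g x < \<infinity>" using gx[of x] by (simp add: le_less_trans)
      then have "g x = ennreal (enn2real (g x))" by simp
      then have "g x + ennreal (- w x) = ennreal (enn2real (g x)) + ennreal (max 0 (- w x))" by (simp add: max_def ennreal_neg)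
      also have "\<dots> = ennreal (enn2real (g x) + max 0 (- w x))" by (simp add: ennreal_plus)
      also have "\<dots> \<le> ennreal (max 0 (enn2real (g x) - w x) + max 0 (w x))" by (intro ennreal_leI) (auto simp: max_def)
      also have "\<dots> = k x + ennreal (w x)" by (simp add: k_def max_def ennreal_neg ennreal_plus)
      finally show "g x + ennreal (- w x) \<le> k x + ennreal (w x)" .
    qed
    also have "\<dots> = integral\<^sup>N M k + ?p" by (subst nn_integral_add) auto
    also have "integral\<^sup>N M k \<le> ?v"
    proof (rule nn_integral_mono)
      fix x assume x: "x \<in> space M"
      have "enn2real (g x) \<le> u x"
        using gx[of x] u[OF x] by (intro enn2real_leI) auto
      then show "k x \<le> ennreal (v x)" using le[OF x] unfolding k_def by (intro ennreal_leI) simp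
    qed
    finally show ?thesis by (simp add: add_right_mono)
  qed
  have npv: "?n \<le> ?v + ?p" using step[of "\<lambda>_. 0"] by (simp add: le_fun_def)
  have "integral\<^sup>N M g \<le> ?v + ?p - ?n" if "simple_function M g" "g \<le> (\<lambda>x. ennreal (u x))" for g
    using step[OF that] by (subst ennreal_le_minus_iff) auto
  then have "(\<integral>\<^sup>+x. ennreal (u x) \<partial>M) \<le> ?v + ?p - ?n"
    unfolding nn_integral_def[of M "\<lambda>x. ennreal (u x)"]
    by (intro SUP_least) (auto simp: nn_integral_eq_simple_integral[symmetric])
  then have "(\<integral>\<^sup>+x. ennreal (u x) \<partial>M) + ?n \<le> ?v + ?p - ?n + ?n" by (rule add_right_mono)
  also have "\<dots> = ?v + ?p" using npv by (rule diff_add_cancel_ennreal)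
  finally have main: "(\<integral>\<^sup>+x. ennreal (u x) \<partial>M) + ?n \<le> ?v + ?p" .
  obtain a where a: "?v = ennreal a" "0 \<le> a" using fin by (cases "?v") auto
  obtain b where b: "?p = ennreal b" "0 \<le> b" using pn by (cases "?p") auto
  obtain c where c: "?n = ennreal c" "0 \<le> c" using pn by (cases "?n") auto
  have "(\<integral>\<^sup>+x. ennreal (u x) \<partial>M) \<le> ?v + ?p" using main by (meson dual_order.trans add_increasing2 zero_le order_refl)
  then have "(\<integral>\<^sup>+x. ennreal (u x) \<partial>M) < \<infinity>" using fin pn by (simp add: le_less_trans)
  then obtain d where d: "(\<integral>\<^sup>+x. ennreal (u x) \<partial>M) = ennreal d" "0 \<le> d" by (cases "\<integral>\<^sup>+x. ennreal (u x) \<partial>M") auto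
  have "d + c \<le> a + b" using main a b c d by (simp add: ennreal_plus[symmetric] del: ennreal_plus)
  moreover have "(\<integral>x. w x \<partial>M) = b - c" using real_lebesgue_integral_def[OF w] b c by simp
  ultimately show ?thesis using a d by (simp add: enn2ereal_ennreal)
qed

section \<open>Measures on curves\<close>

text \<open>A lower semicontinuous function is Borel: its strict superlevel sets are relatively open.\<close>

lemma borel_measurable_lsc:
  fixes \<phi> :: "'a::metric_space \<Rightarrow> real"
  assumes "\<And>x \<epsilon>. x \<in> S \<Longrightarrow> \<epsilon> > 0 \<Longrightarrow> \<exists>\<delta>>0. \<forall>y\<in>S. dist y x < \<delta> \<longrightarrow> \<phi> x - \<epsilon> < \<phi> y"
  shows "\<phi> \<in> borel_measurable (restrict_space borel S)"
  unfolding borel_measurable_iff_greater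
proof
  fix a :: real
  define U where "U = \<Union>{B. open B \<and> S \<inter> B \<subseteq> {x. a < \<phi> x}}"
  have "{x \<in> space (restrict_space borel S). a < \<phi> x} = U \<inter> S"
  proof (intro equalityI subsetI)
    fix x assume "x \<in> {x \<in> space (restrict_space borel S). a < \<phi> x}"
    then have x: "x \<in> S" "a < \<phi> x" by (auto simp: space_restrict_space)
    obtain \<delta> where "\<delta> > 0" "\<And>y. y \<in> S \<Longrightarrow> dist y x < \<delta> \<Longrightarrow> \<phi> x - (\<phi> x - a) < \<phi> y"
      using assms[OF x(1), of "\<phi> x - a"] x(2) by auto
    then have "open (ball x \<delta>) \<and> S \<inter> ball x \<delta> \<subseteq> {x. a < \<phi> x}" "x \<in> ball x \<delta>"
      by (auto simp: dist_commute)
    then have "x \<in> U" unfolding U_def by (intro UnionI[of "ball x \<delta>"] CollectI) simp_all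
    then show "x \<in> U \<inter> S" using x(1) by simp
  qed (auto simp: U_def space_restrict_space)
  moreover have "open U" unfolding U_def by (intro open_Union) auto
  ultimately show "{x \<in> space (restrict_space borel S). a < \<phi> x} \<in> sets (restrict_space borel S)"
    unfolding sets_restrict_space by (intro image_eqI[of _ _ U]) (simp_all add: Int_commute)
qed

lemma W2_le:
  assumes "p \<in> couplings S m m'" "(\<integral>\<^sup>+z. ennreal ((dist (fst z) (snd z))\<^sup>2) \<partial>p) \<le> ennreal c" "0 \<le> c"
  shows "W2 S m m' \<le> sqrt c"
  unfolding W2_def
proof (intro real_sqrt_le_mono enn2real_leI assms(3))
  show "(INF p\<in>couplings S m m'. \<integral>\<^sup>+z. ennreal ((dist (fst z) (snd z))\<^sup>2) \<partial>p) \<le> ennreal c"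
    using assms(1,2) by (rule INF_lower2)
qed

lemma interpolate_same:
  assumes "0 \<le> t" "t \<le> 1"
  shows "interpolate t m m = m"
proof (rule measure_interpolate_eqI[symmetric])
  fix A
  have "ennreal (1 - t) * emeasure m A + ennreal t * emeasure m A = ennreal ((1 - t) + t) * emeasure m A"
    using assms by (subst ennreal_plus) (auto simp: distrib_right)
  then show "emeasure m A = ennreal (1 - t) * emeasure m A + ennreal t * emeasure m A" by simp
qed (use assms in auto)

lemma continuous_on_eval: "continuous_on S (\<lambda>\<gamma> :: 'a::topological_space \<Rightarrow>\<^sub>C 'b::metric_space. \<gamma> t)"
  unfolding continuous_on_iff by (meson dist_bounded le_less_trans)

locale mean_field_game = lagrangian q \<Lambda> \<Omega> T C L
  for q :: "real^'d \<Rightarrow> 'p::polish_space" and \<Lambda> \<Omega> T C L +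
  fixes m0 :: "'p measure"
  assumes m0: "m0 \<in> prob_measures2 \<Omega>"
begin

abbreviation "MG \<equiv> restrict_space borel \<Gamma>"
abbreviation "MO \<equiv> restrict_space borel \<Omega>"

lemma eval_measurable: "t \<in> {0..T} \<Longrightarrow> (\<lambda>\<gamma> :: real \<Rightarrow>\<^sub>C 'p. \<gamma> t) \<in> measurable MG MO"
  by (intro measurable_restrict_space2 measurable_restrict_space1 borel_measurable_continuous_onI continuous_on_eval)
    (auto simp: space_restrict_space curve_in)

lemma running_cost_measurable: "(\<lambda>\<gamma> :: real \<Rightarrow>\<^sub>C 'p. running_cost \<gamma>) \<in> borel_measurable MG"
  by (rule borel_measurable_lsc) (use running_cost_lsc in blast)

text \<open>The energy is the running cost for the Lagrangian \<open>\<bar>v\<bar>\<^sup>2\<close>, hence lower semicontinuous.\<close>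

lemma energy_measurable: "(\<lambda>\<gamma> :: real \<Rightarrow>\<^sub>C 'p. energy T \<gamma>) \<in> borel_measurable MG"
proof -
  have "C1_lagrangian q \<Omega> (\<lambda>x v. (norm v)\<^sup>2)"
    unfolding C1_lagrangian_def
  proof (intro exI conjI ballI)
    let ?DL = "\<lambda>z :: (real^'d) \<times> (real^'d). 2 *\<^sub>R (blinfun_inner_right (snd z) o\<^sub>L snd_blinfun)"
    show "continuous_on (Dom \<times> UNIV) ?DL"
      by (intro continuous_intros bounded_linear.continuous_on[OF bounded_linear_blinfun_inner_right])
    show "((\<lambda>(y, v). (norm v)\<^sup>2) has_derivative blinfun_apply (?DL z)) (at z within Dom \<times> UNIV)" for z
      unfolding power2_norm_eq_inner case_prod_beta
      by (auto intro!: derivative_eq_intros simp: scaleR_blinfun.rep_eq blinfun_compose.rep_eq snd_blinfun.rep_eq inner_commute)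
  qed
  moreover have "convex_on UNIV (\<lambda>v :: real^'d. (norm v)\<^sup>2)"
  proof (rule convex_onI)
    fix u :: real and x y :: "real^'d" assume u: "0 < u" "u < 1"
    have "(1 - u) * (norm x)\<^sup>2 + u * (norm y)\<^sup>2 - (norm ((1 - u) *\<^sub>R x + u *\<^sub>R y))\<^sup>2 = u * (1 - u) * (norm (x - y))\<^sup>2"
      unfolding power2_norm_eq_inner
      by (simp add: inner_add_left inner_add_right inner_diff_left inner_diff_right inner_commute algebra_simps)
    moreover have "0 \<le> u * (1 - u) * (norm (x - y))\<^sup>2" using u by simp
    ultimately show "(norm ((1 - u) *\<^sub>R x + u *\<^sub>R y))\<^sup>2 \<le> (1 - u) * (norm x)\<^sup>2 + u * (norm y)\<^sup>2" by linarith
  qed simp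
  ultimately interpret E: lagrangian q \<Lambda> \<Omega> T 1 "\<lambda>x v. (norm v)\<^sup>2"
    using T closed_dom by unfold_locales auto
  have "E.running_cost = energy T" by (simp add: fun_eq_iff E.running_cost_def energy_def)
  then show ?thesis using borel_measurable_lsc[of \<Gamma> "\<lambda>\<gamma>. energy T \<gamma>"] E.running_cost_lsc by auto
qed

lemma kinetic_nn: "\<gamma> \<in> \<Gamma> \<Longrightarrow> kinetic_energy q T \<gamma> = ennreal (energy T \<gamma>)"
  by (rule curve_energy(2)[OF T])

lemma kinetic_measurable: "(\<lambda>\<gamma> :: real \<Rightarrow>\<^sub>C 'p. kinetic_energy q T \<gamma>) \<in> borel_measurable MG"
proof -
  have "(\<lambda>\<gamma> :: real \<Rightarrow>\<^sub>C 'p. ennreal (energy T \<gamma>)) \<in> borel_measurable MG" using energy_measurable by measurable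
  then show ?thesis
    by (rule measurable_cong[THEN iffD1, rotated]) (simp add: space_restrict_space kinetic_nn)
qed

definition finite_energy :: "(real \<Rightarrow>\<^sub>C 'p) measure \<Rightarrow> bool" where
  "finite_energy \<eta> \<longleftrightarrow> \<eta> \<in> prob_measures_from q \<Omega> T m0 \<and> (\<integral>\<^sup>+\<gamma>. kinetic_energy q T \<gamma> \<partial>\<eta>) < \<infinity>"

lemma prob_fromD:
  assumes "\<eta> \<in> prob_measures_from q \<Omega> T m0"
  shows "prob_space \<eta>" "sets \<eta> = sets MG" "space \<eta> = \<Gamma>" "marginal \<Omega> \<eta> 0 = m0" "\<eta> \<in> prob_measures \<Gamma>"
proof -
  show "prob_space \<eta>" and s: "sets \<eta> = sets MG" and "marginal \<Omega> \<eta> 0 = m0" "\<eta> \<in> prob_measures \<Gamma>"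
    using assms by (auto simp: prob_measures_from_def prob_measures_def)
  show "space \<eta> = \<Gamma>" using sets_eq_imp_space_eq[OF s] by (simp add: space_restrict_space)
qed

lemma measurable_sets_MG: "sets \<eta> = sets MG \<Longrightarrow> h \<in> measurable MG N \<Longrightarrow> h \<in> measurable \<eta> N"
  using measurable_cong_sets[of \<eta> MG N N] by blast

lemma eval_measurable':
  assumes "\<eta> \<in> prob_measures_from q \<Omega> T m0" "t \<in> {0..T}"
  shows "(\<lambda>\<gamma>. apply_bcontfun \<gamma> t) \<in> measurable \<eta> MO"
  by (rule measurable_sets_MG[OF prob_fromD(2)[OF assms(1)] eval_measurable[OF assms(2)]])

lemma marginal_prob:
  assumes "\<eta> \<in> prob_measures_from q \<Omega> T m0" "t \<in> {0..T}"
  shows "marginal \<Omega> \<eta> t \<in> prob_measures \<Omega>"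
proof -
  interpret prob_space \<eta> by (rule prob_fromD(1)[OF assms(1)])
  have "(\<lambda>\<gamma>. apply_bcontfun \<gamma> t) \<in> measurable \<eta> MO"
    by (rule eval_measurable'[OF assms])
  then show ?thesis by (auto simp: marginal_def prob_measures_def intro: prob_space_distr)
qed

lemma finite_energy_integrable:
  assumes "finite_energy \<eta>"
  shows "integrable \<eta> (\<lambda>\<gamma>. energy T \<gamma>)" "integrable \<eta> (\<lambda>\<gamma>. running_cost \<gamma>)"
    "(\<integral>\<^sup>+\<gamma>. ennreal (energy T \<gamma>) \<partial>\<eta>) = ennreal (\<integral>\<gamma>. energy T \<gamma> \<partial>\<eta>)"
proof -
  have \<eta>: "\<eta> \<in> prob_measures_from q \<Omega> T m0" using assms by (simp add: finite_energy_def)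
  interpret prob_space \<eta> by (rule prob_fromD(1)[OF \<eta>])
  note sp = prob_fromD(2,3)[OF \<eta>]
  have [measurable]: "(\<lambda>\<gamma>. energy T (apply_bcontfun \<gamma>)) \<in> borel_measurable \<eta>" "(\<lambda>\<gamma>. running_cost (apply_bcontfun \<gamma>)) \<in> borel_measurable \<eta>"
    by (rule measurable_sets_MG[OF sp(1) energy_measurable]) (rule measurable_sets_MG[OF sp(1) running_cost_measurable])
  have "(\<integral>\<^sup>+\<gamma>. ennreal (energy T \<gamma>) \<partial>\<eta>) = (\<integral>\<^sup>+\<gamma>. kinetic_energy q T \<gamma> \<partial>\<eta>)"
    by (intro nn_integral_cong) (simp add: sp kinetic_nn)
  then have fin: "(\<integral>\<^sup>+\<gamma>. ennreal (energy T \<gamma>) \<partial>\<eta>) < \<infinity>" using assms by (simp add: finite_energy_def)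
  show i: "integrable \<eta> (\<lambda>\<gamma>. energy T \<gamma>)"
    using fin by (intro integrableI_nonneg) (auto intro!: AE_I2 simp: sp curve_energy(3)[OF T])
  show "(\<integral>\<^sup>+\<gamma>. ennreal (energy T \<gamma>) \<partial>\<eta>) = ennreal (\<integral>\<gamma>. energy T \<gamma> \<partial>\<eta>)"
    using i by (intro nn_integral_eq_integral) (auto intro!: AE_I2 simp: sp curve_energy(3)[OF T])
  have i': "integrable \<eta> (\<lambda>\<gamma>. C * energy T \<gamma> + C * T)" using i by simp
  show "integrable \<eta> (\<lambda>\<gamma>. running_cost \<gamma>)"
  proof (rule Bochner_Integration.integrable_bound[OF i'])
    show "AE \<gamma> in \<eta>. norm (running_cost \<gamma>) \<le> norm (C * energy T \<gamma> + C * T)"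
    proof (rule AE_I2)
      fix \<gamma> assume "\<gamma> \<in> space \<eta>"
      then have \<gamma>: "\<gamma> \<in> \<Gamma>" using sp by simp
      have "0 \<le> C * (running_cost \<gamma> + C * T)" using running_cost_bounds(1)[OF \<gamma>] curve_energy(3)[OF T \<gamma>] by linarith
      then have "0 \<le> running_cost \<gamma> + C * T" using C by (simp add: zero_le_mult_iff)
      moreover have "0 \<le> C * energy T \<gamma>" using C curve_energy(3)[OF T \<gamma>] by simp
      ultimately show "norm (running_cost \<gamma>) \<le> norm (C * energy T \<gamma> + C * T)"
        using running_cost_bounds(2)[OF \<gamma>] by simp
    qed
  qed measurable
qed

text \<open>A curve of energy \<open>e\<close> stays within \<open>sqrt (T * e)\<close> of its starting point, whose distribution \<open>m0\<close>
  has a second moment.\<close>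

lemma marginal_prob2:
  assumes "finite_energy \<eta>" "t \<in> {0..T}"
  shows "marginal \<Omega> \<eta> t \<in> prob_measures2 \<Omega>"
proof -
  have \<eta>: "\<eta> \<in> prob_measures_from q \<Omega> T m0" using assms by (simp add: finite_energy_def)
  interpret prob_space \<eta> by (rule prob_fromD(1)[OF \<eta>])
  note sp = prob_fromD(2,3)[OF \<eta>]
  obtain x0 where x0: "x0 \<in> \<Omega>" "(\<integral>\<^sup>+x. ennreal ((dist x x0)\<^sup>2) \<partial>m0) < \<infinity>"
    using m0 by (auto simp: prob_measures2_def)
  have 0: "0 \<in> {0..T}" using T by simp
  have dm: "(\<lambda>x. ennreal ((dist x x0)\<^sup>2)) \<in> borel_measurable MO"
    by (intro measurable_compose[OF _ measurable_ennreal] measurable_restrict_space1 borel_measurable_continuous_onI continuous_intros)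
  have nn: "(\<integral>\<^sup>+x. ennreal ((dist x x0)\<^sup>2) \<partial>marginal \<Omega> \<eta> s) = (\<integral>\<^sup>+\<gamma>. ennreal ((dist (\<gamma> s) x0)\<^sup>2) \<partial>\<eta>)" if "s \<in> {0..T}" for s
    unfolding marginal_def by (rule nn_integral_distr[OF eval_measurable'[OF \<eta> that]]) (simp add: dm)
  have [measurable]: "(\<lambda>\<gamma>. energy T (apply_bcontfun \<gamma>)) \<in> borel_measurable \<eta>"
    using finite_energy_integrable(1)[OF assms(1)] by auto
  have [measurable]: "(\<lambda>\<gamma>. ennreal ((dist (apply_bcontfun \<gamma> 0) x0)\<^sup>2)) \<in> borel_measurable \<eta>"
    by (rule measurable_compose[OF eval_measurable'[OF \<eta> 0] dm])
  have "(\<integral>\<^sup>+\<gamma>. ennreal ((dist (\<gamma> t) x0)\<^sup>2) \<partial>\<eta>) \<le>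
    (\<integral>\<^sup>+\<gamma>. ennreal 2 * ennreal ((dist (\<gamma> 0) x0)\<^sup>2) + ennreal (2 * T) * ennreal (energy T \<gamma>) \<partial>\<eta>)"
  proof (rule nn_integral_mono)
    fix \<gamma> assume "\<gamma> \<in> space \<eta>"
    then have \<gamma>: "\<gamma> \<in> \<Gamma>" using sp by simp
    note e0 = curve_energy(3)[OF T \<gamma>]
    have "(dist (\<gamma> t) x0)\<^sup>2 \<le> (dist (\<gamma> 0) (\<gamma> t) + dist (\<gamma> 0) x0)\<^sup>2"
      by (intro power_mono dist_triangle3) auto
    also have "\<dots> \<le> 2 * (dist (\<gamma> 0) (\<gamma> t))\<^sup>2 + 2 * (dist (\<gamma> 0) x0)\<^sup>2"
      using sum_squares_bound[of "dist (\<gamma> 0) (\<gamma> t)" "dist (\<gamma> 0) x0"] by (simp add: power2_sum)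
    also have "(dist (\<gamma> 0) (\<gamma> t))\<^sup>2 \<le> \<bar>t - 0\<bar> * energy T \<gamma>" by (rule dist_curve_energy[OF T \<gamma> 0 assms(2)])
    also have "\<bar>t - 0\<bar> * energy T \<gamma> \<le> T * energy T \<gamma>" using assms(2) e0 by (intro mult_right_mono) auto
    finally have "(dist (\<gamma> t) x0)\<^sup>2 \<le> 2 * (dist (\<gamma> 0) x0)\<^sup>2 + 2 * T * energy T \<gamma>" by simp
    then have "ennreal ((dist (\<gamma> t) x0)\<^sup>2) \<le> ennreal (2 * (dist (\<gamma> 0) x0)\<^sup>2 + 2 * T * energy T \<gamma>)" by (rule ennreal_leI)
    also have "\<dots> = ennreal 2 * ennreal ((dist (\<gamma> 0) x0)\<^sup>2) + ennreal (2 * T) * ennreal (energy T \<gamma>)"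
      using e0 T by (simp add: ennreal_plus ennreal_mult)
    finally show "ennreal ((dist (\<gamma> t) x0)\<^sup>2) \<le> ennreal 2 * ennreal ((dist (\<gamma> 0) x0)\<^sup>2) + ennreal (2 * T) * ennreal (energy T \<gamma>)" .
  qed
  also have "\<dots> = ennreal 2 * (\<integral>\<^sup>+\<gamma>. ennreal ((dist (\<gamma> 0) x0)\<^sup>2) \<partial>\<eta>) + ennreal (2 * T) * (\<integral>\<^sup>+\<gamma>. ennreal (energy T \<gamma>) \<partial>\<eta>)"
  proof -
    have 1: "(\<lambda>\<gamma>. ennreal 2 * ennreal ((dist (apply_bcontfun \<gamma> 0) x0)\<^sup>2)) \<in> borel_measurable \<eta>"
      "(\<lambda>\<gamma>. ennreal (2 * T) * ennreal (energy T (apply_bcontfun \<gamma>))) \<in> borel_measurable \<eta>"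
      by measurable
    have 2: "(\<lambda>\<gamma>. ennreal (energy T (apply_bcontfun \<gamma>))) \<in> borel_measurable \<eta>" by measurable
    have 3: "(\<lambda>\<gamma>. ennreal ((dist (apply_bcontfun \<gamma> 0) x0)\<^sup>2)) \<in> borel_measurable \<eta>" by measurable
    show ?thesis unfolding nn_integral_add[OF 1] nn_integral_cmult[OF 2] nn_integral_cmult[OF 3] ..
  qed
  also have "\<dots> < \<infinity>"
    using x0(2) nn[OF 0] prob_fromD(4)[OF \<eta>] finite_energy_integrable(3)[OF assms(1)]
    by (simp add: ennreal_mult_less_top)
  finally have "(\<integral>\<^sup>+x. ennreal ((dist x x0)\<^sup>2) \<partial>marginal \<Omega> \<eta> t) < \<infinity>" unfolding nn[OF assms(2)] .
  then show ?thesis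
    using marginal_prob[OF \<eta> assms(2)] x0(1) unfolding prob_measures2_def by blast
qed

text \<open>Push-forward under an admissible modification preserves the initial distribution and finite
  energy, and the marginals move by a bounded Wasserstein distance.\<close>

definition admissible :: "((real \<Rightarrow>\<^sub>C 'p) \<Rightarrow> (real \<Rightarrow>\<^sub>C 'p)) \<Rightarrow> real \<Rightarrow> real \<Rightarrow> bool" where
  "admissible \<Phi> B E \<longleftrightarrow> \<Phi> \<in> measurable MG MG \<and>
    (\<forall>\<gamma>\<in>\<Gamma>. apply_bcontfun (\<Phi> \<gamma>) 0 = apply_bcontfun \<gamma> 0) \<and>
    (\<forall>\<gamma>\<in>\<Gamma>. \<forall>t\<in>{0..T}. dist (apply_bcontfun \<gamma> t) (apply_bcontfun (\<Phi> \<gamma>) t) \<le> B) \<and>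
    (\<forall>\<gamma>\<in>\<Gamma>. energy T (apply_bcontfun (\<Phi> \<gamma>)) \<le> energy T (apply_bcontfun \<gamma>) + E) \<and> 0 \<le> B \<and> 0 \<le> E"

lemma admissible_id: "admissible id 0 0"
  unfolding admissible_def by (auto simp: id_def)

lemma admissible_in:
  assumes "admissible \<Phi> B E" "\<gamma> \<in> \<Gamma>"
  shows "\<Phi> \<gamma> \<in> \<Gamma>"
  using assms measurable_space[of \<Phi> MG MG \<gamma>] by (auto simp: admissible_def space_restrict_space)

context
  fixes \<eta> \<Phi> B E
  assumes fe: "finite_energy \<eta>" and adm: "admissible \<Phi> B E"
begin

definition modified :: "(real \<Rightarrow>\<^sub>C 'p) measure" where
  "modified = distr \<eta> MG \<Phi>"

definition mixture :: "real \<Rightarrow> (real \<Rightarrow>\<^sub>C 'p) measure" where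
  "mixture \<sigma> = interpolate \<sigma> \<eta> modified"

lemma \<eta>_from: "\<eta> \<in> prob_measures_from q \<Omega> T m0" using fe by (simp add: finite_energy_def)

lemma \<Phi>_measurable: "\<Phi> \<in> measurable \<eta> MG"
  by (rule measurable_sets_MG[OF prob_fromD(2)[OF \<eta>_from]]) (use adm in \<open>simp add: admissible_def\<close>)

lemma sets_modified: "sets modified = sets \<eta>"
  using prob_fromD(2)[OF \<eta>_from] by (simp add: modified_def)

lemma marginal_modified: "t \<in> {0..T} \<Longrightarrow> marginal \<Omega> modified t = distr \<eta> MO (\<lambda>\<gamma>. \<Phi> \<gamma> t)"
  unfolding marginal_def modified_def
  by (subst distr_distr[OF eval_measurable \<Phi>_measurable]) (auto simp: o_def)

lemma modified_from: "modified \<in> prob_measures_from q \<Omega> T m0"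
proof -
  interpret prob_space \<eta> by (rule prob_fromD(1)[OF \<eta>_from])
  have "prob_space modified" unfolding modified_def by (rule prob_space_distr[OF \<Phi>_measurable])
  moreover have "marginal \<Omega> modified 0 = m0"
  proof -
    have "distr \<eta> MO (\<lambda>\<gamma>. \<Phi> \<gamma> 0) = distr \<eta> MO (\<lambda>\<gamma>. \<gamma> 0)"
      using adm prob_fromD(3)[OF \<eta>_from] by (intro distr_cong) (auto simp: admissible_def)
    then show ?thesis using marginal_modified[of 0] T prob_fromD(4)[OF \<eta>_from] by (simp add: marginal_def)
  qed
  ultimately show ?thesis by (simp add: prob_measures_from_def prob_measures_def modified_def)
qed

lemma modified_finite_energy: "finite_energy modified"
proof -
  interpret prob_space \<eta> by (rule prob_fromD(1)[OF \<eta>_from])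
  note sp = prob_fromD(2,3)[OF \<eta>_from]
  have [measurable]: "(\<lambda>\<gamma>. energy T (apply_bcontfun \<gamma>)) \<in> borel_measurable \<eta>"
    using finite_energy_integrable(1)[OF fe] by auto
  have "(\<integral>\<^sup>+\<gamma>. kinetic_energy q T \<gamma> \<partial>modified) = (\<integral>\<^sup>+\<gamma>. kinetic_energy q T (\<Phi> \<gamma>) \<partial>\<eta>)"
    unfolding modified_def by (rule nn_integral_distr[OF \<Phi>_measurable]) (simp add: kinetic_measurable)
  also have "\<dots> \<le> (\<integral>\<^sup>+\<gamma>. ennreal (energy T \<gamma>) + ennreal E \<partial>\<eta>)"
  proof (rule nn_integral_mono)
    fix \<gamma> assume "\<gamma> \<in> space \<eta>"
    then have \<gamma>: "\<gamma> \<in> \<Gamma>" using sp by simp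
    have "energy T (\<Phi> \<gamma>) \<le> energy T \<gamma> + E" "0 \<le> E" using adm \<gamma> by (auto simp: admissible_def)
    then show "kinetic_energy q T (\<Phi> \<gamma>) \<le> ennreal (energy T \<gamma>) + ennreal E"
      using kinetic_nn[OF admissible_in[OF adm \<gamma>]] curve_energy(3)[OF T \<gamma>]
      by (simp add: ennreal_plus[symmetric] ennreal_leI del: ennreal_plus)
  qed
  also have "\<dots> = (\<integral>\<^sup>+\<gamma>. ennreal (energy T \<gamma>) \<partial>\<eta>) + ennreal E"
    by (simp add: nn_integral_add emeasure_space_1)
  also have "\<dots> < \<infinity>" using finite_energy_integrable(3)[OF fe] by simp
  finally show ?thesis using modified_from by (simp add: finite_energy_def)
qed

lemma mixture_marginal:
  assumes "0 \<le> \<sigma>" "\<sigma> \<le> 1" "t \<in> {0..T}"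
  shows "marginal \<Omega> (mixture \<sigma>) t = interpolate \<sigma> (marginal \<Omega> \<eta> t) (marginal \<Omega> modified t)"
  unfolding marginal_def mixture_def
  by (rule distr_interpolate[OF sets_modified assms(1,2) eval_measurable'[OF \<eta>_from assms(3)]])

lemma mixture_from:
  assumes "0 \<le> \<sigma>" "\<sigma> \<le> 1"
  shows "mixture \<sigma> \<in> prob_measures_from q \<Omega> T m0"
proof -
  have "mixture \<sigma> \<in> prob_measures \<Gamma>"
    unfolding mixture_def
    using prob_fromD(5)[OF \<eta>_from] prob_fromD(5)[OF modified_from] assms by (intro interpolate_prob_measures)
  moreover have "marginal \<Omega> (mixture \<sigma>) 0 = m0"
    using mixture_marginal[OF assms, of 0] T prob_fromD(4)[OF \<eta>_from] prob_fromD(4)[OF modified_from] assms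
    by (simp add: interpolate_same)
  ultimately show ?thesis by (simp add: prob_measures_from_def)
qed

lemma mixture_finite_energy:
  assumes "0 \<le> \<sigma>" "\<sigma> \<le> 1"
  shows "finite_energy (mixture \<sigma>)"
proof -
  have "(\<lambda>\<gamma>. kinetic_energy q T (apply_bcontfun \<gamma>)) \<in> borel_measurable \<eta>"
    by (rule measurable_sets_MG[OF prob_fromD(2)[OF \<eta>_from] kinetic_measurable])
  from nn_integral_interpolate[OF sets_modified assms this]
  have "(\<integral>\<^sup>+\<gamma>. kinetic_energy q T \<gamma> \<partial>mixture \<sigma>) < \<infinity>"
    using fe modified_finite_energy by (simp add: mixture_def finite_energy_def ennreal_mult_less_top)
  then show ?thesis using mixture_from[OF assms] by (simp add: finite_energy_def)
qed

text \<open>An explicit coupling: the positions of one and the same curve at the two times, the second one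
  after the modification for a fraction \<open>\<sigma>\<close> of the mass. Between the two times the curve travels at most
  the square root of elapsed time times energy, and the modification moves it by at most \<open>B\<close>.\<close>

lemma W2_mixture:
  assumes \<sigma>: "0 \<le> \<sigma>" "\<sigma> \<le> 1" and t: "t0 \<in> {0..T}" "t \<in> {0..T}"
  shows "W2 \<Omega> (marginal \<Omega> \<eta> t0) (marginal \<Omega> (mixture \<sigma>) t) \<le>
    sqrt (2 * \<bar>t - t0\<bar> * (\<integral>\<gamma>. energy T \<gamma> \<partial>\<eta>) + 2 * \<sigma> * B\<^sup>2)"
proof -
  interpret prob_space \<eta> by (rule prob_fromD(1)[OF \<eta>_from])
  note sp = prob_fromD(2,3)[OF \<eta>_from]
  define E0 where "E0 = (\<integral>\<gamma>. energy T \<gamma> \<partial>\<eta>)"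
  have [measurable]: "(\<lambda>\<gamma>. energy T (apply_bcontfun \<gamma>)) \<in> borel_measurable \<eta>"
    using finite_energy_integrable(1)[OF fe] by auto
  have E0: "0 \<le> E0" unfolding E0_def
    by (intro Bochner_Integration.integral_nonneg) (simp add: sp curve_energy(3)[OF T])
  note ev = eval_measurable'[OF \<eta>_from]
  have ev\<Phi>: "(\<lambda>\<gamma>. \<Phi> \<gamma> t) \<in> measurable \<eta> MO"
    by (rule measurable_compose[OF \<Phi>_measurable eval_measurable[OF t(2)]])
  define p1 where "p1 = distr \<eta> (MO \<Otimes>\<^sub>M MO) (\<lambda>\<gamma>. (apply_bcontfun \<gamma> t0, apply_bcontfun \<gamma> t))"
  define p2 where "p2 = distr \<eta> (MO \<Otimes>\<^sub>M MO) (\<lambda>\<gamma>. (apply_bcontfun \<gamma> t0, apply_bcontfun (\<Phi> \<gamma>) t))"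
  define p where "p = interpolate \<sigma> p1 p2"
  have m1: "(\<lambda>\<gamma>. (apply_bcontfun \<gamma> t0, apply_bcontfun \<gamma> t)) \<in> measurable \<eta> (MO \<Otimes>\<^sub>M MO)" using ev t by (intro measurable_Pair) auto
  have m2: "(\<lambda>\<gamma>. (apply_bcontfun \<gamma> t0, apply_bcontfun (\<Phi> \<gamma>) t)) \<in> measurable \<eta> (MO \<Otimes>\<^sub>M MO)" using ev t ev\<Phi> by (intro measurable_Pair) auto
  have s12: "sets p2 = sets p1" by (simp add: p1_def p2_def)
  have "distr p MO fst = interpolate \<sigma> (distr p1 MO fst) (distr p2 MO fst)"
    unfolding p_def by (rule distr_interpolate[OF s12 \<sigma>]) (simp add: p1_def)
  also have "distr p1 MO fst = marginal \<Omega> \<eta> t0"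
    unfolding p1_def marginal_def by (subst distr_distr[OF _ m1]) (auto simp: o_def)
  also have "distr p2 MO fst = marginal \<Omega> \<eta> t0"
    unfolding p2_def marginal_def by (subst distr_distr[OF _ m2]) (auto simp: o_def)
  finally have fst: "distr p MO fst = marginal \<Omega> \<eta> t0" using \<sigma> by (simp add: interpolate_same)
  have "distr p MO snd = interpolate \<sigma> (distr p1 MO snd) (distr p2 MO snd)"
    unfolding p_def by (rule distr_interpolate[OF s12 \<sigma>]) (simp add: p1_def)
  also have "distr p1 MO snd = marginal \<Omega> \<eta> t"
    unfolding p1_def marginal_def by (subst distr_distr[OF _ m1]) (auto simp: o_def)
  also have "distr p2 MO snd = marginal \<Omega> modified t"
    unfolding p2_def marginal_modified[OF t(2)] by (subst distr_distr[OF _ m2]) (auto simp: o_def)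
  finally have snd: "distr p MO snd = marginal \<Omega> (mixture \<sigma>) t" using mixture_marginal[OF \<sigma> t(2)] by simp
  have coup: "p \<in> couplings \<Omega> (marginal \<Omega> \<eta> t0) (marginal \<Omega> (mixture \<sigma>) t)"
    using fst snd sets_interpolate[OF s12 \<sigma>] by (simp add: couplings_def p_def) (simp add: p1_def)
  have dm: "(\<lambda>z. ennreal ((dist (fst z) (snd z))\<^sup>2)) \<in> borel_measurable (MO \<Otimes>\<^sub>M MO)"
  proof -
    have id: "(\<lambda>x. x) \<in> measurable MO borel" by (rule measurable_restrict_space1) simp
    have [measurable]: "(\<lambda>z. fst z) \<in> borel_measurable (MO \<Otimes>\<^sub>M MO)" "(\<lambda>z. snd z) \<in> borel_measurable (MO \<Otimes>\<^sub>M MO)"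
      by (rule measurable_compose[OF measurable_fst id]) (rule measurable_compose[OF measurable_snd id])
    show ?thesis by measurable
  qed
  have "(\<integral>\<^sup>+z. ennreal ((dist (fst z) (snd z))\<^sup>2) \<partial>p) =
    ennreal (1 - \<sigma>) * (\<integral>\<^sup>+z. ennreal ((dist (fst z) (snd z))\<^sup>2) \<partial>p1) + ennreal \<sigma> * (\<integral>\<^sup>+z. ennreal ((dist (fst z) (snd z))\<^sup>2) \<partial>p2)"
    unfolding p_def by (rule nn_integral_interpolate[OF s12 \<sigma>]) (use dm in \<open>simp add: p1_def\<close>)
  also have "\<dots> \<le> ennreal (1 - \<sigma>) * ennreal (2 * \<bar>t - t0\<bar> * E0) + ennreal \<sigma> * ennreal (2 * \<bar>t - t0\<bar> * E0 + 2 * B\<^sup>2)"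
  proof (intro add_mono mult_left_mono)
    have d1: "(dist (apply_bcontfun \<gamma> t0) (apply_bcontfun \<gamma> t))\<^sup>2 \<le> \<bar>t - t0\<bar> * energy T \<gamma>" if "\<gamma> \<in> \<Gamma>" for \<gamma>
      by (rule dist_curve_energy[OF T that t])
    have i: "(\<integral>\<^sup>+\<gamma>. ennreal (2 * \<bar>t - t0\<bar> * energy T \<gamma> + b) \<partial>\<eta>) = ennreal (2 * \<bar>t - t0\<bar> * E0 + b)" if "0 \<le> b" for b
      using finite_energy_integrable(1)[OF fe] that
      by (subst nn_integral_eq_integral) (auto intro!: AE_I2 simp: sp curve_energy(3)[OF T] E0_def prob_space[unfolded sp(2)])
    have "(\<integral>\<^sup>+z. ennreal ((dist (fst z) (snd z))\<^sup>2) \<partial>p1) = (\<integral>\<^sup>+\<gamma>. ennreal ((dist (apply_bcontfun \<gamma> t0) (apply_bcontfun \<gamma> t))\<^sup>2) \<partial>\<eta>)"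
      unfolding p1_def by (subst nn_integral_distr[OF m1]) (simp_all add: dm)
    also have "\<dots> \<le> (\<integral>\<^sup>+\<gamma>. ennreal (2 * \<bar>t - t0\<bar> * energy T \<gamma> + 0) \<partial>\<eta>)"
    proof (intro nn_integral_mono ennreal_leI)
      fix \<gamma> assume "\<gamma> \<in> space \<eta>"
      then have \<gamma>: "\<gamma> \<in> \<Gamma>" using sp by simp
      have "0 \<le> \<bar>t - t0\<bar> * energy T \<gamma>" using curve_energy(3)[OF T \<gamma>] by simp
      then show "(dist (apply_bcontfun \<gamma> t0) (apply_bcontfun \<gamma> t))\<^sup>2 \<le> 2 * \<bar>t - t0\<bar> * energy T \<gamma> + 0" using d1[OF \<gamma>] by linarith
    qed
    finally show "(\<integral>\<^sup>+z. ennreal ((dist (fst z) (snd z))\<^sup>2) \<partial>p1) \<le> ennreal (2 * \<bar>t - t0\<bar> * E0)" using i[of 0] by simp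
    have "(\<integral>\<^sup>+z. ennreal ((dist (fst z) (snd z))\<^sup>2) \<partial>p2) = (\<integral>\<^sup>+\<gamma>. ennreal ((dist (apply_bcontfun \<gamma> t0) (apply_bcontfun (\<Phi> \<gamma>) t))\<^sup>2) \<partial>\<eta>)"
      unfolding p2_def by (subst nn_integral_distr[OF m2]) (simp_all add: dm)
    also have "\<dots> \<le> (\<integral>\<^sup>+\<gamma>. ennreal (2 * \<bar>t - t0\<bar> * energy T \<gamma> + 2 * B\<^sup>2) \<partial>\<eta>)"
    proof (intro nn_integral_mono ennreal_leI)
      fix \<gamma> assume "\<gamma> \<in> space \<eta>"
      then have \<gamma>: "\<gamma> \<in> \<Gamma>" using sp by simp
      have "dist (apply_bcontfun \<gamma> t) (apply_bcontfun (\<Phi> \<gamma>) t) \<le> B" using adm \<gamma> t by (simp add: admissible_def)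
      then have b: "(dist (apply_bcontfun \<gamma> t) (apply_bcontfun (\<Phi> \<gamma>) t))\<^sup>2 \<le> B\<^sup>2" by (intro power_mono) auto
      have "(dist (apply_bcontfun \<gamma> t0) (apply_bcontfun (\<Phi> \<gamma>) t))\<^sup>2 \<le> (dist (apply_bcontfun \<gamma> t0) (apply_bcontfun \<gamma> t) + dist (apply_bcontfun \<gamma> t) (apply_bcontfun (\<Phi> \<gamma>) t))\<^sup>2"
        by (intro power_mono dist_triangle) auto
      also have "\<dots> \<le> 2 * (dist (apply_bcontfun \<gamma> t0) (apply_bcontfun \<gamma> t))\<^sup>2 + 2 * (dist (apply_bcontfun \<gamma> t) (apply_bcontfun (\<Phi> \<gamma>) t))\<^sup>2"
        using sum_squares_bound[of "dist (apply_bcontfun \<gamma> t0) (apply_bcontfun \<gamma> t)" "dist (apply_bcontfun \<gamma> t) (apply_bcontfun (\<Phi> \<gamma>) t)"] by (simp add: power2_sum)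
      also have "\<dots> \<le> 2 * (\<bar>t - t0\<bar> * energy T \<gamma>) + 2 * B\<^sup>2" using d1[OF \<gamma>] b by simp
      finally show "(dist (apply_bcontfun \<gamma> t0) (apply_bcontfun (\<Phi> \<gamma>) t))\<^sup>2 \<le> 2 * \<bar>t - t0\<bar> * energy T \<gamma> + 2 * B\<^sup>2" by simp
    qed
    finally show "(\<integral>\<^sup>+z. ennreal ((dist (fst z) (snd z))\<^sup>2) \<partial>p2) \<le> ennreal (2 * \<bar>t - t0\<bar> * E0 + 2 * B\<^sup>2)" using i[of "2 * B\<^sup>2"] by simp
  qed auto
  also have "\<dots> = ennreal (2 * \<bar>t - t0\<bar> * E0 + 2 * \<sigma> * B\<^sup>2)"
  proof -
    have n: "0 \<le> 2 * \<bar>t - t0\<bar> * E0" using E0 by simp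
    then have n': "0 \<le> (1 - \<sigma>) * (2 * \<bar>t - t0\<bar> * E0)" "0 \<le> \<sigma> * (2 * \<bar>t - t0\<bar> * E0 + 2 * B\<^sup>2)" using \<sigma> by simp_all
    have eq: "(1 - \<sigma>) * (2 * \<bar>t - t0\<bar> * E0) + \<sigma> * (2 * \<bar>t - t0\<bar> * E0 + 2 * B\<^sup>2) = 2 * \<bar>t - t0\<bar> * E0 + 2 * \<sigma> * B\<^sup>2"
      by (simp add: algebra_simps)
    have "ennreal (1 - \<sigma>) * ennreal (2 * \<bar>t - t0\<bar> * E0) = ennreal ((1 - \<sigma>) * (2 * \<bar>t - t0\<bar> * E0))"
      "ennreal \<sigma> * ennreal (2 * \<bar>t - t0\<bar> * E0 + 2 * B\<^sup>2) = ennreal (\<sigma> * (2 * \<bar>t - t0\<bar> * E0 + 2 * B\<^sup>2))"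
      using \<sigma> n by (intro ennreal_mult[symmetric]; simp)+
    then show ?thesis using ennreal_plus[OF n'] by (simp only: eq)
  qed
  finally show ?thesis
    unfolding E0_def[symmetric] using \<sigma> E0 by (intro W2_le[OF coup]) auto
qed

text \<open>By the coupling bound, the marginals of the mixtures depend continuously, in \<open>W2\<close>, on time and on
  the mixture parameter near 0.\<close>

lemma f_mixture_continuous:
  assumes f: "continuous_on_P2 \<Omega> f" and x: "x \<in> \<Omega>" and t0: "t0 \<in> {0..T}" and \<epsilon>: "\<epsilon> > 0"
  shows "\<exists>\<delta>>0. \<forall>\<sigma> t x'. 0 \<le> \<sigma> \<and> \<sigma> \<le> 1 \<and> \<sigma> < \<delta> \<and> t \<in> {0..T} \<and> \<bar>t - t0\<bar> < \<delta> \<and> x' \<in> \<Omega> \<and> dist x x' < \<delta> \<longrightarrow>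
    \<bar>f (marginal \<Omega> (mixture \<sigma>) t) x' - f (marginal \<Omega> \<eta> t0) x\<bar> < \<epsilon>"
proof -
  define E0 where "E0 = (\<integral>\<gamma>. energy T \<gamma> \<partial>\<eta>)"
  have E0: "0 \<le> E0" unfolding E0_def
    by (intro Bochner_Integration.integral_nonneg) (simp add: prob_fromD(3)[OF \<eta>_from] curve_energy(3)[OF T])
  obtain d where d: "d > 0" "\<And>m' x'. m' \<in> prob_measures2 \<Omega> \<Longrightarrow> x' \<in> \<Omega> \<Longrightarrow> W2 \<Omega> (marginal \<Omega> \<eta> t0) m' < d \<Longrightarrow> dist x x' < d \<Longrightarrow>
    \<bar>f m' x' - f (marginal \<Omega> \<eta> t0) x\<bar> < \<epsilon>"
    using f marginal_prob2[OF fe t0] x \<epsilon> unfolding continuous_on_P2_def by meson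
  define \<delta> where "\<delta> = min d (d\<^sup>2 / (2 * E0 + 2 * B\<^sup>2 + 1))"
  have pos: "2 * E0 + 2 * B\<^sup>2 + 1 > 0" using E0 by (simp add: add_nonneg_pos)
  have \<delta>: "\<delta> > 0" using d(1) pos by (simp add: \<delta>_def)
  have "\<bar>f (marginal \<Omega> (mixture \<sigma>) t) x' - f (marginal \<Omega> \<eta> t0) x\<bar> < \<epsilon>"
    if h: "0 \<le> \<sigma>" "\<sigma> \<le> 1" "\<sigma> < \<delta>" "t \<in> {0..T}" "\<bar>t - t0\<bar> < \<delta>" "x' \<in> \<Omega>" "dist x x' < \<delta>" for \<sigma> t x'
  proof (rule d(2))
    show "marginal \<Omega> (mixture \<sigma>) t \<in> prob_measures2 \<Omega>"
      by (intro marginal_prob2 mixture_finite_energy h)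
    have "W2 \<Omega> (marginal \<Omega> \<eta> t0) (marginal \<Omega> (mixture \<sigma>) t) \<le> sqrt (2 * \<bar>t - t0\<bar> * E0 + 2 * \<sigma> * B\<^sup>2)"
      using W2_mixture[OF h(1,2) t0 h(4)] by (simp add: E0_def)
    also have "\<dots> < sqrt (d\<^sup>2)"
    proof (rule real_sqrt_less_mono)
      have "2 * \<bar>t - t0\<bar> * E0 + 2 * \<sigma> * B\<^sup>2 \<le> 2 * \<delta> * E0 + 2 * \<delta> * B\<^sup>2"
        using h E0 by (intro add_mono mult_right_mono mult_left_mono) auto
      also have "\<dots> < \<delta> * (2 * E0 + 2 * B\<^sup>2 + 1)" using \<delta> by (simp add: algebra_simps)
      also have "\<dots> \<le> d\<^sup>2 / (2 * E0 + 2 * B\<^sup>2 + 1) * (2 * E0 + 2 * B\<^sup>2 + 1)"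
        using pos by (intro mult_right_mono) (auto simp: \<delta>_def)
      also have "\<dots> = d\<^sup>2" using pos by simp
      finally show "2 * \<bar>t - t0\<bar> * E0 + 2 * \<sigma> * B\<^sup>2 < d\<^sup>2" .
    qed
    finally show "W2 \<Omega> (marginal \<Omega> \<eta> t0) (marginal \<Omega> (mixture \<sigma>) t) < d" using d(1) by simp
  qed (use h in \<open>auto simp: \<delta>_def\<close>)
  then show ?thesis using \<delta> by blast
qed

text \<open>Compactness of \<open>{0..T} \<times> K\<close> turns the pointwise continuity into a uniform one.\<close>

lemma f_mixture_uniform:
  assumes f: "continuous_on_P2 \<Omega> f" and K: "compact K" "K \<subseteq> \<Omega>" and \<epsilon>: "\<epsilon> > 0"
  shows "\<exists>\<delta>>0. \<forall>\<sigma> t x. 0 \<le> \<sigma> \<and> \<sigma> \<le> 1 \<and> \<sigma> < \<delta> \<and> t \<in> {0..T} \<and> x \<in> K \<longrightarrow>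
    \<bar>f (marginal \<Omega> (mixture \<sigma>) t) x - f (marginal \<Omega> \<eta> t) x\<bar> < \<epsilon>"
proof (rule ccontr)
  assume neg: "\<not> ?thesis"
  define bad where "bad \<sigma> t x \<longleftrightarrow> 0 \<le> \<sigma> \<and> \<sigma> \<le> 1 \<and> t \<in> {0..T} \<and> x \<in> K \<and>
    \<not> \<bar>f (marginal \<Omega> (mixture \<sigma>) t) x - f (marginal \<Omega> \<eta> t) x\<bar> < \<epsilon>" for \<sigma> t x
  have "\<exists>\<sigma> t x. \<sigma> < \<delta> \<and> bad \<sigma> t x" if "\<delta> > 0" for \<delta> using neg that unfolding bad_def by meson
  then have "\<forall>n. \<exists>\<sigma> t x. \<sigma> < 1 / real (Suc n) \<and> bad \<sigma> t x" by simp
  then obtain \<sigma> t x where bad: "\<And>n. \<sigma> n < 1 / real (Suc n)" "\<And>n. bad (\<sigma> n) (t n) (x n)" by metis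
  have \<sigma>01: "0 \<le> \<sigma> n" "\<sigma> n \<le> 1" and mem: "t n \<in> {0..T}" "x n \<in> K"
    and ge: "\<not> \<bar>f (marginal \<Omega> (mixture (\<sigma> n)) (t n)) (x n) - f (marginal \<Omega> \<eta> (t n)) (x n)\<bar> < \<epsilon>" for n
    using bad(2)[of n] unfolding bad_def by auto
  have cpt: "compact ({0..T} \<times> K)" using K by (intro compact_Times) auto
  have tK: "(t n, x n) \<in> {0..T} \<times> K" for n using mem by simp
  obtain y r where y: "y \<in> {0..T} \<times> K" "strict_mono r" "((\<lambda>n. (t n, x n)) \<circ> r) \<longlonglongrightarrow> y"
    using cpt[unfolded compact_def, rule_format, of "\<lambda>n. (t n, x n)", OF tK] by (elim bexE exE conjE)
  obtain t0 x0 where y0: "y = (t0, x0)" by force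
  have tx: "t0 \<in> {0..T}" "x0 \<in> \<Omega>" using y(1) K y0 by auto
  obtain \<delta> where \<delta>: "\<delta> > 0" "\<And>\<sigma> t x'. 0 \<le> \<sigma> \<Longrightarrow> \<sigma> \<le> 1 \<Longrightarrow> \<sigma> < \<delta> \<Longrightarrow> t \<in> {0..T} \<Longrightarrow> \<bar>t - t0\<bar> < \<delta> \<Longrightarrow> x' \<in> \<Omega> \<Longrightarrow> dist x0 x' < \<delta> \<Longrightarrow>
    \<bar>f (marginal \<Omega> (mixture \<sigma>) t) x' - f (marginal \<Omega> \<eta> t0) x0\<bar> < \<epsilon> / 2"
    using f_mixture_continuous[OF f tx(2,1) half_gt_zero[OF \<epsilon>]] by blast
  have l1: "(\<lambda>n. t (r n)) \<longlonglongrightarrow> t0" "(\<lambda>n. x (r n)) \<longlonglongrightarrow> x0"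
    using tendsto_fst[OF y(3)] tendsto_snd[OF y(3)] by (auto simp: y0 o_def)
  obtain N where N: "1 / real (Suc N) < \<delta>" using nat_approx_posE[OF \<delta>(1)] by blast
  have "\<forall>\<^sub>F n in sequentially. dist (t (r n)) t0 < \<delta> \<and> dist (x (r n)) x0 < \<delta> \<and> n \<ge> N"
    using tendstoD[OF l1(1) \<delta>(1)] tendstoD[OF l1(2) \<delta>(1)] eventually_ge_at_top[of N] by eventually_elim auto
  then obtain n where n: "dist (t (r n)) t0 < \<delta>" "dist (x (r n)) x0 < \<delta>" "n \<ge> N"
    unfolding eventually_sequentially by auto
  have "n \<le> r n" using y(2) by (rule strict_mono_imp_increasing)
  then have "1 / real (Suc (r n)) \<le> 1 / real (Suc N)" using n(3) by (intro divide_left_mono) auto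
  then have s: "\<sigma> (r n) < \<delta>" using bad(1)[of "r n"] N by linarith
  have x: "x (r n) \<in> \<Omega>" using mem(2) K(2) by blast
  have "\<bar>f (marginal \<Omega> (mixture (\<sigma> (r n))) (t (r n))) (x (r n)) - f (marginal \<Omega> \<eta> t0) x0\<bar> < \<epsilon> / 2"
    using n s x mem(1)[of "r n"] \<sigma>01 by (intro \<delta>(2)) (auto simp: dist_real_def dist_commute)
  moreover have "\<bar>f (marginal \<Omega> (mixture 0) (t (r n))) (x (r n)) - f (marginal \<Omega> \<eta> t0) x0\<bar> < \<epsilon> / 2"
    using n x mem(1)[of "r n"] \<delta>(1) by (intro \<delta>(2)) (auto simp: dist_real_def dist_commute)
  moreover have "mixture 0 = \<eta>" unfolding mixture_def by (rule interpolate_0[OF sets_modified])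
  ultimately have "\<bar>f (marginal \<Omega> (mixture (\<sigma> (r n))) (t (r n))) (x (r n)) - f (marginal \<Omega> \<eta> (t (r n))) (x (r n))\<bar> < \<epsilon>"
    unfolding \<open>mixture 0 = \<eta>\<close> by linarith
  then show False using ge[of "r n"] by blast
qed

end

text \<open>The special case of the trivial modification.\<close>

lemma f_marginal_continuous:
  assumes fe: "finite_energy \<eta>" and f: "continuous_on_P2 \<Omega> f"
  shows "continuous_on ({0..T} \<times> \<Omega>) (\<lambda>(t, x). f (marginal \<Omega> \<eta> t) x)"
  unfolding continuous_on_iff
proof (intro ballI allI impI)
  fix z \<epsilon> :: real and y assume y: "y \<in> {0..T} \<times> \<Omega>" and \<epsilon>: "\<epsilon> > 0"
  obtain t0 x0 where y0: "y = (t0, x0)" by force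
  have mix: "mixture \<eta> id 0 = \<eta>"
    unfolding mixture_def[OF fe admissible_id] by (rule interpolate_0[OF sets_modified[OF fe admissible_id]])
  obtain \<delta> where \<delta>: "\<delta> > 0" "\<And>\<sigma> t x'. 0 \<le> \<sigma> \<Longrightarrow> \<sigma> \<le> 1 \<Longrightarrow> \<sigma> < \<delta> \<Longrightarrow> t \<in> {0..T} \<Longrightarrow> \<bar>t - t0\<bar> < \<delta> \<Longrightarrow> x' \<in> \<Omega> \<Longrightarrow> dist x0 x' < \<delta> \<Longrightarrow>
    \<bar>f (marginal \<Omega> (mixture \<eta> id \<sigma>) t) x' - f (marginal \<Omega> \<eta> t0) x0\<bar> < \<epsilon>"
    using f_mixture_continuous[OF fe admissible_id f, of x0 t0 \<epsilon>] y \<epsilon> y0 by auto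
  show "\<exists>d>0. \<forall>z\<in>{0..T} \<times> \<Omega>. dist z y < d \<longrightarrow>
    dist (case z of (t, x) \<Rightarrow> f (marginal \<Omega> \<eta> t) x) (case y of (t, x) \<Rightarrow> f (marginal \<Omega> \<eta> t) x) < \<epsilon>"
  proof (intro exI[of _ \<delta>] conjI \<delta>(1) ballI impI)
    fix z assume z: "z \<in> {0..T} \<times> \<Omega>" "dist z y < \<delta>"
    have "dist (fst z) t0 < \<delta>" "dist (snd z) x0 < \<delta>"
      using z(2) dist_fst_le[of z y] dist_snd_le[of z y] by (auto simp: y0)
    then have "\<bar>f (marginal \<Omega> (mixture \<eta> id 0) (fst z)) (snd z) - f (marginal \<Omega> \<eta> t0) x0\<bar> < \<epsilon>"
      using z(1) \<delta>(1) by (intro \<delta>(2)) (auto simp: dist_real_def dist_commute)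
    then show "dist (case z of (t, x) \<Rightarrow> f (marginal \<Omega> \<eta> t) x) (case y of (t, x) \<Rightarrow> f (marginal \<Omega> \<eta> t) x) < \<epsilon>"
      by (simp add: mix y0 dist_real_def case_prod_beta)
  qed
qed

end

section \<open>The first variation of the potential\<close>

context mean_field_game
begin

lemma const_curve:
  assumes "x \<in> \<Omega>"
  shows "const_bcontfun x \<in> \<Gamma>" "energy T (const_bcontfun x) = 0"
proof -
  obtain y where y: "q y = x" using surj_q by (metis surj_def)
  have v: "velocity q T (\<lambda>_. x) t = 0" if "t \<in> {0..T}" for t
    by (rule velocity_lift[OF T that, of "\<lambda>_. y"]) (use y in auto)
  have eq: "apply_bcontfun (const_bcontfun x) = (\<lambda>_. x)" by (simp add: fun_eq_iff const_bcontfun.rep_eq)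
  have "kinetic_energy q T (\<lambda>_. x) = (\<integral>\<^sup>+t\<in>{0..T}. 0 \<partial>lborel)"
    unfolding kinetic_energy_def by (intro nn_integral_cong) (auto simp: v split: split_indicator)
  then have "kinetic_energy q T (\<lambda>_. x) < \<infinity>" by simp
  moreover have "absolutely_continuous_curve T (\<lambda>_. x)"
    unfolding absolutely_continuous_curve_def by (auto intro: exI[of _ 1])
  ultimately show "const_bcontfun x \<in> \<Gamma>" using assms by (simp add: curves_def eq)
  show "energy T (const_bcontfun x) = 0"
    unfolding energy_def set_lebesgue_integral_def eq
    by (rule Bochner_Integration.integral_eq_zero_AE) (auto intro!: AE_I2 simp: v split: split_indicator)
qed

lemma const_curve_measurable: "const_bcontfun \<in> measurable MO MG"
proof (rule measurable_restrict_space2)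
  show "const_bcontfun \<in> space MO \<rightarrow> \<Gamma>" using const_curve(1) by (auto simp: space_restrict_space)
  have "dist (const_bcontfun x :: real \<Rightarrow>\<^sub>C 'p) (const_bcontfun y) \<le> dist x y" for x y :: 'p
    by (rule dist_bound) (simp add: const_bcontfun.rep_eq)
  then have "continuous_on UNIV (const_bcontfun :: 'p \<Rightarrow> real \<Rightarrow>\<^sub>C 'p)"
    unfolding continuous_on_iff by (meson le_less_trans)
  then show "const_bcontfun \<in> measurable MO (borel :: (real \<Rightarrow>\<^sub>C 'p) measure)"
    by (intro measurable_restrict_space1 borel_measurable_continuous_onI)
qed

lemma total_cost_finite_energy:
  assumes "finite_energy \<eta>"
  shows "total_cost q \<Omega> T L F G \<eta> = ereal (\<integral>\<gamma>. running_cost \<gamma> \<partial>\<eta>) +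
    integral_bdd_below \<Omega> T F (marginal \<Omega> \<eta>) + ereal (G (marginal \<Omega> \<eta> T))"
  using assms unfolding total_cost_def finite_energy_def running_cost_def by auto

text \<open>The measure on constant curves with initial distribution \<open>m0\<close> has no energy and a constant flow of
  marginals, hence finite cost.\<close>

lemma minimizer_finite:
  assumes \<eta>: "\<eta> \<in> prob_measures_from q \<Omega> T m0"
    and min: "\<forall>\<eta>'\<in>prob_measures_from q \<Omega> T m0. total_cost q \<Omega> T L F G \<eta> \<le> total_cost q \<Omega> T L F G \<eta>'"
  shows "finite_energy \<eta>" "total_cost q \<Omega> T L F G \<eta> < \<infinity>"
proof -
  have m0': "m0 \<in> prob_measures \<Omega>" using m0 by (simp add: prob_measures2_def)
  then interpret m0: prob_space m0 by (simp add: prob_measures_def)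
  have s0: "sets m0 = sets MO" using m0' by (simp add: prob_measures_def)
  have sp0: "space m0 = \<Omega>" using sets_eq_imp_space_eq[OF s0] by (simp add: space_restrict_space)
  have cm: "const_bcontfun \<in> measurable m0 MG"
    using const_curve_measurable measurable_cong_sets[OF s0 refl, of MG] by blast
  define \<eta>0 where "\<eta>0 = distr m0 MG const_bcontfun"
  have marg: "marginal \<Omega> \<eta>0 t = m0" if "t \<in> {0..T}" for t
  proof -
    have "marginal \<Omega> \<eta>0 t = distr m0 MO (\<lambda>x. x)"
      unfolding marginal_def \<eta>0_def
      by (subst distr_distr[OF eval_measurable[OF that] cm]) (simp add: o_def const_bcontfun.rep_eq)
    also have "\<dots> = m0" by (rule distr_id2) (simp add: s0)
    finally show ?thesis .
  qed
  have from0: "\<eta>0 \<in> prob_measures_from q \<Omega> T m0"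
    using m0.prob_space_distr[OF cm] marg[of 0] T by (simp add: prob_measures_from_def prob_measures_def \<eta>0_def)
  have "(\<integral>\<^sup>+\<gamma>. kinetic_energy q T \<gamma> \<partial>\<eta>0) = (\<integral>\<^sup>+x. kinetic_energy q T (const_bcontfun x) \<partial>m0)"
    unfolding \<eta>0_def by (rule nn_integral_distr[OF cm]) (simp add: kinetic_measurable)
  also have "\<dots> = (\<integral>\<^sup>+x. 0 \<partial>m0)"
  proof (intro nn_integral_cong)
    fix x assume "x \<in> space m0"
    then have x: "x \<in> \<Omega>" by (simp add: sp0)
    show "kinetic_energy q T (apply_bcontfun (const_bcontfun x)) = 0"
      unfolding kinetic_nn[OF const_curve(1)[OF x]] const_curve(2)[OF x] by simp
  qed
  finally have fe0: "finite_energy \<eta>0" using from0 by (simp add: finite_energy_def)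
  have "(\<integral>\<^sup>+t\<in>{0..T}. ennreal (F (marginal \<Omega> \<eta>0 t) - Inf (F ` prob_measures \<Omega>)) \<partial>lborel) =
    (\<integral>\<^sup>+t\<in>{0..T}. ennreal (F m0 - Inf (F ` prob_measures \<Omega>)) \<partial>lborel)"
    by (intro nn_integral_cong) (auto simp: marg split: split_indicator)
  also have "\<dots> < \<infinity>" by (simp add: nn_integral_cmult_indicator ennreal_mult_less_top emeasure_lborel_Icc_eq)
  finally have "integral_bdd_below \<Omega> T F (marginal \<Omega> \<eta>0) < \<infinity>"
    by (auto simp: integral_bdd_below_def Let_def less_top[symmetric])
  then have "total_cost q \<Omega> T L F G \<eta>0 < \<infinity>" by (simp add: total_cost_finite_energy[OF fe0])
  then show fin: "total_cost q \<Omega> T L F G \<eta> < \<infinity>" using min from0 by (meson le_less_trans)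
  have "(\<integral>\<^sup>+\<gamma>. kinetic_energy q T \<gamma> \<partial>\<eta>) \<noteq> \<infinity>" using fin unfolding total_cost_def by (auto split: if_splits)
  then show "finite_energy \<eta>" using \<eta> by (simp add: finite_energy_def less_top)
qed

context
  fixes \<eta> \<Phi> B E A and s :: real
  assumes fe: "finite_energy \<eta>" and adm: "admissible \<Phi> B E"
    and A: "A \<in> sets MG" and off: "\<And>\<gamma>. \<gamma> \<in> \<Gamma> \<Longrightarrow> \<gamma> \<notin> A \<Longrightarrow> \<Phi> \<gamma> = \<gamma>"
    and s: "0 < s" "s < 1"
begin

abbreviation "mix \<equiv> mixture \<eta> \<Phi>"

lemma A_sets: "A \<in> sets \<eta>"
  using A prob_fromD(2)[OF \<eta>_from[OF fe adm]] by simp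

text \<open>Only curves in \<open>A\<close> are modified, so by the mean value theorem the increment of \<open>F\<close> is
  controlled by the change of \<open>f\<close> along these curves.\<close>

lemma linear_derivative_increment:
  assumes dF: "linear_derivative \<Omega> F f" and t: "t \<in> {0..T}"
    and c: "\<And>\<sigma> \<gamma>. 0 < \<sigma> \<Longrightarrow> \<sigma> < s \<Longrightarrow> \<gamma> \<in> A \<Longrightarrow>
      f (marginal \<Omega> (mix \<sigma>) t) (apply_bcontfun (\<Phi> \<gamma>) t) - f (marginal \<Omega> (mix \<sigma>) t) (apply_bcontfun \<gamma> t) \<le> c"
  shows "F (marginal \<Omega> (mix s) t) - F (marginal \<Omega> \<eta> t) \<le> s * (measure \<eta> A * c)"
proof -
  note from_\<eta> = \<eta>_from[OF fe adm]
  interpret prob_space \<eta> by (rule prob_fromD(1)[OF from_\<eta>])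
  note sp = prob_fromD(2,3)[OF from_\<eta>]
  let ?m = "marginal \<Omega> \<eta> t" and ?m' = "marginal \<Omega> (modified \<eta> \<Phi>) t"
  have P2: "?m \<in> prob_measures2 \<Omega>" "?m' \<in> prob_measures2 \<Omega>"
    by (rule marginal_prob2[OF fe t]) (rule marginal_prob2[OF modified_finite_energy[OF fe adm] t])
  obtain \<sigma> where \<sigma>: "0 < \<sigma>" "\<sigma> < s" and eq: "F (interpolate s ?m ?m') - F ?m =
    s * ((\<integral>x. f (interpolate \<sigma> ?m ?m') x \<partial>?m') - (\<integral>x. f (interpolate \<sigma> ?m ?m') x \<partial>?m))"
    using linear_derivative_mean_value[OF dF P2 s] by blast
  define \<phi> where "\<phi> = f (interpolate \<sigma> ?m ?m')"
  have mix\<sigma>: "marginal \<Omega> (mix \<sigma>) t = interpolate \<sigma> ?m ?m'"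
    by (rule mixture_marginal[OF fe adm]) (use \<sigma> s t in auto)
  have mixs: "marginal \<Omega> (mix s) t = interpolate s ?m ?m'"
    by (rule mixture_marginal[OF fe adm]) (use s t in auto)
  have "interpolate \<sigma> ?m ?m' \<in> prob_measures2 \<Omega>" using \<sigma> s by (intro interpolate_prob_measures2 P2) auto
  then have int: "integrable ?m \<phi>" "integrable ?m' \<phi>"
    using dF P2 unfolding linear_derivative_def \<phi>_def by blast+
  note ev = eval_measurable'[OF from_\<eta> t]
  have ev\<Phi>: "(\<lambda>\<gamma>. apply_bcontfun (\<Phi> \<gamma>) t) \<in> measurable \<eta> MO"
    by (rule measurable_compose[OF \<Phi>_measurable[OF fe adm] eval_measurable[OF t]])
  note m' = marginal_modified[OF fe adm t]
  have \<phi>m: "\<phi> \<in> borel_measurable MO"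
    using int(1) borel_measurable_integrable[OF int(1)] by (simp add: marginal_def)
  have i1: "integrable \<eta> (\<lambda>\<gamma>. \<phi> (apply_bcontfun \<gamma> t))" "(\<integral>x. \<phi> x \<partial>?m) = (\<integral>\<gamma>. \<phi> (apply_bcontfun \<gamma> t) \<partial>\<eta>)"
    using int(1) integrable_distr_eq[OF ev \<phi>m] integral_distr[OF ev \<phi>m] by (simp_all add: marginal_def)
  have i2: "integrable \<eta> (\<lambda>\<gamma>. \<phi> (apply_bcontfun (\<Phi> \<gamma>) t))" "(\<integral>x. \<phi> x \<partial>?m') = (\<integral>\<gamma>. \<phi> (apply_bcontfun (\<Phi> \<gamma>) t) \<partial>\<eta>)"
    using int(2) integrable_distr_eq[OF ev\<Phi> \<phi>m] integral_distr[OF ev\<Phi> \<phi>m] by (simp_all add: m')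
  have "(\<integral>x. \<phi> x \<partial>?m') - (\<integral>x. \<phi> x \<partial>?m) = (\<integral>\<gamma>. \<phi> (apply_bcontfun (\<Phi> \<gamma>) t) - \<phi> (apply_bcontfun \<gamma> t) \<partial>\<eta>)"
    using i1 i2 by simp
  also have "\<dots> \<le> (\<integral>\<gamma>. indicator A \<gamma> * c \<partial>\<eta>)"
  proof (rule integral_mono)
    show "integrable \<eta> (\<lambda>\<gamma>. \<phi> (apply_bcontfun (\<Phi> \<gamma>) t) - \<phi> (apply_bcontfun \<gamma> t))" using i1 i2 by simp
    show "integrable \<eta> (\<lambda>\<gamma>. indicator A \<gamma> * c)"
      using A_sets by (intro integrable_mult_left integrable_real_indicator) (auto simp: less_top[symmetric])
    fix \<gamma> assume "\<gamma> \<in> space \<eta>"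
    then have \<gamma>: "\<gamma> \<in> \<Gamma>" using sp by simp
    show "\<phi> (apply_bcontfun (\<Phi> \<gamma>) t) - \<phi> (apply_bcontfun \<gamma> t) \<le> indicator A \<gamma> * c"
      using c[OF \<sigma>, of \<gamma>] off[OF \<gamma>] by (cases "\<gamma> \<in> A") (auto simp: \<phi>_def mix\<sigma>)
  qed
  also have "\<dots> = measure \<eta> A * c" using A_sets by simp
  finally have "(\<integral>x. \<phi> x \<partial>?m') - (\<integral>x. \<phi> x \<partial>?m) \<le> measure \<eta> A * c" .
  then show ?thesis unfolding mixs eq \<phi>_def using s by (intro mult_left_mono) auto
qed

lemma running_cost_increment:
  assumes D: "\<And>\<gamma>. \<gamma> \<in> A \<Longrightarrow> running_cost (\<Phi> \<gamma>) - running_cost \<gamma> \<le> D"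
  shows "(\<integral>\<gamma>. running_cost \<gamma> \<partial>mix s) \<le> (\<integral>\<gamma>. running_cost \<gamma> \<partial>\<eta>) + s * (measure \<eta> A * D)"
proof -
  note from_\<eta> = \<eta>_from[OF fe adm]
  interpret prob_space \<eta> by (rule prob_fromD(1)[OF from_\<eta>])
  note sp = prob_fromD(2,3)[OF from_\<eta>]
  let ?r = "\<lambda>\<gamma> :: real \<Rightarrow>\<^sub>C 'p. running_cost (apply_bcontfun \<gamma>)"
  have i1: "integrable \<eta> ?r" by (rule finite_energy_integrable(2)[OF fe])
  have i2: "integrable (modified \<eta> \<Phi>) ?r" by (rule finite_energy_integrable(2)[OF modified_finite_energy[OF fe adm]])
  have i2': "integrable \<eta> (\<lambda>\<gamma>. ?r (\<Phi> \<gamma>))" "(\<integral>\<gamma>. ?r \<gamma> \<partial>modified \<eta> \<Phi>) = (\<integral>\<gamma>. ?r (\<Phi> \<gamma>) \<partial>\<eta>)"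
    using i2 integrable_distr_eq[OF \<Phi>_measurable[OF fe adm] running_cost_measurable]
      integral_distr[OF \<Phi>_measurable[OF fe adm] running_cost_measurable]
    by (simp_all add: modified_def[OF fe adm])
  have "(\<integral>\<gamma>. ?r \<gamma> \<partial>mix s) = (1 - s) * (\<integral>\<gamma>. ?r \<gamma> \<partial>\<eta>) + s * (\<integral>\<gamma>. ?r \<gamma> \<partial>modified \<eta> \<Phi>)"
    unfolding mixture_def[OF fe adm] using s by (intro integral_interpolate(2) sets_modified[OF fe adm] i1 i2) auto
  also have "\<dots> = (\<integral>\<gamma>. ?r \<gamma> \<partial>\<eta>) + s * (\<integral>\<gamma>. ?r (\<Phi> \<gamma>) - ?r \<gamma> \<partial>\<eta>)"
    using i1 i2' by (simp add: algebra_simps)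
  also have "(\<integral>\<gamma>. ?r (\<Phi> \<gamma>) - ?r \<gamma> \<partial>\<eta>) \<le> (\<integral>\<gamma>. indicator A \<gamma> * D \<partial>\<eta>)"
  proof (rule integral_mono)
    show "integrable \<eta> (\<lambda>\<gamma>. ?r (\<Phi> \<gamma>) - ?r \<gamma>)" using i1 i2' by simp
    show "integrable \<eta> (\<lambda>\<gamma>. indicator A \<gamma> * D)"
      using A_sets by (intro integrable_mult_left integrable_real_indicator) (auto simp: less_top[symmetric])
    fix \<gamma> assume "\<gamma> \<in> space \<eta>"
    then have \<gamma>: "\<gamma> \<in> \<Gamma>" using sp by simp
    show "?r (\<Phi> \<gamma>) - ?r \<gamma> \<le> indicator A \<gamma> * D"
      using D[of \<gamma>] off[OF \<gamma>] by (cases "\<gamma> \<in> A") auto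
  qed
  also have "(\<integral>\<gamma>. indicator A \<gamma> * D \<partial>\<eta>) = measure \<eta> A * D" using A_sets by simp
  finally show ?thesis using s by simp
qed

text \<open>The first-order condition. Replacing \<open>\<eta>\<close> by the mixture with parameter \<open>s\<close> changes each of the three
  parts of the cost by at most \<open>s\<close> times the mass of \<open>A\<close> times the corresponding bound, and the total
  change is nonnegative for a minimizer. The bounds \<open>wf\<close> and \<open>wg\<close> are required at all smaller parameters
  because the mean value theorem does not tell at which one the derivative is taken.\<close>

theorem variation_inequality:
  assumes min: "\<forall>\<eta>'\<in>prob_measures_from q \<Omega> T m0. total_cost q \<Omega> T L F G \<eta> \<le> total_cost q \<Omega> T L F G \<eta>'"
    and fin: "total_cost q \<Omega> T L F G \<eta> < \<infinity>"
    and bF: "bdd_below (F ` prob_measures \<Omega>)"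
    and dF: "linear_derivative \<Omega> F f" and dG: "linear_derivative \<Omega> G g"
    and pos: "emeasure \<eta> A > 0"
    and D: "\<And>\<gamma>. \<gamma> \<in> A \<Longrightarrow> running_cost (\<Phi> \<gamma>) - running_cost \<gamma> \<le> D"
    and w: "integrable (time_measure T) w"
    and wf: "\<And>\<sigma> t \<gamma>. 0 < \<sigma> \<Longrightarrow> \<sigma> < s \<Longrightarrow> t \<in> {0..T} \<Longrightarrow> \<gamma> \<in> A \<Longrightarrow>
      f (marginal \<Omega> (mix \<sigma>) t) (apply_bcontfun (\<Phi> \<gamma>) t) - f (marginal \<Omega> (mix \<sigma>) t) (apply_bcontfun \<gamma> t) \<le> w t"
    and wg: "\<And>\<sigma> \<gamma>. 0 < \<sigma> \<Longrightarrow> \<sigma> < s \<Longrightarrow> \<gamma> \<in> A \<Longrightarrow>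
      g (marginal \<Omega> (mix \<sigma>) T) (apply_bcontfun (\<Phi> \<gamma>) T) - g (marginal \<Omega> (mix \<sigma>) T) (apply_bcontfun \<gamma> T) \<le> c"
  shows "0 \<le> D + (\<integral>t. w t \<partial>time_measure T) + c"
proof -
  note from_\<eta> = \<eta>_from[OF fe adm]
  interpret prob_space \<eta> by (rule prob_fromD(1)[OF from_\<eta>])
  define a where "a = measure \<eta> A"
  have a: "a > 0" using pos by (simp add: a_def emeasure_eq_measure)
  define b where "b = Inf (F ` prob_measures \<Omega>)"
  have b: "b \<le> F (marginal \<Omega> \<eta>' t)" if "\<eta>' \<in> prob_measures_from q \<Omega> T m0" "t \<in> {0..T}" for \<eta>' t
    unfolding b_def using marginal_prob[OF that] by (intro cInf_lower bF) auto
  have mixf: "mix s \<in> prob_measures_from q \<Omega> T m0" "finite_energy (mix s)"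
    using s by (auto intro: mixture_from[OF fe adm] mixture_finite_energy[OF fe adm])
  define V where "V = (\<integral>\<^sup>+t. ennreal (F (marginal \<Omega> \<eta> t) - b) \<partial>time_measure T)"
  define U where "U = (\<integral>\<^sup>+t. ennreal (F (marginal \<Omega> (mix s) t) - b) \<partial>time_measure T)"
  have V: "integral_bdd_below \<Omega> T F (marginal \<Omega> \<eta>) = enn2ereal V + ereal (b * T)"
    unfolding integral_bdd_below_def Let_def V_def b_def by (subst nn_integral_restrict_space) auto
  have U: "integral_bdd_below \<Omega> T F (marginal \<Omega> (mix s)) = enn2ereal U + ereal (b * T)"
    unfolding integral_bdd_below_def Let_def U_def b_def by (subst nn_integral_restrict_space) auto
  have "V \<noteq> \<infinity>" using fin unfolding total_cost_finite_energy[OF fe] V by auto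
  then have Vfin: "V < \<infinity>" by (simp add: less_top)
  then obtain v where v: "V = ennreal v" "0 \<le> v" by (cases V) auto
  have "enn2ereal U \<le> enn2ereal V + ereal (\<integral>t. s * (a * w t) \<partial>time_measure T)"
    unfolding U_def V_def
  proof (rule nn_integral_le_add_measurable)
    show "integrable (time_measure T) (\<lambda>t. s * (a * w t))" using w by simp
    show "(\<integral>\<^sup>+t. ennreal (F (marginal \<Omega> \<eta> t) - b) \<partial>time_measure T) < \<infinity>" using Vfin by (simp add: V_def)
    fix t assume "t \<in> space (time_measure T)"
    then have t: "t \<in> {0..T}" by simp
    show "0 \<le> F (marginal \<Omega> \<eta> t) - b" "0 \<le> F (marginal \<Omega> (mix s) t) - b"
      using b[OF from_\<eta> t] b[OF mixf(1) t] by auto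
    show "F (marginal \<Omega> (mix s) t) - b \<le> F (marginal \<Omega> \<eta> t) - b + s * (a * w t)"
      using linear_derivative_increment[OF dF t, of "w t"] wf t by (simp add: a_def)
  qed
  also have "\<dots> = ereal (v + s * (a * (\<integral>t. w t \<partial>time_measure T)))" using v by (simp add: enn2ereal_ennreal)
  finally have Ule: "enn2ereal U \<le> ereal (v + s * (a * (\<integral>t. w t \<partial>time_measure T)))" .
  have Gle: "G (marginal \<Omega> (mix s) T) \<le> G (marginal \<Omega> \<eta> T) + s * (a * c)"
    using linear_derivative_increment[OF dG _ wg] T by (simp add: a_def)
  have "ereal (\<integral>\<gamma>. running_cost \<gamma> \<partial>\<eta>) + (ereal v + ereal (b * T)) + ereal (G (marginal \<Omega> \<eta> T)) = total_cost q \<Omega> T L F G \<eta>"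
    unfolding total_cost_finite_energy[OF fe] V using v by (simp add: enn2ereal_ennreal)
  also have "\<dots> \<le> total_cost q \<Omega> T L F G (mix s)" using min mixf(1) by blast
  also have "\<dots> = ereal (\<integral>\<gamma>. running_cost \<gamma> \<partial>mix s) + (enn2ereal U + ereal (b * T)) + ereal (G (marginal \<Omega> (mix s) T))"
    unfolding total_cost_finite_energy[OF mixf(2)] U ..
  also have "\<dots> \<le> ereal ((\<integral>\<gamma>. running_cost \<gamma> \<partial>\<eta>) + s * (a * D)) +
      (ereal (v + s * (a * (\<integral>t. w t \<partial>time_measure T))) + ereal (b * T)) + ereal (G (marginal \<Omega> \<eta> T) + s * (a * c))"
    using running_cost_increment[OF D] Ule Gle by (intro add_mono) (auto simp: a_def)
  finally have "0 \<le> s * (a * (D + (\<integral>t. w t \<partial>time_measure T) + c))" by (simp add: algebra_simps)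
  then have "0 \<le> (s * a) * (D + (\<integral>t. w t \<partial>time_measure T) + c)" by (simp add: mult.assoc)
  moreover have "0 < s * a" using s a by simp
  ultimately show ?thesis by (simp only: zero_le_mult_iff) linarith
qed

end

end

section \<open>Local connectedness of the state space\<close>

definition ramp :: "real \<Rightarrow> real" where "ramp \<tau> = max 0 (min 1 (2 - 3 * \<tau>))"

definition bump :: "real \<Rightarrow> real" where "bump \<tau> = max 0 (min 1 (min (3 * \<tau>) (3 - 3 * \<tau>)))"

text \<open>Three segments of equal duration: from \<open>y\<close> in the direction \<open>u\<close>, parallel to the chord, and back to
  \<open>z\<close>. The excursion is proportional to \<open>dist y z\<close>, so the path is longer than the chord by a bounded factor only and
  depends in a Lipschitz way on \<open>y\<close>; with \<open>u\<close> pointing inwards it avoids leaving a domain whose boundary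
  is curved.\<close>

definition detour :: "'a::real_normed_vector \<Rightarrow> 'a \<Rightarrow> 'a \<Rightarrow> real \<Rightarrow> 'a" where
  "detour u y z \<tau> = z + ramp \<tau> *\<^sub>R (y - z) + (bump \<tau> * dist y z) *\<^sub>R u"

definition detour_connected :: "'a::real_normed_vector set \<Rightarrow> bool" where
  "detour_connected D \<longleftrightarrow> (\<forall>x\<in>D. \<exists>r>0. \<exists>u. \<forall>y\<in>D \<inter> ball x r. \<forall>z\<in>D \<inter> ball x r. \<forall>\<tau>\<in>{0..1}. detour u y z \<tau> \<in> D)"

lemma ramp_range: "0 \<le> ramp \<tau>" "ramp \<tau> \<le> 1" and bump_range: "0 \<le> bump \<tau>" "bump \<tau> \<le> 1"
  by (auto simp: ramp_def bump_def)

lemma clamp_contraction: "\<bar>max 0 (min 1 a) - max 0 (min 1 b)\<bar> \<le> \<bar>a - b :: real\<bar>"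
  by (auto simp: max_def min_def)

lemma ramp_lipschitz: "\<bar>ramp \<tau> - ramp \<tau>'\<bar> \<le> 3 * \<bar>\<tau> - \<tau>'\<bar>"
proof -
  have "\<bar>ramp \<tau> - ramp \<tau>'\<bar> \<le> \<bar>(2 - 3 * \<tau>) - (2 - 3 * \<tau>')\<bar>" unfolding ramp_def by (rule clamp_contraction)
  also have "\<dots> = 3 * \<bar>\<tau> - \<tau>'\<bar>" by (simp add: abs_if)
  finally show ?thesis .
qed

lemma bump_lipschitz: "\<bar>bump \<tau> - bump \<tau>'\<bar> \<le> 3 * \<bar>\<tau> - \<tau>'\<bar>"
proof -
  have "\<bar>bump \<tau> - bump \<tau>'\<bar> \<le> \<bar>min (3 * \<tau>) (3 - 3 * \<tau>) - min (3 * \<tau>') (3 - 3 * \<tau>')\<bar>"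
    unfolding bump_def by (rule clamp_contraction)
  also have "\<dots> \<le> 3 * \<bar>\<tau> - \<tau>'\<bar>" by (auto simp: min_def abs_if)
  finally show ?thesis .
qed

lemma detour_cases:
  assumes "\<tau> \<in> {0..1}"
    and "\<And>\<theta>. \<theta> \<in> {0..1} \<Longrightarrow> y + (\<theta> * dist y z) *\<^sub>R u \<in> D"
    and "\<And>\<theta>. \<theta> \<in> {0..1} \<Longrightarrow> (1 - \<theta>) *\<^sub>R y + \<theta> *\<^sub>R z + dist y z *\<^sub>R u \<in> D"
    and "\<And>\<theta>. \<theta> \<in> {0..1} \<Longrightarrow> z + (\<theta> * dist y z) *\<^sub>R u \<in> D"
  shows "detour u y z \<tau> \<in> D"
proof -
  consider "\<tau> \<le> 1/3" | "1/3 < \<tau>" "\<tau> \<le> 2/3" | "2/3 < \<tau>" by linarith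
  then show ?thesis
  proof cases
    case 1
    then have "ramp \<tau> = 1" "bump \<tau> = 3 * \<tau>" using assms(1) by (auto simp: ramp_def bump_def)
    then have "detour u y z \<tau> = y + (3 * \<tau> * dist y z) *\<^sub>R u" by (simp add: detour_def)
    then show ?thesis using assms(2)[of "3 * \<tau>"] 1 assms(1) by simp
  next
    case 2
    then have "ramp \<tau> = 2 - 3 * \<tau>" "bump \<tau> = 1" by (auto simp: ramp_def bump_def)
    moreover have "z + (2 - 3 * \<tau>) *\<^sub>R (y - z) = (1 - (3 * \<tau> - 1)) *\<^sub>R y + (3 * \<tau> - 1) *\<^sub>R z"
      by (simp add: algebra_simps scaleR_2)
    ultimately have "detour u y z \<tau> = (1 - (3 * \<tau> - 1)) *\<^sub>R y + (3 * \<tau> - 1) *\<^sub>R z + dist y z *\<^sub>R u"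
      by (simp add: detour_def)
    then show ?thesis using assms(3)[of "3 * \<tau> - 1"] 2 by simp
  next
    case 3
    then have "ramp \<tau> = 0" "bump \<tau> = 3 - 3 * \<tau>" using assms(1) by (auto simp: ramp_def bump_def)
    then have "detour u y z \<tau> = z + ((3 - 3 * \<tau>) * dist y z) *\<^sub>R u" by (simp add: detour_def)
    then show ?thesis using assms(4)[of "3 - 3 * \<tau>"] 3 assms(1) by simp
  qed
qed

lemma detour_0: "detour u y z 0 = y" and detour_1: "detour u y z 1 = z"
  by (simp_all add: detour_def ramp_def bump_def)

lemma dist_detour_time:
  "dist (detour u y z \<tau>) (detour u y z \<tau>') \<le> 3 * dist y z * (1 + norm u) * \<bar>\<tau> - \<tau>'\<bar>"
proof -
  have "detour u y z \<tau> - detour u y z \<tau>' = (ramp \<tau> - ramp \<tau>') *\<^sub>R (y - z) + ((bump \<tau> - bump \<tau>') * dist y z) *\<^sub>R u"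
    unfolding detour_def by (simp add: scaleR_left_diff_distrib left_diff_distrib)
  then have "dist (detour u y z \<tau>) (detour u y z \<tau>') \<le> norm ((ramp \<tau> - ramp \<tau>') *\<^sub>R (y - z)) + norm (((bump \<tau> - bump \<tau>') * dist y z) *\<^sub>R u)"
    unfolding dist_norm by (metis norm_triangle_ineq)
  also have "\<dots> = \<bar>ramp \<tau> - ramp \<tau>'\<bar> * dist y z + \<bar>bump \<tau> - bump \<tau>'\<bar> * (dist y z * norm u)"
    by (simp add: dist_norm abs_mult)
  also have "\<dots> \<le> (3 * \<bar>\<tau> - \<tau>'\<bar>) * dist y z + (3 * \<bar>\<tau> - \<tau>'\<bar>) * (dist y z * norm u)"
    by (intro add_mono mult_right_mono ramp_lipschitz bump_lipschitz) auto
  also have "\<dots> = 3 * dist y z * (1 + norm u) * \<bar>\<tau> - \<tau>'\<bar>" by (simp add: algebra_simps)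
  finally show ?thesis .
qed

lemma dist_detour_start: "dist (detour u y z \<tau>) (detour u y' z \<tau>) \<le> dist y y' * (1 + norm u)"
proof -
  have "detour u y z \<tau> - detour u y' z \<tau> = ramp \<tau> *\<^sub>R (y - y') + (bump \<tau> * (dist y z - dist y' z)) *\<^sub>R u"
    unfolding detour_def by (simp add: scaleR_left_diff_distrib scaleR_right_diff_distrib right_diff_distrib)
  then have "dist (detour u y z \<tau>) (detour u y' z \<tau>) \<le> norm (ramp \<tau> *\<^sub>R (y - y')) + norm ((bump \<tau> * (dist y z - dist y' z)) *\<^sub>R u)"
    unfolding dist_norm by (metis norm_triangle_ineq)
  also have "\<dots> = ramp \<tau> * dist y y' + bump \<tau> * (\<bar>dist y z - dist y' z\<bar> * norm u)"
    using ramp_range bump_range by (simp add: dist_norm abs_mult)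
  also have "\<dots> \<le> 1 * dist y y' + 1 * (dist y y' * norm u)"
  proof (intro add_mono mult_mono mult_right_mono)
    show "\<bar>dist y z - dist y' z\<bar> \<le> dist y y'"
      using dist_triangle[of y z y'] dist_triangle[of y' z y] by (simp add: dist_commute abs_le_iff)
  qed (auto simp: ramp_range bump_range)
  finally show ?thesis by (simp add: algebra_simps)
qed

lemma dist_detour_end: "\<tau> \<in> {0..1} \<Longrightarrow> dist (detour u y z \<tau>) z \<le> 3 * dist y z * (1 + norm u)"
  using dist_detour_time[of u y z \<tau> 1] mult_left_le[of "\<bar>\<tau> - 1\<bar>" "3 * dist y z * (1 + norm u)"]
  by (auto simp: detour_1)

lemma detour_connected_UNIV: "detour_connected UNIV"
  unfolding detour_connected_def by (auto intro: exI[of _ 1])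

text \<open>Near a boundary point the domain lies above the graph of a function that is Lipschitz with
  some constant \<open>M\<close>. Moving up by \<open>M\<close> times the distance of \<open>y\<close> and \<open>z\<close> makes the translated
  segment stay above the graph.\<close>

lemma detour_connected_C2_domain:
  assumes U: "open U" and C2: "C2_boundary U"
  shows "detour_connected (closure U :: (real^'d) set)"
  unfolding detour_connected_def
proof
  fix x0 assume x0: "x0 \<in> closure U"
  show "\<exists>r>0. \<exists>u. \<forall>y\<in>closure U \<inter> ball x0 r. \<forall>z\<in>closure U \<inter> ball x0 r. \<forall>\<tau>\<in>{0..1}. detour u y z \<tau> \<in> closure U"
  proof (cases "x0 \<in> U")
    case True
    then obtain r where r: "r > 0" "ball x0 r \<subseteq> U" using U openE by blast
    have "detour 0 y z \<tau> \<in> closure U" if y: "y \<in> ball x0 r" "z \<in> ball x0 r" and \<tau>: "\<tau> \<in> {0..1}" for y z \<tau>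
    proof (rule detour_cases[OF \<tau>])
      have "ball x0 r \<subseteq> closure U" using r closure_subset by blast
      then show "y + (\<theta> * dist y z) *\<^sub>R 0 \<in> closure U" "z + (\<theta> * dist y z) *\<^sub>R 0 \<in> closure U" for \<theta> using y by auto
      show "(1 - \<theta>) *\<^sub>R y + \<theta> *\<^sub>R z + dist y z *\<^sub>R 0 \<in> closure U" if "\<theta> \<in> {0..1}" for \<theta>
        using convexD_alt[OF convex_ball y, of \<theta>] that \<open>ball x0 r \<subseteq> closure U\<close> by auto
    qed
    then show ?thesis using r(1) by blast
  next
    case False
    then have "x0 \<in> frontier U" using x0 U by (simp add: frontier_def interior_open)
    then obtain r0 e h where r0: "r0 > 0" and e: "norm e = 1" and h: "C2_function h" and
      graph: "U \<inter> ball x0 r0 = {x \<in> ball x0 r0. x \<bullet> e > h (x - (x \<bullet> e) *\<^sub>R e)}"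
      using C2 unfolding C2_boundary_def by blast
    define P where "P x = x - (x \<bullet> e) *\<^sub>R e" for x
    have ee: "e \<bullet> e = 1" using e by (simp add: norm_eq_1)
    have P_diff: "norm (P x - P y) \<le> norm (x - y)" for x y
    proof (rule power2_le_imp_le)
      define d where "d = x - y"
      have "P x - P y = d - (d \<bullet> e) *\<^sub>R e" by (simp add: P_def d_def inner_diff_left algebra_simps)
      then have "(norm (P x - P y))\<^sup>2 = (norm (x - y))\<^sup>2 - (d \<bullet> e)\<^sup>2"
        unfolding power2_norm_eq_inner d_def[symmetric]
        by (simp add: inner_diff_left inner_diff_right inner_commute ee power2_eq_square)
      then show "(norm (P x - P y))\<^sup>2 \<le> (norm (x - y))\<^sup>2" by simp
    qed simp
    have P_add: "P (x + c *\<^sub>R e) = P x" for x c by (simp add: P_def inner_add_left ee algebra_simps)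
    have P_comb: "P ((1 - c) *\<^sub>R x + c *\<^sub>R y) = (1 - c) *\<^sub>R P x + c *\<^sub>R P y" for x y c
      by (simp add: P_def inner_add_left algebra_simps)
    obtain D1 :: "real^'d \<Rightarrow> (real^'d) \<Rightarrow>\<^sub>L real" and D2 where D1: "\<And>x. (h has_derivative blinfun_apply (D1 x)) (at x)"
      and D2: "\<And>x. (D1 has_derivative blinfun_apply (D2 x)) (at x)"
      using h unfolding C2_function_def by blast
    have contD1: "continuous_on UNIV D1" by (rule has_derivative_continuous_on[OF D2])
    have conth: "continuous_on UNIV h" by (rule has_derivative_continuous_on[OF D1])
    have "bounded (D1 ` cball (P x0) r0)"
      by (intro compact_imp_bounded compact_continuous_image continuous_on_subset[OF contD1]) auto
    then obtain M0 where M0: "\<And>x. x \<in> cball (P x0) r0 \<Longrightarrow> norm (D1 x) \<le> M0" unfolding bounded_iff by blast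
    define M where "M = max M0 0"
    have M: "0 \<le> M" "\<And>x. x \<in> cball (P x0) r0 \<Longrightarrow> norm (D1 x) \<le> M" using M0 by (auto simp: M_def le_max_iff_disj)
    have lip: "\<bar>h a - h b\<bar> \<le> M * norm (a - b)" if "a \<in> cball (P x0) r0" "b \<in> cball (P x0) r0" for a b
    proof -
      have "norm (h a - h b) \<le> M * norm (a - b)"
        by (rule differentiable_bound[OF convex_cball has_derivative_at_withinI[OF D1]])
          (use M that in \<open>auto simp: norm_blinfun.rep_eq\<close>)
      then show ?thesis by simp
    qed
    have Pball: "P x \<in> cball (P x0) r0" if "x \<in> ball x0 r0" for x
      using P_diff[of x0 x] that by (simp add: dist_norm)
    have cl1: "x \<bullet> e \<ge> h (P x)" if "x \<in> closure U" "x \<in> ball x0 r0" for x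
    proof (rule ccontr)
      assume "\<not> x \<bullet> e \<ge> h (P x)"
      then have xin: "x \<in> {x. x \<bullet> e < h (P x)} \<inter> ball x0 r0" using that by auto
      define W where "W = {x. x \<bullet> e < h (P x)} \<inter> ball x0 r0"
      have "open ({x. x \<bullet> e < h (P x)} \<inter> ball x0 r0)"
        unfolding P_def
        by (intro open_Int open_Collect_less open_ball continuous_intros continuous_on_compose2[OF conth]) auto
      then have "W \<inter> U \<noteq> {}"
        using open_Int_closure_eq_empty[of W U] xin that(1) unfolding W_def[symmetric] by blast
      then obtain w where "w \<in> W" "w \<in> U" by blast
      then have w: "w \<bullet> e < h (P w)" "w \<in> U \<inter> ball x0 r0" by (auto simp: W_def)
      from w(2) have "h (P w) < w \<bullet> e" unfolding graph P_def by simp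
      with w(1) show False by simp
    qed
    have cl2: "x \<in> closure U" if x: "x \<in> ball x0 r0" "x \<bullet> e \<ge> h (P x)" for x
      unfolding closure_approachable
    proof (intro allI impI)
      fix \<delta> :: real assume \<delta>: "\<delta> > 0"
      define c where "c = min \<delta> (r0 - dist x0 x) / 2"
      have c: "c > 0" "c < \<delta>" "c < r0 - dist x0 x" using \<delta> x(1) by (auto simp: c_def)
      have d: "dist (x + c *\<^sub>R e) x = c" using c e by (simp add: dist_norm)
      then have "x + c *\<^sub>R e \<in> ball x0 r0" using c dist_triangle[of x0 "x + c *\<^sub>R e" x] by (simp add: dist_commute)
      moreover have "(x + c *\<^sub>R e) \<bullet> e > h (P (x + c *\<^sub>R e))" using x(2) c by (simp add: P_add inner_add_left ee)
      ultimately have "x + c *\<^sub>R e \<in> U" using graph by (auto simp: P_def)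
      then show "\<exists>y\<in>U. dist y x < \<delta>" using d c by (intro bexI[of _ "x + c *\<^sub>R e"]) auto
    qed
    define r where "r = r0 / (2 + 2 * M)"
    have "0 < 2 + 2 * M" using M(1) by simp
    then have r: "r > 0" "r * (2 + 2 * M) = r0" using r0 by (auto simp: r_def)
    have rr: "r + 2 * r * M < r0" using r by (simp add: algebra_simps)
    have "detour (M *\<^sub>R e) y z \<tau> \<in> closure U"
      if y: "y \<in> closure U" "y \<in> ball x0 r" and z: "z \<in> closure U" "z \<in> ball x0 r" and \<tau>: "\<tau> \<in> {0..1}" for y z \<tau>
    proof (rule detour_cases[OF \<tau>])
      have yz: "dist y z \<le> 2 * r" using y z dist_triangle3[of y z x0] by auto
      have inb: "w + (\<theta> * dist y z) *\<^sub>R (M *\<^sub>R e) \<in> ball x0 r0" if w: "w \<in> ball x0 r" and \<theta>: "\<theta> \<in> {0..1}" for w \<theta>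
      proof -
        have "dist x0 (w + (\<theta> * dist y z) *\<^sub>R (M *\<^sub>R e)) \<le> dist x0 w + dist w (w + (\<theta> * dist y z) *\<^sub>R (M *\<^sub>R e))"
          by (rule dist_triangle)
        also have "dist w (w + (\<theta> * dist y z) *\<^sub>R (M *\<^sub>R e)) = \<theta> * dist y z * M"
          using \<theta> M e by (simp add: dist_norm)
        also have "\<dots> \<le> 1 * (2 * r) * M" using \<theta> yz M r by (intro mult_right_mono mult_mono) auto
        finally show ?thesis using w rr by simp
      qed
      have bb: "ball x0 r \<subseteq> ball x0 r0" using rr r M by (intro subset_ball) (simp add: add_increasing2 less_imp_le order_trans[OF _ less_imp_le[OF rr]])
      have side: "w + (\<theta> * dist y z) *\<^sub>R (M *\<^sub>R e) \<in> closure U" if w: "w \<in> closure U" "w \<in> ball x0 r" and \<theta>: "\<theta> \<in> {0..1}" for w \<theta>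
      proof (rule cl2[OF inb[OF w(2) \<theta>]])
        have "h (P w) \<le> w \<bullet> e" using cl1[OF w(1)] w(2) bb by blast
        moreover have "0 \<le> \<theta> * dist y z * M" using \<theta> M by simp
        ultimately show "h (P (w + (\<theta> * dist y z) *\<^sub>R (M *\<^sub>R e))) \<le> (w + (\<theta> * dist y z) *\<^sub>R (M *\<^sub>R e)) \<bullet> e"
          by (simp add: P_add inner_add_left ee)
      qed
      show "y + (\<theta> * dist y z) *\<^sub>R (M *\<^sub>R e) \<in> closure U" if "\<theta> \<in> {0..1}" for \<theta> by (rule side[OF y that])
      show "z + (\<theta> * dist y z) *\<^sub>R (M *\<^sub>R e) \<in> closure U" if "\<theta> \<in> {0..1}" for \<theta> by (rule side[OF z that])
      fix \<theta> :: real assume \<theta>: "\<theta> \<in> {0..1}"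
      define w where "w = (1 - \<theta>) *\<^sub>R y + \<theta> *\<^sub>R z"
      have w: "w \<in> ball x0 r" unfolding w_def using convexD_alt[OF convex_ball y(2) z(2), of \<theta>] \<theta> by simp
      have "w + (1 * dist y z) *\<^sub>R (M *\<^sub>R e) \<in> closure U"
      proof (rule cl2[OF inb[OF w]])
        have Pw: "P w = (1 - \<theta>) *\<^sub>R P y + \<theta> *\<^sub>R P z" unfolding w_def by (rule P_comb)
        have hw: "h (P w) \<le> h (P y) + M * (\<theta> * dist y z)" "h (P w) \<le> h (P z) + M * ((1 - \<theta>) * dist y z)"
        proof -
          have "P w - P y = \<theta> *\<^sub>R (P z - P y)" "P w - P z = (1 - \<theta>) *\<^sub>R (P y - P z)" by (simp_all add: Pw algebra_simps)
          then have n: "norm (P w - P y) \<le> \<theta> * dist y z" "norm (P w - P z) \<le> (1 - \<theta>) * dist y z"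
            using \<theta> P_diff[of z y] P_diff[of y z] by (auto simp: dist_norm norm_minus_commute intro!: mult_left_mono)
          have "h (P w) \<le> h (P y) + M * norm (P w - P y)" "h (P w) \<le> h (P z) + M * norm (P w - P z)"
          proof -
            have "w \<in> ball x0 r0" "y \<in> ball x0 r0" "z \<in> ball x0 r0" using w y z bb by blast+
            then have "\<bar>h (P w) - h (P y)\<bar> \<le> M * norm (P w - P y)" "\<bar>h (P w) - h (P z)\<bar> \<le> M * norm (P w - P z)"
              by (auto intro!: lip Pball)
            then show "h (P w) \<le> h (P y) + M * norm (P w - P y)" "h (P w) \<le> h (P z) + M * norm (P w - P z)" by linarith+
          qed
          then show "h (P w) \<le> h (P y) + M * (\<theta> * dist y z)" "h (P w) \<le> h (P z) + M * ((1 - \<theta>) * dist y z)"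
            using mult_left_mono[OF n(1) M(1)] mult_left_mono[OF n(2) M(1)] by linarith+
        qed
        have hy: "h (P y) \<le> y \<bullet> e" "h (P z) \<le> z \<bullet> e" using cl1 y z bb by blast+
        have "h (P w) = (1 - \<theta>) * h (P w) + \<theta> * h (P w)" by (simp add: algebra_simps)
        also have "\<dots> \<le> (1 - \<theta>) * (y \<bullet> e + M * (\<theta> * dist y z)) + \<theta> * (z \<bullet> e + M * ((1 - \<theta>) * dist y z))"
          using hw hy \<theta> by (intro add_mono mult_left_mono) auto
        also have "\<dots> = w \<bullet> e + (2 * \<theta> * (1 - \<theta>)) * (M * dist y z)"
          by (simp add: w_def inner_add_left algebra_simps)
        also have "\<dots> \<le> w \<bullet> e + 1 * (M * dist y z)"
        proof (intro add_left_mono mult_right_mono)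
          \<comment> \<open>half of this sum is \<open>1 - 2 * \<theta> * (1 - \<theta>)\<close>\<close>
          have "0 \<le> (1 - 2 * \<theta>)\<^sup>2 + 1" by simp
          then show "2 * \<theta> * (1 - \<theta>) \<le> 1" by (simp add: power2_eq_square algebra_simps)
        qed (use M in simp)
        finally show "h (P (w + (1 * dist y z) *\<^sub>R (M *\<^sub>R e))) \<le> (w + (1 * dist y z) *\<^sub>R (M *\<^sub>R e)) \<bullet> e"
          by (simp add: P_add inner_add_left ee algebra_simps)
      qed simp
      then show "(1 - \<theta>) *\<^sub>R y + \<theta> *\<^sub>R z + dist y z *\<^sub>R (M *\<^sub>R e) \<in> closure U" by (simp add: w_def)
    qed
    then show ?thesis using r(1) by (intro exI[of _ r] conjI exI[of _ "M *\<^sub>R e"]) auto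
  qed
qed

section \<open>Competitors\<close>

lemma ac_lipschitz:
  assumes "\<And>s t. s \<in> {0..T} \<Longrightarrow> t \<in> {0..T} \<Longrightarrow> dist (l s) (l t) \<le> K * \<bar>s - t\<bar>"
  shows "absolutely_continuous_curve T l"
proof (rule ac_curveI)
  fix \<epsilon> :: real assume \<epsilon>: "\<epsilon> > 0"
  define K' where "K' = \<bar>K\<bar> + 1"
  have "(\<Sum>i<n. dist (l (A i)) (l (B i))) < \<epsilon>" if fam: "interval_family T n A B" and s: "(\<Sum>i<n. B i - A i) < \<epsilon> / K'" for n A B
  proof -
    have "(\<Sum>i<n. dist (l (A i)) (l (B i))) \<le> (\<Sum>i<n. K' * (B i - A i))"
    proof (rule sum_mono)
      fix i assume "i \<in> {..<n}"
      then have AB: "0 \<le> A i" "A i \<le> B i" "B i \<le> T" using fam by (auto simp: interval_family_def)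
      then have "dist (l (A i)) (l (B i)) \<le> K * \<bar>A i - B i\<bar>" by (intro assms) auto
      also have "\<dots> \<le> K' * \<bar>A i - B i\<bar>" by (intro mult_right_mono) (auto simp: K'_def)
      finally show "dist (l (A i)) (l (B i)) \<le> K' * (B i - A i)" using AB by simp
    qed
    also have "\<dots> = K' * (\<Sum>i<n. B i - A i)" by (simp add: sum_distrib_left)
    also have "\<dots> < \<epsilon>" using s by (simp add: K'_def field_simps)
    finally show ?thesis .
  qed
  moreover have "\<epsilon> / K' > 0" using \<epsilon> by (simp add: K'_def)
  ultimately show "\<exists>\<delta>>0. \<forall>n A B. interval_family T n A B \<longrightarrow> (\<Sum>i<n. B i - A i) < \<delta> \<longrightarrow>
      (\<Sum>i<n. dist (l (A i)) (l (B i))) < \<epsilon>" by blast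
qed

text \<open>The concatenation is the sum of a curve that rests after time \<open>h\<close> and one that rests before.\<close>

lemma ac_concat:
  fixes l1 l2 :: "real \<Rightarrow> 'a::real_normed_vector"
  assumes l1: "\<And>s t. s \<in> {0..h} \<Longrightarrow> t \<in> {0..h} \<Longrightarrow> dist (l1 s) (l1 t) \<le> K * \<bar>s - t\<bar>"
    and l2: "absolutely_continuous_curve T l2" and h: "0 \<le> h" "h \<le> T" "l1 h = l2 h" and K: "0 \<le> K"
  shows "absolutely_continuous_curve T (\<lambda>t. if t \<le> h then l1 t else l2 t)"
proof -
  have "absolutely_continuous_curve T (\<lambda>t. l1 (max 0 (min t h)))"
  proof (rule ac_lipschitz[where K = K])
    fix s t :: real
    have "dist (l1 (max 0 (min s h))) (l1 (max 0 (min t h))) \<le> K * \<bar>max 0 (min s h) - max 0 (min t h)\<bar>"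
      using h by (intro l1) auto
    also have "\<dots> \<le> K * \<bar>s - t\<bar>" using K by (intro mult_left_mono) linarith+
    finally show "dist (l1 (max 0 (min s h))) (l1 (max 0 (min t h))) \<le> K * \<bar>s - t\<bar>" .
  qed
  moreover have "absolutely_continuous_curve T (\<lambda>t. l2 (max t h) - l2 h)"
  proof (rule ac_curveI)
    fix \<epsilon> :: real assume "\<epsilon> > 0"
    then obtain d where d: "d > 0" "\<And>n A B. interval_family T n A B \<Longrightarrow> (\<Sum>i<n. B i - A i) < d \<Longrightarrow> (\<Sum>i<n. dist (l2 (A i)) (l2 (B i))) < \<epsilon>"
      using ac_curveD[OF l2] by blast
    have "(\<Sum>i<n. dist (l2 (max (A i) h) - l2 h) (l2 (max (B i) h) - l2 h)) < \<epsilon>"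
      if fam: "interval_family T n A B" and s: "(\<Sum>i<n. B i - A i) < d" for n A B
    proof -
      have AB: "0 \<le> A i" "A i \<le> B i" "B i \<le> T" if "i < n" for i using fam that by (auto simp: interval_family_def)
      have "interval_family T n (\<lambda>i. max (A i) h) (\<lambda>i. max (B i) h)"
        by (rule interval_family_sub[OF fam]) (use AB h in \<open>force+\<close>)
      moreover have "(\<Sum>i<n. max (B i) h - max (A i) h) < d"
      proof -
        have "(\<Sum>i<n. max (B i) h - max (A i) h) \<le> (\<Sum>i<n. B i - A i)"
        proof (rule sum_mono)
          fix i assume "i \<in> {..<n}"
          then have "A i \<le> B i" using AB by simp
          then show "max (B i) h - max (A i) h \<le> B i - A i" by linarith
        qed
        then show ?thesis using s by simp
      qed
      ultimately show ?thesis using d(2) by (simp add: dist_norm)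
    qed
    then show "\<exists>\<delta>>0. \<forall>n A B. interval_family T n A B \<longrightarrow> (\<Sum>i<n. B i - A i) < \<delta> \<longrightarrow>
      (\<Sum>i<n. dist (l2 (max (A i) h) - l2 h) (l2 (max (B i) h) - l2 h)) < \<epsilon>" using d(1) by blast
  qed
  ultimately have "absolutely_continuous_curve T (\<lambda>t. l1 (max 0 (min t h)) + (l2 (max t h) - l2 h))"
    by (rule ac_curve_add)
  then show ?thesis
    by (rule ac_curve_dominated[OF _ zero_less_one]) (use h in \<open>auto simp: max_def min_def\<close>)
qed

lemma norm_derivative_le_lipschitz:
  fixes l :: "real \<Rightarrow> 'a::real_normed_vector"
  assumes d: "(l has_vector_derivative v) (at t within S)" and t: "t \<in> {a<..<b}" "{a<..<b} \<subseteq> S"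
    and lip: "\<And>s. s \<in> {a<..<b} \<Longrightarrow> dist (l s) (l t) \<le> K * \<bar>s - t\<bar>"
  shows "norm v \<le> K"
proof (rule field_le_epsilon)
  fix e :: real assume e: "e > 0"
  obtain d where d: "d > 0" "\<And>y. y \<in> S \<Longrightarrow> norm (y - t) < d \<Longrightarrow> norm (l y - l t - (y - t) *\<^sub>R v) \<le> e * norm (y - t)"
    using d e unfolding has_vector_derivative_def has_derivative_within_alt by meson
  define y where "y = t + min (d / 2) ((b - t) / 2)"
  have y: "y \<in> {a<..<b}" "norm (y - t) < d" "y > t" using t d(1) by (auto simp: y_def min_def field_simps)
  have "norm ((y - t) *\<^sub>R v) \<le> norm (l y - l t) + norm (l y - l t - (y - t) *\<^sub>R v)"
    by (metis norm_triangle_sub norm_minus_commute add.commute diff_diff_eq2 norm_triangle_ineq4 add_diff_cancel_left' diff_add_cancel)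
  also have "\<dots> \<le> K * \<bar>y - t\<bar> + e * norm (y - t)"
  proof (rule add_mono)
    show "norm (l y - l t) \<le> K * \<bar>y - t\<bar>" using lip[OF y(1)] by (simp add: dist_norm)
    have "y \<in> S" using y(1) t(2) by blast
    then show "norm (l y - l t - (y - t) *\<^sub>R v) \<le> e * norm (y - t)" using d(2) y(2) by blast
  qed
  finally have "(y - t) * norm v \<le> (y - t) * (K + e)" using y(3) by (simp add: distrib_left mult.commute)
  then show "norm v \<le> K + e" using y by simp
qed

context lagrangian
begin

text \<open>The competitor follows the given curve, with lift \<open>l\<close>, from time \<open>h\<close> on and spends the time
  before that on a detour from the new starting point \<open>y\<close> to the position at time \<open>h\<close>.\<close>

definition competitor_path :: "(real \<Rightarrow> real^'d) \<Rightarrow> real^'d \<Rightarrow> real \<Rightarrow> real^'d \<Rightarrow> real \<Rightarrow> real^'d" where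
  "competitor_path l u h y t = (if t \<le> h then detour u y (l h) (t / h) else l t)"

definition competitor :: "(real \<Rightarrow> real^'d) \<Rightarrow> real^'d \<Rightarrow> real \<Rightarrow> real^'d \<Rightarrow> real \<Rightarrow>\<^sub>C 'p" where
  "competitor l u h y = Bcontfun (\<lambda>t. q (competitor_path l u h y (max 0 (min T t))))"

lemma AE_time_except: "AE t in time_measure T. t \<noteq> (a::real)"
  by (subst AE_restrict_space_iff) (auto intro!: AE_I2 eventually_mono[OF AE_lborel_singleton[of a]])

context
  fixes \<gamma> :: "real \<Rightarrow>\<^sub>C 'p" and l :: "real \<Rightarrow> real^'d" and u :: "real^'d" and h :: real
  assumes \<gamma>: "\<gamma> \<in> \<Gamma>" and l: "continuous_on {0..T} l" "\<forall>s\<in>{0..T}. q (l s) = \<gamma> s"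
    and h: "0 < h" "h < T"
begin

lemma competitor_path_ac: "absolutely_continuous_curve T (competitor_path l u h y)"
proof -
  define K where "K = 3 * dist y (l h) * (1 + norm u) / h"
  have "absolutely_continuous_curve T (\<lambda>t. if t \<le> h then detour u y (l h) (t / h) else l t)"
  proof (rule ac_concat[where K = K])
    show "absolutely_continuous_curve T l"
      using \<gamma> by (intro ac_lift[OF _ l]) (simp add: curves_def)
    show "dist (detour u y (l h) (s / h)) (detour u y (l h) (t / h)) \<le> K * \<bar>s - t\<bar>" for s t
    proof -
      have "\<bar>s / h - t / h\<bar> = \<bar>s - t\<bar> / h" using h by (simp add: diff_divide_distrib[symmetric])
      then show ?thesis using dist_detour_time[of u y "l h" "s / h" "t / h"] by (simp add: K_def)
    qed
    show "0 \<le> K" using h by (simp add: K_def)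
  qed (use h in \<open>auto simp: detour_1\<close>)
  then show ?thesis by (simp add: competitor_path_def[abs_def])
qed

lemma competitor_path_continuous: "continuous_on {0..T} (competitor_path l u h y)"
  by (rule ac_curve_continuous[OF competitor_path_ac])

lemma competitor_apply: "competitor l u h y t = q (competitor_path l u h y (max 0 (min T t)))"
proof -
  have clamp: "max 0 (min T t) \<in> {0..T}" for t using T by auto
  have "continuous_on UNIV (\<lambda>t. q (competitor_path l u h y (max 0 (min T t))))"
    by (intro continuous_on_compose2[OF continuous_on_q] continuous_on_compose2[OF competitor_path_continuous] continuous_intros)
      (use clamp in auto)
  moreover have "bounded (range (\<lambda>t. q (competitor_path l u h y (max 0 (min T t)))))"
  proof (rule bounded_subset)
    show "bounded ((\<lambda>t. q (competitor_path l u h y t)) ` {0..T})"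
      by (intro compact_imp_bounded compact_continuous_image continuous_on_compose2[OF continuous_on_q]
          competitor_path_continuous) auto
    show "range (\<lambda>t. q (competitor_path l u h y (max 0 (min T t)))) \<subseteq> (\<lambda>t. q (competitor_path l u h y t)) ` {0..T}"
      using clamp by auto
  qed
  ultimately show ?thesis by (simp add: competitor_def Bcontfun_inverse bcontfun_def)
qed

lemma competitor_lift: "\<forall>s\<in>{0..T}. q (competitor_path l u h y s) = competitor l u h y s"
  by (simp add: competitor_apply)

lemma competitor_start: "competitor l u h y 0 = q y"
  using T h by (simp add: competitor_apply competitor_path_def detour_0)

lemma competitor_late: "t \<in> {h<..T} \<Longrightarrow> competitor l u h y t = \<gamma> t"
  using h l(2) by (simp add: competitor_apply competitor_path_def)

lemma dist_competitor: "dist (competitor l u h y) (competitor l u h y') \<le> dist y y' * (1 + norm u)"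
proof (rule dist_bound)
  fix t
  define s where "s = max 0 (min T t)"
  have "dist (competitor l u h y t) (competitor l u h y' t) \<le> dist (competitor_path l u h y s) (competitor_path l u h y' s)"
    by (simp add: competitor_apply s_def dist_q_le)
  also have "\<dots> \<le> dist y y' * (1 + norm u)"
    using dist_detour_start[of u y "l h" "s / h" y'] by (simp add: competitor_path_def)
  finally show "dist (competitor l u h y t) (competitor l u h y' t) \<le> dist y y' * (1 + norm u)" .
qed

text \<open>\<open>K\<close> bounds the speed on the detour and \<open>Q\<close> its energy.\<close>

context
  fixes y and K Q :: real
  assumes inside: "\<And>\<tau>. \<tau> \<in> {0..1} \<Longrightarrow> detour u y (l h) \<tau> \<in> Dom"
    and K: "K = 3 * dist y (l h) * (1 + norm u) / h" and Q: "Q = h * K\<^sup>2"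
begin

lemma competitor_path_in: "t \<in> {0..T} \<Longrightarrow> competitor_path l u h y t \<in> Dom"
  using inside[of "t / h"] h l(2) curve_in[OF \<gamma>] by (auto simp: competitor_path_def)

lemma K_nonneg: "0 \<le> K" using h by (simp add: K)

lemma competitor_velocity_late:
  assumes t: "t \<in> {h<..<T}"
  shows "vel (competitor l u h y) t = vel \<gamma> t"
proof -
  have t': "t \<in> {0..T}" using t h by auto
  have c1: "continuous (at t within {0..T}) (competitor_path l u h y)" "continuous (at t within {0..T}) l"
    using competitor_path_continuous l(1) t' by (auto simp: continuous_on_eq_continuous_within)
  have "(competitor_path l u h y has_vector_derivative v) (at t within {0..T}) \<longleftrightarrow> (l has_vector_derivative v) (at t within {0..T})" for v
  proof (rule has_vector_derivative_cong_ev)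
    have "\<forall>\<^sub>F s in nhds t. s \<in> {h<..}" using t by (intro eventually_nhds_in_open) auto
    then show "\<forall>\<^sub>F s in nhds t. s \<in> {0..T} \<longrightarrow> competitor_path l u h y s = l s"
      by eventually_elim (auto simp: competitor_path_def)
    show "competitor_path l u h y t = l t" using t by (simp add: competitor_path_def)
  qed
  then have "has_velocity q T (competitor l u h y) v t \<longleftrightarrow> has_velocity q T \<gamma> v t" for v
    using has_velocity_iff[OF T t' competitor_lift c1(1)] has_velocity_iff[OF T t' l(2) c1(2)] by blast
  then show ?thesis by (simp add: velocity_def)
qed

lemma competitor_velocity_early:
  assumes t: "t \<in> {0<..<h}"
  shows "norm (vel (competitor l u h y) t) \<le> K"
proof (cases "\<exists>v. has_velocity q T (competitor l u h y) v t")
  case True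
  then have v: "has_velocity q T (competitor l u h y) (vel (competitor l u h y) t) t"
    unfolding velocity_def by (simp add: someI_ex[OF True])
  have t': "t \<in> {0..T}" using t h by auto
  have "continuous (at t within {0..T}) (competitor_path l u h y)"
    using competitor_path_continuous t' by (auto simp: continuous_on_eq_continuous_within)
  then have d: "(competitor_path l u h y has_vector_derivative vel (competitor l u h y) t) (at t within {0..T})"
    using has_velocity_iff[OF T t' competitor_lift] v by blast
  show ?thesis
  proof (rule norm_derivative_le_lipschitz[OF d t])
    show "{0<..<h} \<subseteq> {0..T}" using h by auto
    fix s assume s: "s \<in> {0<..<h}"
    have "\<bar>s / h - t / h\<bar> = \<bar>s - t\<bar> / h" using h by (simp add: diff_divide_distrib[symmetric])
    then show "dist (competitor_path l u h y s) (competitor_path l u h y t) \<le> K * \<bar>s - t\<bar>"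
      using dist_detour_time[of u y "l h" "s / h" "t / h"] s t by (simp add: competitor_path_def K)
  qed
qed (simp add: velocity_def K_nonneg)

lemma competitor_velocity_AE:
  "AE t in time_measure T. (norm (vel (competitor l u h y) t))\<^sup>2 \<le> indicator {0..h} t * K\<^sup>2 + (norm (vel \<gamma> t))\<^sup>2"
  using AE_time_except[of 0] AE_time_except[of h] AE_time_except[of T] AE_space
proof eventually_elim
  case (elim t)
  then consider "t \<in> {0<..<h}" | "t \<in> {h<..<T}" by fastforce
  then show ?case
  proof cases
    case 1
    then have "(norm (vel (competitor l u h y) t))\<^sup>2 \<le> K\<^sup>2" using competitor_velocity_early by (intro power_mono) auto
    moreover have "0 \<le> (norm (vel \<gamma> t))\<^sup>2" by simp
    moreover have "indicator {0..h} t = (1::real)" using 1 by simp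
    ultimately show ?thesis using add_increasing2[of "(norm (vel \<gamma> t))\<^sup>2" _ "K\<^sup>2"] by simp
  next
    case 2
    then show ?thesis using competitor_velocity_late by simp
  qed
qed

lemma bound_integrable: "integrable (time_measure T) (\<lambda>t. indicator {0..h} t * K\<^sup>2 + (norm (vel \<gamma> t))\<^sup>2)"
  "(\<integral>t. indicator {0..h} t * K\<^sup>2 + (norm (vel \<gamma> t))\<^sup>2 \<partial>time_measure T) = Q + energy T \<gamma>"
  "integrable (time_measure T) (\<lambda>t. indicator {0..h} t :: real)" "(\<integral>t. indicator {0..h} t \<partial>time_measure T) = h"
proof -
  interpret finite_measure "time_measure T" by (rule finite_measure_time)
  have s: "{0..h} \<in> sets (time_measure T)" using h by (auto simp: sets_restrict_space image_iff intro: bexI[of _ "{0..h}"])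
  have "{0..h} \<inter> {0..T} = {0..h}" using h by auto
  then have m: "measure (time_measure T) {0..h} = h" using h s by (simp add: measure_restrict_space)
  show i: "integrable (time_measure T) (\<lambda>t. indicator {0..h} t :: real)"
    using s by (intro integrable_real_indicator) (auto simp: less_top[symmetric])
  show ii: "(\<integral>t. indicator {0..h} t \<partial>time_measure T) = h"   proof -
    have "min h T = h" using h by simp
    then show ?thesis using s m by simp
  qed
  show "integrable (time_measure T) (\<lambda>t. indicator {0..h} t * K\<^sup>2 + (norm (vel \<gamma> t))\<^sup>2)"
    using i vel_integrable(2)[OF \<gamma>] by auto
  show "(\<integral>t. indicator {0..h} t * K\<^sup>2 + (norm (vel \<gamma> t))\<^sup>2 \<partial>time_measure T) = Q + energy T \<gamma>"
  proof -
    have "(\<integral>t. indicator {0..h} t * K\<^sup>2 + (norm (vel \<gamma> t))\<^sup>2 \<partial>time_measure T) =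
      (\<integral>t. indicator {0..h} t * K\<^sup>2 \<partial>time_measure T) + (\<integral>t. (norm (vel \<gamma> t))\<^sup>2 \<partial>time_measure T)"
      using i vel_integrable(2)[OF \<gamma>] by (intro Bochner_Integration.integral_add) auto
    also have "(\<integral>t. indicator {0..h} t * K\<^sup>2 \<partial>time_measure T) = Q"
      unfolding Q using ii by (subst integral_mult_left_zero) simp
    finally show ?thesis by (simp only: energy_def integral_time)
  qed
qed

lemma competitor_curve: "competitor l u h y \<in> \<Gamma>"
proof -
  have "kinetic_energy q T (competitor l u h y) = (\<integral>\<^sup>+t. ennreal ((norm (vel (competitor l u h y) t))\<^sup>2) \<partial>time_measure T)"
    unfolding kinetic_energy_def by (subst nn_integral_restrict_space) auto
  also have "\<dots> \<le> (\<integral>\<^sup>+t. ennreal (indicator {0..h} t * K\<^sup>2 + (norm (vel \<gamma> t))\<^sup>2) \<partial>time_measure T)"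
  proof (intro nn_integral_mono_AE)
    show "AE t in time_measure T. ennreal ((norm (vel (competitor l u h y) t))\<^sup>2) \<le> ennreal (indicator {0..h} t * K\<^sup>2 + (norm (vel \<gamma> t))\<^sup>2)"
      using competitor_velocity_AE by eventually_elim (rule ennreal_leI)
  qed
  also have "\<dots> < \<infinity>"
    using bound_integrable(1) by (subst nn_integral_eq_integral) (auto intro!: AE_I2)
  finally have "kinetic_energy q T (competitor l u h y) < \<infinity>" .
  moreover have "absolutely_continuous_curve T (competitor l u h y)"
    by (rule ac_project[OF competitor_path_ac competitor_lift])
  moreover have "competitor l u h y t \<in> \<Omega>" if "t \<in> {0..T}" for t
    using competitor_path_in[OF that] competitor_lift that by auto
  ultimately show ?thesis using T by (auto simp: curves_def competitor_apply)
qed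

lemma competitor_energy: "energy T (competitor l u h y) \<le> Q + energy T \<gamma>"
proof -
  have "energy T (competitor l u h y) = (\<integral>t. (norm (vel (competitor l u h y) t))\<^sup>2 \<partial>time_measure T)"
    by (simp add: energy_def integral_time)
  also have "\<dots> \<le> (\<integral>t. indicator {0..h} t * K\<^sup>2 + (norm (vel \<gamma> t))\<^sup>2 \<partial>time_measure T)"
    by (intro integral_mono_AE vel_integrable(2) competitor_curve bound_integrable competitor_velocity_AE)
  finally show ?thesis by (simp add: bound_integrable)
qed

lemma competitor_running_cost: "running_cost (competitor l u h y) \<le> running_cost \<gamma> + (C * Q + 2 * C * h)"
proof -
  have i: "integrable (time_measure T) (\<lambda>t. L (\<gamma> t) (vel \<gamma> t) + (C * K\<^sup>2 + 2 * C) * indicator {0..h} t)"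
    using running_integrable[OF \<gamma>] bound_integrable(3) by auto
  have "running_cost (competitor l u h y) = (\<integral>t. L (competitor l u h y t) (vel (competitor l u h y) t) \<partial>time_measure T)"
    by (simp add: running_cost_def integral_time)
  also have "\<dots> \<le> (\<integral>t. L (\<gamma> t) (vel \<gamma> t) + (C * K\<^sup>2 + 2 * C) * indicator {0..h} t \<partial>time_measure T)"
  proof (intro integral_mono_AE running_integrable competitor_curve i)
    show "AE t in time_measure T. L (competitor l u h y t) (vel (competitor l u h y) t) \<le> L (\<gamma> t) (vel \<gamma> t) + (C * K\<^sup>2 + 2 * C) * indicator {0..h} t"
      using AE_time_except[of 0] AE_time_except[of h] AE_time_except[of T] AE_space
    proof eventually_elim
      case (elim t)
      then have t: "t \<in> {0..T}" by simp
      consider "t \<in> {0<..<h}" | "t \<in> {h<..<T}" using elim by fastforce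
      then show ?case
      proof cases
        case 1
        have "L (competitor l u h y t) (vel (competitor l u h y) t) \<le> C * (norm (vel (competitor l u h y) t))\<^sup>2 + C"
          by (intro L_upper curve_in[OF competitor_curve] t)
        also have "\<dots> \<le> C * K\<^sup>2 + C"
          using C competitor_velocity_early[OF 1] by (intro add_right_mono mult_left_mono power_mono) auto
        finally have "L (competitor l u h y t) (vel (competitor l u h y) t) \<le> C * K\<^sup>2 + C" .
        moreover have "- C \<le> L (\<gamma> t) (vel \<gamma> t)"
        proof -
          have "0 \<le> (1 / C) * (norm (vel \<gamma> t))\<^sup>2" using C by simp
          then show ?thesis using L_lower[OF curve_in[OF \<gamma> t], of "vel \<gamma> t"] by linarith
        qed
        moreover have "indicator {0..h} t = (1::real)" using 1 by simp
        ultimately show ?thesis by simp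
      next
        case 2
        then have "indicator {0..h} t = (0::real)" by simp
        then show ?thesis using competitor_velocity_late[OF 2] competitor_late[of t] 2 by simp
      qed
    qed
  qed
  also have "\<dots> = running_cost \<gamma> + (C * K\<^sup>2 + 2 * C) * h"
    using running_integrable[OF \<gamma>] bound_integrable(3,4) by (simp add: running_cost_def integral_time[symmetric])
  finally show ?thesis by (simp add: Q algebra_simps)
qed

end

end

text \<open>This is what makes short detours cheap: by the Cauchy-Schwarz inequality the square of the distance
  to be covered in time \<open>h\<close> is at most \<open>h\<close> times the energy spent up to time \<open>h\<close>, so the detour needs an energy
  of the order of the latter.\<close>

lemma initial_energy_tendsto:
  assumes \<gamma>: "\<gamma> \<in> \<Gamma>"
  shows "(\<lambda>n. LINT r:{0..1 / real (Suc n)}|lborel. indicator {0..T} r * (norm (vel \<gamma> r))\<^sup>2) \<longlonglongrightarrow> 0"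
proof -
  have i: "integrable lborel (\<lambda>r. indicator {0..T} r *\<^sub>R (norm (vel \<gamma> r))\<^sup>2)"
    using curve_energy(1)[OF T \<gamma>] by (simp add: set_integrable_def)
  have "(\<lambda>n. \<integral>r. indicator {0..1 / real (Suc n)} r *\<^sub>R (indicator {0..T} r * (norm (vel \<gamma> r))\<^sup>2) \<partial>lborel) \<longlonglongrightarrow> (\<integral>r. 0 \<partial>(lborel :: real measure))"
  proof (rule integral_dominated_convergence[where w = "\<lambda>r. indicator {0..T} r *\<^sub>R (norm (vel \<gamma> r))\<^sup>2"])
    show "AE r in lborel. (\<lambda>n. indicator {0..1 / real (Suc n)} r *\<^sub>R (indicator {0..T} r * (norm (vel \<gamma> r))\<^sup>2)) \<longlonglongrightarrow> 0"
      using AE_lborel_singleton[of 0]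
    proof eventually_elim
      case (elim r)
      have "\<forall>\<^sub>F n in sequentially. indicator {0..1 / real (Suc n)} r *\<^sub>R (indicator {0..T} r * (norm (vel \<gamma> r))\<^sup>2) = 0"
      proof (cases "r < 0")
        case False
        then have "r > 0" using elim by simp
        then obtain N where N: "1 / real (Suc N) < r" using nat_approx_posE by blast
        have "1 / real (Suc n) < r" if "n \<ge> N" for n
        proof -
          have "1 / real (Suc n) \<le> 1 / real (Suc N)" using that by (intro divide_left_mono) auto
          then show ?thesis using N by linarith
        qed
        then show ?thesis unfolding eventually_sequentially by (intro exI[of _ N]) (auto simp: not_le)
      qed (auto intro!: always_eventually)
      then show ?case by (rule tendsto_eventually)
    qed
  qed (use i in \<open>auto intro!: borel_measurable_scaleR borel_measurable_indicator AE_I2 split: split_indicator\<close>)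
  then show ?thesis by (simp add: set_lebesgue_integral_def)
qed

end


context mean_field_game
begin

lemma individual_cost_eq:
  assumes fe: "finite_energy \<eta>" and f: "continuous_on_P2 \<Omega> f" and \<gamma>: "\<gamma> \<in> \<Gamma>"
  shows "integrable (time_measure T) (\<lambda>t. f (marginal \<Omega> \<eta> t) (\<gamma> t))"
    and "individual_cost q \<Omega> T L f g \<eta> \<gamma> =
      running_cost \<gamma> + (\<integral>t. f (marginal \<Omega> \<eta> t) (\<gamma> t) \<partial>time_measure T) + g (marginal \<Omega> \<eta> T) (\<gamma> T)"
proof -
  have "continuous_on {0..T} (\<lambda>t. (\<lambda>(t, x). f (marginal \<Omega> \<eta> t) x) (t, \<gamma> t))"
    by (rule continuous_on_compose2[OF f_marginal_continuous[OF fe f]])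
      (auto intro!: continuous_intros curve_in[OF \<gamma>])
  then have "continuous_on {0..T} (\<lambda>t. f (marginal \<Omega> \<eta> t) (\<gamma> t))" by simp
  then have "set_integrable lborel {0..T} (\<lambda>t. f (marginal \<Omega> \<eta> t) (\<gamma> t))"
    unfolding set_integrable_def by (intro borel_integrable_compact) auto
  then show i: "integrable (time_measure T) (\<lambda>t. f (marginal \<Omega> \<eta> t) (\<gamma> t))" by (simp only: integrable_time_iff)
  show "individual_cost q \<Omega> T L f g \<eta> \<gamma> =
      running_cost \<gamma> + (\<integral>t. f (marginal \<Omega> \<eta> t) (\<gamma> t) \<partial>time_measure T) + g (marginal \<Omega> \<eta> T) (\<gamma> T)"
    unfolding individual_cost_def running_cost_def integral_time[symmetric]
    using running_integrable[OF \<gamma>] i by simp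
qed

text \<open>Suppose a curve \<open>\<gamma>s\<close> in the support is beaten by \<open>\<gamma>'\<close>, by an amount \<open>\<Delta>\<close>. Curves near \<open>\<gamma>s\<close> form a set of
  positive mass; each of them is replaced by a competitor of \<open>\<gamma>'\<close> with its own starting point. A curve
  near \<open>\<gamma>s\<close> cannot be much cheaper than \<open>\<gamma>s\<close>, by lower semicontinuity, while its competitor is not much more
  expensive than \<open>\<gamma>'\<close>, if the detour is short in time and the neighbourhood small. The first-order
  condition then bounds \<open>\<Delta>\<close> by less than \<open>\<Delta>\<close>.\<close>

theorem support_optimal:
  assumes conn: "detour_connected Dom"
    and \<eta>: "\<eta> \<in> prob_measures_from q \<Omega> T m0"
    and min: "\<forall>\<eta>'\<in>prob_measures_from q \<Omega> T m0. total_cost q \<Omega> T L F G \<eta> \<le> total_cost q \<Omega> T L F G \<eta>'"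
    and bF: "bdd_below (F ` prob_measures \<Omega>)"
    and f: "continuous_on_P2 \<Omega> f" and g: "continuous_on_P2 \<Omega> g"
    and dF: "linear_derivative \<Omega> F f" and dG: "linear_derivative \<Omega> G g"
    and supp: "\<gamma>s \<in> support_in \<Gamma> \<eta>" and \<gamma>': "\<gamma>' \<in> \<Gamma>" "\<gamma>' 0 = \<gamma>s 0"
  shows "individual_cost q \<Omega> T L f g \<eta> \<gamma>s \<le> individual_cost q \<Omega> T L f g \<eta> \<gamma>'"
proof (rule ccontr)
  assume neg: "\<not> ?thesis"
  have fe: "finite_energy \<eta>" and fin: "total_cost q \<Omega> T L F G \<eta> < \<infinity>" using minimizer_finite[OF \<eta> min] by auto
  have \<gamma>s: "\<gamma>s \<in> \<Gamma>" and supp': "\<And>\<epsilon>. \<epsilon> > 0 \<Longrightarrow> emeasure \<eta> (ball \<gamma>s \<epsilon> \<inter> \<Gamma>) > 0"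
    using supp by (auto simp: support_in_def)
  define m where "m t = marginal \<Omega> \<eta> t" for t
  have Tin: "T \<in> {0..T}" "0 \<in> {0..T}" using T by auto
  obtain ls where ls: "continuous_on {0..T} ls" "\<forall>s\<in>{0..T}. q (ls s) = \<gamma>s s" using ex_curve_lift[OF \<gamma>s] by blast
  define x0 where "x0 = ls 0"
  have qx0: "q x0 = \<gamma>s 0" using ls Tin by (simp add: x0_def)
  obtain l where l: "continuous_on {0..T} l" "l 0 = x0" "\<forall>s\<in>{0..T}. q (l s) = \<gamma>' s"
    using curve_lift[OF \<gamma>'(1) T, of x0] qx0 \<gamma>'(2) by auto
  have x0: "x0 \<in> Dom" using qx0 curve_in[OF \<gamma>s Tin(2)] by simp
  obtain r1 u where r1: "r1 > 0" and u: "\<And>y z \<tau>. y \<in> Dom \<inter> ball x0 r1 \<Longrightarrow> z \<in> Dom \<inter> ball x0 r1 \<Longrightarrow> \<tau> \<in> {0..1} \<Longrightarrow> detour u y z \<tau> \<in> Dom"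
    using conn x0 unfolding detour_connected_def by meson
  \<comment> \<open>a compact set that contains all positions of interest\<close>
  have bdd: "\<exists>R. \<forall>t\<in>{0..T}. norm (c t) \<le> R" if "continuous_on {0..T} c" for c :: "real \<Rightarrow> real^'d"
  proof -
    have "bounded (c ` {0..T})" using that by (intro compact_imp_bounded compact_continuous_image) auto
    then show ?thesis unfolding bounded_iff by blast
  qed
  obtain Rs where Rs: "\<And>t. t \<in> {0..T} \<Longrightarrow> norm (ls t) \<le> Rs" using bdd[OF ls(1)] by blast
  obtain Rl where Rl: "\<And>t. t \<in> {0..T} \<Longrightarrow> norm (l t) \<le> Rl" using bdd[OF l(1)] by blast
  define a where "a = 1 + norm u"
  have a: "a \<ge> 1" by (simp add: a_def)
  define R where "R = max (Rs + 1) (Rl + 6 * r1 * a)"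
  define Kc where "Kc = q ` (Dom \<inter> cball 0 R)"
  have Kc: "compact Kc" "Kc \<subseteq> \<Omega>"
    unfolding Kc_def using closed_dom by (auto intro!: compact_continuous_image continuous_on_q closed_Int_compact)
  have near: "\<gamma> t \<in> Kc" if \<gamma>: "\<gamma> \<in> \<Gamma>" "dist \<gamma>s \<gamma> < 1" and t: "t \<in> {0..T}" for \<gamma> t
  proof -
    obtain y where y: "q y = \<gamma> t" "dist (ls t) y = dist (\<gamma>s t) (\<gamma> t)" using lift_point[of "\<gamma> t" "ls t"] ls(2) t by auto
    have "dist (ls t) y < 1" using y(2) dist_bounded[of \<gamma>s t \<gamma>] \<gamma>(2) by simp
    then have "norm y \<le> Rs + 1" using Rs[OF t] norm_triangle_ineq2[of y "ls t"] by (simp add: dist_norm norm_minus_commute)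
    moreover have "q y \<in> \<Omega>" using y(1) curve_in[OF \<gamma>(1) t] by simp
    ultimately have "y \<in> Dom \<inter> cball 0 R" by (simp add: R_def)
    then show ?thesis unfolding Kc_def y(1)[symmetric] by (rule imageI)
  qed
  have r1a: "0 \<le> 6 * r1 * a" using r1 a by simp
  have \<gamma>'K: "\<gamma>' t \<in> Kc" if t: "t \<in> {0..T}" for t
  proof -
    have "norm (l t) \<le> Rl + 6 * r1 * a" using Rl[OF t] r1a by linarith
    then have "l t \<in> Dom \<inter> cball 0 R" using l(3) t curve_in[OF \<gamma>'(1) t] by (simp add: R_def)
    then show ?thesis unfolding Kc_def using l(3) t by (metis imageI)
  qed
  \<comment> \<open>bounds and moduli of continuity of the costs along the flow of marginals\<close>
  have cK: "continuous_on ({0..T} \<times> Kc) (\<lambda>(t, x). \<phi> (m t) x)" if "continuous_on_P2 \<Omega> \<phi>" for \<phi>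
    unfolding m_def using Kc by (intro continuous_on_subset[OF f_marginal_continuous[OF fe that]]) auto
  have cptK: "compact ({0..T} \<times> Kc)" using Kc by (intro compact_Times) auto
  have "bounded ((\<lambda>(t, x). f (m t) x) ` ({0..T} \<times> Kc))"
    by (intro compact_imp_bounded compact_continuous_image cK f cptK)
  then obtain M where M: "\<And>t x. t \<in> {0..T} \<Longrightarrow> x \<in> Kc \<Longrightarrow> \<bar>f (m t) x\<bar> \<le> M" unfolding bounded_iff by force
  have unif: "\<exists>\<delta>>0. \<forall>t\<in>{0..T}. \<forall>x\<in>Kc. \<forall>x'\<in>Kc. dist x x' < \<delta> \<longrightarrow> \<bar>\<phi> (m t) x - \<phi> (m t) x'\<bar> < \<epsilon>"
    if \<phi>: "continuous_on_P2 \<Omega> \<phi>" and \<epsilon>: "\<epsilon> > 0" for \<phi> and \<epsilon> :: real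
  proof -
    obtain \<delta> where \<delta>: "\<delta> > 0" "\<And>z z'. z \<in> {0..T} \<times> Kc \<Longrightarrow> z' \<in> {0..T} \<times> Kc \<Longrightarrow> dist z' z < \<delta> \<Longrightarrow>
      dist ((\<lambda>(t, x). \<phi> (m t) x) z') ((\<lambda>(t, x). \<phi> (m t) x) z) < \<epsilon>"
      using compact_uniformly_continuous[OF cK[OF \<phi>] cptK] \<epsilon> unfolding uniformly_continuous_on_def by meson
    have "\<bar>\<phi> (m t) x - \<phi> (m t) x'\<bar> < \<epsilon>" if "t \<in> {0..T}" "x \<in> Kc" "x' \<in> Kc" "dist x x' < \<delta>" for t x x'
      using \<delta>(2)[of "(t, x')" "(t, x)"] that by (simp add: dist_Pair_Pair dist_real_def)
    then show ?thesis using \<delta>(1) by blast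
  qed
  define \<Delta> where "\<Delta> = individual_cost q \<Omega> T L f g \<eta> \<gamma>s - individual_cost q \<Omega> T L f g \<eta> \<gamma>'"
  have \<Delta>: "\<Delta> > 0" using neg by (simp add: \<Delta>_def)
  \<comment> \<open>tolerance: semicontinuity of the running cost costs one \<open>\<kappa>\<close>, the potential at the final time \<open>3 * \<kappa>\<close>,
    and the potential in between \<open>3 * \<kappa>\<close> per unit of time\<close>
  define \<kappa> where "\<kappa> = \<Delta> / (4 * (4 + 3 * T))"
  have \<kappa>: "\<kappa> > 0" "\<kappa> * (4 + 3 * T) = \<Delta> / 4" using \<Delta> T by (auto simp: \<kappa>_def field_simps)
  \<comment> \<open>the duration \<open>h = 1 / (n + 1)\<close> of the detour, so short that its part of the cost is small and the
    position of \<open>\<gamma>'\<close> at time \<open>h\<close> is within reach of a detour\<close>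
  define e where "e h = (LINT r:{0..h}|lborel. indicator {0..T} r * (norm (vel \<gamma>' r))\<^sup>2)" for h
  obtain n :: nat where n: "1 / real (Suc n) < T" "(2 * C + 2 * M + 2 * \<kappa>) * (1 / real (Suc n)) < \<Delta> / 8"
    "C * (18 * a\<^sup>2) * e (1 / real (Suc n)) < \<Delta> / 8" "1 / real (Suc n) * energy T \<gamma>' < r1\<^sup>2"
  proof -
    have l0: "(\<lambda>n. 1 / real (Suc n)) \<longlonglongrightarrow> 0" by (rule LIMSEQ_inverse_real_of_nat[unfolded inverse_eq_divide])
    have 1: "\<forall>\<^sub>F n in sequentially. 1 / real (Suc n) < T" using order_tendstoD(2)[OF l0 T] .
    have "(\<lambda>n. (2 * C + 2 * M + 2 * \<kappa>) * (1 / real (Suc n))) \<longlonglongrightarrow> 0" using tendsto_mult_left[OF l0] by simp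
    then have 2: "\<forall>\<^sub>F n in sequentially. (2 * C + 2 * M + 2 * \<kappa>) * (1 / real (Suc n)) < \<Delta> / 8"
      using \<Delta> by (intro order_tendstoD(2)[of _ 0]) auto
    have "(\<lambda>n. e (1 / real (Suc n))) \<longlonglongrightarrow> 0" unfolding e_def by (rule initial_energy_tendsto[OF \<gamma>'(1)])
    then have "(\<lambda>n. C * (18 * a\<^sup>2) * e (1 / real (Suc n))) \<longlonglongrightarrow> 0" using tendsto_mult_left[of _ 0 sequentially "C * (18 * a\<^sup>2)"] by simp
    then have 3: "\<forall>\<^sub>F n in sequentially. C * (18 * a\<^sup>2) * e (1 / real (Suc n)) < \<Delta> / 8"
      using \<Delta> by (intro order_tendstoD(2)[of _ 0]) auto
    have "(\<lambda>n. 1 / real (Suc n) * energy T \<gamma>') \<longlonglongrightarrow> 0" using tendsto_mult_right[OF l0] by simp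
    then have 4: "\<forall>\<^sub>F n in sequentially. 1 / real (Suc n) * energy T \<gamma>' < r1\<^sup>2"
      using r1 by (intro order_tendstoD(2)[of _ 0]) auto
    have "\<forall>\<^sub>F n in sequentially. 1 / real (Suc n) < T \<and> (2 * C + 2 * M + 2 * \<kappa>) * (1 / real (Suc n)) < \<Delta> / 8 \<and>
      C * (18 * a\<^sup>2) * e (1 / real (Suc n)) < \<Delta> / 8 \<and> 1 / real (Suc n) * energy T \<gamma>' < r1\<^sup>2"
      using 1 2 3 4 by eventually_elim simp
    then show thesis using that unfolding eventually_sequentially by blast
  qed
  define h where "h = 1 / real (Suc n)"
  have h0: "0 < h" by (simp add: h_def)
  note h = n[folded h_def]
  define z where "z = l h"
  have hin: "h \<in> {0..T}" using h0 h(1) by simp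
  have zD: "z \<in> Dom" using l(3) hin curve_in[OF \<gamma>'(1) hin] by (simp add: z_def)
  have zsq: "(dist x0 z)\<^sup>2 \<le> h * e h"
  proof -
    have "(dist (l 0) (l h))\<^sup>2 \<le> (h - 0) * (LINT r:{0..h}|lborel. (norm (vel \<gamma>' r))\<^sup>2)"
      using h0 h(1) by (intro dist_lift_energy[OF T \<gamma>'(1) l(1,3)]) auto
    also have "(LINT r:{0..h}|lborel. (norm (vel \<gamma>' r))\<^sup>2) = e h"
      unfolding e_def set_lebesgue_integral_def using h(1)
      by (intro Bochner_Integration.integral_cong) (auto split: split_indicator)
    finally show ?thesis by (simp add: l(2) z_def)
  qed
  have zr: "dist x0 z < r1"
  proof (rule power2_less_imp_less)

    have "e h \<le> energy T \<gamma>'"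
      unfolding e_def energy_def set_lebesgue_integral_def
      using curve_energy(1)[OF T \<gamma>'(1)]
      by (intro integral_mono') (auto simp: set_integrable_def split: split_indicator)
    then have "h * e h \<le> h * energy T \<gamma>'" using h0 by (intro mult_left_mono) auto
    then show "(dist x0 z)\<^sup>2 < r1\<^sup>2" using zsq h(4) by linarith
  qed (use r1 in simp)
  \<comment> \<open>the radius of the neighbourhood, small compared with \<open>h\<close> as the displacement of the starting point
    has to be made up for within time \<open>h\<close>\<close>
  define r2 where "r2 = min 1 (h * \<Delta> / (8 * (C * (18 * a\<^sup>2) + 1)))"
  have Ca: "0 \<le> C * (18 * a\<^sup>2)" using C by simp
  have r2: "0 < r2" "r2 \<le> 1" using h0 \<Delta> Ca by (auto simp: r2_def)
  have r2': "C * (18 * a\<^sup>2) * r2\<^sup>2 \<le> h * (\<Delta> / 8)"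
  proof -
    have "C * (18 * a\<^sup>2) * r2\<^sup>2 \<le> (C * (18 * a\<^sup>2) + 1) * r2"
      using r2 Ca by (intro mult_mono) (auto simp: power2_eq_square mult_left_le)
    also have "\<dots> \<le> (C * (18 * a\<^sup>2) + 1) * (h * \<Delta> / (8 * (C * (18 * a\<^sup>2) + 1)))"
      using Ca by (intro mult_left_mono) (auto simp: r2_def)
    also have "\<dots> = h * (\<Delta> / 8)"
    proof -
      have cancel: "c * (h * \<Delta> / (8 * c)) = h * (\<Delta> / 8)" if "c > 0" for c :: real using that by simp
      show ?thesis by (rule cancel) (use Ca in linarith)
    qed
    finally show ?thesis .
  qed
  obtain \<delta>1 where \<delta>1: "\<delta>1 > 0" "\<And>\<gamma>. \<gamma> \<in> \<Gamma> \<Longrightarrow> dist \<gamma> \<gamma>s < \<delta>1 \<Longrightarrow> running_cost \<gamma>s - \<kappa> < running_cost \<gamma>"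
    using running_cost_lsc[OF \<gamma>s \<kappa>(1)] by blast
  obtain \<delta>2 where \<delta>2: "\<delta>2 > 0" "\<And>t x x'. t \<in> {0..T} \<Longrightarrow> x \<in> Kc \<Longrightarrow> x' \<in> Kc \<Longrightarrow> dist x x' < \<delta>2 \<Longrightarrow> \<bar>f (m t) x - f (m t) x'\<bar> < \<kappa>"
    using unif[OF f \<kappa>(1)] by blast
  obtain \<delta>3 where \<delta>3: "\<delta>3 > 0" "\<And>t x x'. t \<in> {0..T} \<Longrightarrow> x \<in> Kc \<Longrightarrow> x' \<in> Kc \<Longrightarrow> dist x x' < \<delta>3 \<Longrightarrow> \<bar>g (m t) x - g (m t) x'\<bar> < \<kappa>"
    using unif[OF g \<kappa>(1)] by blast
  define r where "r = min (1/4) (min r1 (min r2 (min \<delta>1 (min \<delta>2 \<delta>3))))"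
  have "r \<le> min (1/4) (min r1 (min r2 (min \<delta>1 (min \<delta>2 \<delta>3))))" unfolding r_def by (rule order_refl)
  then have r: "r \<le> 1/4" "r \<le> r1" "r \<le> r2" "r \<le> \<delta>1" "r \<le> \<delta>2" "r \<le> \<delta>3" unfolding min.bounded_iff by auto
  have r0: "r > 0" unfolding r_def using r1(1) r2(1) \<delta>1(1) \<delta>2(1) \<delta>3(1) by simp
  \<comment> \<open>a local section of the chart, and the modification of the curves\<close>
  obtain \<sigma> where \<sigma>: "\<And>p. q (\<sigma> p) = p \<and> dist x0 (\<sigma> p) = dist (q x0) p"
  proof -
    have "\<exists>y. q y = p \<and> dist x0 y = dist (q x0) p" for p using lift_point[of p x0] by auto
    then show thesis using that by metis
  qed
  have \<sigma>_iso: "dist (\<sigma> p) (\<sigma> p') = dist p p'" if "dist (q x0) p < 1/4" "dist (q x0) p' < 1/4" for p p'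
  proof -
    have "dist (\<sigma> p) (\<sigma> p') < 1/2" using \<sigma>[of p] \<sigma>[of p'] that dist_triangle3[of "\<sigma> p" "\<sigma> p'" x0] by linarith
    then show ?thesis using dist_q_local \<sigma> by metis
  qed
  define y where "y \<gamma> = \<sigma> (apply_bcontfun \<gamma> 0)" for \<gamma> :: "real \<Rightarrow>\<^sub>C 'p"
  define \<psi> where "\<psi> \<gamma> = competitor l u h (y \<gamma>)" for \<gamma>
  define A where "A = ball \<gamma>s r \<inter> \<Gamma>"
  define \<Phi> where "\<Phi> \<gamma> = (if \<gamma> \<in> ball \<gamma>s r then \<psi> \<gamma> else \<gamma>)" for \<gamma>
  have A\<Gamma>: "\<gamma> \<in> \<Gamma>" if "\<gamma> \<in> A" for \<gamma> using that by (simp add: A_def)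
  have A_dist: "dist \<gamma>s \<gamma> < r" "dist (\<gamma>s t) (\<gamma> t) < r" if "\<gamma> \<in> A" for \<gamma> t
    using that dist_bounded[of \<gamma>s t \<gamma>] by (auto simp: A_def)
  have start: "q (y \<gamma>) = \<gamma> 0" "dist x0 (y \<gamma>) < r" "y \<gamma> \<in> Dom" if "\<gamma> \<in> A" for \<gamma>
    using \<sigma>[of "\<gamma> 0"] A_dist(2)[OF that, of 0] curve_in[OF A\<Gamma>[OF that] Tin(2)] by (auto simp: y_def qx0)
  have inside: "detour u (y \<gamma>) (l h) \<tau> \<in> Dom" if "\<gamma> \<in> A" "\<tau> \<in> {0..1}" for \<gamma> \<tau>
    using start[OF that(1)] zD zr r by (intro u[OF _ _ that(2)]) (auto simp: z_def)
  note comp = competitor_curve[OF \<gamma>'(1) l(1,3) h0 h(1) _ refl refl] competitor_energy[OF \<gamma>'(1) l(1,3) h0 h(1) _ refl refl]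
    competitor_running_cost[OF \<gamma>'(1) l(1,3) h0 h(1) _ refl refl]
  define Q where "Q \<gamma> = h * (3 * dist (y \<gamma>) (l h) * (1 + norm u) / h)\<^sup>2" for \<gamma>
  have \<psi>\<Gamma>: "\<psi> \<gamma> \<in> \<Gamma>" and \<psi>E: "energy T (\<psi> \<gamma>) \<le> Q \<gamma> + energy T \<gamma>'"
    and \<psi>R: "running_cost (\<psi> \<gamma>) \<le> running_cost \<gamma>' + (C * Q \<gamma> + 2 * C * h)" if "\<gamma> \<in> A" for \<gamma>
    unfolding \<psi>_def Q_def using inside[OF that] by (intro comp; blast)+
  have \<psi>_start: "\<psi> \<gamma> 0 = \<gamma> 0" if "\<gamma> \<in> A" for \<gamma>
    using competitor_start[OF \<gamma>'(1) l(1,3) h0 h(1)] start(1)[OF that] by (simp add: \<psi>_def)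
  have \<psi>_late: "\<psi> \<gamma> t = \<gamma>' t" if "t \<in> {h<..T}" for \<gamma> t
    unfolding \<psi>_def by (rule competitor_late[OF \<gamma>'(1) l(1,3) h0 h(1) that])
  have yz: "dist (y \<gamma>) z < r1 + r1" if "\<gamma> \<in> A" for \<gamma>
    using start(2)[OF that] zr r(2) dist_triangle3[of "y \<gamma>" z x0] by linarith
  have \<psi>K: "\<psi> \<gamma> t \<in> Kc" if \<gamma>: "\<gamma> \<in> A" and t: "t \<in> {0..T}" for \<gamma> t
  proof (cases "t \<le> h")
    case False
    then show ?thesis using \<psi>_late[of t \<gamma>] \<gamma>'K[OF t] t by simp
  next
    case True
    then have \<tau>: "t / h \<in> {0..1}" using t h0 by simp
    have "\<psi> \<gamma> t = q (detour u (y \<gamma>) z (t / h))"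
      using competitor_lift[OF \<gamma>'(1) l(1,3) h0 h(1), of u "y \<gamma>", THEN bspec, OF t] True
      by (simp add: \<psi>_def competitor_path_def z_def)
    moreover have "norm (detour u (y \<gamma>) z (t / h)) \<le> R"
    proof -
      have "dist (detour u (y \<gamma>) z (t / h)) z \<le> 3 * dist (y \<gamma>) z * a" unfolding a_def by (rule dist_detour_end[OF \<tau>])
      also have "\<dots> \<le> 3 * (r1 + r1) * a" using yz[OF \<gamma>] a by (intro mult_right_mono) auto
      finally have "norm (detour u (y \<gamma>) z (t / h)) \<le> norm z + 6 * r1 * a"
        using norm_triangle_ineq2[of "detour u (y \<gamma>) z (t / h)" z] by (simp add: dist_norm)
      also have "\<dots> \<le> R" using Rl[OF hin] by (simp add: R_def z_def)
      finally show ?thesis .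
    qed
    moreover have "detour u (y \<gamma>) z (t / h) \<in> Dom" using inside[OF \<gamma> \<tau>] by (simp add: z_def)
    ultimately show ?thesis unfolding Kc_def by auto
  qed
  have CQ: "C * Q \<gamma> \<le> \<Delta> / 4" if "\<gamma> \<in> A" for \<gamma>
  proof -
    have d: "(dist (y \<gamma>) z)\<^sup>2 \<le> 2 * r2\<^sup>2 + 2 * (h * e h)"
    proof -
      have "(dist (y \<gamma>) z)\<^sup>2 \<le> (dist x0 (y \<gamma>) + dist x0 z)\<^sup>2" by (intro power_mono dist_triangle3) auto
      also have "\<dots> \<le> 2 * (dist x0 (y \<gamma>))\<^sup>2 + 2 * (dist x0 z)\<^sup>2"
        using sum_squares_bound[of "dist x0 (y \<gamma>)" "dist x0 z"] by (simp add: power2_sum)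
      also have "(dist x0 (y \<gamma>))\<^sup>2 \<le> r2\<^sup>2" using start(2)[OF that] r(3) by (intro power_mono) auto
      finally show ?thesis using zsq by linarith
    qed
    have "C * Q \<gamma> = C * (9 * a\<^sup>2) * (dist (y \<gamma>) z)\<^sup>2 / h"
      using h0 by (simp add: Q_def z_def a_def power_mult_distrib power_divide power2_eq_square)
    also have "\<dots> \<le> C * (9 * a\<^sup>2) * (2 * r2\<^sup>2 + 2 * (h * e h)) / h"
      using d C h0 by (intro divide_right_mono mult_left_mono) auto
    also have "\<dots> = C * (18 * a\<^sup>2) * r2\<^sup>2 / h + C * (18 * a\<^sup>2) * e h" using h0 by (simp add: field_simps)
    also have "\<dots> \<le> \<Delta> / 8 + \<Delta> / 8"
      using r2' h(3) h0 by (intro add_mono) (auto simp: field_simps)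
    finally show ?thesis by simp
  qed
  have off: "\<Phi> \<gamma> = \<gamma>" if "\<gamma> \<in> \<Gamma>" "\<gamma> \<notin> A" for \<gamma> using that by (auto simp: \<Phi>_def A_def)
  have on: "\<Phi> \<gamma> = \<psi> \<gamma>" if "\<gamma> \<in> A" for \<gamma> using that by (auto simp: \<Phi>_def A_def)
  have A_sets: "A \<in> sets MG" unfolding A_def by (auto simp: sets_restrict_space image_iff intro!: bexI[of _ "ball \<gamma>s r"])
  have \<Phi>m: "\<Phi> \<in> measurable MG MG"
  proof (rule measurable_restrict_space2)
    show "\<Phi> \<in> space MG \<rightarrow> \<Gamma>" using off on \<psi>\<Gamma> by (auto simp: space_restrict_space) (metis)
    have sp: "{\<gamma> \<in> space MG. \<gamma> \<in> ball \<gamma>s r} = A" by (auto simp: A_def space_restrict_space)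
    have c\<psi>: "continuous_on A \<psi>"
      unfolding continuous_on_iff
    proof (intro ballI allI impI)
      fix \<gamma> \<epsilon> assume \<gamma>: "\<gamma> \<in> A" and \<epsilon>: "\<epsilon> > (0::real)"
      have "dist (\<psi> \<gamma>1) (\<psi> \<gamma>) < \<epsilon>" if \<gamma>1: "\<gamma>1 \<in> A" "dist \<gamma>1 \<gamma> < \<epsilon> / a" for \<gamma>1
      proof -
        have "dist (q x0) (\<gamma>1 0) < 1/4" "dist (q x0) (\<gamma> 0) < 1/4"
          using A_dist(2)[OF \<gamma>1(1), of 0] A_dist(2)[OF \<gamma>, of 0] r(1) by (auto simp: qx0)
        then have "dist (y \<gamma>1) (y \<gamma>) = dist (\<gamma>1 0) (\<gamma> 0)" unfolding y_def by (rule \<sigma>_iso)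
        also have "\<dots> \<le> dist \<gamma>1 \<gamma>" by (rule dist_bounded)
        finally have d: "dist (y \<gamma>1) (y \<gamma>) < \<epsilon> / a" using \<gamma>1(2) by simp
        have "dist (\<psi> \<gamma>1) (\<psi> \<gamma>) \<le> dist (y \<gamma>1) (y \<gamma>) * a"
          unfolding \<psi>_def a_def by (rule dist_competitor[OF \<gamma>'(1) l(1,3) h0 h(1)])
        also have "\<dots> < \<epsilon>" using d a by (simp add: field_simps)
        finally show ?thesis .
      qed
      then show "\<exists>d>0. \<forall>x'\<in>A. dist x' \<gamma> < d \<longrightarrow> dist (\<psi> x') (\<psi> \<gamma>) < \<epsilon>"
        using \<epsilon> a by (intro exI[of _ "\<epsilon> / a"]) auto
    qed
    have "\<psi> \<in> measurable (restrict_space MG {\<gamma>. \<gamma> \<in> ball \<gamma>s r}) borel"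
    proof -
      have "sets (restrict_space MG {\<gamma>. \<gamma> \<in> ball \<gamma>s r}) = sets (restrict_space borel A)"
        unfolding A_def by (simp only: sets_restrict_restrict_space Collect_mem_eq Int_commute)
      then show ?thesis using borel_measurable_continuous_on_restrict[OF c\<psi>] by (simp cong: measurable_cong_sets)
    qed
    moreover have "(\<lambda>\<gamma>. \<gamma>) \<in> measurable (restrict_space MG {\<gamma>. \<gamma> \<notin> ball \<gamma>s r}) borel"
      by (intro measurable_restrict_space1) simp
    ultimately show "\<Phi> \<in> measurable MG borel"
      unfolding \<Phi>_def[abs_def] using sp A_sets by (subst measurable_If_restrict_space_iff) auto
  qed
  have adm: "admissible \<Phi> (2 * R) (\<Delta> / (4 * C) + energy T \<gamma>')"
    unfolding admissible_def
  proof (intro conjI ballI \<Phi>m)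
    have R0: "0 \<le> R" using Rs[OF Tin(1)] norm_ge_zero[of "ls T"] unfolding R_def by linarith
    then show "0 \<le> 2 * R" by simp
    have e0: "0 \<le> \<Delta> / (4 * C) + energy T \<gamma>'" using \<Delta> C curve_energy(3)[OF T \<gamma>'(1)] by simp
    then show "0 \<le> \<Delta> / (4 * C) + energy T \<gamma>'" .
    fix \<gamma> assume \<gamma>: "\<gamma> \<in> \<Gamma>"
    show "apply_bcontfun (\<Phi> \<gamma>) 0 = apply_bcontfun \<gamma> 0" using off[OF \<gamma>] on[of \<gamma>] \<psi>_start[of \<gamma>] by (cases "\<gamma> \<in> A") auto
    show "energy T (\<Phi> \<gamma>) \<le> energy T \<gamma> + (\<Delta> / (4 * C) + energy T \<gamma>')"
    proof (cases "\<gamma> \<in> A")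
      case True
      have "Q \<gamma> \<le> \<Delta> / (4 * C)" using CQ[OF True] C by (simp add: field_simps)
      then show ?thesis using \<psi>E[OF True] on[OF True] curve_energy(3)[OF T \<gamma>] by simp
    qed (use off[OF \<gamma>] e0 in simp)
    fix t assume t: "t \<in> {0..T}"
    show "dist (apply_bcontfun \<gamma> t) (apply_bcontfun (\<Phi> \<gamma>) t) \<le> 2 * R"
    proof (cases "\<gamma> \<in> A")
      case True
      have "\<gamma> t \<in> Kc" using near[OF \<gamma> _ t] A_dist(1)[OF True] r(1) by simp
      moreover have "\<Phi> \<gamma> t \<in> Kc" using \<psi>K[OF True t] on[OF True] by simp
      ultimately obtain v w where vw: "\<gamma> t = q v" "\<Phi> \<gamma> t = q w" "norm v \<le> R" "norm w \<le> R"
        unfolding Kc_def by (auto simp: dist_norm)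
      have "dist (q v) (q w) \<le> norm v + norm w" using dist_q_le[of v w] norm_triangle_ineq4[of v w] by (simp add: dist_norm)
      then show ?thesis using vw by simp
    qed (use off[OF \<gamma>] R0 in simp)
  qed
  \<comment> \<open>small mixture parameters\<close>
  note fmix = f_mixture_uniform[OF fe adm _ Kc \<kappa>(1)]
  obtain \<delta>4 where \<delta>4: "\<delta>4 > 0" "\<And>\<tau> t x. 0 \<le> \<tau> \<Longrightarrow> \<tau> \<le> 1 \<Longrightarrow> \<tau> < \<delta>4 \<Longrightarrow> t \<in> {0..T} \<Longrightarrow> x \<in> Kc \<Longrightarrow>
    \<bar>f (marginal \<Omega> (mixture \<eta> \<Phi> \<tau>) t) x - f (m t) x\<bar> < \<kappa>"
    using fmix[OF f] unfolding m_def by blast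
  obtain \<delta>5 where \<delta>5: "\<delta>5 > 0" "\<And>\<tau> t x. 0 \<le> \<tau> \<Longrightarrow> \<tau> \<le> 1 \<Longrightarrow> \<tau> < \<delta>5 \<Longrightarrow> t \<in> {0..T} \<Longrightarrow> x \<in> Kc \<Longrightarrow>
    \<bar>g (marginal \<Omega> (mixture \<eta> \<Phi> \<tau>) t) x - g (m t) x\<bar> < \<kappa>"
    using fmix[OF g] unfolding m_def by blast
  define s where "s = min (1/2) (min \<delta>4 \<delta>5)"
  have s: "0 < s" "s < 1" "s \<le> \<delta>4" "s \<le> \<delta>5" using \<delta>4 \<delta>5 by (auto simp: s_def)
  define w where "w t = (f (m t) (\<gamma>' t) - f (m t) (\<gamma>s t) + 3 * \<kappa>) + (2 * M + 2 * \<kappa>) * indicator {0..h} t" for t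
  have fi: "integrable (time_measure T) (\<lambda>t. f (m t) (\<gamma>' t))" "integrable (time_measure T) (\<lambda>t. f (m t) (\<gamma>s t))"
    unfolding m_def by (intro individual_cost_eq(1)[OF fe f] \<gamma>'(1) \<gamma>s)+
  interpret time: finite_measure "time_measure T" by (rule finite_measure_time)

  have xA: "\<gamma>s \<in> A" using \<gamma>s r0 by (simp add: A_def)
  have ind': "integrable (time_measure T) (\<lambda>t. indicator {0..h} t :: real)" "(\<integral>t. indicator {0..h} t \<partial>time_measure T) = h"
    using bound_integrable(3,4)[OF \<gamma>'(1) l(1,3) h0 h(1) inside[OF xA] refl refl] by auto
  have wi: "integrable (time_measure T) w"
    unfolding w_def using fi ind' by auto
  have w_int: "(\<integral>t. w t \<partial>time_measure T) = (\<integral>t. f (m t) (\<gamma>' t) \<partial>time_measure T) - (\<integral>t. f (m t) (\<gamma>s t) \<partial>time_measure T)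
    + 3 * \<kappa> * T + (2 * M + 2 * \<kappa>) * h"
    unfolding w_def using fi ind' by (simp add: measure_time)
  have "0 \<le> (running_cost \<gamma>' - running_cost \<gamma>s + \<kappa> + (\<Delta> / 4 + 2 * C * h)) + (\<integral>t. w t \<partial>time_measure T)
      + (g (m T) (\<gamma>' T) - g (m T) (\<gamma>s T) + 3 * \<kappa>)"
  proof (rule variation_inequality[OF fe adm A_sets off s(1,2) min fin bF dF dG _ _ wi])
    show "0 < emeasure \<eta> A" unfolding A_def by (rule supp'[OF r0])
    fix \<gamma> assume \<gamma>: "\<gamma> \<in> A"
    have "running_cost \<gamma>s - \<kappa> < running_cost \<gamma>"
      using A_dist(1)[OF \<gamma>] r(4) by (intro \<delta>1(2) A\<Gamma>[OF \<gamma>]) (simp add: dist_commute)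
    then show "running_cost (\<Phi> \<gamma>) - running_cost \<gamma> \<le> running_cost \<gamma>' - running_cost \<gamma>s + \<kappa> + (\<Delta> / 4 + 2 * C * h)"
      using \<psi>R[OF \<gamma>] CQ[OF \<gamma>] on[OF \<gamma>] by simp
  next
    fix \<tau> t \<gamma> assume \<tau>: "0 < \<tau>" "\<tau> < s" and t: "t \<in> {0..T}" and \<gamma>: "\<gamma> \<in> A"
    have \<tau>': "0 \<le> \<tau>" "\<tau> \<le> 1" "\<tau> < \<delta>4" using \<tau> s by auto
    have gK: "\<gamma> t \<in> Kc" "\<gamma>s t \<in> Kc"
      using near[OF A\<Gamma>[OF \<gamma>] _ t] near[OF \<gamma>s _ t] A_dist(1)[OF \<gamma>] r(1) by auto
    have 1: "\<bar>f (marginal \<Omega> (mixture \<eta> \<Phi> \<tau>) t) (\<gamma> t) - f (m t) (\<gamma> t)\<bar> < \<kappa>" by (rule \<delta>4(2)[OF \<tau>' t gK(1)])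
    have 2: "\<bar>f (marginal \<Omega> (mixture \<eta> \<Phi> \<tau>) t) (\<psi> \<gamma> t) - f (m t) (\<psi> \<gamma> t)\<bar> < \<kappa>" by (rule \<delta>4(2)[OF \<tau>' t \<psi>K[OF \<gamma> t]])
    have 3: "\<bar>f (m t) (\<gamma>s t) - f (m t) (\<gamma> t)\<bar> < \<kappa>"
      using A_dist(2)[OF \<gamma>, of t] r(5) by (intro \<delta>2(2)[OF t gK(2,1)]) simp
    show "f (marginal \<Omega> (mixture \<eta> \<Phi> \<tau>) t) (apply_bcontfun (\<Phi> \<gamma>) t) - f (marginal \<Omega> (mixture \<eta> \<Phi> \<tau>) t) (apply_bcontfun \<gamma> t) \<le> w t"
    proof (cases "t \<le> h")
      case True
      have i: "indicator {0..h} t = (1::real)" using True t by simp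
      have "\<bar>f (m t) (\<psi> \<gamma> t)\<bar> \<le> M" "\<bar>f (m t) (\<gamma>' t)\<bar> \<le> M" using M[OF t \<psi>K[OF \<gamma> t]] M[OF t \<gamma>'K[OF t]] by auto
      then show ?thesis unfolding w_def i on[OF \<gamma>] mult_1_right using 1 2 3 \<kappa>(1) unfolding abs_le_iff abs_less_iff by linarith
    next
      case False
      have i: "indicator {0..h} t = (0::real)" using False by simp
      have "\<psi> \<gamma> t = \<gamma>' t" using \<psi>_late[of t \<gamma>] t False by simp
      then show ?thesis unfolding w_def i on[OF \<gamma>] using 1 2 3 by simp
    qed
  next
    fix \<tau> \<gamma> assume \<tau>: "0 < \<tau>" "\<tau> < s" and \<gamma>: "\<gamma> \<in> A"
    have \<tau>': "0 \<le> \<tau>" "\<tau> \<le> 1" "\<tau> < \<delta>5" using \<tau> s by auto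
    have gK: "\<gamma> T \<in> Kc" "\<gamma>s T \<in> Kc"
      using near[OF A\<Gamma>[OF \<gamma>] _ Tin(1)] near[OF \<gamma>s _ Tin(1)] A_dist(1)[OF \<gamma>] r(1) by auto
    have 1: "\<bar>g (marginal \<Omega> (mixture \<eta> \<Phi> \<tau>) T) (\<gamma> T) - g (m T) (\<gamma> T)\<bar> < \<kappa>" by (rule \<delta>5(2)[OF \<tau>' Tin(1) gK(1)])
    have 2: "\<bar>g (marginal \<Omega> (mixture \<eta> \<Phi> \<tau>) T) (\<gamma>' T) - g (m T) (\<gamma>' T)\<bar> < \<kappa>" by (rule \<delta>5(2)[OF \<tau>' Tin(1) \<gamma>'K[OF Tin(1)]])
    have 3: "\<bar>g (m T) (\<gamma>s T) - g (m T) (\<gamma> T)\<bar> < \<kappa>"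
      using A_dist(2)[OF \<gamma>, of T] r(6) by (intro \<delta>3(2)[OF Tin(1) gK(2,1)]) simp
    have "\<psi> \<gamma> T = \<gamma>' T" using \<psi>_late[of T \<gamma>] h(1) by simp
    then show "g (marginal \<Omega> (mixture \<eta> \<Phi> \<tau>) T) (apply_bcontfun (\<Phi> \<gamma>) T) - g (marginal \<Omega> (mixture \<eta> \<Phi> \<tau>) T) (apply_bcontfun \<gamma> T)
        \<le> g (m T) (\<gamma>' T) - g (m T) (\<gamma>s T) + 3 * \<kappa>"
      unfolding on[OF \<gamma>] using 1 2 3 by simp
  qed
  moreover have "running_cost \<gamma>' - running_cost \<gamma>s + ((\<integral>t. f (m t) (\<gamma>' t) \<partial>time_measure T) - (\<integral>t. f (m t) (\<gamma>s t) \<partial>time_measure T))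
      + (g (m T) (\<gamma>' T) - g (m T) (\<gamma>s T)) = - \<Delta>"
    unfolding \<Delta>_def individual_cost_eq(2)[OF fe f \<gamma>s] individual_cost_eq(2)[OF fe f \<gamma>'(1)] m_def by simp
  moreover have "\<kappa> + 3 * \<kappa> * T + 3 * \<kappa> = \<Delta> / 4" using \<kappa>(2) by (simp add: algebra_simps)
  moreover have "2 * C * h + (2 * M + 2 * \<kappa>) * h < \<Delta> / 8" using h(2) by (simp add: algebra_simps)
  ultimately show False using \<Delta> unfolding w_int by linarith
qed

end

section \<open>Minimizers are Nash equilibria\<close>

theorem theorem2p4:
  fixes q :: "real^'d \<Rightarrow> 'p::polish_space"
    and \<Omega> :: "'p set"
    and T C :: real
    and m0 :: "'p measure"
    and L :: "'p \<Rightarrow> real^'d \<Rightarrow> real"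
    and f g :: "'p measure \<Rightarrow> 'p \<Rightarrow> real"
    and F G :: "'p measure \<Rightarrow> real"
    and \<eta> :: "(real \<Rightarrow>\<^sub>C 'p) measure"
  assumes "state_space q \<Omega>"
    and "T > 0"
    and "m0 \<in> prob_measures2 \<Omega>"
    and "C1_lagrangian q \<Omega> L"
    and "\<forall>x\<in>\<Omega>. convex_on UNIV (L x)"
    and "C > 0"
    and "\<forall>x\<in>\<Omega>. \<forall>v. (1 / C) * (norm v)\<^sup>2 - C \<le> L x v \<and> L x v \<le> C * (norm v)\<^sup>2 + C"
    and "continuous_on_P2 \<Omega> f"
    and "continuous_on_P2 \<Omega> g"
    and "bdd_below (F ` prob_measures \<Omega>)"
    and "bdd_below (G ` prob_measures \<Omega>)"
    and "linear_derivative \<Omega> F f"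
    and "linear_derivative \<Omega> G g"
    and "\<eta> \<in> prob_measures_from q \<Omega> T m0"
    and "\<forall>\<eta>'\<in>prob_measures_from q \<Omega> T m0. total_cost q \<Omega> T L F G \<eta> \<le> total_cost q \<Omega> T L F G \<eta>'"
  shows "nash_equilibrium q \<Omega> T m0 (individual_cost q \<Omega> T L f g) \<eta>"
proof -
  have "\<exists>\<Lambda>. lattice_chart q \<Lambda> \<and> closed (q -` \<Omega>) \<and> detour_connected (q -` \<Omega>)"
    using assms(1) unfolding state_space_def
  proof (elim disjE conjE exE)
    fix D assume q: "euclidean_chart q" and D: "compact_C2_domain D" and \<Omega>: "\<Omega> = q ` D"
    have "inj q"
    proof (rule injI)
      fix x y assume "q x = q y"
      then have "dist x y = 0" using q unfolding euclidean_chart_def by (metis dist_self)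
      then show "x = y" by simp
    qed
    then have "q -` \<Omega> = D" by (simp add: \<Omega> inj_vimage_image_eq)
    moreover obtain U where "open U" "C2_boundary U" "D = closure U"
      using D unfolding compact_C2_domain_def by blast
    ultimately show ?thesis
      using lattice_chart_euclidean[OF q] detour_connected_C2_domain[of U] by auto
  qed (use lattice_chart_euclidean lattice_chart_torus detour_connected_UNIV in auto)
  then obtain \<Lambda> where "lattice_chart q \<Lambda>" and closed: "closed (q -` \<Omega>)" and conn: "detour_connected (q -` \<Omega>)"
    by blast
  then interpret lattice_chart q \<Lambda> by simp
  interpret mean_field_game q \<Lambda> \<Omega> T C L m0
    by unfold_locales (use assms closed in auto)
  have "\<gamma>s \<in> (\<Union>x\<in>\<Omega>. best_responses q \<Omega> T (individual_cost q \<Omega> T L f g) \<eta> x)"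
    if supp: "\<gamma>s \<in> support_in \<Gamma> \<eta>" for \<gamma>s
  proof -
    have \<gamma>s: "\<gamma>s \<in> \<Gamma>" using supp by (simp add: support_in_def)
    have "individual_cost q \<Omega> T L f g \<eta> \<gamma>s \<le> individual_cost q \<Omega> T L f g \<eta> \<gamma>'" if "\<gamma>' \<in> curves_from q \<Omega> T (\<gamma>s 0)" for \<gamma>'
      using that by (intro support_optimal[OF conn assms(14,15,10,8,9,12,13) supp]) (auto simp: curves_from_def)
    then have "\<gamma>s \<in> best_responses q \<Omega> T (individual_cost q \<Omega> T L f g) \<eta> (\<gamma>s 0)"
      using \<gamma>s by (simp add: best_responses_def curves_from_def)
    moreover have "\<gamma>s 0 \<in> \<Omega>" using curve_in[OF \<gamma>s] T by simp
    ultimately show ?thesis by blast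
  qed
  then show ?thesis unfolding nash_equilibrium_def using assms(14) by blast
qed

end
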